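(* Suppose that $\Psi$ is good and let $\eta_*=N^{-\epsilon_b}$. Then, with high probability, $\mathcal S(X)$ is $\eta_*$-regular around its smallest eigenvalue $\lambda_M(\mathcal S(X))$.
   Context: **Model.** $\Theta$ is a real random variable, independent of $N$, symmetrically distributed, with $\mathbb E\Theta=0$, $\mathbb E\Theta^2=1$, absolutely continuous with a positive density at $0$, and, as $s\to\infty$, $\big|\mathbb P(|\Theta|>s)+\frac{\mathsf c}{\Gamma(1-\alpha/2)}s^{-\alpha}\big|\lesssim s^{-(\alpha+\varrho)}$ for some $\alpha\in(2,4)$, $\mathsf c>0$, $\varrho>0$. $M=M(N)<N$ and $c_N:=M/N\to c_\infty\in(0,1)$. $Y=(y_{ij})$ is $M\times N$ with $\sqrt N y_{ij}$ i.i.d. copies of $\Theta$. **Resampling.** Fix $0<\epsilon_b<(\alpha-2)/(10\alpha)$ and $0<\epsilon_a<\min\{\epsilon_b,4-\alpha\}/10000$. Let $\psi_{ij},\chi_{ij}\in\{0,1\}$ be Bernoulli variables with $\mathbb P(\psi_{ij}=1)=\mathbb P(|y_{ij}|\ge N^{-\epsilon_b})$ and $\mathbb P(\chi_{ij}=1)=\mathbb P(|y_{ij}|\in[N^{-1/2-\epsilon_a},N^{-\epsilon_b}])/\mathbb P(|y_{ij}|<N^{-\epsilon_b})$. Let $a_{ij},b_{ij},c_{ij}$ have the law of $y_{ij}$ conditioned respectively on $|y_{ij}|\le N^{-1/2-\epsilon_a}$, on $|y_{ij}|\in[N^{-1/2-\epsilon_a},N^{-\epsilon_b})$, and on $|y_{ij}|\ge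 N^{-\epsilon_b}$; all these variables are mutually independent. Set $\mathsf A_{ij}=(1-\psi_{ij})(1-\chi_{ij})a_{ij}$, $\mathsf B_{ij}=(1-\psi_{ij})\chi_{ij}b_{ij}$, $\mathsf C_{ij}=\psi_{ij}c_{ij}$, and sample $Y=\mathsf A+\mathsf B+\mathsf C$, $X=\mathsf B+\mathsf C$. Put $\Psi=(\psi_{ij})$ and $\epsilon_\alpha=(\alpha-2)/(5\alpha)$; $\Psi$ is *good* if at most $N^{1-\epsilon_\alpha}$ of its entries equal $1$. Convention: entries of $X$ are truncated, i.e. $X$ is identified with $(x_{ij}\mathbf 1_{|x_{ij}|\le N^{100}})$, which equals $X$ with probability $1-o(1)$. **Notation.** $\mathcal S(H)=HH^*$; $m_H(z)=M^{-1}\mathrm{Tr}(HH^\top-z)^{-1}$; $\lambda_M$ is the smallest of the ordered eigenvalues $\lambda_1\ge\dots\ge\lambda_M$. "With high probability": for every $D>0$, with probability at least $1-N^{-D}$ for $N$ large. **$\eta_*$-regularity.** Let $\eta_*=N^{-\tau_*}$ with a constant $0<\tau_*\le 2/3$. For an $M\times N$ matrix $H$, $\mathcal S(H)$ is $\eta_*$-regular around the left edge $\lambda_-=\lambda_M(\mathcal S(H))$ if there are constants $c_H>0$, $C_H>1$ such that: (i) for $z=E+\mathrm i\eta$ with $\lambda_-\le E\le\lambda_-+c_H$ and $\eta_*+\sqrt{\eta_*|E-\lambda_-|}\le\eta\le10$, $\frac1{C_H}\sqrt{|E-\lambda_-|+\eta}\le\mathrm{Im}\,m_H(E+\mathrm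 i\eta)\le C_H\sqrt{|E-\lambda_-|+\eta}$; and for $z=E+\mathrm i\eta$ with $\lambda_--c_H\le E\le\lambda_-$ and $\eta_*\le\eta\le10$, $\frac1{C_H}\frac{\eta}{\sqrt{|E-\lambda_-|+\eta}}\le\mathrm{Im}\,m_H(E+\mathrm i\eta)\le C_H\frac{\eta}{\sqrt{|E-\lambda_-|+\eta}}$; (ii) $c_H/2\le\lambda_-\le2C_H$; (iii) $\|\mathcal S(H)\|\le N^{C_H}$. *)

theory Defs
  imports
    "HOL-Probability.Probability"
    "HOL-Library.Landau_Symbols"
    "Jordan_Normal_Form.Spectral_Radius"
    "Jordan_Normal_Form.Gauss_Jordan_Elimination"
begin

text \<open>
  \<^const>\<open>Gamma\<close> is negative at \<open>1 - \<alpha>/2\<close> for \<open>2 < \<alpha> < 4\<close>, so the tail of \<open>\<bar>\<Theta>\<bar>\<close> is asymptotic to a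
  positive multiple of \<open>s powr -\<alpha>\<close>.

  A density is only determined up to null sets, so its value at 0 alone carries no information.
  Positivity of the density at 0 is read as: some version of the density is bounded away from 0
  near 0. This holds in particular if some version is continuous at 0 with positive value there.
\<close>

locale heavy_tailed = prob_space P for P :: "'p measure" +
  fixes \<Theta> :: "'p \<Rightarrow> real" and \<alpha> \<c> \<rho> :: real
  assumes params: "2 < \<alpha>" "\<alpha> < 4" "0 < \<c>" "0 < \<rho>"
    and rv: "random_variable borel \<Theta>"
    and symmetric: "distr P borel (\<lambda>\<omega>. - \<Theta> \<omega>) = distr P borel \<Theta>"
    and integrable_sq: "integrable P (\<lambda>\<omega>. (\<Theta> \<omega>)\<^sup>2)"
    and mean: "expectation \<Theta> = 0"
    and second_moment: "expectation (\<lambda>\<omega>. (\<Theta> \<omega>)\<^sup>2) = 1"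
    and density: "\<exists>f. distributed P lborel \<Theta> f \<and>
                      (\<exists>\<delta>>0. eventually (\<lambda>x. ennreal \<delta> \<le> f x) (nhds (0::real)))"
    and tail: "(\<lambda>s. prob {\<omega> \<in> space P. s < \<bar>\<Theta> \<omega>\<bar>} + \<c> / Gamma (1 - \<alpha> / 2) * s powr (- \<alpha>))
                 \<in> O[at_top](\<lambda>s. s powr (- (\<alpha> + \<rho>)))"

definition entry_law :: "'p measure \<Rightarrow> ('p \<Rightarrow> real) \<Rightarrow> nat \<Rightarrow> real measure" where
  "entry_law P \<Theta> N = distr P borel (\<lambda>\<omega>. \<Theta> \<omega> / sqrt (real N))"

definition psi_prob :: "real measure \<Rightarrow> real \<Rightarrow> nat \<Rightarrow> real" where
  "psi_prob \<mu> \<epsilon>b N = measure \<mu> {x. \<bar>x\<bar> \<ge> real N powr (- \<epsilon>b)}"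

definition chi_prob :: "real measure \<Rightarrow> real \<Rightarrow> real \<Rightarrow> nat \<Rightarrow> real" where
  "chi_prob \<mu> \<epsilon>a \<epsilon>b N =
     measure \<mu> {x. \<bar>x\<bar> \<in> {real N powr (- 1/2 - \<epsilon>a) .. real N powr (- \<epsilon>b)}} /
     measure \<mu> {x. \<bar>x\<bar> < real N powr (- \<epsilon>b)}"

text \<open>
  All variables of the resampling are collected in one family \<open>\<xi>\<close>, indexed by a kind and a matrix
  position, so that mutual independence is a single \<^const>\<open>prob_space.indep_vars\<close> assumption.
  The kinds stand for \<open>\<psi>, \<chi>, a, b, c\<close>. Positions \<open>(i, j)\<close> are counted from 0.
  \<open>\<mu>\<close> is the law of an entry \<open>y\<^sub>i\<^sub>j\<close>; \<^const>\<open>uniform_measure\<close> \<open>\<mu> S\<close> is \<open>\<mu>\<close> conditioned on \<open>S\<close>.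
\<close>

datatype kind = Psi | Chi | Small | Medium | Large

locale resampling = prob_space Q for Q :: "'q measure" +
  fixes \<mu> :: "real measure" and \<epsilon>a \<epsilon>b :: real and M N :: nat
    and \<xi> :: "kind \<times> nat \<times> nat \<Rightarrow> 'q \<Rightarrow> real"
  assumes indep: "indep_vars (\<lambda>_. borel) \<xi> (UNIV \<times> {..<M} \<times> {..<N})"
    and psi: "\<And>i j. i < M \<Longrightarrow> j < N \<Longrightarrow>
          (\<forall>\<omega>\<in>space Q. \<xi> (Psi, i, j) \<omega> \<in> {0, 1}) \<and>
          prob {\<omega> \<in> space Q. \<xi> (Psi, i, j) \<omega> = 1} = psi_prob \<mu> \<epsilon>b N"
    and chi: "\<And>i j. i < M \<Longrightarrow> j < N \<Longrightarrow>
          (\<forall>\<omega>\<in>space Q. \<xi> (Chi, i, j) \<omega> \<in> {0, 1}) \<and>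
          prob {\<omega> \<in> space Q. \<xi> (Chi, i, j) \<omega> = 1} = chi_prob \<mu> \<epsilon>a \<epsilon>b N"
    and small: "\<And>i j. i < M \<Longrightarrow> j < N \<Longrightarrow> distr Q borel (\<xi> (Small, i, j)) =
          uniform_measure \<mu> {x. \<bar>x\<bar> \<le> real N powr (- 1/2 - \<epsilon>a)}"
    and medium: "\<And>i j. i < M \<Longrightarrow> j < N \<Longrightarrow> distr Q borel (\<xi> (Medium, i, j)) =
          uniform_measure \<mu> {x. \<bar>x\<bar> \<in> {real N powr (- 1/2 - \<epsilon>a) ..< real N powr (- \<epsilon>b)}}"
    and large: "\<And>i j. i < M \<Longrightarrow> j < N \<Longrightarrow> distr Q borel (\<xi> (Large, i, j)) =
          uniform_measure \<mu> {x. \<bar>x\<bar> \<ge> real N powr (- \<epsilon>b)}"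

definition Psi_mat :: "nat \<Rightarrow> nat \<Rightarrow> (kind \<times> nat \<times> nat \<Rightarrow> 'q \<Rightarrow> real) \<Rightarrow> 'q \<Rightarrow> real mat" where
  "Psi_mat M N \<xi> \<omega> = Matrix.mat M N (\<lambda>(i, j). \<xi> (Psi, i, j) \<omega>)"

definition B_mat :: "nat \<Rightarrow> nat \<Rightarrow> (kind \<times> nat \<times> nat \<Rightarrow> 'q \<Rightarrow> real) \<Rightarrow> 'q \<Rightarrow> real mat" where
  "B_mat M N \<xi> \<omega> =
     Matrix.mat M N (\<lambda>(i, j). (1 - \<xi> (Psi, i, j) \<omega>) * \<xi> (Chi, i, j) \<omega> * \<xi> (Medium, i, j) \<omega>)"

definition C_mat :: "nat \<Rightarrow> nat \<Rightarrow> (kind \<times> nat \<times> nat \<Rightarrow> 'q \<Rightarrow> real) \<Rightarrow> 'q \<Rightarrow> real mat" where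
  "C_mat M N \<xi> \<omega> = Matrix.mat M N (\<lambda>(i, j). \<xi> (Psi, i, j) \<omega> * \<xi> (Large, i, j) \<omega>)"

text \<open>The entries of \<open>X = B + C\<close> are truncated at \<open>N^100\<close>, by convention.\<close>

definition X_mat :: "nat \<Rightarrow> nat \<Rightarrow> (kind \<times> nat \<times> nat \<Rightarrow> 'q \<Rightarrow> real) \<Rightarrow> 'q \<Rightarrow> real mat" where
  "X_mat M N \<xi> \<omega> =
     map_mat (\<lambda>x. if \<bar>x\<bar> \<le> real N ^ 100 then x else 0) (B_mat M N \<xi> \<omega> + C_mat M N \<xi> \<omega>)"

definition good :: "real \<Rightarrow> real mat \<Rightarrow> bool" where
  "good \<alpha> \<Psi> \<longleftrightarrow>
     real (card {(i, j). i < dim_row \<Psi> \<and> j < dim_col \<Psi> \<and> \<Psi> $$ (i, j) = 1})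
       \<le> real (dim_col \<Psi>) powr (1 - (\<alpha> - 2) / (5 * \<alpha>))"

definition cov :: "real mat \<Rightarrow> real mat" where
  "cov H = H * transpose_mat H"

definition stieltjes :: "real mat \<Rightarrow> complex \<Rightarrow> complex" where
  "stieltjes H z =
     (let n = dim_row H;
          G = the (mat_inverse (map_mat complex_of_real (cov H) - z \<cdot>\<^sub>m 1\<^sub>m n))
      in (\<Sum>i<n. G $$ (i, i)) / of_nat n)"

definition lambda_min :: "real mat \<Rightarrow> real" where
  "lambda_min A = Min (spectrum A)"

definition op_norm :: "real mat \<Rightarrow> real" where
  "op_norm A = (SUP v \<in> {v \<in> carrier_vec (dim_col A). v \<bullet> v = 1}. sqrt ((A *\<^sub>v v) \<bullet> (A *\<^sub>v v)))"

text \<open>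
  \<open>edge_regular \<tau> cH CH H\<close>: \<open>cov H\<close> is \<open>\<eta>\<^sub>*\<close>-regular around its smallest eigenvalue, for
  \<open>\<eta>\<^sub>* = N powr -\<tau>\<close> with \<open>N\<close> the number of columns of \<open>H\<close>, with the given constants.
  The constants are parameters of the predicate because they may not depend on \<open>N\<close>; for a single
  matrix, existence of constants would be a nearly empty condition.
\<close>

definition edge_regular :: "real \<Rightarrow> real \<Rightarrow> real \<Rightarrow> real mat \<Rightarrow> bool" where
  "edge_regular \<tau> cH CH H \<longleftrightarrow>
    (let N = real (dim_col H); \<eta>s = N powr (- \<tau>); l = lambda_min (cov H) in
      0 < \<tau> \<and> \<tau> \<le> 2/3 \<and> 0 < cH \<and> 1 < CH \<and>
      (\<forall>E \<eta>. l \<le> E \<and> E \<le> l + cH \<and> \<eta>s + sqrt (\<eta>s * \<bar>E - l\<bar>) \<le> \<eta> \<and> \<eta> \<le> 10 \<longrightarrow>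
         1 / CH * sqrt (\<bar>E - l\<bar> + \<eta>) \<le> Im (stieltjes H (Complex E \<eta>)) \<and>
         Im (stieltjes H (Complex E \<eta>)) \<le> CH * sqrt (\<bar>E - l\<bar> + \<eta>)) \<and>
      (\<forall>E \<eta>. l - cH \<le> E \<and> E \<le> l \<and> \<eta>s \<le> \<eta> \<and> \<eta> \<le> 10 \<longrightarrow>
         1 / CH * (\<eta> / sqrt (\<bar>E - l\<bar> + \<eta>)) \<le> Im (stieltjes H (Complex E \<eta>)) \<and>
         Im (stieltjes H (Complex E \<eta>)) \<le> CH * (\<eta> / sqrt (\<bar>E - l\<bar> + \<eta>))) \<and>
      cH / 2 \<le> l \<and> l \<le> 2 * CH \<and>
      op_norm (cov H) \<le> N powr CH)"

end

theory Submission
  imports Defs "HOL-Real_Asymp.Real_Asymp"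
begin

text \<open>
  Given \<open>\<Psi>\<close>, the columns of \<open>X\<close> without large entries are independent with i.i.d. bounded symmetric
  entries; let \<open>v\<close> and \<open>\<kappa>\<close> be their second and fourth moments, \<open>n\<close> the number of these columns, \<open>a = M v\<close>, \<open>b = n v\<close>
  and \<open>L = N powr \<epsilon>b\<close>. Since \<open>\<epsilon>b\<close> is small, the tail assumption gives \<open>\<kappa> \<le> v / L ^ 10\<close>.
  The remaining columns are at most \<open>N powr (1 - \<epsilon>\<^sub>\<alpha>)\<close> many, and each of them changes the trace of
  the resolvent at height \<open>\<eta>\<close> by at most \<open>1 / \<eta>\<close> and does not lower the smallest eigenvalue.

  At height \<open>\<eta> \<ge> 1 / L\<close> the fluctuations are far below the needed precision, so McDiarmid's
  inequality and leave-one-out identities show that \<open>s = v Tr (X X\<^sup>* - z)\<^sup>-\<^sup>1\<close> nearly solves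
  \<open>z s\<^sup>2 + (z + a - b) s + a = 0\<close>. The stability of this equation is elementary: as \<open>Im (z s) \<ge> 0\<close>, the root
  \<open>2 z s + z + a - b\<close> has imaginary part at least \<open>\<eta>\<close>. This yields the square root behaviour of
  \<open>Im m\<close> around \<open>(sqrt b - sqrt a)\<^sup>2\<close>.

  It remains to see that no eigenvalue lies more than \<open>O(1 / L)\<close> below \<open>(sqrt b - sqrt a)\<^sup>2\<close>. Adding the columns one
  by one, a level starting at \<open>- sqrt a (sqrt b - sqrt a)\<close> is raised by a fixed amount each time, as in the
  barrier argument of Batson, Spielman and Srivastava. The potential \<open>Tr (G + G\<^sup>2 / L)\<close> of the resolvent at the level is
  controlled through an exponential moment, and \<open>Tr G ^ p\<close> for a large constant \<open>p\<close> guards against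
  eigenvalues that come too close to the level.
\<close>

section \<open>Spectral decompositions\<close>

text \<open>The barrier needs a bound on every eigenvalue of the resolvent at every step, but no
  stopping time is introduced. The asserted failure probability contains
  \<open>exp (t * (potential - \<phi>))\<close> and \<open>\<zeta> * Tr G ^ p\<close>. Either it is
  at least 1 and nothing is claimed, or it forces the potential below \<open>\<phi>\<close> and each
  eigenvalue of \<open>G\<close> below \<open>\<gamma>m = L ^ 3\<close>. The part
  \<open>G^2 / L\<close> of the potential gives \<open>Tr G^2 \<le> L * \<phi>\<close>, which keeps
  the relative growth of \<open>Tr G ^ p\<close> per step at order \<open>v * L\<close>. Set against
  a reserve of order \<open>v / L\<close> in the increment of the level, this produces the scale
  \<open>L ^ 2\<close>, below the guard \<open>L ^ 3\<close>, hence a failure probability of order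
  \<open>N * L powr (1 - p)\<close>. Columns with large entries are never analysed: arbitrary added
  columns preserve the lower bound and barely move the trace, so all randomness in use is
  independent of \<open>\<Psi>\<close>. That the smallest eigenvalue does not lie far above the edge
  is deterministic: a gap there would contradict the square root behaviour of
  \<open>Im m\<close>.\<close>

definition dotp :: "nat \<Rightarrow> (nat \<Rightarrow> real) \<Rightarrow> (nat \<Rightarrow> real) \<Rightarrow> real" where
  "dotp m x y = (\<Sum>a<m. x a * y a)"

definition bform :: "nat \<Rightarrow> (nat \<Rightarrow> nat \<Rightarrow> real) \<Rightarrow> (nat \<Rightarrow> real) \<Rightarrow> (nat \<Rightarrow> real) \<Rightarrow> real" where
  "bform m A x y = (\<Sum>a<m. \<Sum>b<m. A a b * x a * y b)"

definition orthonormal :: "nat \<Rightarrow> nat \<Rightarrow> (nat \<Rightarrow> nat \<Rightarrow> real) \<Rightarrow> bool" where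
  "orthonormal m k u \<longleftrightarrow> (\<forall>i<k. \<forall>j<k. dotp m (u i) (u j) = of_bool (i = j))"

text \<open>Matrices are functions of which only the indices below \<open>m\<close> matter, so that
  adding a column is the pointwise sum \<open>A a b + x a * x b\<close>. Eigenvalues are unordered
  and eigenvectors are not canonical; results are therefore phrased for an arbitrary
  decomposition.\<close>

definition spectral ::
    "nat \<Rightarrow> (nat \<Rightarrow> nat \<Rightarrow> real) \<Rightarrow> (nat \<Rightarrow> real) \<Rightarrow> (nat \<Rightarrow> nat \<Rightarrow> real) \<Rightarrow> bool" where
  "spectral m A lam u \<longleftrightarrow> orthonormal m m u \<and>
     (\<forall>a<m. \<forall>b<m. A a b = (\<Sum>i<m. lam i * u i a * u i b))"

lemma dotp_commute: "dotp m x y = dotp m y x"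
  by (simp add: dotp_def mult.commute)

lemma dotp_add_left: "dotp m (\<lambda>a. x a + y a) z = dotp m x z + dotp m y z"
  and dotp_add_right: "dotp m z (\<lambda>a. x a + y a) = dotp m z x + dotp m z y"
  and dotp_diff_left: "dotp m (\<lambda>a. x a - y a) z = dotp m x z - dotp m y z"
  and dotp_diff_right: "dotp m z (\<lambda>a. x a - y a) = dotp m z x - dotp m z y"
  and dotp_scale_left: "dotp m (\<lambda>a. c * x a) z = c * dotp m x z"
  and dotp_scale_right: "dotp m z (\<lambda>a. c * x a) = c * dotp m z x"
  by (simp_all add: dotp_def algebra_simps sum.distrib sum_subtractf sum_distrib_left)

lemma dotp_sum_left: "dotp m (\<lambda>a. \<Sum>i\<in>I. f i a) z = (\<Sum>i\<in>I. dotp m (f i) z)"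
  unfolding dotp_def sum_distrib_right by (rule sum.swap)

lemma dotp_sum_right: "dotp m z (\<lambda>a. \<Sum>i\<in>I. f i a) = (\<Sum>i\<in>I. dotp m z (f i))"
  unfolding dotp_def sum_distrib_left by (rule sum.swap)

lemma dotp_self_nonneg: "0 \<le> dotp m x x"
  by (simp add: dotp_def sum_nonneg)

lemma dotp_self_eq_0: "dotp m x x = 0 \<longleftrightarrow> (\<forall>a<m. x a = 0)"
  by (auto simp: dotp_def sum_nonneg_eq_0_iff)

lemma dotp_cong: "(\<And>a. a < m \<Longrightarrow> x a = x' a) \<Longrightarrow> (\<And>a. a < m \<Longrightarrow> y a = y' a) \<Longrightarrow> dotp m x y = dotp m x' y'"
  by (simp add: dotp_def)

lemma dotp_unit: "a < m \<Longrightarrow> dotp m x (\<lambda>b. of_bool (b = a)) = x a"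
  by (simp add: dotp_def of_bool_def if_distrib cong: if_cong)

section \<open>Bessel, completeness and Parseval for finite orthonormal families\<close>

lemma orthonormal_dotp:
  "orthonormal m k u \<Longrightarrow> i < k \<Longrightarrow> j < k \<Longrightarrow> dotp m (u i) (u j) = of_bool (i = j)"
  by (simp add: orthonormal_def)

lemma dotp_expansion:
  assumes "orthonormal m k u" "j < k"
  shows "dotp m (u j) (\<lambda>a. \<Sum>i<k. c i * u i a) = c j"
proof -
  have "dotp m (u j) (\<lambda>a. \<Sum>i<k. c i * u i a) = (\<Sum>i<k. c i * dotp m (u j) (u i))"
    by (simp add: dotp_sum_right dotp_scale_right)
  also have "\<dots> = (\<Sum>i<k. if i = j then c i else 0)"
    using assms by (intro sum.cong) (auto simp: orthonormal_dotp)
  finally show ?thesis using assms by simp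
qed

lemma bessel_residual:
  assumes "orthonormal m k u"
  defines "r \<equiv> (\<lambda>x a. x a - (\<Sum>i<k. dotp m (u i) x * u i a))"
  shows "j < k \<Longrightarrow> dotp m (u j) (r x) = 0"
    and "dotp m (r x) (r x) = dotp m x x - (\<Sum>i<k. (dotp m (u i) x)\<^sup>2)"
proof -
  show orth: "dotp m (u j) (r x) = 0" if "j < k" for j
    using dotp_expansion[OF assms(1) that, of "\<lambda>i. dotp m (u i) x"] by (simp add: r_def dotp_diff_right)
  have "dotp m (r x) (r x) = dotp m x (r x) - (\<Sum>i<k. dotp m (u i) x * dotp m (u i) (r x))"
    by (subst r_def) (simp add: dotp_diff_left dotp_sum_left dotp_scale_left)
  also have "\<dots> = dotp m x (r x)" using orth by simp
  also have "\<dots> = dotp m x x - (\<Sum>i<k. dotp m (u i) x * dotp m x (u i))"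
    by (simp add: r_def dotp_diff_right dotp_sum_right dotp_scale_right)
  finally show "dotp m (r x) (r x) = dotp m x x - (\<Sum>i<k. (dotp m (u i) x)\<^sup>2)"
    by (simp add: dotp_commute[of m x "u _"] power2_eq_square)
qed

lemma orthonormal_sum_sq:
  assumes "orthonormal m k u"
  shows "(\<Sum>a<m. \<Sum>i<k. (u i a)\<^sup>2) = real k"
proof -
  have "(\<Sum>a<m. \<Sum>i<k. (u i a)\<^sup>2) = (\<Sum>i<k. dotp m (u i) (u i))"
    by (subst sum.swap) (simp add: dotp_def power2_eq_square)
  also have "\<dots> = real k" using assms by (simp add: orthonormal_dotp)
  finally show ?thesis .
qed

lemma orthonormal_row_le:
  assumes "orthonormal m k u" "a < m"
  shows "(\<Sum>i<k. (u i a)\<^sup>2) \<le> 1"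
proof -
  let ?e = "\<lambda>b. of_bool (b = a) :: real"
  have "0 \<le> dotp m ?e ?e - (\<Sum>i<k. (dotp m (u i) ?e)\<^sup>2)"
    by (subst bessel_residual(2)[OF assms(1), symmetric]) (rule dotp_self_nonneg)
  then show ?thesis using assms(2) by (simp add: dotp_unit)
qed

text \<open>By Bessel each row has square sum at most 1, and these sums add up to \<open>m\<close>;
  hence all equal 1 and the residual of every unit vector vanishes.\<close>

lemma orthonormal_complete:
  assumes on: "orthonormal m m u" and a: "a < m" and b: "b < m"
  shows "(\<Sum>i<m. u i a * u i b) = of_bool (a = b)"
proof -
  let ?e = "\<lambda>b. of_bool (b = a) :: real"
  have "(\<Sum>a<m. 1 - (\<Sum>i<m. (u i a)\<^sup>2)) = 0"
    using orthonormal_sum_sq[OF on] by (simp add: sum_subtractf)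
  then have "1 - (\<Sum>i<m. (u i a)\<^sup>2) = 0"
    using orthonormal_row_le[OF on] a by (subst (asm) sum_nonneg_eq_0_iff) auto
  then have "dotp m ?e ?e - (\<Sum>i<m. (dotp m (u i) ?e)\<^sup>2) = 0"
    using a by (simp add: dotp_unit)
  then have "?e b - (\<Sum>i<m. dotp m (u i) ?e * u i b) = 0"
    using bessel_residual(2)[OF on, of ?e, symmetric] b dotp_self_eq_0 by simp
  then have "?e b = (\<Sum>i<m. u i a * u i b)" using a by (simp only: dotp_unit)
  then show ?thesis by (simp only: eq_commute)
qed

lemma parseval:
  assumes "orthonormal m m u"
  shows "(\<Sum>i<m. dotp m (u i) x * dotp m (u i) y) = dotp m x y"
proof -
  have "(\<Sum>i<m. dotp m (u i) x * dotp m (u i) y) = (\<Sum>i<m. \<Sum>a<m. \<Sum>b<m. x a * y b * (u i a * u i b))"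
    by (simp add: dotp_def sum_product mult_ac)
  also have "\<dots> = (\<Sum>a<m. \<Sum>b<m. \<Sum>i<m. x a * y b * (u i a * u i b))"
    by (subst sum.swap) (rule sum.cong[OF refl], rule sum.swap)
  also have "\<dots> = (\<Sum>a<m. \<Sum>b<m. x a * y b * of_bool (a = b))"
    by (simp add: sum_distrib_left[symmetric] orthonormal_complete[OF assms])
  also have "\<dots> = dotp m x y"
    by (simp add: dotp_def of_bool_def if_distrib cong: if_cong)
  finally show ?thesis .
qed

section \<open>Bilinear forms and the existence of eigenvectors\<close>

lemma bform_sym:
  assumes "\<And>a b. a < m \<Longrightarrow> b < m \<Longrightarrow> A a b = A b a"
  shows "bform m A x y = bform m A y x"
  unfolding bform_def using assms by (subst sum.swap) (auto intro!: sum.cong)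

lemma bform_dotp: "bform m A x y = dotp m x (\<lambda>a. \<Sum>b<m. A a b * y b)"
  by (simp add: bform_def dotp_def sum_distrib_left mult_ac)

lemma bform_add_left: "bform m A (\<lambda>a. x a + y a) z = bform m A x z + bform m A y z"
  and bform_add_right: "bform m A z (\<lambda>a. x a + y a) = bform m A z x + bform m A z y"
  and bform_scale_left: "bform m A (\<lambda>a. c * x a) z = c * bform m A x z"
  and bform_scale_right: "bform m A z (\<lambda>a. c * x a) = c * bform m A z x"
  by (simp_all add: bform_def algebra_simps sum.distrib sum_distrib_left)

lemma continuous_dotp: "continuous_on S (\<lambda>v. dotp m w v)"
  "continuous_on S (\<lambda>v. dotp m v v)" "continuous_on S (\<lambda>v. bform m A v v)"
  unfolding dotp_def bform_def
  by (intro continuous_intros continuous_on_subset[OF continuous_on_product_coordinates]; simp)+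

text \<open>The first order condition at a minimum: with the step
  \<open>- b / (\<bar>c\<bar> + 1)\<close> the linear term would outweigh the quadratic one.\<close>

lemma linear_coefficient_zero:
  fixes b c :: real
  assumes "\<And>t. 0 \<le> 2 * t * b + t\<^sup>2 * c"
  shows "b = 0"
proof (rule ccontr)
  assume "b \<noteq> 0"
  define d where "d = \<bar>c\<bar> + 1"
  have d: "0 < d" "c < d" by (auto simp: d_def)
  have "0 \<le> 2 * (- b / d) * b + (- b / d)\<^sup>2 * c" by (rule assms)
  then have "0 \<le> (b\<^sup>2 / d\<^sup>2) * (c - 2 * d)"
    using d by (simp add: field_simps power2_eq_square)
  moreover have "0 < b\<^sup>2 / d\<^sup>2" using \<open>b \<noteq> 0\<close> d by simp
  ultimately have "0 \<le> c - 2 * d" using mult_pos_neg[of "b\<^sup>2 / d\<^sup>2" "c - 2 * d"] by linarith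
  then show False using d by simp
qed

text \<open>Minimising the Rayleigh quotient on the orthogonal complement of the eigenvectors already
  found produces the next one.\<close>

lemma next_eigenvector:
  assumes on: "orthonormal m k u" and k: "k < m"
    and sym: "\<And>a b. a < m \<Longrightarrow> b < m \<Longrightarrow> A a b = A b a"
    and eig: "\<And>i a. i < k \<Longrightarrow> a < m \<Longrightarrow> (\<Sum>b<m. A a b * u i b) = lam i * u i a"
  shows "\<exists>v \<mu>. dotp m v v = 1 \<and> (\<forall>i<k. dotp m (u i) v = 0) \<and>
           (\<forall>a<m. (\<Sum>b<m. A a b * v b) = \<mu> * v a)"
proof -
  define W where "W = {v. \<forall>i<k. dotp m (u i) v = 0}"
  \<comment> \<open>Coordinates from \<open>m\<close> on are pinned to 0, which makes the unit
    sphere compact in the product topology on functions of type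
    \<open>nat \<Rightarrow> real\<close>.\<close>
  define K where "K = PiE UNIV (\<lambda>a. if a < m then {-1..1::real} else {0}) \<inter>
     ({v. dotp m v v = 1} \<inter> (\<Inter>i\<in>{..<k}. {v. dotp m (u i) v = 0}))"
  have "compactin (product_topology (\<lambda>_. euclidean) UNIV) (PiE UNIV (\<lambda>a::nat. if a < m then {-1..1::real} else {0}))"
    by (subst compactin_PiE) auto
  then have "compact (PiE UNIV (\<lambda>a::nat. if a < m then {-1..1::real} else {0}))"
    by (simp add: euclidean_product_topology)
  moreover have "closed ({v. dotp m v v = 1} \<inter> (\<Inter>i\<in>{..<k}. {v. dotp m (u i) v = 0}))"
    by (intro closed_Int closed_INT ballI closed_Collect_eq continuous_dotp continuous_on_const)
  ultimately have cK: "compact K" unfolding K_def by (rule compact_Int_closed)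
  have normalize: "\<exists>c v. v \<in> K \<and> 0 < c \<and> (\<forall>a<m. w a = c * v a)" if w: "w \<in> W" "dotp m w w \<noteq> 0" for w
  proof -
    define c where "c = sqrt (dotp m w w)"
    have c: "c > 0" "c * c = dotp m w w"
      using w dotp_self_nonneg[of m w] by (auto simp: c_def less_le)
    define v where "v = (\<lambda>a. if a < m then w a / c else 0)"
    have wv: "\<forall>a<m. w a = c * v a" using c by (simp add: v_def)
    have d1: "dotp m v v = 1"
    proof -
      have "c * c * dotp m v v = dotp m (\<lambda>a. c * v a) (\<lambda>a. c * v a)"
        by (simp add: dotp_scale_left dotp_scale_right)
      also have "\<dots> = dotp m w w" using wv by (intro dotp_cong) auto
      finally show ?thesis using c w(2) by simp
    qed
    have "dotp m (u i) v = 0" if "i < k" for i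
    proof -
      have "c * dotp m (u i) v = dotp m (u i) (\<lambda>a. c * v a)" by (simp add: dotp_scale_right)
      also have "\<dots> = dotp m (u i) w" using wv by (intro dotp_cong) auto
      finally show ?thesis using w that c by (simp add: W_def)
    qed
    moreover have "v a \<in> {-1..1}" if "a < m" for a
    proof -
      have "(v a)\<^sup>2 \<le> dotp m v v" unfolding dotp_def power2_eq_square
        using that by (intro member_le_sum) auto
      then have "\<bar>v a\<bar> \<le> 1" using d1 by (simp add: abs_square_le_1)
      then show ?thesis by auto
    qed
    ultimately have "v \<in> K" using d1 by (auto simp: K_def v_def)
    then show ?thesis using wv c by blast
  qed
  \<comment> \<open>The \<open>k < m\<close> vectors have total square sum \<open>k\<close>, so some
    unit vector is outside their span; its residual shows that \<open>K\<close> is nonempty.\<close>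
  have "\<exists>a<m. (\<Sum>i<k. (u i a)\<^sup>2) < 1"
  proof (rule ccontr)
    assume "\<not> ?thesis"
    then have "(\<Sum>a<m. (1::real)) \<le> (\<Sum>a<m. \<Sum>i<k. (u i a)\<^sup>2)" by (intro sum_mono) (metis lessThan_iff not_less)
    then show False using orthonormal_sum_sq[OF on] k by simp
  qed
  then obtain a where a: "a < m" "(\<Sum>i<k. (u i a)\<^sup>2) < 1" by blast
  define e :: "nat \<Rightarrow> real" where "e = (\<lambda>b. of_bool (b = a))"
  define r where "r = (\<lambda>b. e b - (\<Sum>i<k. dotp m (u i) e * u i b))"
  have "r \<in> W" unfolding W_def r_def using bessel_residual(1)[OF on] by auto
  moreover have "dotp m r r \<noteq> 0"
    using a unfolding r_def bessel_residual(2)[OF on] by (simp add: e_def dotp_unit)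
  ultimately obtain v0 where "v0 \<in> K" using normalize by blast
  then have "K \<noteq> {}" by blast
  then obtain v where v: "v \<in> K" and min: "\<And>w. w \<in> K \<Longrightarrow> bform m A v v \<le> bform m A w w"
    using continuous_attains_inf[OF cK _ continuous_dotp(3)] by blast
  define \<mu> where "\<mu> = bform m A v v"
  have vu: "dotp m (u i) v = 0" if "i < k" for i
    using v that by (auto simp: K_def)
  have v1: "dotp m v v = 1" using v by (auto simp: K_def)
  have ray: "\<mu> * dotp m w w \<le> bform m A w w" if "w \<in> W" for w
  proof (cases "dotp m w w = 0")
    case True
    then have "\<forall>a<m. w a = 0" by (simp add: dotp_self_eq_0)
    then have "bform m A w w = 0" by (auto simp: bform_def intro!: sum.neutral)
    then show ?thesis using True by simp
  next
    case False
    then obtain c v' where v': "v' \<in> K" "c > 0" "\<forall>a<m. w a = c * v' a" using normalize \<open>w \<in> W\<close> by blast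
    have "bform m A w w = bform m A (\<lambda>a. c * v' a) (\<lambda>a. c * v' a)"
      using v' by (auto simp: bform_def intro!: sum.cong)
    then have "bform m A w w = c * c * bform m A v' v'" by (simp add: bform_scale_left bform_scale_right)
    moreover have "dotp m w w = dotp m (\<lambda>a. c * v' a) (\<lambda>a. c * v' a)"
      using v' by (intro dotp_cong) auto
    then have "dotp m w w = c * c * dotp m v' v'" by (simp add: dotp_scale_left dotp_scale_right)
    moreover have "dotp m v' v' = 1" using v' by (auto simp: K_def)
    ultimately show ?thesis using min[OF v'(1)] v' by (simp add: \<mu>_def mult.commute)
  qed
  \<comment> \<open>Half the gradient of the Rayleigh quotient at the minimiser. By symmetry of
    \<open>A\<close> it is orthogonal to the earlier eigenvectors, hence an admissible direction,
    and minimality along \<open>h\<close> itself forces \<open>h = 0\<close>.\<close>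
  define h where "h = (\<lambda>a. (\<Sum>b<m. A a b * v b) - \<mu> * v a)"
  have hW: "dotp m (u i) h = 0" if "i < k" for i
  proof -
    have "dotp m (u i) h = bform m A (u i) v - \<mu> * dotp m (u i) v"
      by (simp add: h_def dotp_diff_right dotp_scale_right bform_dotp)
    also have "bform m A (u i) v = bform m A v (u i)" by (rule bform_sym[OF sym])
    also have "\<dots> = dotp m v (\<lambda>a. lam i * u i a)"
      unfolding bform_dotp using eig that by (intro dotp_cong) auto
    also have "\<dots> = lam i * dotp m (u i) v" by (simp add: dotp_scale_right dotp_commute)
    finally show ?thesis using vu that by simp
  qed
  have sw: "bform m A h v = bform m A v h" by (rule bform_sym[OF sym])
  have "0 \<le> 2 * t * (bform m A v h - \<mu> * dotp m v h) + t\<^sup>2 * (bform m A h h - \<mu> * dotp m h h)" for t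
  proof -
    have "(\<lambda>a. v a + t * h a) \<in> W"
      using hW vu by (auto simp: W_def dotp_add_right dotp_scale_right)
    from ray[OF this] show ?thesis
      by (simp add: bform_add_left bform_add_right bform_scale_left bform_scale_right dotp_add_left
          dotp_add_right dotp_scale_left dotp_scale_right sw dotp_commute[of m h v]
          \<mu>_def[symmetric] v1 algebra_simps power2_eq_square)
  qed
  then have "bform m A v h - \<mu> * dotp m v h = 0" by (rule linear_coefficient_zero)
  moreover have "bform m A v h = dotp m h (\<lambda>a. \<Sum>b<m. A a b * v b)"
    by (subst bform_sym[OF sym]) (auto simp: bform_dotp)
  moreover have "dotp m h h = dotp m h (\<lambda>a. \<Sum>b<m. A a b * v b) - \<mu> * dotp m h v"
    by (simp add: h_def dotp_diff_right dotp_scale_right)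
  ultimately have "dotp m h h = 0" by (simp add: dotp_commute[of m h v])
  then have "\<forall>a<m. (\<Sum>b<m. A a b * v b) = \<mu> * v a" by (simp add: dotp_self_eq_0 h_def)
  then show ?thesis using v1 vu by (intro exI[of _ v] exI[of _ \<mu>]) simp
qed

lemma spectral_theorem:
  assumes sym: "\<And>a b. a < m \<Longrightarrow> b < m \<Longrightarrow> A a b = A b a"
  shows "\<exists>lam u. spectral m A lam u"
proof -
  have "k \<le> m \<Longrightarrow> \<exists>lam u. orthonormal m k u \<and>
     (\<forall>i<k. \<forall>a<m. (\<Sum>b<m. A a b * u i b) = lam i * u i a)" for k
  proof (induction k)
    case 0 then show ?case by (auto simp: orthonormal_def)
  next
    case (Suc k)
    then obtain lam u where u: "orthonormal m k u"
      "\<forall>i<k. \<forall>a<m. (\<Sum>b<m. A a b * u i b) = lam i * u i a" by auto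
    obtain v \<mu> where v: "dotp m v v = 1" "\<forall>i<k. dotp m (u i) v = 0"
      "\<forall>a<m. (\<Sum>b<m. A a b * v b) = \<mu> * v a"
      using next_eigenvector[OF u(1), of A lam] Suc.prems sym u(2) by auto
    have "orthonormal m (Suc k) (u(k := v))"
      using u(1) v by (auto simp: orthonormal_def less_Suc_eq dotp_commute[of m v "u _"])
    moreover have "\<forall>i<Suc k. \<forall>a<m. (\<Sum>b<m. A a b * (u(k := v)) i b) = (lam(k := \<mu>)) i * (u(k := v)) i a"
      using u(2) v by (auto simp: less_Suc_eq)
    ultimately show ?case by blast
  qed
  from this[of m] obtain lam u where u: "orthonormal m m u"
    "\<forall>i<m. \<forall>a<m. (\<Sum>b<m. A a b * u i b) = lam i * u i a" by auto
  have "A a b = (\<Sum>i<m. lam i * u i a * u i b)" if "a < m" "b < m" for a b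
  proof -
    have "(\<Sum>i<m. lam i * u i a * u i b) = (\<Sum>i<m. (\<Sum>c<m. A a c * u i c) * u i b)"
      using u(2) that by simp
    also have "\<dots> = (\<Sum>c<m. A a c * (\<Sum>i<m. u i c * u i b))"
      by (simp add: sum_distrib_right sum_distrib_left mult_ac) (rule sum.swap)
    also have "\<dots> = (\<Sum>c<m. A a c * of_bool (c = b))"
      using orthonormal_complete[OF u(1)] that by simp
    also have "\<dots> = A a b" using that by (simp add: of_bool_def if_distrib cong: if_cong)
    finally show ?thesis by simp
  qed
  then show ?thesis using u(1) unfolding spectral_def by blast
qed

lemma spectral_apply:
  assumes "spectral m A lam u" "i < m" "a < m"
  shows "(\<Sum>b<m. A a b * u i b) = lam i * u i a"
proof -
  have "(\<Sum>b<m. A a b * u i b) = (\<Sum>b<m. (\<Sum>j<m. lam j * u j a * u j b) * u i b)"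
    using assms by (auto simp: spectral_def intro!: sum.cong)
  also have "\<dots> = (\<Sum>b<m. \<Sum>j<m. lam j * u j a * (u j b * u i b))"
    by (simp only: sum_distrib_right mult.assoc)
  also have "\<dots> = (\<Sum>j<m. lam j * u j a * dotp m (u j) (u i))"
    by (subst sum.swap) (simp add: dotp_def sum_distrib_left)
  also have "\<dots> = (\<Sum>j<m. if j = i then lam j * u j a else 0)"
    using assms by (intro sum.cong) (auto simp: spectral_def orthonormal_dotp)
  finally show ?thesis using assms by simp
qed

lemma spectral_bform:
  assumes "spectral m A lam u"
  shows "bform m A x y = (\<Sum>i<m. lam i * dotp m (u i) x * dotp m (u i) y)"
proof -
  have "bform m A x y = (\<Sum>a<m. \<Sum>b<m. (\<Sum>i<m. lam i * u i a * u i b) * x a * y b)"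
    using assms by (auto simp: bform_def spectral_def intro!: sum.cong)
  also have "\<dots> = (\<Sum>a<m. \<Sum>b<m. \<Sum>i<m. lam i * (u i a * x a) * (u i b * y b))"
    by (simp only: sum_distrib_right) (simp only: mult_ac)
  also have "\<dots> = (\<Sum>a<m. \<Sum>i<m. \<Sum>b<m. lam i * (u i a * x a) * (u i b * y b))"
    by (intro sum.cong refl sum.swap)
  also have "\<dots> = (\<Sum>i<m. \<Sum>a<m. \<Sum>b<m. lam i * (u i a * x a) * (u i b * y b))"
    by (rule sum.swap)
  also have "\<dots> = (\<Sum>i<m. lam i * dotp m (u i) x * dotp m (u i) y)"
    by (simp add: dotp_def sum_product sum_distrib_left mult_ac)
  finally show ?thesis .
qed

lemma spectral_dotp_sq:
  assumes "spectral m A lam u"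
  shows "dotp m x x = (\<Sum>i<m. (dotp m (u i) x)\<^sup>2)"
  using parseval[of m u x x] assms by (simp add: spectral_def power2_eq_square)

section \<open>Rank-one updates and resolvents\<close>

text \<open>Written in the eigenbasis, \<open>qpow\<close> is the quadratic form at \<open>x\<close>
  of the \<open>j\<close>-th power of the resolvent at \<open>z\<close>, and \<open>trpow\<close> is
  the trace of that power. The scalar field is left open: \<open>z\<close> is a real level below the
  spectrum in the barrier argument and a point of the upper half-plane in the local law.\<close>

definition qpow :: "nat \<Rightarrow> (nat \<Rightarrow> real) \<Rightarrow> (nat \<Rightarrow> nat \<Rightarrow> real) \<Rightarrow> (nat \<Rightarrow> real) \<Rightarrow> 'a \<Rightarrow> nat \<Rightarrow> 'a::real_normed_field" where
  "qpow m lam u x z j = (\<Sum>i<m. of_real ((dotp m (u i) x)\<^sup>2) * (1 / (of_real (lam i) - z)) ^ j)"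

definition trpow :: "nat \<Rightarrow> (nat \<Rightarrow> real) \<Rightarrow> 'a \<Rightarrow> nat \<Rightarrow> 'a::real_normed_field" where
  "trpow m lam z j = (\<Sum>i<m. (1 / (of_real (lam i) - z)) ^ j)"

locale rank_one_update =
  fixes m :: nat and A :: "nat \<Rightarrow> nat \<Rightarrow> real" and x :: "nat \<Rightarrow> real"
    and lam lam' :: "nat \<Rightarrow> real" and u u' :: "nat \<Rightarrow> nat \<Rightarrow> real"
  assumes sp: "spectral m A lam u"
    and sp': "spectral m (\<lambda>a b. A a b + x a * x b) lam' u'"
begin

definition "ov k i = dotp m (u' k) (u i)"
abbreviation "y i \<equiv> dotp m (u i) x"
abbreviation "y' k \<equiv> dotp m (u' k) x"

lemma on: "orthonormal m m u" and on': "orthonormal m m u'"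
  using sp sp' by (auto simp: spectral_def)

text \<open>The updated form between \<open>u' k\<close> and \<open>u i\<close> is evaluated in both
  eigenbases; the two values differ by the rank-one term.\<close>

lemma cross:
  assumes "k < m" "i < m"
  shows "ov k i * (lam' k - lam i) = y i * y' k"
proof -
  let ?A' = "\<lambda>a b. A a b + x a * x b"
  have "bform m ?A' (u' k) (u i) = (\<Sum>j<m. lam' j * dotp m (u' j) (u' k) * ov j i)"
    by (simp add: spectral_bform[OF sp'] ov_def)
  also have "\<dots> = (\<Sum>j<m. if j = k then lam' j * ov j i else 0)"
    using assms by (intro sum.cong) (auto simp: orthonormal_dotp[OF on'])
  also have "\<dots> = lam' k * ov k i" using assms by simp
  finally have 1: "bform m ?A' (u' k) (u i) = lam' k * ov k i" .
  have "bform m A (u' k) (u i) = (\<Sum>j<m. lam j * dotp m (u j) (u' k) * dotp m (u j) (u i))"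
    by (simp add: spectral_bform[OF sp])
  also have "\<dots> = (\<Sum>j<m. if j = i then lam j * ov k j else 0)"
    using assms by (intro sum.cong) (auto simp: orthonormal_dotp[OF on] ov_def dotp_commute[of m "u' k"])
  also have "\<dots> = lam i * ov k i" using assms by simp
  finally have 2: "bform m A (u' k) (u i) = lam i * ov k i" .
  have "bform m ?A' (u' k) (u i) = bform m A (u' k) (u i) + (\<Sum>a<m. \<Sum>b<m. x a * u' k a * (x b * u i b))"
    by (simp add: bform_def algebra_simps sum.distrib)
  also have "(\<Sum>a<m. \<Sum>b<m. x a * u' k a * (x b * u i b)) = y' k * y i"
    unfolding dotp_def sum_product by (intro sum.cong refl) (simp add: mult_ac)
  finally show ?thesis using 1 2 by (simp add: algebra_simps)
qed

lemma ov_sums: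
  shows "i < m \<Longrightarrow> (\<Sum>k<m. ov k i * y' k) = y i" and "k < m \<Longrightarrow> (\<Sum>i<m. ov k i * y i) = y' k"
    and "i < m \<Longrightarrow> (\<Sum>k<m. ov k i * ov k i) = 1" and "k < m \<Longrightarrow> (\<Sum>i<m. ov k i * ov k i) = 1"
proof -
  show "i < m \<Longrightarrow> (\<Sum>k<m. ov k i * y' k) = y i" using parseval[OF on', of "u i" x] by (simp add: ov_def)
  show "k < m \<Longrightarrow> (\<Sum>i<m. ov k i * y i) = y' k"
    using parseval[OF on, of "u' k" x] by (simp add: ov_def dotp_commute[of m "u' k" "u _"])
  show "i < m \<Longrightarrow> (\<Sum>k<m. ov k i * ov k i) = 1"
    using parseval[OF on', of "u i" "u i"] by (simp add: ov_def orthonormal_dotp[OF on])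
  show "k < m \<Longrightarrow> (\<Sum>i<m. ov k i * ov k i) = 1"
    using parseval[OF on, of "u' k" "u' k"]
    by (simp add: ov_def orthonormal_dotp[OF on'] dotp_commute[of m "u' k" "u _"])
qed

text \<open>\<open>lam' k\<close> is the updated form at a unit vector, hence at least an average of
  the old eigenvalues.\<close>

lemma eigenvalue_gt:
  assumes "\<And>i. i < m \<Longrightarrow> l < lam i" "k < m"
  shows "l < lam' k"
proof -
  have "(\<Sum>j<m. lam' j * dotp m (u' j) (u' k) * dotp m (u' j) (u' k)) = (\<Sum>j<m. if j = k then lam' j else 0)"
    using assms by (intro sum.cong) (auto simp: orthonormal_dotp[OF on'])
  then have "lam' k = bform m (\<lambda>a b. A a b + x a * x b) (u' k) (u' k)"
    using assms by (simp add: spectral_bform[OF sp'])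
  also have "\<dots> = bform m A (u' k) (u' k) + (\<Sum>a<m. \<Sum>b<m. x a * u' k a * (x b * u' k b))"
    by (simp add: bform_def algebra_simps sum.distrib)
  also have "(\<Sum>a<m. \<Sum>b<m. x a * u' k a * (x b * u' k b)) = y' k * y' k"
    unfolding dotp_def sum_product by (intro sum.cong refl) (simp add: mult_ac)
  also have "bform m A (u' k) (u' k) = (\<Sum>i<m. lam i * (ov k i * ov k i))"
    by (simp add: spectral_bform[OF sp] ov_def dotp_commute[of m "u' k" "u _"] mult.assoc)
  finally have 1: "lam' k \<ge> (\<Sum>i<m. lam i * (ov k i * ov k i))" by simp
  have "\<exists>i<m. ov k i * ov k i \<noteq> 0"
    using ov_sums(4)[OF assms(2)] by (metis (no_types, lifting) lessThan_iff sum.neutral zero_neq_one)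
  then obtain i0 where i0: "i0 < m" "ov k i0 * ov k i0 \<noteq> 0" by blast
  have "0 < (lam i0 - l) * (ov k i0 * ov k i0)" using assms(1)[OF i0(1)] i0(2) by (simp add: zero_less_mult_iff) linarith
  then have "0 < (\<Sum>i<m. (lam i - l) * (ov k i * ov k i))"
    using i0(1) assms(1) by (intro sum_pos2[where i=i0]) (auto simp: less_imp_le)
  also have "\<dots> = (\<Sum>i<m. lam i * (ov k i * ov k i)) - l"
    by (simp add: left_diff_distrib sum_subtractf sum_distrib_left[symmetric] ov_sums(4)[OF assms(2)])
  finally show ?thesis using 1 by simp
qed

context
  fixes z :: "'a::real_normed_field"
  assumes nz: "\<And>i. i < m \<Longrightarrow> of_real (lam i) \<noteq> z" and nz': "\<And>k. k < m \<Longrightarrow> of_real (lam' k) \<noteq> z"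
begin

definition "g i = 1 / (of_real (lam i) - z)"
definition "g' k = 1 / (of_real (lam' k) - z)"
text \<open>With \<open>G\<close> and \<open>G'\<close> the resolvents before and after the update,
  this is the inner product of \<open>x\<close> with \<open>G' ^ p G ^ q x\<close>, expanded in both
  eigenbases.\<close>

definition "tt p q = (\<Sum>k<m. \<Sum>i<m. of_real (ov k i * y i * y' k) * g' k ^ p * g i ^ q)"
abbreviation "q \<equiv> qpow m lam u x z"
abbreviation "h \<equiv> qpow m lam' u' x z"

text \<open>The resolvent identity \<open>G - G' = G' x x^T G\<close> in the two eigenbases. It
  avoids a division by \<open>lam' k - lam i\<close>, which may vanish.\<close>

lemma g_diff:
  assumes "k < m" "i < m"
  shows "of_real (ov k i) * (g i - g' k) = of_real (y i * y' k) * g i * g' k"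
proof -
  have "of_real (lam i) - z \<noteq> 0" "of_real (lam' k) - z \<noteq> 0" using nz nz' assms by auto
  then have "g i - g' k = of_real (lam' k - lam i) * g i * g' k"
    by (simp add: g_def g'_def field_simps)
  then show ?thesis using cross[OF assms]
    by (metis (no_types, lifting) mult.assoc of_real_mult)
qed

lemma tt_0: "tt 0 j = q j" and tt_0': "tt j 0 = h j"
proof -
  have "tt 0 j = (\<Sum>i<m. \<Sum>k<m. of_real (ov k i * y' k) * (of_real (y i) * g i ^ j))"
    unfolding tt_def by (subst sum.swap) (simp add: mult_ac)
  also have "\<dots> = (\<Sum>i<m. of_real (y i) * (of_real (y i) * g i ^ j))"
    by (simp add: sum_distrib_right[symmetric] of_real_sum[symmetric] ov_sums(1) del: of_real_mult of_real_sum)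
  finally show "tt 0 j = q j" by (simp add: qpow_def g_def power2_eq_square mult_ac)
  have "tt j 0 = (\<Sum>k<m. \<Sum>i<m. of_real (ov k i * y i) * (of_real (y' k) * g' k ^ j))"
    unfolding tt_def by (simp add: mult_ac)
  also have "\<dots> = (\<Sum>k<m. of_real (y' k) * (of_real (y' k) * g' k ^ j))"
    by (simp add: sum_distrib_right[symmetric] of_real_sum[symmetric] ov_sums(2) del: of_real_mult of_real_sum)
  finally show "tt j 0 = h j" by (simp add: qpow_def g'_def power2_eq_square mult_ac)
qed

lemma tt_step: "tt p (Suc j) - tt (Suc p) j = h (Suc p) * q (Suc j)"
proof -
  have "tt p (Suc j) - tt (Suc p) j =
     (\<Sum>k<m. \<Sum>i<m. of_real (y i * y' k) * g' k ^ p * g i ^ j * (of_real (ov k i) * (g i - g' k)))"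
    unfolding tt_def by (simp add: sum_subtractf[symmetric] algebra_simps)
  also have "\<dots> = (\<Sum>k<m. \<Sum>i<m. of_real (y i * y' k) * g' k ^ p * g i ^ j * (of_real (y i * y' k) * g i * g' k))"
    by (intro sum.cong refl) (simp only: g_diff lessThan_iff)
  also have "\<dots> = (\<Sum>k<m. \<Sum>i<m. (of_real ((y' k)\<^sup>2) * g' k ^ Suc p) * (of_real ((y i)\<^sup>2) * g i ^ Suc j))"
    by (simp add: power2_eq_square mult_ac)
  also have "\<dots> = h (Suc p) * q (Suc j)"
    by (simp only: qpow_def g_def g'_def sum_product)
  finally show ?thesis .
qed

lemma tt_telescope: "p \<le> n \<Longrightarrow> q n - tt p (n - p) = (\<Sum>l<p. h (Suc l) * q (n - l))"
proof (induction p)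
  case 0 then show ?case by (simp add: tt_0)
next
  case (Suc p)
  then have "tt p (n - p) - tt (Suc p) (n - Suc p) = h (Suc p) * q (n - p)"
    using tt_step[of p "n - Suc p"] by (simp add: Suc_diff_Suc)
  then show ?case using Suc by (simp add: algebra_simps)
qed

text \<open>The noncommutative expansion of \<open>G ^ n - G' ^ n\<close> into terms
  \<open>G' ^ (n - 1 - j) (G - G') G ^ j\<close>; since \<open>G - G'\<close> has rank one, the
  trace of each term is a scalar \<open>tt\<close>.\<close>

lemma trace_diff:
  "trpow m lam z n - trpow m lam' z n = (\<Sum>i<n. tt (n - i) (Suc i))"
proof -
  have "trpow m lam z n = (\<Sum>i<m. \<Sum>k<m. of_real (ov k i * ov k i) * g i ^ n)"
    by (simp add: trpow_def g_def sum_distrib_right[symmetric] of_real_sum[symmetric] ov_sums(3) del: of_real_mult of_real_sum)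
  also have "\<dots> = (\<Sum>k<m. \<Sum>i<m. of_real (ov k i * ov k i) * g i ^ n)"
    by (rule sum.swap)
  finally have 1: "trpow m lam z n = (\<Sum>k<m. \<Sum>i<m. of_real (ov k i * ov k i) * g i ^ n)" .
  have 2: "trpow m lam' z n = (\<Sum>k<m. \<Sum>i<m. of_real (ov k i * ov k i) * g' k ^ n)"
    by (simp add: trpow_def g'_def sum_distrib_right[symmetric] of_real_sum[symmetric] ov_sums(4) del: of_real_mult of_real_sum)
  have "trpow m lam z n - trpow m lam' z n = (\<Sum>k<m. \<Sum>i<m. of_real (ov k i * ov k i) * (g i ^ n - g' k ^ n))"
    unfolding 1 2 by (simp add: sum_subtractf[symmetric] algebra_simps)
  also have "\<dots> = (\<Sum>k<m. \<Sum>i<m. \<Sum>j<n. of_real (ov k i) * (of_real (ov k i) * (g i - g' k)) * g' k ^ (n - Suc j) * g i ^ j)"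
    by (simp add: power_diff_sumr2 sum_distrib_left mult_ac)
  also have "\<dots> = (\<Sum>k<m. \<Sum>i<m. \<Sum>j<n. of_real (ov k i * y i * y' k) * g' k ^ (n - j) * g i ^ Suc j)"
  proof (intro sum.cong refl)
    fix k i j assume "k \<in> {..<m}" "i \<in> {..<m}" "j \<in> {..<n}"
    moreover from this have "g' k ^ (n - j) = g' k * g' k ^ (n - Suc j)"
      by (metis Suc_diff_Suc lessThan_iff power_Suc)
    ultimately show "of_real (ov k i) * (of_real (ov k i) * (g i - g' k)) * g' k ^ (n - Suc j) * g i ^ j =
       of_real (ov k i * y i * y' k) * g' k ^ (n - j) * g i ^ Suc j"
      by (simp only: g_diff lessThan_iff) (simp add: mult_ac)
  qed
  also have "\<dots> = (\<Sum>k<m. \<Sum>j<n. \<Sum>i<m. of_real (ov k i * y i * y' k) * g' k ^ (n - j) * g i ^ Suc j)"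
    by (intro sum.cong refl sum.swap)
  also have "\<dots> = (\<Sum>j<n. \<Sum>k<m. \<Sum>i<m. of_real (ov k i * y i * y' k) * g' k ^ (n - j) * g i ^ Suc j)"
    by (rule sum.swap)
  finally show ?thesis by (simp add: tt_def)
qed

text \<open>The series with coefficients \<open>q (Suc n)\<close> is the Taylor expansion in
  \<open>t\<close> of the quadratic form of the resolvent at \<open>z + t\<close>. So this is the
  Sherman-Morrison formula \<open>(1 - x^T G' x) (1 + x^T G x) = 1\<close> at all shifted parameters
  at once.\<close>

lemma fps_quad: "(1 - Abs_fps (\<lambda>n. h (Suc n))) * (1 + Abs_fps (\<lambda>n. q (Suc n))) = 1"
proof -
  have "Abs_fps (\<lambda>n. q (Suc n)) - Abs_fps (\<lambda>n. h (Suc n)) = Abs_fps (\<lambda>n. h (Suc n)) * Abs_fps (\<lambda>n. q (Suc n))"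
  proof (rule fps_ext)
    fix n
    have "q (Suc n) - h (Suc n) = (\<Sum>l<Suc n. h (Suc l) * q (Suc n - l))"
      using tt_telescope[of "Suc n" "Suc n"] by (simp add: tt_0')
    also have "\<dots> = (\<Sum>i=0..n. h (Suc i) * q (Suc (n - i)))"
      by (intro sum.cong) (auto simp: Suc_diff_le)
    finally show "fps_nth (Abs_fps (\<lambda>n. q (Suc n)) - Abs_fps (\<lambda>n. h (Suc n))) n =
        fps_nth (Abs_fps (\<lambda>n. h (Suc n)) * Abs_fps (\<lambda>n. q (Suc n))) n"
      by (simp add: fps_mult_nth)
  qed
  then show ?thesis by (simp add: algebra_simps)
qed

text \<open>Each term of \<open>trace_diff\<close> is rewritten by \<open>tt_telescope\<close>.
  Exchanging the triangular double sum then produces the multiplicities \<open>n + 1 - l\<close>,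
  which are the coefficients of the derivative of the series.\<close>

lemma fps_trace:
  "Abs_fps (\<lambda>n. trpow m lam z (Suc n) - trpow m lam' z (Suc n)) =
     fps_deriv (Abs_fps (\<lambda>n. q (Suc n))) * (1 - Abs_fps (\<lambda>n. h (Suc n)))"
proof (rule fps_ext)
  fix n
  let ?Q = "Abs_fps (\<lambda>n. q (Suc n))" and ?H = "Abs_fps (\<lambda>n. h (Suc n))"
  have "trpow m lam z (Suc n) - trpow m lam' z (Suc n) = (\<Sum>i<Suc n. tt (Suc n - i) (Suc i))"
    by (rule trace_diff)
  also have "\<dots> = (\<Sum>i<Suc n. q (Suc (Suc n)) - (\<Sum>l<Suc n - i. h (Suc l) * q (Suc (Suc n) - l)))"
  proof (intro sum.cong refl)
    fix i assume "i \<in> {..<Suc n}"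
    then show "tt (Suc n - i) (Suc i) = q (Suc (Suc n)) - (\<Sum>l<Suc n - i. h (Suc l) * q (Suc (Suc n) - l))"
      using tt_telescope[of "Suc n - i" "Suc (Suc n)"] by (simp add: algebra_simps)
  qed
  also have "\<dots> = of_nat (Suc n) * q (Suc (Suc n)) - (\<Sum>i<Suc n. \<Sum>l<Suc n - i. h (Suc l) * q (Suc (Suc n) - l))"
    by (simp add: sum_subtractf)
  also have "(\<Sum>i<Suc n. \<Sum>l<Suc n - i. h (Suc l) * q (Suc (Suc n) - l)) =
      (\<Sum>(i,l)\<in>Sigma {..<Suc n} (\<lambda>i. {..<Suc n - i}). h (Suc l) * q (Suc (Suc n) - l))"
    by (rule sum.Sigma) auto
  also have "\<dots> = (\<Sum>(l,i)\<in>Sigma {..<Suc n} (\<lambda>l. {..<Suc n - l}). h (Suc l) * q (Suc (Suc n) - l))"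
    by (rule sum.reindex_bij_witness[of _ "\<lambda>(i,l). (l,i)" "\<lambda>(i,l). (l,i)"]) auto
  also have "\<dots> = (\<Sum>l<Suc n. \<Sum>i<Suc n - l. h (Suc l) * q (Suc (Suc n) - l))"
    by (rule sum.Sigma[symmetric]) auto
  also have "\<dots> = (\<Sum>l<Suc n. of_nat (Suc n - l) * (h (Suc l) * q (Suc (Suc n) - l)))"
    by simp
  also have "\<dots> = (\<Sum>l=0..n. h (Suc l) * (of_nat (Suc (n - l)) * q (Suc (Suc (n - l)))))"
    by (intro sum.cong) (auto simp: Suc_diff_le)
  also have "\<dots> = fps_nth (?H * fps_deriv ?Q) n" by (simp add: fps_mult_nth)
  finally show "fps_nth (Abs_fps (\<lambda>n. trpow m lam z (Suc n) - trpow m lam' z (Suc n))) n =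
     fps_nth (fps_deriv ?Q * (1 - ?H)) n" by (simp add: algebra_simps)
qed

text \<open>In generating functions, \<open>(1 + Q) \<cdot> (Tr G - Tr G') = Q'\<close>: the Sherman--Morrison trace formula
  at all spectral parameters near \<open>z\<close>.\<close>

lemma trace_recursion:
  "(\<Sum>i=0..n. ((if i = 0 then 1 else 0) + q (Suc i)) * (trpow m lam z (Suc (n - i)) - trpow m lam' z (Suc (n - i))))
     = of_nat (Suc n) * q (Suc (Suc n))"
proof -
  let ?Q = "Abs_fps (\<lambda>n. q (Suc n))" and ?H = "Abs_fps (\<lambda>n. h (Suc n))"
  let ?G = "Abs_fps (\<lambda>n. trpow m lam z (Suc n) - trpow m lam' z (Suc n))"
  have "(1 + ?Q) * ?G = fps_deriv ?Q * ((1 - ?H) * (1 + ?Q))"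
    unfolding fps_trace by (simp only: mult_ac)
  then have "(1 + ?Q) * ?G = fps_deriv ?Q" by (simp only: fps_quad mult_1_right)
  then have "fps_nth ((1 + ?Q) * ?G) n = fps_nth (fps_deriv ?Q) n" by simp
  moreover have "fps_nth (1 + ?Q) i = (if i = 0 then 1 else 0) + q (Suc i)" for i by (cases i) auto
  ultimately show ?thesis by (simp add: fps_mult_nth)
qed

text \<open>Differentiating \<open>(1 - H) (1 + Q) = 1\<close> replaces \<open>Q' (1 - H)\<close> by
  \<open>H' (1 + Q)\<close>. At a real level below the spectrum every term of this form is
  nonnegative, which shows that the traces decrease.\<close>

lemma trace_via_updated:
  "trpow m lam z (Suc n) - trpow m lam' z (Suc n) =
     (\<Sum>i=0..n. of_nat (Suc i) * h (Suc (Suc i)) * ((if n - i = 0 then 1 else 0) + q (Suc (n - i))))"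
proof -
  let ?Q = "Abs_fps (\<lambda>n. q (Suc n))" and ?H = "Abs_fps (\<lambda>n. h (Suc n))"
  have "fps_deriv ((1 - ?H) * (1 + ?Q)) = 0" by (simp add: fps_quad)
  then have "fps_deriv ?Q * (1 - ?H) = fps_deriv ?H * (1 + ?Q)" by (simp add: algebra_simps)
  then have eq: "Abs_fps (\<lambda>n. trpow m lam z (Suc n) - trpow m lam' z (Suc n)) = fps_deriv ?H * (1 + ?Q)"
    using fps_trace by simp
  have "trpow m lam z (Suc n) - trpow m lam' z (Suc n) = fps_nth (fps_deriv ?H * (1 + ?Q)) n"
    using arg_cong[OF eq, of "\<lambda>F. fps_nth F n"] by (simp only: fps_nth_Abs_fps)
  moreover have "fps_nth (1 + ?Q) i = (if i = 0 then 1 else 0) + q (Suc i)" for i by (cases i) auto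
  ultimately show ?thesis by (simp add: fps_mult_nth)
qed

lemma quad_update: "(1 + q 1) * (1 - h 1) = 1"
  using tt_step[of 0 0] by (simp add: tt_0 tt_0' algebra_simps)

lemma trace_update: "(1 + q 1) * (trpow m lam z 1 - trpow m lam' z 1) = q 2"
  using trace_recursion[of 0] by (simp add: numeral_2_eq_2)

end

end

section \<open>Decrements of resolvent traces at a real level below the spectrum\<close>

lemma qpow_nonneg: "(\<And>i. i < m \<Longrightarrow> l < lam i) \<Longrightarrow> 0 \<le> qpow m lam u x (l::real) j"
  unfolding qpow_def by (intro sum_nonneg mult_nonneg_nonneg zero_le_power divide_nonneg_nonneg) (auto simp: less_imp_le)

text \<open>With \<open>i = i' + 2\<close> and \<open>j = j' + 2\<close>, the difference of the two
  sides is \<open>a^2 b^2\<close> times the product of \<open>a ^ i' - b ^ i'\<close> and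
  \<open>a ^ j' - b ^ j'\<close>, which have the same sign.\<close>

lemma power_cross_nonneg:
  fixes a b :: real
  assumes "0 \<le> a" "0 \<le> b" "2 \<le> i" "2 \<le> j" "i + j = p + 2"
  shows "a ^ i * b ^ j + a ^ j * b ^ i \<le> a\<^sup>2 * b ^ p + a ^ p * b\<^sup>2"
proof -
  obtain i' where i: "i = i' + 2" using assms(3) by (metis add.commute le_iff_add)
  obtain j' where j: "j = j' + 2" using assms(4) by (metis add.commute le_iff_add)
  have p: "p = i' + j' + 2" using assms(5) i j by simp
  have "0 \<le> (a ^ i' - b ^ i') * (a ^ j' - b ^ j')"
  proof (cases "a \<le> b")
    case True
    then have "a ^ i' \<le> b ^ i'" "a ^ j' \<le> b ^ j'" using assms by (auto intro: power_mono)
    then show ?thesis by (simp add: mult_nonpos_nonpos)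
  next
    case False
    then have "b ^ i' \<le> a ^ i'" "b ^ j' \<le> a ^ j'" using assms by (auto intro: power_mono)
    then show ?thesis by simp
  qed
  then have "0 \<le> a\<^sup>2 * b\<^sup>2 * ((a ^ i' - b ^ i') * (a ^ j' - b ^ j'))" by simp
  then show ?thesis unfolding i j p by (simp add: algebra_simps power_add power2_eq_square)
qed

text \<open>Moments of a nonnegative measure are log-convex in the exponent, so for a fixed sum of
  exponents the product is largest at the extremes 2 and \<open>p\<close>. The double sum is
  symmetrised so that \<open>power_cross_nonneg\<close> applies termwise.\<close>

lemma qpow_log_convex:
  assumes gt: "\<And>i. i < m \<Longrightarrow> l < lam i" and ij: "2 \<le> i" "2 \<le> j" "i + j = p + 2"
  shows "qpow m lam u x l i * qpow m lam u x l j \<le> qpow m lam u x l 2 * qpow m lam u x (l::real) p"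
proof -
  define w where "w = (\<lambda>i. (dotp m (u i) x)\<^sup>2)"
  define g where "g = (\<lambda>i. 1 / (lam i - l))"
  have g: "0 \<le> g i" if "i < m" for i using gt[OF that] by (simp add: g_def)
  have q: "qpow m lam u x l k = (\<Sum>a<m. w a * g a ^ k)" for k by (simp add: qpow_def w_def g_def)
  have sym: "2 * (qpow m lam u x l i * qpow m lam u x l j) =
     (\<Sum>a<m. \<Sum>b<m. w a * w b * (g a ^ i * g b ^ j + g a ^ j * g b ^ i))" for i j
  proof -
    have "qpow m lam u x l i * qpow m lam u x l j = (\<Sum>a<m. \<Sum>b<m. w a * w b * (g a ^ i * g b ^ j))"
      by (simp only: q sum_product) (simp only: mult_ac)
    moreover have "qpow m lam u x l j * qpow m lam u x l i = (\<Sum>a<m. \<Sum>b<m. w a * w b * (g a ^ j * g b ^ i))"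
      by (simp only: q sum_product) (simp only: mult_ac)
    moreover have "2 * (qpow m lam u x l i * qpow m lam u x l j) =
        qpow m lam u x l i * qpow m lam u x l j + qpow m lam u x l j * qpow m lam u x l i" by simp
    ultimately show ?thesis by (simp only: sum.distrib[symmetric] distrib_left[symmetric])
  qed
  have "2 * (qpow m lam u x l i * qpow m lam u x l j) \<le> 2 * (qpow m lam u x l 2 * qpow m lam u x l p)"
    unfolding sym by (intro sum_mono mult_left_mono power_cross_nonneg g mult_nonneg_nonneg ij) (auto simp: w_def)
  then show ?thesis by simp
qed

context rank_one_update
begin

context
  fixes l :: real
  assumes gt: "\<And>i. i < m \<Longrightarrow> l < lam i"
begin

lemma gt': "k < m \<Longrightarrow> l < lam' k" by (rule eigenvalue_gt[OF gt])

lemma nz_real: "i < m \<Longrightarrow> of_real (lam i) \<noteq> l" "k < m \<Longrightarrow> of_real (lam' k) \<noteq> l"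
  using gt[of i] gt'[of k] by auto

abbreviation "ql \<equiv> qpow m lam u x l"
abbreviation "dtr n \<equiv> trpow m lam l n - trpow m lam' l n"

lemma dtr_nonneg: "0 \<le> dtr (Suc n)"
proof -
  have "0 \<le> (\<Sum>i=0..n. of_nat (Suc i) * qpow m lam' u' x l (Suc (Suc i)) * ((if n - i = 0 then 1 else 0) + ql (Suc (n - i))))"
    by (intro sum_nonneg mult_nonneg_nonneg add_nonneg_nonneg qpow_nonneg gt gt') auto
  then show ?thesis using trace_via_updated[OF nz_real, of n] by simp
qed

text \<open>Only the term \<open>i = 0\<close> of the recursion is kept, with its factor
  \<open>1 + ql 1\<close> bounded below by 1.\<close>

lemma dtr_le: "dtr (Suc n) \<le> real (Suc n) * ql (Suc (Suc n))"
proof -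
  have "dtr (Suc n) \<le> (\<Sum>i\<in>{0}. ((if i = 0 then 1 else 0) + ql (Suc i)) * dtr (Suc (n - i)))"
    using mult_nonneg_nonneg[OF qpow_nonneg[OF gt, where u=u and x=x] dtr_nonneg[of n]] by (simp add: algebra_simps)
  also have "\<dots> \<le> (\<Sum>i=0..n. ((if i = 0 then 1 else 0) + ql (Suc i)) * dtr (Suc (n - i)))"
    by (intro sum_mono2 mult_nonneg_nonneg add_nonneg_nonneg qpow_nonneg gt dtr_nonneg) auto
  finally show ?thesis using trace_recursion[OF nz_real, of n] by simp
qed

text \<open>The recursion is solved for its leading term. In each of the other terms, fewer than
  \<open>p\<close> in number, \<open>dtr_le\<close> and log-convexity leave at most
  \<open>p * (ql 2 * ql p)\<close>.\<close>

lemma dtr_power: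
  assumes p: "1 \<le> p"
  shows "real p * ql (Suc p) - (real p)\<^sup>2 * (ql 2 * ql p) \<le> (1 + ql 1) * dtr p"
proof -
  obtain n where n: "p = Suc n" using p by (cases p) auto
  have "real p * ql (Suc p) = (\<Sum>i=0..n. ((if i = 0 then 1 else 0) + ql (Suc i)) * dtr (Suc (n - i)))"
    using trace_recursion[OF nz_real, of n] n by simp
  also have "\<dots> = (1 + ql 1) * dtr p + (\<Sum>i=1..n. ((if i = 0 then 1 else 0) + ql (Suc i)) * dtr (Suc (n - i)))"
    by (subst sum.atLeast_Suc_atMost) (auto simp: n)
  finally have 1: "real p * ql (Suc p) = (1 + ql 1) * dtr p + (\<Sum>i=1..n. ((if i = 0 then 1 else 0) + ql (Suc i)) * dtr (Suc (n - i)))" .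
  have 2: "(\<Sum>i=1..n. ((if i = 0 then 1 else 0) + ql (Suc i)) * dtr (Suc (n - i)))
      \<le> (\<Sum>i=1..n. real p * (ql 2 * ql p))"
  proof (rule sum_mono)
    fix i assume i: "i \<in> {1..n}"
    have "((if i = 0 then 1 else 0) + ql (Suc i)) * dtr (Suc (n - i)) = ql (Suc i) * dtr (Suc (n - i))"
      using i by simp
    also have "\<dots> \<le> ql (Suc i) * (real (Suc (n - i)) * ql (Suc (Suc (n - i))))"
      by (intro mult_left_mono dtr_le qpow_nonneg gt)
    also have "\<dots> \<le> real p * (ql (Suc i) * ql (Suc (Suc (n - i))))"
      using mult_right_mono[of "real (Suc (n - i))" "real p" "ql (Suc i) * ql (Suc (Suc (n - i)))"] i n
      by (simp add: qpow_nonneg gt mult_ac)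
    also have "\<dots> \<le> real p * (ql 2 * ql p)"
      using i n by (intro mult_left_mono qpow_log_convex gt) auto
    finally show "((if i = 0 then 1 else 0) + ql (Suc i)) * dtr (Suc (n - i)) \<le> real p * (ql 2 * ql p)" .
  qed
  have 3: "(\<Sum>i=1..n. real p * (ql 2 * ql p)) \<le> (real p)\<^sup>2 * (ql 2 * ql p)"
  proof -
    have "real n * real p \<le> (real p)\<^sup>2" unfolding power2_eq_square using n by (intro mult_right_mono) auto
    then have "real n * real p * (ql 2 * ql p) \<le> (real p)\<^sup>2 * (ql 2 * ql p)"
      by (intro mult_right_mono mult_nonneg_nonneg qpow_nonneg gt)
    then show ?thesis by (simp add: mult.assoc)
  qed
  show ?thesis using 1 2 3 by linarith
qed

text \<open>The first two relations of the recursion combine so that the potential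
  \<open>Tr (G + \<theta> G^2)\<close> obeys an inequality of the same shape as the formula for
  \<open>Tr G\<close>, with \<open>ql 1 + \<theta> * ql 2\<close> in the role of
  \<open>ql 1\<close>. The dropped term of order \<open>\<theta>^2\<close> is nonnegative.\<close>

lemma dtr_two_term:
  assumes "0 \<le> \<theta>"
  shows "ql 2 + 2 * \<theta> * ql 3 \<le> (1 + (ql 1 + \<theta> * ql 2)) * (dtr 1 + \<theta> * dtr 2)"
proof -
  have 1: "(1 + ql 1) * dtr 1 = ql 2"
    using trace_recursion[OF nz_real, of 0] by (simp add: numeral_2_eq_2)
  have 2: "(1 + ql 1) * dtr 2 + ql 2 * dtr 1 = 2 * ql 3"
    using trace_recursion[OF nz_real, of 1] by (simp add: numeral_2_eq_2 numeral_3_eq_3)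
  have "0 \<le> \<theta>\<^sup>2 * (ql 2 * dtr 2)"
    using dtr_nonneg[of 1] by (intro mult_nonneg_nonneg qpow_nonneg gt) (auto simp: numeral_2_eq_2)
  moreover have "(1 + (ql 1 + \<theta> * ql 2)) * (dtr 1 + \<theta> * dtr 2) =
     (1 + ql 1) * dtr 1 + \<theta> * ((1 + ql 1) * dtr 2 + ql 2 * dtr 1) + \<theta>\<^sup>2 * (ql 2 * dtr 2)"
    by (simp add: algebra_simps power2_eq_square)
  ultimately show ?thesis using 1 2 by simp
qed

end

end

section \<open>Spectral parameters in the upper half-plane\<close>

lemma Im_of_real_mult: "Im (of_real r * w) = r * Im w"
  by simp

lemma Im_inverse_diff: "Im (1 / (complex_of_real a - z)) = Im z * (cmod (1 / (of_real a - z)))\<^sup>2"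
  by (simp add: Im_divide norm_divide power_divide cmod_power2)

lemma Im_mult_inverse_diff:
  assumes "Im z \<noteq> 0"
  shows "Im (z * (1 / (complex_of_real a - z))) = Im z * (a * (cmod (1 / (of_real a - z)))\<^sup>2)"
proof -
  have "of_real a - z \<noteq> 0" using assms by (auto simp: complex_eq_iff)
  then have "z * (1 / (of_real a - z)) = of_real a * (1 / (of_real a - z)) - 1" by (simp add: field_simps)
  then show ?thesis by (simp only: Im_complex_of_real minus_complex.sel Im_of_real_mult Im_inverse_diff one_complex.sel) simp
qed

lemma Im_weighted:
  "Im (\<Sum>i\<in>I. of_real (w i) * (1 / (complex_of_real (lam i) - z))) =
     Im z * (\<Sum>i\<in>I. w i * (cmod (1 / (of_real (lam i) - z)))\<^sup>2)"
  by (simp only: Im_sum Im_of_real_mult Im_inverse_diff sum_distrib_left) (simp only: mult_ac)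

lemma Im_mult_weighted_nonneg:
  assumes "0 < Im z" "\<And>i. i \<in> I \<Longrightarrow> 0 \<le> w i" "\<And>i. i \<in> I \<Longrightarrow> 0 \<le> lam i"
  shows "0 \<le> Im (z * (\<Sum>i\<in>I. of_real (w i) * (1 / (complex_of_real (lam i) - z))))"
proof -
  have "z * (\<Sum>i\<in>I. of_real (w i) * (1 / (complex_of_real (lam i) - z)))
      = (\<Sum>i\<in>I. of_real (w i) * (z * (1 / (complex_of_real (lam i) - z))))"
    by (simp only: sum_distrib_left) (simp only: mult_ac)
  moreover have "0 \<le> Im (z * (1 / (complex_of_real (lam i) - z)))" if "i \<in> I" for i
    using assms that by (subst Im_mult_inverse_diff) (auto intro!: mult_nonneg_nonneg)
  then have "0 \<le> Im (\<Sum>i\<in>I. of_real (w i) * (z * (1 / (complex_of_real (lam i) - z))))"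
    using assms(2) unfolding Im_sum Im_of_real_mult by (intro sum_nonneg mult_nonneg_nonneg) auto
  ultimately show ?thesis by simp
qed

text \<open>Multiplication by \<open>z\<close> gives \<open>Im (z * (1 + s)) \<ge> Im z\<close>,
  whatever the size of \<open>s\<close>.\<close>

lemma norm_one_plus_ge:
  assumes "0 < Im z" "0 \<le> Im (z * s)"
  shows "Im z / cmod z \<le> cmod (1 + s)"
proof -
  have "z \<noteq> 0" using assms by auto
  have "Im z \<le> Im (z * (1 + s))" using assms by (simp add: distrib_left)
  also have "\<dots> \<le> cmod z * cmod (1 + s)" by (metis abs_Im_le_cmod abs_le_D1 norm_mult)
  finally show ?thesis using \<open>z \<noteq> 0\<close> by (simp add: divide_le_eq mult.commute)
qed

context rank_one_update
begin

lemma nz_complex: "0 < Im z \<Longrightarrow> complex_of_real (lam i) \<noteq> z" "0 < Im z \<Longrightarrow> complex_of_real (lam' i) \<noteq> z"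
  by auto

text \<open>The modulus of \<open>x^T G^2 x\<close> is at most \<open>Im (x^T G x) / Im z\<close>,
  so the quotient in the trace formula is at most \<open>1 / Im z\<close>, independently of the size
  of \<open>x\<close>. This is what makes columns with huge entries harmless.\<close>

lemma trace_change_bound:
  assumes z: "0 < Im z"
  shows "cmod (trpow m lam z 1 - trpow m lam' z 1) \<le> 1 / Im z"
proof -
  let ?q = "qpow m lam u x z"
  have q1: "?q 1 = (\<Sum>i<m. of_real ((dotp m (u i) x)\<^sup>2) * (1 / (complex_of_real (lam i) - z)))"
    by (simp add: qpow_def)
  have "cmod (?q 2) \<le> (\<Sum>i<m. (dotp m (u i) x)\<^sup>2 * (cmod (1 / (of_real (lam i) - z)))\<^sup>2)"
    unfolding qpow_def by (rule order.trans[OF norm_sum]) (simp add: norm_mult norm_power norm_divide)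
  also have "\<dots> = Im (?q 1) / Im z" using z unfolding q1 Im_weighted by simp
  finally have 1: "Im z * cmod (?q 2) \<le> Im (?q 1)" using z by (simp add: field_simps)
  have "Im (?q 1) \<le> cmod (1 + ?q 1)" using abs_Im_le_cmod[of "1 + ?q 1"] by simp
  moreover have "cmod (1 + ?q 1) * cmod (trpow m lam z 1 - trpow m lam' z 1) = cmod (?q 2)"
    using trace_update[OF nz_complex[OF z]] by (metis norm_mult)
  moreover have "cmod (1 + ?q 1) > 0"
    using quad_update[OF nz_complex[OF z]] by (metis mult_zero_left zero_less_norm_iff zero_neq_one)
  ultimately have "cmod (1 + ?q 1) * (Im z * cmod (trpow m lam z 1 - trpow m lam' z 1)) \<le> cmod (1 + ?q 1) * 1"
    using 1 by (simp add: mult_ac)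
  then have "Im z * cmod (trpow m lam z 1 - trpow m lam' z 1) \<le> 1"
    using \<open>cmod (1 + ?q 1) > 0\<close> by (simp only: mult_le_cancel_left_pos)
  then show ?thesis using z by (simp add: field_simps)
qed

end

section \<open>The resolvent as a matrix and its spectral form\<close>

definition rmat :: "nat \<Rightarrow> (nat \<Rightarrow> nat \<Rightarrow> real) \<Rightarrow> complex \<Rightarrow> complex mat" where
  "rmat m A z = Matrix.mat m m (\<lambda>(a, b). complex_of_real (A a b) - (if a = b then z else 0))"

text \<open>By Cramer's rule the entries are rational functions of the matrix entries and therefore
  measurable, which a formula through chosen eigenvectors would not give.\<close>

definition resolvent :: "nat \<Rightarrow> (nat \<Rightarrow> nat \<Rightarrow> real) \<Rightarrow> complex \<Rightarrow> nat \<Rightarrow> nat \<Rightarrow> complex" where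
  "resolvent m A z a b = adj_mat (rmat m A z) $$ (a, b) / Determinant.det (rmat m A z)"

definition tr_res :: "nat \<Rightarrow> (nat \<Rightarrow> nat \<Rightarrow> real) \<Rightarrow> complex \<Rightarrow> complex" where
  "tr_res m A z = (\<Sum>a<m. resolvent m A z a a)"

definition smat :: "nat \<Rightarrow> (nat \<Rightarrow> real) \<Rightarrow> (nat \<Rightarrow> nat \<Rightarrow> real) \<Rightarrow> complex \<Rightarrow> complex mat" where
  "smat m lam u z = Matrix.mat m m (\<lambda>(a, b). \<Sum>i<m. of_real (u i a * u i b) * (1 / (of_real (lam i) - z)))"

lemma rmat_carrier [simp]: "rmat m A z \<in> carrier_mat m m" and smat_carrier [simp]: "smat m lam u z \<in> carrier_mat m m"
  by (simp_all add: rmat_def smat_def)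

lemma rmat_times_smat:
  assumes sp: "spectral m A lam u" and nz: "\<And>i. i < m \<Longrightarrow> complex_of_real (lam i) \<noteq> z"
  shows "rmat m A z * smat m lam u z = 1\<^sub>m m"
proof (rule eq_matI)
  fix a c assume "a < dim_row (1\<^sub>m m :: complex mat)" "c < dim_col (1\<^sub>m m :: complex mat)"
  then have a: "a < m" and c: "c < m" by auto
  have on: "orthonormal m m u" using sp by (simp add: spectral_def)
  let ?g = "\<lambda>i. 1 / (complex_of_real (lam i) - z)"
  have gen: "(p - (if c then z else 0)) * (q * r * g) = (p * q - (if c then z * q else 0)) * (r * g)"
    for p q r g :: complex and c by (simp add: algebra_simps)
  have "(rmat m A z * smat m lam u z) $$ (a, c) = (\<Sum>b<m. (complex_of_real (A a b) - (if a = b then z else 0)) *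
      (\<Sum>i<m. of_real (u i b * u i c) * ?g i))"
    using a c by (simp add: rmat_def smat_def scalar_prod_def lessThan_atLeast0)
  also have "\<dots> = (\<Sum>b<m. \<Sum>i<m. (complex_of_real (A a b * u i b) - (if a = b then z * of_real (u i b) else 0)) * (of_real (u i c) * ?g i))"
    unfolding sum_distrib_left of_real_mult by (intro sum.cong refl) (simp only: gen)
  also have "\<dots> = (\<Sum>i<m. \<Sum>b<m. (complex_of_real (A a b * u i b) - (if a = b then z * of_real (u i b) else 0)) * (of_real (u i c) * ?g i))"
    by (rule sum.swap)
  also have "\<dots> = (\<Sum>i<m. (complex_of_real (\<Sum>b<m. A a b * u i b) - z * of_real (u i a)) * (of_real (u i c) * ?g i))"
  proof -
    have "(\<Sum>b<m. complex_of_real (A a b * u i b) - (if a = b then z * of_real (u i b) else 0)) =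
        complex_of_real (\<Sum>b<m. A a b * u i b) - z * of_real (u i a)" for i
      using a by (simp add: sum_subtractf)
    then show ?thesis by (simp only: sum_distrib_right[symmetric])
  qed
  also have "\<dots> = (\<Sum>i<m. complex_of_real (u i a * u i c))"
  proof (intro sum.cong refl)
    fix i assume "i \<in> {..<m}"
    then have "(\<Sum>b<m. A a b * u i b) = lam i * u i a" "complex_of_real (lam i) - z \<noteq> 0"
      using spectral_apply[OF sp] a nz by auto
    then show "(complex_of_real (\<Sum>b<m. A a b * u i b) - z * of_real (u i a)) * (of_real (u i c) * ?g i) = complex_of_real (u i a * u i c)"
      by (simp add: field_simps)
  qed
  also have "\<dots> = complex_of_real (\<Sum>i<m. u i a * u i c)" by simp
  also have "\<dots> = 1\<^sub>m m $$ (a, c)" using a c by (simp only: orthonormal_complete[OF on]) simp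
  finally show "(rmat m A z * smat m lam u z) $$ (a, c) = 1\<^sub>m m $$ (a, c)" .
qed (simp_all add: rmat_def smat_def)

lemma resolvent_spectral:
  assumes sp: "spectral m A lam u" and nz: "\<And>i. i < m \<Longrightarrow> complex_of_real (lam i) \<noteq> z" and a: "a < m" and b: "b < m"
  shows "resolvent m A z a b = (\<Sum>i<m. of_real (u i a * u i b) * (1 / (of_real (lam i) - z)))"
proof -
  let ?R = "rmat m A z" and ?W = "smat m lam u z"
  have RW: "?R * ?W = 1\<^sub>m m" by (rule rmat_times_smat[OF sp nz])
  have "Determinant.det ?R * Determinant.det ?W = 1"
    using det_mult[OF rmat_carrier smat_carrier, of m A z lam u z] RW by simp
  then have d: "Determinant.det ?R \<noteq> 0" by auto
  have adj: "adj_mat ?R \<in> carrier_mat m m" by (rule adj_mat(1)) simp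
  have "adj_mat ?R = adj_mat ?R * (?R * ?W)" using adj by (simp add: RW)
  also have "\<dots> = (adj_mat ?R * ?R) * ?W" by (rule assoc_mult_mat[symmetric, OF adj rmat_carrier smat_carrier])
  also have "\<dots> = (Determinant.det ?R \<cdot>\<^sub>m 1\<^sub>m m) * ?W" by (subst adj_mat(3)[OF rmat_carrier]) (rule refl)
  also have "\<dots> = Determinant.det ?R \<cdot>\<^sub>m ?W" by (metis left_mult_one_mat mult_smult_assoc_mat one_carrier_mat smat_carrier)
  finally have "adj_mat ?R $$ (a, b) = Determinant.det ?R * ?W $$ (a, b)"
    using a b by (simp add: smat_def)
  then show ?thesis using d a b by (simp add: resolvent_def smat_def)
qed

lemma tr_res_spectral:
  assumes sp: "spectral m A lam u" and nz: "\<And>i. i < m \<Longrightarrow> complex_of_real (lam i) \<noteq> z"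
  shows "tr_res m A z = trpow m lam z 1"
proof -
  have on: "orthonormal m m u" using sp by (simp add: spectral_def)
  have "tr_res m A z = (\<Sum>a<m. \<Sum>i<m. of_real (u i a * u i a) * (1 / (complex_of_real (lam i) - z)))"
    by (simp add: tr_res_def resolvent_spectral[OF sp nz])
  also have "\<dots> = (\<Sum>i<m. \<Sum>a<m. of_real (u i a * u i a) * (1 / (complex_of_real (lam i) - z)))"
    by (rule sum.swap)
  also have "\<dots> = (\<Sum>i<m. of_real (dotp m (u i) (u i)) * (1 / (complex_of_real (lam i) - z)))"
    by (simp only: sum_distrib_right[symmetric] dotp_def of_real_sum)
  finally show ?thesis by (simp add: trpow_def orthonormal_dotp[OF on])
qed

lemma quad_res_spectral:
  assumes sp: "spectral m A lam u" and nz: "\<And>i. i < m \<Longrightarrow> complex_of_real (lam i) \<noteq> z"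
  shows "(\<Sum>a<m. \<Sum>b<m. of_real (x a * x b) * resolvent m A z a b) = qpow m lam u x z 1"
proof -
  let ?g = "\<lambda>i. 1 / (complex_of_real (lam i) - z)"
  have "(\<Sum>a<m. \<Sum>b<m. of_real (x a * x b) * resolvent m A z a b) =
     (\<Sum>a<m. \<Sum>b<m. of_real (x a * x b) * (\<Sum>i<m. of_real (u i a * u i b) * ?g i))"
    by (intro sum.cong refl) (simp only: resolvent_spectral[OF sp nz] lessThan_iff)
  also have "\<dots> = (\<Sum>a<m. \<Sum>b<m. \<Sum>i<m. of_real ((u i a * x a) * (u i b * x b)) * ?g i)"
    unfolding sum_distrib_left by (intro sum.cong refl) (simp add: mult_ac)
  also have "\<dots> = (\<Sum>a<m. \<Sum>i<m. \<Sum>b<m. of_real ((u i a * x a) * (u i b * x b)) * ?g i)"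
    by (intro sum.cong refl sum.swap)
  also have "\<dots> = (\<Sum>i<m. \<Sum>a<m. \<Sum>b<m. of_real ((u i a * x a) * (u i b * x b)) * ?g i)"
    by (rule sum.swap)
  also have "\<dots> = (\<Sum>i<m. of_real ((dotp m (u i) x)\<^sup>2) * ?g i)"
    unfolding dotp_def power2_eq_square sum_product unfolding of_real_sum sum_distrib_right by (rule refl)
  finally show ?thesis by (simp add: qpow_def)
qed

text \<open>The trace of \<open>A G = 1 + z G\<close>, verified eigenvalue by eigenvalue.\<close>

lemma tr_res_apply:
  assumes sp: "spectral m A lam u" and nz: "\<And>i. i < m \<Longrightarrow> complex_of_real (lam i) \<noteq> z"
  shows "(\<Sum>a<m. \<Sum>b<m. of_real (A a b) * resolvent m A z a b) = of_nat m + z * tr_res m A z"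
proof -
  let ?g = "\<lambda>i. 1 / (complex_of_real (lam i) - z)"
  have on: "orthonormal m m u" using sp by (simp add: spectral_def)
  have "(\<Sum>a<m. \<Sum>b<m. of_real (A a b) * resolvent m A z a b) =
     (\<Sum>a<m. \<Sum>b<m. \<Sum>i<m. of_real (A a b * u i b * u i a) * ?g i)"
    unfolding sum_distrib_left
    by (intro sum.cong refl) (simp only: resolvent_spectral[OF sp nz] lessThan_iff sum_distrib_left of_real_mult mult_ac)
  also have "\<dots> = (\<Sum>a<m. \<Sum>i<m. \<Sum>b<m. of_real (A a b * u i b * u i a) * ?g i)"
    by (intro sum.cong refl sum.swap)
  also have "\<dots> = (\<Sum>i<m. \<Sum>a<m. \<Sum>b<m. of_real (A a b * u i b * u i a) * ?g i)"
    by (rule sum.swap)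
  also have "\<dots> = (\<Sum>i<m. \<Sum>a<m. of_real ((\<Sum>b<m. A a b * u i b) * u i a) * ?g i)"
    by (simp only: sum_distrib_right of_real_sum)
  also have "\<dots> = (\<Sum>i<m. \<Sum>a<m. of_real (lam i * u i a * u i a) * ?g i)"
    by (intro sum.cong refl) (simp only: spectral_apply[OF sp] lessThan_iff)
  also have "\<dots> = (\<Sum>i<m. of_real (lam i * dotp m (u i) (u i)) * ?g i)"
    by (simp only: dotp_def sum_distrib_left sum_distrib_right of_real_sum mult.assoc)
  also have "\<dots> = (\<Sum>i<m. 1 + z * ?g i)"
    using nz by (intro sum.cong refl) (simp add: orthonormal_dotp[OF on] field_simps)
  finally show ?thesis using tr_res_spectral[OF sp nz] by (simp add: sum.distrib trpow_def sum_distrib_left)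
qed

lemma measurable_det:
  assumes "\<And>i j. i < n \<Longrightarrow> j < n \<Longrightarrow> (\<lambda>w. f w i j) \<in> borel_measurable N"
  shows "(\<lambda>w. Determinant.det (Matrix.mat n n (\<lambda>(i, j). f w i j)) :: complex) \<in> borel_measurable N"
proof -
  have permutes_less: "p i < n" if "p permutes {0..<n}" "i < n" for p i
    using permutes_in_image[OF that(1), of i] that(2) by simp
  have "(\<lambda>w. \<Sum>p\<in>{p. p permutes {0..<n}}. signof p * (\<Prod>i=0..<n. f w i (p i))) \<in> borel_measurable N"
    by (intro borel_measurable_sum borel_measurable_times borel_measurable_const borel_measurable_prod assms)
       (auto simp: permutes_less)
  moreover have "Determinant.det (Matrix.mat n n (\<lambda>(i, j). f w i j)) =
      (\<Sum>p\<in>{p. p permutes {0..<n}}. signof p * (\<Prod>i=0..<n. f w i (p i)))" for w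
    unfolding Determinant.det_def by (auto intro!: sum.cong prod.cong simp: permutes_less)
  ultimately show ?thesis by simp
qed

text \<open>Numerator and denominator are determinants; the cofactor is rewritten as the determinant
  of the matrix in which \<open>?s\<close> skips one row and one column.\<close>

lemma measurable_resolvent:
  assumes A: "\<And>a b. a < m \<Longrightarrow> b < m \<Longrightarrow> (\<lambda>w. A w a b) \<in> borel_measurable N"
    and z: "z \<in> borel_measurable N" and a: "a < m" and b: "b < m"
  shows "(\<lambda>w. resolvent m (A w) (z w) a b) \<in> borel_measurable N"
proof -
  let ?f = "\<lambda>w a b. complex_of_real (A w a b) - (if a = b then z w else 0)"
  have f: "(\<lambda>w. ?f w i j) \<in> borel_measurable N" if "i < m" "j < m" for i j
    using A[OF that] z by simp
  let ?s = "\<lambda>k i. if i < k then i else Suc i"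
  have eq: "resolvent m (A w) (z w) a b =
      (-1) ^ (b + a) * Determinant.det (Matrix.mat (m - 1) (m - 1) (\<lambda>(i, j). ?f w (?s b i) (?s a j))) /
      Determinant.det (Matrix.mat m m (\<lambda>(i, j). ?f w i j))" for w
  proof -
    have "mat_delete (rmat m (A w) (z w)) b a = Matrix.mat (m - 1) (m - 1) (\<lambda>(i, j). ?f w (?s b i) (?s a j))"
      by (rule eq_matI) (auto simp: mat_delete_def rmat_def)
    then show ?thesis using a b by (simp add: resolvent_def adj_mat_def cofactor_def) (simp add: rmat_def)
  qed
  show ?thesis unfolding eq
    by (intro borel_measurable_divide borel_measurable_times borel_measurable_const measurable_det f)
       (use a b in auto)
qed

lemma measurable_tr_res:
  assumes "\<And>a b. a < m \<Longrightarrow> b < m \<Longrightarrow> (\<lambda>w. A w a b) \<in> borel_measurable N" "z \<in> borel_measurable N"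
  shows "(\<lambda>w. tr_res m (A w) (z w)) \<in> borel_measurable N"
  unfolding tr_res_def by (intro borel_measurable_sum measurable_resolvent assms) auto

section \<open>Columns with independent entries\<close>

text \<open>The law of one column enters through moments of linear functionals, a form that applies
  to the coordinates in any eigenbasis. For i.i.d. centred entries \<open>\<kappa> - 3 * v^2\<close>
  is the fourth cumulant of an entry. The bound \<open>R\<close> makes all polynomials in the
  entries integrable.\<close>

locale column_law = prob_space \<mu> for \<mu> :: "(nat \<Rightarrow> real) measure" +
  fixes m :: nat and v \<kappa> R :: real
  assumes sets_mu [measurable_cong]: "sets \<mu> = sets (PiM {..<m} (\<lambda>_. borel))"
    and bounded: "AE x in \<mu>. \<forall>a<m. \<bar>x a\<bar> \<le> R"
    and second: "\<And>s t. (\<integral>x. dotp m s x * dotp m t x \<partial>\<mu>) = v * dotp m s t"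
    and fourth: "\<And>s t. (\<integral>x. (dotp m s x)\<^sup>2 * (dotp m t x)\<^sup>2 \<partial>\<mu>) =
        v\<^sup>2 * dotp m s s * dotp m t t + 2 * v\<^sup>2 * (dotp m s t)\<^sup>2 + (\<kappa> - 3 * v\<^sup>2) * (\<Sum>a<m. (s a)\<^sup>2 * (t a)\<^sup>2)"
    and v_pos: "0 < v" and \<kappa>_nonneg: "0 \<le> \<kappa>"

text \<open>A class closed under ring operations, so that integrability of a polynomial expression
  in the entries follows from its syntax.\<close>

definition ess_bdd :: "'a measure \<Rightarrow> ('a \<Rightarrow> real) \<Rightarrow> bool" where
  "ess_bdd M f \<longleftrightarrow> f \<in> borel_measurable M \<and> (\<exists>B. AE x in M. \<bar>f x\<bar> \<le> B)"

lemma ess_bdd_const: "ess_bdd M (\<lambda>_. c)"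
  by (auto simp: ess_bdd_def)

lemma ess_bdd_add: "ess_bdd M f \<Longrightarrow> ess_bdd M g \<Longrightarrow> ess_bdd M (\<lambda>x. f x + g x)"
  unfolding ess_bdd_def
proof (elim conjE exE, intro conjI)
  fix B C assume "AE x in M. \<bar>f x\<bar> \<le> B" "AE x in M. \<bar>g x\<bar> \<le> C"
  then have "AE x in M. \<bar>f x + g x\<bar> \<le> B + C" by eventually_elim auto
  then show "\<exists>B. AE x in M. \<bar>f x + g x\<bar> \<le> B" by blast
qed auto

lemma ess_bdd_mult: "ess_bdd M f \<Longrightarrow> ess_bdd M g \<Longrightarrow> ess_bdd M (\<lambda>x. f x * g x)"
  unfolding ess_bdd_def
proof (elim conjE exE, intro conjI)
  fix B C assume "AE x in M. \<bar>f x\<bar> \<le> B" "AE x in M. \<bar>g x\<bar> \<le> C"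
  then have "AE x in M. \<bar>f x * g x\<bar> \<le> B * C" by eventually_elim (auto simp: abs_mult intro!: mult_mono)
  then show "\<exists>B. AE x in M. \<bar>f x * g x\<bar> \<le> B" by blast
qed auto

lemma ess_bdd_diff: "ess_bdd M f \<Longrightarrow> ess_bdd M g \<Longrightarrow> ess_bdd M (\<lambda>x. f x - g x)"
  using ess_bdd_add[OF _ ess_bdd_mult[OF ess_bdd_const[of M "-1"]], of f g] by simp

lemma ess_bdd_power: "ess_bdd M f \<Longrightarrow> ess_bdd M (\<lambda>x. f x ^ n)"
  by (induction n) (auto intro: ess_bdd_mult ess_bdd_const)

lemma ess_bdd_sum: "(\<And>i. i \<in> I \<Longrightarrow> ess_bdd M (f i)) \<Longrightarrow> ess_bdd M (\<lambda>x. \<Sum>i\<in>I. f i x)"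
  by (induction I rule: infinite_finite_induct) (auto intro: ess_bdd_add ess_bdd_const)

lemmas ess_bdd_intros = ess_bdd_const ess_bdd_add ess_bdd_mult ess_bdd_diff ess_bdd_power ess_bdd_sum

lemma (in finite_measure) ess_bdd_integrable: "ess_bdd M f \<Longrightarrow> integrable M f"
  unfolding ess_bdd_def by (metis (mono_tags, lifting) integrable_const_bound real_norm_def eventually_mono)

context column_law
begin

lemma ess_bdd_coord: "a < m \<Longrightarrow> ess_bdd \<mu> (\<lambda>x. x a)"
  unfolding ess_bdd_def using bounded by (auto elim!: eventually_mono)

lemma ess_bdd_dotp: "ess_bdd \<mu> (\<lambda>x. dotp m s x)"
  unfolding dotp_def by (intro ess_bdd_intros ess_bdd_coord) auto

lemmas int = ess_bdd_integrable[OF ess_bdd_mult] ess_bdd_integrable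

lemma expect_quad:
  assumes "orthonormal m m u"
  shows "(\<integral>x. (\<Sum>i<m. k i * (dotp m (u i) x)\<^sup>2) \<partial>\<mu>) = v * (\<Sum>i<m. k i)"
proof -
  have "(\<integral>x. (\<Sum>i<m. k i * (dotp m (u i) x)\<^sup>2) \<partial>\<mu>) = (\<Sum>i<m. k i * (\<integral>x. dotp m (u i) x * dotp m (u i) x \<partial>\<mu>))"
    by (subst Bochner_Integration.integral_sum)
       (auto intro!: ess_bdd_integrable ess_bdd_intros ess_bdd_dotp simp: power2_eq_square)
  also have "\<dots> = (\<Sum>i<m. k i * v)"
    using assms by (intro sum.cong) (auto simp: second orthonormal_dotp)
  finally show ?thesis by (simp add: sum_distrib_left mult.commute)
qed

lemma expect_quad_quad:
  assumes on: "orthonormal m m u"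
  shows "(\<integral>x. (\<Sum>i<m. k i * (dotp m (u i) x)\<^sup>2) * (\<Sum>i<m. l i * (dotp m (u i) x)\<^sup>2) \<partial>\<mu>) =
     v\<^sup>2 * (\<Sum>i<m. k i) * (\<Sum>i<m. l i) + 2 * v\<^sup>2 * (\<Sum>i<m. k i * l i) +
     (\<kappa> - 3 * v\<^sup>2) * (\<Sum>a<m. (\<Sum>i<m. k i * (u i a)\<^sup>2) * (\<Sum>i<m. l i * (u i a)\<^sup>2))"
proof -
  have "(\<integral>x. (\<Sum>i<m. k i * (dotp m (u i) x)\<^sup>2) * (\<Sum>i<m. l i * (dotp m (u i) x)\<^sup>2) \<partial>\<mu>) =
     (\<integral>x. (\<Sum>i<m. \<Sum>j<m. k i * l j * ((dotp m (u i) x)\<^sup>2 * (dotp m (u j) x)\<^sup>2)) \<partial>\<mu>)"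
    by (simp only: sum_product) (simp only: mult_ac)
  also have "\<dots> = (\<Sum>i<m. \<Sum>j<m. k i * l j * (\<integral>x. (dotp m (u i) x)\<^sup>2 * (dotp m (u j) x)\<^sup>2 \<partial>\<mu>))"
    by (subst Bochner_Integration.integral_sum, (intro ess_bdd_integrable ess_bdd_intros ess_bdd_dotp)[1])
       (auto intro!: sum.cong Bochner_Integration.integral_sum[THEN trans] ess_bdd_integrable ess_bdd_intros ess_bdd_dotp)
  also have "\<dots> = (\<Sum>i<m. \<Sum>j<m. v\<^sup>2 * (k i * l j) + (if j = i then 2 * v\<^sup>2 * (k i * l i) else 0) +
      (\<kappa> - 3 * v\<^sup>2) * (\<Sum>a<m. (k i * (u i a)\<^sup>2) * (l j * (u j a)\<^sup>2)))"
  proof (intro sum.cong refl)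
    fix i j assume ij: "i \<in> {..<m}" "j \<in> {..<m}"
    have "k i * l j * (\<integral>x. (dotp m (u i) x)\<^sup>2 * (dotp m (u j) x)\<^sup>2 \<partial>\<mu>) =
      k i * l j * (v\<^sup>2 + 2 * v\<^sup>2 * of_bool (i = j) + (\<kappa> - 3 * v\<^sup>2) * (\<Sum>a<m. (u i a)\<^sup>2 * (u j a)\<^sup>2))"
      using ij on by (simp add: fourth orthonormal_dotp)
    also have "(\<Sum>a<m. (u i a)\<^sup>2 * (u j a)\<^sup>2) * (k i * l j) = (\<Sum>a<m. (k i * (u i a)\<^sup>2) * (l j * (u j a)\<^sup>2))"
      by (simp only: sum_distrib_right) (simp only: mult_ac)
    then have "k i * l j * (v\<^sup>2 + 2 * v\<^sup>2 * of_bool (i = j) + (\<kappa> - 3 * v\<^sup>2) * (\<Sum>a<m. (u i a)\<^sup>2 * (u j a)\<^sup>2)) =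
      v\<^sup>2 * (k i * l j) + (if j = i then 2 * v\<^sup>2 * (k i * l i) else 0) +
      (\<kappa> - 3 * v\<^sup>2) * (\<Sum>a<m. (k i * (u i a)\<^sup>2) * (l j * (u j a)\<^sup>2))"
      by (auto simp: algebra_simps)
    finally show "k i * l j * (\<integral>x. (dotp m (u i) x)\<^sup>2 * (dotp m (u j) x)\<^sup>2 \<partial>\<mu>) =
      v\<^sup>2 * (k i * l j) + (if j = i then 2 * v\<^sup>2 * (k i * l i) else 0) +
      (\<kappa> - 3 * v\<^sup>2) * (\<Sum>a<m. (k i * (u i a)\<^sup>2) * (l j * (u j a)\<^sup>2))" .
  qed
  also have "\<dots> = v\<^sup>2 * (\<Sum>i<m. \<Sum>j<m. k i * l j) + 2 * v\<^sup>2 * (\<Sum>i<m. k i * l i) +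
      (\<kappa> - 3 * v\<^sup>2) * (\<Sum>i<m. \<Sum>j<m. \<Sum>a<m. (k i * (u i a)\<^sup>2) * (l j * (u j a)\<^sup>2))"
    by (simp add: sum.distrib sum_distrib_left)
  also have "(\<Sum>i<m. \<Sum>j<m. \<Sum>a<m. (k i * (u i a)\<^sup>2) * (l j * (u j a)\<^sup>2)) =
      (\<Sum>i<m. \<Sum>a<m. \<Sum>j<m. (k i * (u i a)\<^sup>2) * (l j * (u j a)\<^sup>2))"
    by (intro sum.cong refl sum.swap)
  also have "\<dots> = (\<Sum>a<m. \<Sum>i<m. \<Sum>j<m. (k i * (u i a)\<^sup>2) * (l j * (u j a)\<^sup>2))"
    by (rule sum.swap)
  finally show ?thesis by (simp only: sum_product mult.assoc)
qed

text \<open>Each row of an orthonormal basis has square sum 1, so in the fourth-moment term one of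
  the two weights can be replaced by its maximum. Besides the product of the means only
  \<open>kmax\<close> times a single sum remains.\<close>

lemma expect_quad_quad_le:
  assumes on: "orthonormal m m u" and k: "\<And>i. i < m \<Longrightarrow> 0 \<le> k i" "\<And>i. i < m \<Longrightarrow> k i \<le> kmax"
    and l: "\<And>i. i < m \<Longrightarrow> 0 \<le> l i"
  shows "(\<integral>x. (\<Sum>i<m. k i * (dotp m (u i) x)\<^sup>2) * (\<Sum>i<m. l i * (dotp m (u i) x)\<^sup>2) \<partial>\<mu>) \<le>
     v\<^sup>2 * (\<Sum>i<m. k i) * (\<Sum>i<m. l i) + (2 * v\<^sup>2 + \<kappa>) * (kmax * (\<Sum>i<m. l i))"
proof -
  define S where "S = (\<Sum>a<m. (\<Sum>i<m. k i * (u i a)\<^sup>2) * (\<Sum>i<m. l i * (u i a)\<^sup>2))"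
  have S0: "0 \<le> S" unfolding S_def by (intro sum_nonneg mult_nonneg_nonneg k l) auto
  have "S \<le> (\<Sum>a<m. kmax * (\<Sum>i<m. l i * (u i a)\<^sup>2))" unfolding S_def
  proof (intro sum_mono mult_right_mono)
    fix a assume a: "a \<in> {..<m}"
    have "(\<Sum>i<m. k i * (u i a)\<^sup>2) \<le> (\<Sum>i<m. kmax * (u i a)\<^sup>2)" by (intro sum_mono mult_right_mono k) auto
    also have "\<dots> = kmax" using orthonormal_complete[OF on, of a a] a
      by (simp add: sum_distrib_left[symmetric] power2_eq_square)
    finally show "(\<Sum>i<m. k i * (u i a)\<^sup>2) \<le> kmax" .
    show "0 \<le> (\<Sum>i<m. l i * (u i a)\<^sup>2)" by (intro sum_nonneg mult_nonneg_nonneg l) auto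
  qed
  also have "\<dots> = kmax * (\<Sum>i<m. l i * dotp m (u i) (u i))"
    unfolding sum_distrib_left[symmetric] by (subst sum.swap) (simp add: dotp_def sum_distrib_left power2_eq_square)
  finally have S: "S \<le> kmax * (\<Sum>i<m. l i)" using on by (simp add: orthonormal_dotp)
  have "(\<kappa> - 3 * v\<^sup>2) * S \<le> \<kappa> * S" using S0 by (intro mult_right_mono) auto
  also have "\<dots> \<le> \<kappa> * (kmax * (\<Sum>i<m. l i))" using S \<kappa>_nonneg by (intro mult_left_mono) auto
  finally have 1: "(\<kappa> - 3 * v\<^sup>2) * S \<le> \<kappa> * (kmax * (\<Sum>i<m. l i))" .
  have "(\<Sum>i<m. k i * l i) \<le> kmax * (\<Sum>i<m. l i)" unfolding sum_distrib_left by (intro sum_mono mult_right_mono k l) auto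
  then have 2: "2 * v\<^sup>2 * (\<Sum>i<m. k i * l i) \<le> 2 * v\<^sup>2 * (kmax * (\<Sum>i<m. l i))" by (intro mult_left_mono) auto
  show ?thesis using 1 2 unfolding expect_quad_quad[OF on] S_def[symmetric] by (simp add: algebra_simps)
qed

text \<open>Cauchy-Schwarz in each row, with the weights \<open>(u i a)^2\<close> of total mass 1,
  bounds the fourth-moment term by the sum of the \<open>(g i)^2\<close>.\<close>

lemma variance_quad_le:
  assumes on: "orthonormal m m u"
  shows "(\<integral>x. ((\<Sum>i<m. g i * (dotp m (u i) x)\<^sup>2) - v * (\<Sum>i<m. g i))\<^sup>2 \<partial>\<mu>) \<le> (\<kappa> + 2 * v\<^sup>2) * (\<Sum>i<m. (g i)\<^sup>2)"
proof -
  let ?q = "\<lambda>x. \<Sum>i<m. g i * (dotp m (u i) x)\<^sup>2" and ?s = "v * (\<Sum>i<m. g i)"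
  define S where "S = (\<Sum>a<m. (\<Sum>i<m. g i * (u i a)\<^sup>2) * (\<Sum>i<m. g i * (u i a)\<^sup>2))"
  have "(\<integral>x. (?q x - ?s)\<^sup>2 \<partial>\<mu>) = (\<integral>x. (?q x * ?q x - 2 * ?s * ?q x) + ?s\<^sup>2 \<partial>\<mu>)"
    by (rule Bochner_Integration.integral_cong) (auto simp: power2_eq_square algebra_simps)
  also have "\<dots> = (\<integral>x. ?q x * ?q x \<partial>\<mu>) - 2 * ?s * (\<integral>x. ?q x \<partial>\<mu>) + ?s\<^sup>2"
    by (subst Bochner_Integration.integral_add Bochner_Integration.integral_diff,
        (intro ess_bdd_integrable ess_bdd_intros ess_bdd_dotp)+)+
       (simp add: prob_space)
  also have "\<dots> = 2 * v\<^sup>2 * (\<Sum>i<m. (g i)\<^sup>2) + (\<kappa> - 3 * v\<^sup>2) * S"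
    unfolding expect_quad_quad[OF on] expect_quad[OF on] S_def
    by (simp add: power2_eq_square algebra_simps)
  also have "\<dots> \<le> 2 * v\<^sup>2 * (\<Sum>i<m. (g i)\<^sup>2) + \<kappa> * (\<Sum>i<m. (g i)\<^sup>2)"
  proof -
    have S0: "0 \<le> S" unfolding S_def by (intro sum_nonneg) auto
    have "S \<le> (\<Sum>a<m. \<Sum>i<m. (g i)\<^sup>2 * (u i a)\<^sup>2)" unfolding S_def
    proof (rule sum_mono)
      fix a assume a: "a \<in> {..<m}"
      have one: "(\<Sum>i<m. (u i a)\<^sup>2) = 1" using orthonormal_complete[OF on, of a a] a by (simp add: power2_eq_square)
      have "(\<Sum>i<m. (g i * u i a) * u i a)\<^sup>2 \<le> (\<Sum>i<m. (g i * u i a)\<^sup>2) * (\<Sum>i<m. (u i a)\<^sup>2)"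
        by (rule Cauchy_Schwarz_ineq_sum)
      then show "(\<Sum>i<m. g i * (u i a)\<^sup>2) * (\<Sum>i<m. g i * (u i a)\<^sup>2) \<le> (\<Sum>i<m. (g i)\<^sup>2 * (u i a)\<^sup>2)"
        unfolding one by (simp add: power2_eq_square mult_ac)
    qed
    also have "\<dots> = (\<Sum>i<m. (g i)\<^sup>2 * dotp m (u i) (u i))"
      by (subst sum.swap) (simp add: dotp_def sum_distrib_left power2_eq_square)
    finally have S: "S \<le> (\<Sum>i<m. (g i)\<^sup>2)" using on by (simp add: orthonormal_dotp)
    have "(\<kappa> - 3 * v\<^sup>2) * S \<le> \<kappa> * S" using S0 by (intro mult_right_mono) auto
    also have "\<dots> \<le> \<kappa> * (\<Sum>i<m. (g i)\<^sup>2)" using S \<kappa>_nonneg by (intro mult_left_mono) auto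
    finally show ?thesis by simp
  qed
  finally show ?thesis by (simp add: algebra_simps)
qed

end

section \<open>Moment identities for vectors with i.i.d. entries\<close>

lemma (in prob_space) integral_quartic:
  fixes f :: "'a \<Rightarrow> real"
  assumes "ess_bdd M f"
  shows "(\<integral>y. c0 + c1 * f y + c2 * (f y)\<^sup>2 + c3 * f y ^ 3 + c4 * f y ^ 4 \<partial>M) =
     c0 + c1 * (\<integral>y. f y \<partial>M) + c2 * (\<integral>y. (f y)\<^sup>2 \<partial>M) + c3 * (\<integral>y. f y ^ 3 \<partial>M) + c4 * (\<integral>y. f y ^ 4 \<partial>M)"
proof -
  have [simp]: "integrable M f" "integrable M (\<lambda>y. f y ^ n)" for n
    using assms by (auto intro!: ess_bdd_integrable ess_bdd_intros)
  show ?thesis by (simp add: prob_space)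
qed

text \<open>Induction over the coordinates: the last one is integrated out first, and the integrand
  is a polynomial of degree at most four in it.\<close>

lemma iid_moments:
  assumes \<nu>: "prob_space \<nu>" and sets_nu: "sets \<nu> = sets borel" and bdd: "AE x in \<nu>. \<bar>x\<bar> \<le> R"
    and m1: "(\<integral>x. x \<partial>\<nu>) = 0" and m2: "(\<integral>x. x\<^sup>2 \<partial>\<nu>) = v" and m4: "(\<integral>x. x ^ 4 \<partial>\<nu>) = \<kappa>"
  defines "P n \<equiv> PiM {..<n::nat} (\<lambda>_. \<nu>)"
  shows "(\<integral>x. dotp n s x \<partial>P n) = 0 \<and> (\<integral>x. dotp n s x * dotp n t x \<partial>P n) = v * dotp n s t \<and>
    (\<integral>x. (dotp n s x)\<^sup>2 * (dotp n t x)\<^sup>2 \<partial>P n) =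
        v\<^sup>2 * dotp n s s * dotp n t t + 2 * v\<^sup>2 * (dotp n s t)\<^sup>2 + (\<kappa> - 3 * v\<^sup>2) * (\<Sum>a<n. (s a)\<^sup>2 * (t a)\<^sup>2)"
    and "AE x in P n. \<forall>a<n. \<bar>x a\<bar> \<le> R"
proof -
  interpret nu: prob_space \<nu> by (rule \<nu>)
  interpret prod: product_prob_space "\<lambda>_::nat. \<nu>" by unfold_locales
  have meas[measurable_cong]: "sets (P n) = sets (PiM {..<n} (\<lambda>_. borel))" for n
    unfolding P_def by (intro sets_PiM_cong) (auto simp: sets_nu)
  have PP: "prob_space (P n)" for n unfolding P_def by (intro prob_space_PiM \<nu>)
  show AE: "AE x in P n. \<forall>a<n. \<bar>x a\<bar> \<le> R" for n
  proof -
    have "AE x in P n. \<bar>x a\<bar> \<le> R" if "a < n" for a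
      unfolding P_def using that bdd by (intro AE_PiM_component \<nu>) auto
    then have "AE x in P n. \<forall>a\<in>{..<n}. \<bar>x a\<bar> \<le> R" by (intro AE_finite_allI) auto
    then show ?thesis by eventually_elim auto
  qed
  have coord: "ess_bdd (P n) (\<lambda>x. x a)" if "a < n" for a n
    unfolding ess_bdd_def using AE[of n] that by (auto elim!: eventually_mono)
  have dot: "ess_bdd (P n) (\<lambda>x. dotp n s x)" for s n
    unfolding dotp_def by (intro ess_bdd_intros coord) auto
  have idb: "ess_bdd \<nu> (\<lambda>y. y)"
    unfolding ess_bdd_def using bdd sets_nu by (auto cong: measurable_cong_sets)
  note quartic = nu.integral_quartic[OF idb, unfolded m1 m2 m4]
  \<comment> \<open>The third moment occurs on the way, but only as a factor of linear functionals
    of the other coordinates, whose means vanish.\<close>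
  define M3 where "M3 = (\<integral>x. x ^ 3 \<partial>\<nu>)"
  have upd: "dotp (Suc n) s (x(n := y)) = dotp n s x + s n * y" for n s x y
    by (simp add: dotp_def)
  have ins: "(\<integral>x. f x \<partial>P (Suc n)) = (\<integral>x. (\<integral>y. f (x(n := y)) \<partial>\<nu>) \<partial>P n)"
    if "ess_bdd (P (Suc n)) f" for f :: "(nat \<Rightarrow> real) \<Rightarrow> real" and n
  proof -
    interpret prob_space "P (Suc n)" by (rule PP)
    have "integrable (PiM (insert n {..<n}) (\<lambda>_. \<nu>)) f"
      using ess_bdd_integrable[OF that] by (simp add: P_def lessThan_Suc)
    from prod.product_integral_insert[OF _ _ this] show ?thesis by (simp add: P_def lessThan_Suc)
  qed
  show "(\<integral>x. dotp n s x \<partial>P n) = 0 \<and> (\<integral>x. dotp n s x * dotp n t x \<partial>P n) = v * dotp n s t \<and>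
    (\<integral>x. (dotp n s x)\<^sup>2 * (dotp n t x)\<^sup>2 \<partial>P n) =
        v\<^sup>2 * dotp n s s * dotp n t t + 2 * v\<^sup>2 * (dotp n s t)\<^sup>2 + (\<kappa> - 3 * v\<^sup>2) * (\<Sum>a<n. (s a)\<^sup>2 * (t a)\<^sup>2)" for n s t
  proof (induction n arbitrary: s t)
    case 0
    interpret prob_space "P 0" by (rule PP)
    show ?case by (simp add: dotp_def)
  next
    case (Suc n)
    interpret prob_space "P n" by (rule PP)
    let ?S = "\<lambda>x. dotp n s x" and ?T = "\<lambda>x. dotp n t x"
    define a b where "a = s n" and "b = t n"
    note IH = Suc.IH[THEN conjunct1] Suc.IH[THEN conjunct2, THEN conjunct1] Suc.IH[THEN conjunct2, THEN conjunct2]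
    have int: "integrable (P n) (\<lambda>x. ?S x)" "integrable (P n) (\<lambda>x. ?T x)" "integrable (P n) (\<lambda>x. ?S x * ?T x)"
      "integrable (P n) (\<lambda>x. ?S x * ?S x)" "integrable (P n) (\<lambda>x. ?T x * ?T x)" "integrable (P n) (\<lambda>x. (?S x)\<^sup>2 * (?T x)\<^sup>2)"
      by (intro ess_bdd_integrable ess_bdd_intros dot)+
    have 1: "(\<integral>x. dotp (Suc n) s x \<partial>P (Suc n)) = 0"
    proof -
      have "(\<integral>x. dotp (Suc n) s x \<partial>P (Suc n)) = (\<integral>x. (\<integral>y. ?S x + a * y \<partial>\<nu>) \<partial>P n)"
        by (subst ins[OF dot]) (simp add: upd a_def)
      also have "\<dots> = (\<integral>x. ?S x \<partial>P n)"
        using quartic[of _ a 0 0 0] by simp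
      finally show ?thesis by (simp add: IH)
    qed
    have 2: "(\<integral>x. dotp (Suc n) s x * dotp (Suc n) t x \<partial>P (Suc n)) = v * dotp (Suc n) s t"
    proof -
      have "(\<integral>x. dotp (Suc n) s x * dotp (Suc n) t x \<partial>P (Suc n)) = (\<integral>x. (\<integral>y. (?S x + a * y) * (?T x + b * y) \<partial>\<nu>) \<partial>P n)"
        by (subst ins[OF ess_bdd_mult[OF dot dot]]) (simp add: upd a_def b_def)
      also have "\<dots> = (\<integral>x. ?S x * ?T x + a * b * v \<partial>P n)"
      proof (rule Bochner_Integration.integral_cong[OF refl])
        fix x
        show "(\<integral>y. (?S x + a * y) * (?T x + b * y) \<partial>\<nu>) = ?S x * ?T x + a * b * v"
          using quartic[of "?S x * ?T x" "a * ?T x + b * ?S x" "a * b" 0 0]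
          by (simp add: algebra_simps power2_eq_square)
      qed
      finally show ?thesis using int by (simp add: IH prob_space dotp_def[of "Suc n"] a_def b_def) (simp add: dotp_def algebra_simps)
    qed
    have 4: "(\<integral>x. (dotp (Suc n) s x)\<^sup>2 * (dotp (Suc n) t x)\<^sup>2 \<partial>P (Suc n)) =
        v\<^sup>2 * dotp (Suc n) s s * dotp (Suc n) t t + 2 * v\<^sup>2 * (dotp (Suc n) s t)\<^sup>2 + (\<kappa> - 3 * v\<^sup>2) * (\<Sum>a<Suc n. (s a)\<^sup>2 * (t a)\<^sup>2)"
    proof -
      have "(\<integral>x. (dotp (Suc n) s x)\<^sup>2 * (dotp (Suc n) t x)\<^sup>2 \<partial>P (Suc n)) = (\<integral>x. (\<integral>y. (?S x + a * y)\<^sup>2 * (?T x + b * y)\<^sup>2 \<partial>\<nu>) \<partial>P n)"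
        by (subst ins, intro ess_bdd_intros dot) (simp add: upd a_def b_def)
      also have "\<dots> = (\<integral>x. ((?S x)\<^sup>2 * (?T x)\<^sup>2 + v * a\<^sup>2 * (?T x * ?T x) + v * b\<^sup>2 * (?S x * ?S x) + 4 * v * a * b * (?S x * ?T x))
          + (2 * M3 * a * b\<^sup>2 * ?S x + 2 * M3 * a\<^sup>2 * b * ?T x + \<kappa> * a\<^sup>2 * b\<^sup>2) \<partial>P n)"
      proof (rule Bochner_Integration.integral_cong[OF refl])
        fix x
        have "(\<integral>y. (?S x + a * y)\<^sup>2 * (?T x + b * y)\<^sup>2 \<partial>\<nu>) =
          (\<integral>y. (?S x)\<^sup>2 * (?T x)\<^sup>2 + (2 * a * ?S x * (?T x)\<^sup>2 + 2 * b * ?T x * (?S x)\<^sup>2) * y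
            + (a\<^sup>2 * (?T x)\<^sup>2 + b\<^sup>2 * (?S x)\<^sup>2 + 4 * a * b * ?S x * ?T x) * y\<^sup>2
            + (2 * a * b\<^sup>2 * ?S x + 2 * a\<^sup>2 * b * ?T x) * y ^ 3 + a\<^sup>2 * b\<^sup>2 * y ^ 4 \<partial>\<nu>)"
          by (rule Bochner_Integration.integral_cong[OF refl])
             (simp add: algebra_simps power2_eq_square power3_eq_cube power4_eq_xxxx)
        then show "(\<integral>y. (?S x + a * y)\<^sup>2 * (?T x + b * y)\<^sup>2 \<partial>\<nu>) =
         ((?S x)\<^sup>2 * (?T x)\<^sup>2 + v * a\<^sup>2 * (?T x * ?T x) + v * b\<^sup>2 * (?S x * ?S x) + 4 * v * a * b * (?S x * ?T x))
          + (2 * M3 * a * b\<^sup>2 * ?S x + 2 * M3 * a\<^sup>2 * b * ?T x + \<kappa> * a\<^sup>2 * b\<^sup>2)"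
          unfolding quartic M3_def[symmetric] by (simp add: algebra_simps power2_eq_square)
      qed
      finally have "(\<integral>x. (dotp (Suc n) s x)\<^sup>2 * (dotp (Suc n) t x)\<^sup>2 \<partial>P (Suc n)) =
         (v\<^sup>2 * dotp n s s * dotp n t t + 2 * v\<^sup>2 * (dotp n s t)\<^sup>2 + (\<kappa> - 3 * v\<^sup>2) * (\<Sum>a<n. (s a)\<^sup>2 * (t a)\<^sup>2))
          + v * a\<^sup>2 * (v * dotp n t t) + v * b\<^sup>2 * (v * dotp n s s) + 4 * v * a * b * (v * dotp n s t) + \<kappa> * a\<^sup>2 * b\<^sup>2"
        using int by (simp add: IH prob_space)
      moreover have "dotp (Suc n) s s = dotp n s s + a * a" "dotp (Suc n) t t = dotp n t t + b * b"
        "dotp (Suc n) s t = dotp n s t + a * b" by (simp_all add: dotp_def a_def b_def)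
      ultimately show ?thesis by (simp add: algebra_simps power2_eq_square a_def[symmetric] b_def[symmetric])
    qed
    show ?case using 1 2 4 by blast
  qed
qed

lemma iid_column_law:
  assumes "prob_space \<nu>" "sets \<nu> = sets borel" "AE x in \<nu>. \<bar>x\<bar> \<le> R"
    "(\<integral>x. x \<partial>\<nu>) = 0" "(\<integral>x. x\<^sup>2 \<partial>\<nu>) = v" "(\<integral>x. x ^ 4 \<partial>\<nu>) = \<kappa>" "0 < v"
  shows "column_law (PiM {..<m} (\<lambda>_. \<nu>)) m v \<kappa> R"
proof -
  note mom = iid_moments[OF assms(1-6)]
  interpret prob_space "PiM {..<m} (\<lambda>_. \<nu>)" by (intro prob_space_PiM assms)
  have "sets (PiM {..<m} (\<lambda>_. \<nu>)) = sets (PiM {..<m} (\<lambda>_. borel))"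
    by (intro sets_PiM_cong) (auto simp: assms)
  moreover have "0 \<le> \<kappa>" unfolding assms(6)[symmetric] by (intro Bochner_Integration.integral_nonneg) auto
  ultimately show ?thesis
    by unfold_locales (use mom assms(7) in auto)
qed

section \<open>A lower barrier for the smallest eigenvalue\<close>

definition gram :: "nat set \<Rightarrow> (nat \<Rightarrow> nat \<Rightarrow> real) \<Rightarrow> nat \<Rightarrow> nat \<Rightarrow> real" where
  "gram J x a b = (\<Sum>j\<in>J. x j a * x j b)"

text \<open>Bounding \<open>exp x\<close> below by its quadratic Taylor polynomial reduces this to
  \<open>(1 + x + x^2/2) (1 - x + x^2/2) = 1 + x^4/4 \<ge> 1\<close>.\<close>

lemma exp_minus_le_quadratic:
  assumes "0 \<le> (x::real)"
  shows "exp (- x) \<le> 1 - x + x\<^sup>2 / 2"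
proof -
  have q: "1 - x + x\<^sup>2 / 2 = ((x - 1)\<^sup>2 + 1) / 2" by (simp add: power2_eq_square field_simps)
  have pos: "0 < 1 - x + x\<^sup>2 / 2" unfolding q by (simp add: add_nonneg_pos)
  have "1 \<le> (1 + x + x\<^sup>2 / 2) * (1 - x + x\<^sup>2 / 2)"
    using zero_le_power2[of "x\<^sup>2"] by (simp add: power2_eq_square algebra_simps)
  also have "\<dots> \<le> exp x * (1 - x + x\<^sup>2 / 2)"
    using pos exp_lower_Taylor_quadratic[OF assms] by (intro mult_right_mono) auto
  finally show ?thesis by (simp add: exp_minus field_simps)
qed

text \<open>The tangent at \<open>s\<close> to a convex function. It turns the random denominator
  \<open>1 + V\<close> into a polynomial, whose expectation needs only moments.\<close>

lemma inverse_tangent: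
  fixes V s :: real
  assumes "0 \<le> V" "0 \<le> s"
  shows "1 / (1 + s) - (V - s) / (1 + s)\<^sup>2 \<le> 1 / (1 + V)"
proof -
  have "1 / (1 + V) - (1 / (1 + s) - (V - s) / (1 + s)\<^sup>2) = (V - s)\<^sup>2 / ((1 + V) * (1 + s)\<^sup>2)"
    using assms by (simp add: divide_simps power2_eq_square) (simp add: algebra_simps)
  also have "\<dots> \<ge> 0" using assms by auto
  finally show ?thesis by simp
qed

text \<open>The condition is open in \<open>y\<close>, so rational vectors suffice and the event is
  a countable union. It expresses that the smallest eigenvalue is below a level without choosing
  eigenvectors measurably.\<close>

lemma measurable_below_form:
  assumes A: "\<And>a b. a < m \<Longrightarrow> b < m \<Longrightarrow> (\<lambda>w. A w a b) \<in> borel_measurable N"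
    and L: "L \<in> borel_measurable N"
  shows "{w \<in> space N. \<exists>y. bform m (A w) y y < L w * dotp m y y} \<in> sets N"
proof -
  define D where "D = (\<lambda>w a. if a < m then w a else (0::real)) ` (PiE {..<m} (\<lambda>_. \<rat>))"
  have cD: "countable D" unfolding D_def by (intro countable_image countable_PiE) (auto simp: countable_rat)
  have dense: "\<exists>y\<in>D. bform m B y y < l * dotp m y y" if y: "bform m B y y < l * dotp m y y" for B l y
  proof -
    \<comment> \<open>\<open>y\<close> rounded down to multiples of \<open>1 / (k + 1)\<close>:
      rational vectors converging to \<open>y\<close>.\<close>
    define z where "z = (\<lambda>k a. if a < m then of_int \<lfloor>y a * real (Suc k)\<rfloor> / real (Suc k) else (0::real))"
    have low: "c - 1 / real (Suc k) \<le> of_int \<lfloor>c * real (Suc k)\<rfloor> / real (Suc k)" for c k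
    proof -
      have "(c * real (Suc k) - 1) / real (Suc k) \<le> of_int \<lfloor>c * real (Suc k)\<rfloor> / real (Suc k)"
        by (rule divide_right_mono) (linarith, simp)
      then show ?thesis by (simp add: diff_divide_distrib)
    qed
    have conv: "(\<lambda>k. z k a) \<longlonglongrightarrow> y a" if "a < m" for a
    proof (rule tendsto_sandwich)
      show "\<forall>\<^sub>F k in sequentially. y a - 1 / real (Suc k) \<le> z k a"
        using that low by (intro always_eventually allI) (simp only: z_def if_True)
      show "\<forall>\<^sub>F k in sequentially. z k a \<le> y a"
        using that by (intro always_eventually allI) (simp add: z_def divide_le_eq)
      show "(\<lambda>k. y a - 1 / real (Suc k)) \<longlonglongrightarrow> y a"
        using tendsto_diff[OF tendsto_const LIMSEQ_inverse_real_of_nat] by (simp add: inverse_eq_divide)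
    qed auto
    have "(\<lambda>k. bform m B (z k) (z k) - l * dotp m (z k) (z k)) \<longlonglongrightarrow> bform m B y y - l * dotp m y y"
      unfolding bform_def dotp_def by (intro tendsto_intros conv) auto
    then have "\<forall>\<^sub>F k in sequentially. bform m B (z k) (z k) - l * dotp m (z k) (z k) < 0"
      by (rule order_tendstoD) (use y in simp)
    then obtain k where k: "bform m B (z k) (z k) - l * dotp m (z k) (z k) < 0"
      by (auto dest: eventually_happens)
    have "z k \<in> D" unfolding D_def
      by (rule image_eqI[of _ _ "\<lambda>a\<in>{..<m}. of_int \<lfloor>y a * real (Suc k)\<rfloor> / real (Suc k)"]) (auto simp: z_def fun_eq_iff)
    then show ?thesis using k by (intro bexI[of _ "z k"]) auto
  qed
  have "{w \<in> space N. \<exists>y. bform m (A w) y y < L w * dotp m y y} =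
      (\<Union>y\<in>D. {w \<in> space N. bform m (A w) y y < L w * dotp m y y})"
    using dense by blast
  moreover have "{w \<in> space N. bform m (A w) y y < L w * dotp m y y} \<in> sets N" for y
  proof -
    have "(\<lambda>w. bform m (A w) y y) \<in> borel_measurable N"
      unfolding bform_def by (intro borel_measurable_sum borel_measurable_times borel_measurable_const A) auto
    moreover have "(\<lambda>w. L w * dotp m y y) \<in> borel_measurable N" using L by simp
    ultimately show ?thesis by (rule borel_measurable_less)
  qed
  ultimately show ?thesis using cD by (auto intro!: sets.countable_UN')
qed

lemma spectral_lower_bound:
  assumes "spectral m A lam u" "\<And>i. i < m \<Longrightarrow> l \<le> lam i"
  shows "l * dotp m y y \<le> bform m A y y"
proof -
  have "l * dotp m y y = (\<Sum>i<m. l * (dotp m (u i) y)\<^sup>2)"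
    by (simp add: spectral_dotp_sq[OF assms(1)] sum_distrib_left)
  also have "\<dots> \<le> (\<Sum>i<m. lam i * (dotp m (u i) y)\<^sup>2)"
    using assms(2) by (intro sum_mono mult_right_mono) auto
  also have "\<dots> = bform m A y y"
    by (simp add: spectral_bform[OF assms(1)] power2_eq_square mult.assoc)
  finally show ?thesis .
qed

text \<open>Raising the level from \<open>l\<close> to \<open>l + d\<close> costs at most the derivative of the potential at the new
  level, by convexity.\<close>

lemma level_shift:
  fixes y :: real
  assumes "0 \<le> d" "d < y"
  shows "(1 / (y - d)) ^ n \<le> (1 / y) ^ n + real n * d * (1 / (y - d)) ^ Suc n"
proof -
  define a b where "a = 1 / y" and "b = 1 / (y - d)"
  have ab: "0 < a" "a \<le> b" "b - a = d * a * b" using assms by (auto simp: a_def b_def field_simps)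
  have "b ^ n - a ^ n = (b - a) * (\<Sum>i<n. a ^ (n - Suc i) * b ^ i)" by (rule power_diff_sumr2)
  also have "\<dots> \<le> (b - a) * (\<Sum>i<n. b ^ (n - Suc i) * b ^ i)"
    using ab by (intro mult_left_mono sum_mono mult_right_mono power_mono) auto
  also have "(\<Sum>i<n. b ^ (n - Suc i) * b ^ i) = real n * b ^ (n - 1)"
    by (simp add: power_add[symmetric])
  also have "(b - a) * (real n * b ^ (n - 1)) \<le> (d * b * b) * (real n * b ^ (n - 1))"
    unfolding ab(3) using ab assms by (intro mult_right_mono mult_left_mono) auto
  also have "\<dots> = real n * d * b ^ Suc n" by (cases n) auto
  finally show ?thesis by (simp add: a_def b_def)
qed

context column_law
begin

text \<open>Raising the level by \<open>d\<close> costs at most \<open>d * K2\<close> in the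
  potential, while a random column lowers it on average by about
  \<open>v * K2 / (1 + v * K1)\<close>. Condition \<open>c1\<close> says that the gain wins after
  all error terms, so the exponential moment does not grow; \<open>c2\<close> and \<open>c3\<close>
  do the same for \<open>Tr G ^ p\<close> up to an additive remainder. The bound goes through a
  polynomial \<open>W\<close> in the column because \<open>lam'\<close> and \<open>u'\<close> are
  not chosen measurably.\<close>

lemma barrier_step:
  fixes d \<theta> t \<phi> \<zeta> \<sigma> g r l :: real and p :: nat
  assumes sp: "spectral m A lam u"
    and gt: "\<And>i. i < m \<Longrightarrow> l + d < lam i"
    and g: "\<And>i. i < m \<Longrightarrow> 1 / (lam i - (l + d)) \<le> g"
    and nn: "0 \<le> d" "0 \<le> \<theta>" "0 \<le> t" "0 \<le> \<zeta>" "0 < \<sigma>" "0 \<le> r" "1 \<le> p"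
  defines "T \<equiv> trpow m lam (l + d)" and "e \<equiv> 2 * v\<^sup>2 + \<kappa>"
  defines "K1 \<equiv> T 1 + \<theta> * T 2" and "K2 \<equiv> T 2 + 2 * \<theta> * T 3"
  assumes c1: "d \<le> v / (1 + v * K1) - e * (g + \<theta> * g\<^sup>2) - t / 2 * (v\<^sup>2 * K2 + e * (g\<^sup>2 + 2 * \<theta> * g ^ 3))"
    and c2: "d \<le> v / (1 + v * K1) - e * g - v * \<sigma>"
    and c3: "real p * v\<^sup>2 * T 2 + real p * e * g\<^sup>2 \<le> v * r"
  shows "\<exists>W. ess_bdd \<mu> W \<and>
    (\<forall>x lam' u'. spectral m (\<lambda>a b. A a b + x a * x b) lam' u' \<longrightarrow>
       exp (t * (trpow m lam' (l + d) 1 + \<theta> * trpow m lam' (l + d) 2 - \<phi>)) + \<zeta> * trpow m lam' (l + d) p \<le> W x) \<and>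
    (\<integral>x. W x \<partial>\<mu>) \<le> exp (t * (trpow m lam l 1 + \<theta> * trpow m lam l 2 - \<phi>)) +
       \<zeta> * (trpow m lam l p + real p * v * real m * r * (r / \<sigma>) ^ p)"
proof -
  have on: "orthonormal m m u" using sp by (simp add: spectral_def)
  define \<gamma> where "\<gamma> = (\<lambda>i. 1 / (lam i - (l + d)))"
  have \<gamma>: "0 < \<gamma> i" "\<gamma> i \<le> g" if "i < m" for i using gt[OF that] g[OF that] by (auto simp: \<gamma>_def)
  have T: "T n = (\<Sum>i<m. \<gamma> i ^ n)" for n by (simp add: T_def trpow_def \<gamma>_def)
  have T0: "0 \<le> T n" for n unfolding T using \<gamma> by (intro sum_nonneg zero_le_power) (simp add: less_imp_le)
  define Y where "Y = (\<lambda>k x. \<Sum>i<m. k i * (dotp m (u i) x)\<^sup>2)"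
  have Yb: "ess_bdd \<mu> (Y k)" for k
    unfolding Y_def by (intro ess_bdd_intros ess_bdd_dotp)
  define q where "q = (\<lambda>n x. qpow m lam u x (l + d) n)"
  have q: "q n = Y (\<lambda>i. \<gamma> i ^ n)" for n
    by (simp add: q_def Y_def \<gamma>_def qpow_def fun_eq_iff mult.commute)
  have qb: "ess_bdd \<mu> (q n)" for n unfolding q by (rule Yb)
  define k1 k2 where "k1 = (\<lambda>i. \<gamma> i + \<theta> * \<gamma> i ^ 2)" and "k2 = (\<lambda>i. \<gamma> i ^ 2 + 2 * \<theta> * \<gamma> i ^ 3)"
  have V: "q 1 x + \<theta> * q 2 x = Y k1 x" and U: "q 2 x + 2 * \<theta> * q 3 x = Y k2 x" for x
    by (simp_all add: q Y_def k1_def k2_def algebra_simps sum.distrib sum_distrib_left)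
  have K1: "(\<Sum>i<m. k1 i) = K1" and K2: "(\<Sum>i<m. k2 i) = K2"
    by (simp_all add: K1_def K2_def T k1_def k2_def sum.distrib sum_distrib_left mult_ac)
  have g0: "0 \<le> g" if "0 < m" using \<gamma>[OF that] by simp
  have k1: "0 \<le> k1 i" "k1 i \<le> g + \<theta> * g\<^sup>2" if "i < m" for i
    using \<gamma>[OF that] nn by (auto simp: k1_def intro!: add_mono mult_left_mono power_mono)
  have k2: "0 \<le> k2 i" "k2 i \<le> g\<^sup>2 + 2 * \<theta> * g ^ 3" if "i < m" for i
    using \<gamma>[OF that] nn by (auto simp: k2_def intro!: add_mono mult_left_mono power_mono)
  have K0: "0 \<le> K1" "0 \<le> K2" using T0 nn by (auto simp: K1_def K2_def)
  \<comment> \<open>The means of \<open>Y k1\<close> and of \<open>q 1\<close>, the points at which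
    the reciprocals are linearised.\<close>
  define s s1 where "s = v * K1" and "s1 = v * T 1"
  have s0: "0 \<le> s" "0 \<le> s1" "s1 \<le> s"
    using K0 T0 v_pos nn by (auto simp: s_def s1_def K1_def)
  define E0 where "E0 = exp (t * (K1 - \<phi>))"
  have e0: "0 \<le> e" using \<kappa>_nonneg by (simp add: e_def)
  \<comment> \<open>The tangent to \<open>1 / (1 + V)\<close> at \<open>s\<close> is
    \<open>cc s - V / (1 + s)^2\<close>.\<close>
  define cc where "cc = (\<lambda>s::real. 1 / (1 + s) + s / (1 + s)\<^sup>2)"
  define W where "W = (\<lambda>x. (E0 + \<zeta> * T p) - E0 * t * cc s * Y k2 x + E0 * t / (1 + s)\<^sup>2 * (Y k1 x * Y k2 x)
     + E0 * t\<^sup>2 / 2 * (Y k2 x * Y k2 x) - \<zeta> * real p * cc s1 * q (Suc p) x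
     + \<zeta> * real p / (1 + s1)\<^sup>2 * (q 1 x * q (Suc p) x) + \<zeta> * (real p)\<^sup>2 * (q 2 x * q p x))"
  have bW: "ess_bdd \<mu> W" unfolding W_def by (intro ess_bdd_intros Yb qb)
  have EY: "(\<integral>x. Y k x \<partial>\<mu>) = v * (\<Sum>i<m. k i)" for k unfolding Y_def by (rule expect_quad[OF on])
  have EYY: "(\<integral>x. Y k x * Y k' x \<partial>\<mu>) \<le> v\<^sup>2 * (\<Sum>i<m. k i) * (\<Sum>i<m. k' i) + e * (kmax * (\<Sum>i<m. k' i))"
    if "\<And>i. i < m \<Longrightarrow> 0 \<le> k i" "\<And>i. i < m \<Longrightarrow> k i \<le> kmax" "\<And>i. i < m \<Longrightarrow> 0 \<le> k' i" for k k' kmax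
    unfolding Y_def e_def by (rule expect_quad_quad_le[OF on that])
  have dom: "exp (t * (trpow m lam' (l + d) 1 + \<theta> * trpow m lam' (l + d) 2 - \<phi>)) + \<zeta> * trpow m lam' (l + d) p \<le> W x"
    if sp': "spectral m (\<lambda>a b. A a b + x a * x b) lam' u'" for x lam' u'
  proof -
    interpret rank_one_update m A x lam lam' u u' by unfold_locales (rule sp, rule sp')
    have qn: "0 \<le> q n x" for n unfolding q_def by (rule qpow_nonneg[OF gt])
    let ?V = "Y k1 x" and ?U = "Y k2 x"
    have UV0: "0 \<le> ?U" "0 \<le> ?V" unfolding V[symmetric] U[symmetric] using qn nn by auto
    define D where "D = (T 1 - trpow m lam' (l + d) 1) + \<theta> * (T 2 - trpow m lam' (l + d) 2)"
    have "?U \<le> (1 + ?V) * D"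
      using dtr_two_term[OF gt nn(2)] unfolding V[symmetric] U[symmetric] D_def T_def q_def .
    then have "?U / (1 + ?V) \<le> D" using UV0 by (simp add: divide_le_eq mult.commute)
    then have "t * (?U / (1 + ?V)) \<le> t * D" using nn(3) by (rule mult_left_mono)
    then have "exp (- (t * D)) \<le> exp (- (t * (?U / (1 + ?V))))" by simp
    also have "\<dots> \<le> 1 - t * (?U / (1 + ?V)) + (t * (?U / (1 + ?V)))\<^sup>2 / 2"
      using nn UV0 by (intro exp_minus_le_quadratic) auto
    also have "\<dots> \<le> 1 - t * (?U * (1 / (1 + s) - (?V - s) / (1 + s)\<^sup>2)) + (t * ?U)\<^sup>2 / 2"
    proof -
      have "?U * (1 / (1 + s) - (?V - s) / (1 + s)\<^sup>2) \<le> ?U * (1 / (1 + ?V))"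
        by (intro mult_left_mono inverse_tangent UV0 s0)
      then have "t * (?U * (1 / (1 + s) - (?V - s) / (1 + s)\<^sup>2)) \<le> t * (?U / (1 + ?V))"
        using nn by (intro mult_left_mono) auto
      moreover have "?U / (1 + ?V) \<le> ?U"
        using UV0 by (simp add: divide_le_eq) (simp add: algebra_simps)
      then have "(t * (?U / (1 + ?V)))\<^sup>2 \<le> (t * ?U)\<^sup>2"
        using nn UV0 by (intro power_mono mult_left_mono) auto
      ultimately show ?thesis by (simp add: divide_right_mono)
    qed
    finally have 1: "E0 * exp (- (t * D)) \<le> E0 * (1 - t * (?U * (1 / (1 + s) - (?V - s) / (1 + s)\<^sup>2)) + (t * ?U)\<^sup>2 / 2)"
      by (intro mult_left_mono) (auto simp: E0_def)
    have 2: "exp (t * (trpow m lam' (l + d) 1 + \<theta> * trpow m lam' (l + d) 2 - \<phi>)) = E0 * exp (- (t * D))"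
      unfolding E0_def exp_add[symmetric] K1_def D_def by (simp add: algebra_simps)
    define D' where "D' = T p - trpow m lam' (l + d) p"
    have "real p * q (Suc p) x - (real p)\<^sup>2 * (q 2 x * q p x) \<le> (1 + q 1 x) * D'"
      using dtr_power[OF gt nn(7)] unfolding D'_def T_def q_def .
    then have "(real p * q (Suc p) x - (real p)\<^sup>2 * (q 2 x * q p x)) / (1 + q 1 x) \<le> D'"
      using qn[of 1] by (simp add: divide_le_eq mult.commute)
    moreover have "(real p)\<^sup>2 * (q 2 x * q p x) / (1 + q 1 x) \<le> (real p)\<^sup>2 * (q 2 x * q p x)"
      using qn[of 1] qn[of 2] qn[of p] by (simp add: divide_le_eq) (simp add: algebra_simps)
    moreover have "real p * q (Suc p) x * (1 / (1 + s1) - (q 1 x - s1) / (1 + s1)\<^sup>2) \<le> real p * q (Suc p) x * (1 / (1 + q 1 x))"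
      using qn by (intro mult_left_mono inverse_tangent s0) auto
    ultimately have "real p * q (Suc p) x * (1 / (1 + s1) - (q 1 x - s1) / (1 + s1)\<^sup>2) - (real p)\<^sup>2 * (q 2 x * q p x) \<le> D'"
      by (simp add: diff_divide_distrib)
    then have 3: "\<zeta> * trpow m lam' (l + d) p \<le> \<zeta> * (T p - (real p * q (Suc p) x * (1 / (1 + s1) - (q 1 x - s1) / (1 + s1)\<^sup>2) - (real p)\<^sup>2 * (q 2 x * q p x)))"
      using nn by (intro mult_left_mono) (auto simp: D'_def)
    have "E0 * (1 - t * (?U * (1 / (1 + s) - (?V - s) / (1 + s)\<^sup>2)) + (t * ?U)\<^sup>2 / 2) +
        \<zeta> * (T p - (real p * q (Suc p) x * (1 / (1 + s1) - (q 1 x - s1) / (1 + s1)\<^sup>2) - (real p)\<^sup>2 * (q 2 x * q p x))) = W x"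
      unfolding W_def cc_def by (simp add: algebra_simps power2_eq_square diff_divide_distrib add_divide_distrib)
    then show ?thesis using 1 2 3 by linarith
  qed
  have iW: "integrable \<mu> (Y k1)" "integrable \<mu> (Y k2)" "integrable \<mu> (\<lambda>x. Y k1 x * Y k2 x)" "integrable \<mu> (\<lambda>x. Y k2 x * Y k2 x)"
     "integrable \<mu> (q n)" "integrable \<mu> (\<lambda>x. q n x * q n' x)" for n n'
    by (intro ess_bdd_integrable ess_bdd_intros Yb qb)+
  have EW: "(\<integral>x. W x \<partial>\<mu>) = (E0 + \<zeta> * T p) - E0 * t * cc s * (v * K2) + E0 * t / (1 + s)\<^sup>2 * (\<integral>x. Y k1 x * Y k2 x \<partial>\<mu>)
     + E0 * t\<^sup>2 / 2 * (\<integral>x. Y k2 x * Y k2 x \<partial>\<mu>) - \<zeta> * real p * cc s1 * (v * T (Suc p))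
     + \<zeta> * real p / (1 + s1)\<^sup>2 * (\<integral>x. q 1 x * q (Suc p) x \<partial>\<mu>) + \<zeta> * (real p)\<^sup>2 * (\<integral>x. q 2 x * q p x \<partial>\<mu>)"
  proof -
    have Eq: "(\<integral>x. q n x \<partial>\<mu>) = v * T n" for n unfolding q EY T ..
    have EU: "(\<integral>x. Y k2 x \<partial>\<mu>) = v * K2" unfolding EY K2 ..
    show ?thesis unfolding W_def by (simp add: iW prob_space Eq EU)
  qed
  have ccv: "cc y = 1 / (1 + y) + y / (1 + y)\<^sup>2" for y by (simp add: cc_def)
  have le1: "a / (1 + y)\<^sup>2 \<le> a" if "0 \<le> a" "0 \<le> y" for a y :: real
  proof -
    have "a / (1 + y)\<^sup>2 \<le> a / 1" using that by (intro divide_left_mono) (auto intro: one_le_power)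
    then show ?thesis by simp
  qed
  have E0p: "0 < E0" by (simp add: E0_def)
  \<comment> \<open>The net gain: once the moments are inserted, the exponential part is at most
    \<open>E0 * (1 - t * K2 * X)\<close>.\<close>
  define X where "X = v / (1 + s) - e * (g + \<theta> * g\<^sup>2) - t / 2 * (v\<^sup>2 * K2 + e * (g\<^sup>2 + 2 * \<theta> * g ^ 3))"
  have dX: "d \<le> X" using c1 by (simp add: X_def s_def)
  have first: "E0 - E0 * t * cc s * (v * K2) + E0 * t / (1 + s)\<^sup>2 * (\<integral>x. Y k1 x * Y k2 x \<partial>\<mu>)
     + E0 * t\<^sup>2 / 2 * (\<integral>x. Y k2 x * Y k2 x \<partial>\<mu>) \<le> exp (t * (trpow m lam l 1 + \<theta> * trpow m lam l 2 - \<phi>))"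
  proof -
    have a1: "(\<integral>x. Y k1 x * Y k2 x \<partial>\<mu>) \<le> v\<^sup>2 * K1 * K2 + e * ((g + \<theta> * g\<^sup>2) * K2)"
      using EYY[of k1 "g + \<theta> * g\<^sup>2" k2] k1 k2 by (simp add: K1 K2)
    have a2: "(\<integral>x. Y k2 x * Y k2 x \<partial>\<mu>) \<le> v\<^sup>2 * K2 * K2 + e * ((g\<^sup>2 + 2 * \<theta> * g ^ 3) * K2)"
      using EYY[of k2 "g\<^sup>2 + 2 * \<theta> * g ^ 3" k2] k2 by (simp add: K2)
    have "0 \<le> e * ((g + \<theta> * g\<^sup>2) * K2)"
      using e0 K0 nn g0 by (cases "m = 0") (auto simp: K2_def T intro!: mult_nonneg_nonneg add_nonneg_nonneg)
    then have a3: "e * ((g + \<theta> * g\<^sup>2) * K2) / (1 + s)\<^sup>2 \<le> e * ((g + \<theta> * g\<^sup>2) * K2)"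
      by (rule le1) (rule s0)
    have "(\<integral>x. Y k1 x * Y k2 x \<partial>\<mu>) / (1 + s)\<^sup>2 \<le> (v\<^sup>2 * K1 * K2 + e * ((g + \<theta> * g\<^sup>2) * K2)) / (1 + s)\<^sup>2"
      using a1 by (rule divide_right_mono) simp
    also have "\<dots> \<le> s / (1 + s)\<^sup>2 * (v * K2) + e * ((g + \<theta> * g\<^sup>2) * K2)"
      using a3 by (simp add: add_divide_distrib s_def power2_eq_square mult_ac)
    finally have a4: "E0 * t * ((\<integral>x. Y k1 x * Y k2 x \<partial>\<mu>) / (1 + s)\<^sup>2) \<le>
        E0 * t * (s / (1 + s)\<^sup>2 * (v * K2) + e * ((g + \<theta> * g\<^sup>2) * K2))"
      using E0p nn by (intro mult_left_mono) auto
    have a5: "E0 * t\<^sup>2 / 2 * (\<integral>x. Y k2 x * Y k2 x \<partial>\<mu>) \<le>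
        E0 * t\<^sup>2 / 2 * (v\<^sup>2 * K2 * K2 + e * ((g\<^sup>2 + 2 * \<theta> * g ^ 3) * K2))"
      using a2 E0p by (intro mult_left_mono) auto
    have "E0 - E0 * t * cc s * (v * K2) + E0 * t * (s / (1 + s)\<^sup>2 * (v * K2) + e * ((g + \<theta> * g\<^sup>2) * K2))
        + E0 * t\<^sup>2 / 2 * (v\<^sup>2 * K2 * K2 + e * ((g\<^sup>2 + 2 * \<theta> * g ^ 3) * K2)) = E0 * (1 - t * K2 * X)"
      unfolding ccv X_def by (simp add: algebra_simps power2_eq_square)
    then have "E0 - E0 * t * cc s * (v * K2) + E0 * t / (1 + s)\<^sup>2 * (\<integral>x. Y k1 x * Y k2 x \<partial>\<mu>)
     + E0 * t\<^sup>2 / 2 * (\<integral>x. Y k2 x * Y k2 x \<partial>\<mu>) \<le> E0 * (1 - t * K2 * X)"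
      using a4 a5 by simp
    \<comment> \<open>Back to an exponential by \<open>1 - x \<le> exp (- x)\<close>; the factor
      \<open>exp (- (t * K2 * d))\<close> pays exactly what \<open>level_shift\<close> charges for
      moving from \<open>l\<close> to \<open>l + d\<close>.\<close>
    also have "\<dots> \<le> E0 * exp (- (t * K2 * d))"
    proof -
      have "t * K2 * d \<le> t * K2 * X" using dX nn K0 by (intro mult_left_mono) auto
      then have "1 - t * K2 * X \<le> 1 + (- (t * K2 * d))" by simp
      also have "\<dots> \<le> exp (- (t * K2 * d))" by (rule exp_ge_add_one_self)
      finally show ?thesis using E0p by (intro mult_left_mono) auto
    qed
    also have "\<dots> = exp (t * (K1 - d * K2 - \<phi>))"
      unfolding E0_def exp_add[symmetric] by (simp add: algebra_simps)
    also have "\<dots> \<le> exp (t * (trpow m lam l 1 + \<theta> * trpow m lam l 2 - \<phi>))"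
    proof -
      have sh: "T n \<le> trpow m lam l n + real n * d * T (Suc n)" for n
      proof -
        have "T n \<le> (\<Sum>i<m. (1 / (lam i - l)) ^ n + real n * d * \<gamma> i ^ Suc n)" unfolding T
        proof (rule sum_mono)
          fix i assume "i \<in> {..<m}"
          then show "\<gamma> i ^ n \<le> (1 / (lam i - l)) ^ n + real n * d * \<gamma> i ^ Suc n"
            using level_shift[of d "lam i - l" n] gt[of i] nn by (simp add: \<gamma>_def diff_diff_add)
        qed
        then show ?thesis by (simp add: T trpow_def sum.distrib sum_distrib_left)
      qed
      have "K1 \<le> trpow m lam l 1 + d * T 2 + \<theta> * (trpow m lam l 2 + 2 * d * T 3)"
        unfolding K1_def using sh[of 1] sh[of 2] nn
        by (intro add_mono mult_left_mono) (auto simp: numeral_2_eq_2 numeral_3_eq_3)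
      then have "K1 - d * K2 - \<phi> \<le> trpow m lam l 1 + \<theta> * trpow m lam l 2 - \<phi>"
        by (simp add: K2_def algebra_simps)
      then show ?thesis using nn by (auto intro: mult_left_mono)
    qed
    finally show ?thesis .
  qed
  have second: "\<zeta> * T p - \<zeta> * real p * cc s1 * (v * T (Suc p))
     + \<zeta> * real p / (1 + s1)\<^sup>2 * (\<integral>x. q 1 x * q (Suc p) x \<partial>\<mu>) + \<zeta> * (real p)\<^sup>2 * (\<integral>x. q 2 x * q p x \<partial>\<mu>)
     \<le> \<zeta> * (trpow m lam l p + real p * v * real m * r * (r / \<sigma>) ^ p)"
  proof -
    have a1: "(\<integral>x. q 1 x * q (Suc p) x \<partial>\<mu>) \<le> v\<^sup>2 * T 1 * T (Suc p) + e * (g * T (Suc p))"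
      using EYY[of "\<lambda>i. \<gamma> i ^ 1" g "\<lambda>i. \<gamma> i ^ Suc p"] \<gamma> unfolding q T by (simp add: less_imp_le)
    have a2: "(\<integral>x. q 2 x * q p x \<partial>\<mu>) \<le> v\<^sup>2 * T 2 * T p + e * (g\<^sup>2 * T p)"
      using EYY[of "\<lambda>i. \<gamma> i ^ 2" "g\<^sup>2" "\<lambda>i. \<gamma> i ^ p"] \<gamma> unfolding q T by (simp add: less_imp_le power_mono)
    have "0 \<le> e * (g * T (Suc p))"
    proof (cases "m = 0")
      case False
      then show ?thesis using e0 T0[of "Suc p"] g0 by (intro mult_nonneg_nonneg) auto
    qed (simp add: T)
    then have a3: "e * (g * T (Suc p)) / (1 + s1)\<^sup>2 \<le> e * (g * T (Suc p))" by (rule le1) (rule s0)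
    have "(\<integral>x. q 1 x * q (Suc p) x \<partial>\<mu>) / (1 + s1)\<^sup>2 \<le> (v\<^sup>2 * T 1 * T (Suc p) + e * (g * T (Suc p))) / (1 + s1)\<^sup>2"
      using a1 by (rule divide_right_mono) simp
    also have "\<dots> \<le> s1 / (1 + s1)\<^sup>2 * (v * T (Suc p)) + e * (g * T (Suc p))"
      using a3 by (simp add: add_divide_distrib s1_def power2_eq_square mult_ac)
    finally have a4: "real p * ((\<integral>x. q 1 x * q (Suc p) x \<partial>\<mu>) / (1 + s1)\<^sup>2) \<le>
        real p * (s1 / (1 + s1)\<^sup>2 * (v * T (Suc p)) + e * (g * T (Suc p)))"
      by (intro mult_left_mono) auto
    have a5: "(real p)\<^sup>2 * (\<integral>x. q 2 x * q p x \<partial>\<mu>) \<le> real p * (v * r) * T p"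
    proof -
      have "(real p)\<^sup>2 * (\<integral>x. q 2 x * q p x \<partial>\<mu>) \<le> (real p)\<^sup>2 * (v\<^sup>2 * T 2 * T p + e * (g\<^sup>2 * T p))"
        using a2 by (intro mult_left_mono) auto
      also have "\<dots> = real p * (real p * v\<^sup>2 * T 2 + real p * e * g\<^sup>2) * T p"
        by (simp add: power2_eq_square algebra_simps)
      also have "\<dots> \<le> real p * (v * r) * T p" using c3 T0 by (intro mult_right_mono mult_left_mono) auto
      finally show ?thesis .
    qed
    have sh: "T p \<le> trpow m lam l p + real p * d * T (Suc p)"
    proof -
      have "T p \<le> (\<Sum>i<m. (1 / (lam i - l)) ^ p + real p * d * \<gamma> i ^ Suc p)" unfolding T
      proof (rule sum_mono)
        fix i assume "i \<in> {..<m}"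
        then show "\<gamma> i ^ p \<le> (1 / (lam i - l)) ^ p + real p * d * \<gamma> i ^ Suc p"
          using level_shift[of d "lam i - l" p] gt[of i] nn by (simp add: \<gamma>_def diff_diff_add)
      qed
      then show ?thesis by (simp add: T trpow_def sum.distrib sum_distrib_left)
    qed
    have "v / (1 + s) \<le> v / (1 + s1)" using s0 v_pos by (intro divide_left_mono) auto
    then have "d \<le> v / (1 + s1) - e * g - v * \<sigma>" using c2 by (simp add: s_def)
    then have a6: "real p * d * T (Suc p) \<le> real p * (v / (1 + s1) - e * g - v * \<sigma>) * T (Suc p)"
      using T0 by (intro mult_right_mono mult_left_mono) auto
    \<comment> \<open>A summand is positive only where \<open>\<gamma> i < r / \<sigma>\<close>, and
      there it is at most \<open>r * (r / \<sigma>) ^ p\<close>. The reserve \<open>\<sigma>\<close>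
      from \<open>c2\<close> thus absorbs the growth \<open>r * T p\<close>.\<close>
    have a7: "r * T p - \<sigma> * T (Suc p) \<le> real m * (r * (r / \<sigma>) ^ p)"
    proof -
      have "r * T p - \<sigma> * T (Suc p) = (\<Sum>i<m. \<gamma> i ^ p * (r - \<sigma> * \<gamma> i))"
        by (simp add: T sum_distrib_left sum_subtractf algebra_simps)
      also have "\<dots> \<le> (\<Sum>i<m. r * (r / \<sigma>) ^ p)"
      proof (rule sum_mono)
        fix i assume i: "i \<in> {..<m}"
        then have \<gamma>i: "0 < \<gamma> i" using \<gamma> by simp
        show "\<gamma> i ^ p * (r - \<sigma> * \<gamma> i) \<le> r * (r / \<sigma>) ^ p"
        proof (cases "\<gamma> i \<le> r / \<sigma>")
          case True
          have "\<gamma> i ^ p * (r - \<sigma> * \<gamma> i) \<le> \<gamma> i ^ p * r" using \<gamma>i nn by (intro mult_left_mono) auto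
          also have "\<dots> \<le> (r / \<sigma>) ^ p * r" using True \<gamma>i nn by (intro mult_right_mono power_mono) auto
          finally show ?thesis by (simp add: mult.commute)
        next
          case False
          then have "r - \<sigma> * \<gamma> i \<le> 0" using nn by (simp add: field_simps)
          then have "\<gamma> i ^ p * (r - \<sigma> * \<gamma> i) \<le> 0" using \<gamma>i by (intro mult_nonneg_nonpos) auto
          also have "0 \<le> r * (r / \<sigma>) ^ p" using nn by auto
          finally show ?thesis .
        qed
      qed
      finally show ?thesis by simp
    qed
    have "T p - real p * cc s1 * (v * T (Suc p)) + real p * ((\<integral>x. q 1 x * q (Suc p) x \<partial>\<mu>) / (1 + s1)\<^sup>2)
        + (real p)\<^sup>2 * (\<integral>x. q 2 x * q p x \<partial>\<mu>) \<le>
      trpow m lam l p + real p * (v / (1 + s1) - e * g - v * \<sigma>) * T (Suc p) - real p * cc s1 * (v * T (Suc p))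
        + real p * (s1 / (1 + s1)\<^sup>2 * (v * T (Suc p)) + e * (g * T (Suc p))) + real p * (v * r) * T p"
      using sh a4 a5 a6 by linarith
    also have "\<dots> = trpow m lam l p + real p * v * (r * T p - \<sigma> * T (Suc p))"
      unfolding ccv by (simp add: algebra_simps)
    also have "\<dots> \<le> trpow m lam l p + real p * v * (real m * (r * (r / \<sigma>) ^ p))"
      using a7 v_pos by (intro add_left_mono mult_left_mono) auto
    finally have "\<zeta> * (T p - real p * cc s1 * (v * T (Suc p)) + real p * ((\<integral>x. q 1 x * q (Suc p) x \<partial>\<mu>) / (1 + s1)\<^sup>2)
        + (real p)\<^sup>2 * (\<integral>x. q 2 x * q p x \<partial>\<mu>)) \<le> \<zeta> * (trpow m lam l p + real p * v * (real m * (r * (r / \<sigma>) ^ p)))"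
      using nn by (intro mult_left_mono) auto
    then show ?thesis by (simp add: algebra_simps)
  qed
  show ?thesis
    by (intro exI[of _ W] conjI bW allI impI dom) (assumption, use EW first second in linarith)
qed

end

lemma spectral_symmetric: "spectral m A lam u \<Longrightarrow> a < m \<Longrightarrow> b < m \<Longrightarrow> A a b = A b a"
  by (simp add: spectral_def mult_ac)

lemma gram_insert: "finite J \<Longrightarrow> j \<notin> J \<Longrightarrow> gram (insert j J) (x(j := y)) a b = y a * y b + gram J x a b"
  by (auto simp: gram_def intro!: sum.cong)

context column_law
begin

lemma measurable_entry: "k \<in> K \<Longrightarrow> a < m \<Longrightarrow> (\<lambda>x. x k a) \<in> borel_measurable (PiM K (\<lambda>_. \<mu>))"
proof -
  assume "k \<in> K" "a < m"
  have "(\<lambda>f. f a) \<in> borel_measurable (PiM {..<m} (\<lambda>_. borel :: real measure))"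
    using \<open>a < m\<close> by (intro measurable_component_singleton) simp
  then have "(\<lambda>f. f a) \<in> borel_measurable \<mu>"
    by (simp add: measurable_cong_sets[OF sets_mu refl])
  moreover have "(\<lambda>x. x k) \<in> measurable (PiM K (\<lambda>_. \<mu>)) \<mu>"
    using \<open>k \<in> K\<close> by (rule measurable_component_singleton)
  ultimately have "(\<lambda>f. f a) \<in> borel_measurable \<mu>" "(\<lambda>x. x k) \<in> measurable (PiM K (\<lambda>_. \<mu>)) \<mu>" .
  from measurable_comp[OF this(2,1)] show ?thesis by (simp add: comp_def)
qed

lemma measurable_gram: "a < m \<Longrightarrow> b < m \<Longrightarrow> J \<subseteq> K \<Longrightarrow> (\<lambda>x. gram J x a b) \<in> borel_measurable (PiM K (\<lambda>_. \<mu>))"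
  unfolding gram_def by (intro borel_measurable_sum borel_measurable_times measurable_entry) auto

text \<open>The inserted column is the outer variable of integration: it is added to
  \<open>A\<close>, and the induction hypothesis treats the remaining columns from the level
  \<open>l + d\<close>. The remainder of \<open>barrier_step\<close> is a constant, so it
  accumulates linearly in the number of columns.\<close>

lemma barrier:
  fixes d \<theta> t \<phi> \<zeta> \<sigma> r l \<gamma>m :: real and p :: nat
  assumes fin: "finite J"
    and nn: "0 \<le> d" "0 < \<theta>" "0 < t" "0 < \<zeta>" "0 < \<sigma>" "0 \<le> r" "1 \<le> p" "0 < \<gamma>m"
    and b1: "1 \<le> \<zeta> * \<gamma>m ^ p" and b2: "2 * d * \<gamma>m \<le> 1"
  defines "g \<equiv> 2 * \<gamma>m" and "e \<equiv> 2 * v\<^sup>2 + \<kappa>"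
  defines "K \<equiv> real m * (g\<^sup>2 + 2 * \<theta> * g ^ 3)"
  assumes b3: "d + v * \<sigma> + e * (g + \<theta> * g\<^sup>2) + t / 2 * (v\<^sup>2 * K + e * (g\<^sup>2 + 2 * \<theta> * g ^ 3)) \<le> v / (1 + v * (\<phi> + d * K))"
    and b4: "real p * v\<^sup>2 * (4 * \<phi> / \<theta>) + real p * e * g\<^sup>2 \<le> v * r"
    and sp: "spectral m A lam u" and gt: "\<And>i. i < m \<Longrightarrow> l < lam i"
  shows "emeasure (PiM J (\<lambda>_. \<mu>)) {x \<in> space (PiM J (\<lambda>_. \<mu>)).
            \<exists>y. bform m (\<lambda>a b. A a b + gram J x a b) y y < (l + real (card J) * d) * dotp m y y}
     \<le> ennreal (exp (t * (trpow m lam l 1 + \<theta> * trpow m lam l 2 - \<phi>)) +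
          \<zeta> * (trpow m lam l p + real (card J) * (real p * v * real m * r * (r / \<sigma>) ^ p)))"
  using fin sp gt
proof (induction J arbitrary: A lam u l rule: finite_induct)
  case empty
  have "\<not> bform m (\<lambda>a b. A a b + gram {} x a b) y y < (l + real (card {}) * d) * dotp m y y" for x y
    using spectral_lower_bound[OF empty(1), of l y] empty(2) by (auto simp: gram_def not_less less_imp_le)
  then show ?case by simp
next
  case (insert j J)
  note sp = insert.prems(1) and gt = insert.prems(2)
  interpret P: product_prob_space "\<lambda>_::nat. \<mu>" by unfold_locales
  interpret PJ: prob_space "PiM (insert j J) (\<lambda>_. \<mu>)" by (intro prob_space_PiM prob_space_axioms)
  define Rr where "Rr = real p * v * real m * r * (r / \<sigma>) ^ p"
  have Rr0: "0 \<le> Rr" using nn v_pos by (simp add: Rr_def)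
  define \<Phi> where "\<Phi> = trpow m lam l 1 + \<theta> * trpow m lam l 2"
  define \<gamma> where "\<gamma> = (\<lambda>i. 1 / (lam i - l))"
  have \<gamma>0: "0 < \<gamma> i" if "i < m" for i using gt[OF that] by (simp add: \<gamma>_def)
  have tr: "trpow m lam l n = (\<Sum>i<m. \<gamma> i ^ n)" for n by (simp add: trpow_def \<gamma>_def)
  have tr0: "0 \<le> trpow m lam l n" for n unfolding tr using \<gamma>0 by (intro sum_nonneg zero_le_power) (simp add: less_imp_le)
  define B where "B = exp (t * (\<Phi> - \<phi>)) + \<zeta> * (trpow m lam l p + real (card (insert j J)) * Rr)"
  let ?L = "l + real (card (insert j J)) * d"
  let ?E = "{x \<in> space (PiM (insert j J) (\<lambda>_. \<mu>)). \<exists>y. bform m (\<lambda>a b. A a b + gram (insert j J) x a b) y y < ?L * dotp m y y}"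
  \<comment> \<open>If the asserted bound \<open>B\<close> is at least 1 nothing is to be shown.
    Otherwise both of its summands are below 1, which gives \<open>\<Phi> < \<phi>\<close> and,
    through \<open>b1\<close>, \<open>\<gamma> i < \<gamma>m\<close>.\<close>
  show ?case
  proof (cases "B \<ge> 1")
    case True
    have "emeasure (PiM (insert j J) (\<lambda>_. \<mu>)) ?E \<le> 1" by (rule PJ.emeasure_le_1)
    also have "\<dots> \<le> ennreal B" using True by (simp add: ennreal_1[symmetric] del: ennreal_1)
    finally show ?thesis by (simp add: B_def \<Phi>_def Rr_def)
  next
    case False
    have c0: "0 \<le> \<zeta> * (trpow m lam l p + real (card (insert j J)) * Rr)" using nn tr0 Rr0 by (intro mult_nonneg_nonneg add_nonneg_nonneg) auto
    have "exp (t * (\<Phi> - \<phi>)) < 1" using False c0 unfolding B_def by linarith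
    then have \<Phi>\<phi>: "\<Phi> < \<phi>" using nn by (simp add: mult_less_0_iff)
    have "\<zeta> * trpow m lam l p + \<zeta> * (real (card (insert j J)) * Rr) < 1"
      using False exp_gt_zero[of "t * (\<Phi> - \<phi>)"] unfolding B_def distrib_left by linarith
    moreover have "0 \<le> \<zeta> * (real (card (insert j J)) * Rr)" using nn Rr0 by auto
    ultimately have zt: "\<zeta> * trpow m lam l p < 1" by linarith
    have \<gamma>m: "\<gamma> i < \<gamma>m" if "i < m" for i
    proof -
      have "\<gamma> i ^ p \<le> trpow m lam l p" unfolding tr
        using that \<gamma>0 by (intro member_le_sum) (auto simp: less_imp_le)
      then have "\<zeta> * \<gamma> i ^ p \<le> \<zeta> * trpow m lam l p" using nn by (intro mult_left_mono) auto
      then have "\<zeta> * \<gamma> i ^ p < \<zeta> * \<gamma>m ^ p" using zt b1 by linarith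
      then have "\<gamma> i ^ p < \<gamma>m ^ p" using nn by simp
      then show ?thesis using nn power_less_imp_less_base by (meson less_imp_le)
    qed
    \<comment> \<open>By \<open>b2\<close> the distance to the level exceeds \<open>2 * d\<close>,
      so the step at most doubles each \<open>\<gamma> i\<close>; this is the origin of
      \<open>g = 2 * \<gamma>m\<close>.\<close>
    have half: "2 * d < lam i - l" if "i < m" for i
    proof -
      have "1 < \<gamma>m * (lam i - l)" using \<gamma>m[OF that] gt[OF that] by (simp add: \<gamma>_def field_simps)
      then have "2 * d * \<gamma>m < (lam i - l) * \<gamma>m" using b2 by (simp add: mult.commute)
      then show ?thesis using nn by simp
    qed
    have gt': "l + d < lam i" if "i < m" for i using half[OF that] gt[OF that] nn by linarith
    define \<gamma>' where "\<gamma>' = (\<lambda>i. 1 / (lam i - (l + d)))"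
    have \<gamma>': "0 < \<gamma>' i" "\<gamma>' i \<le> 2 * \<gamma> i" "\<gamma>' i \<le> g" if "i < m" for i
    proof -
      show "0 < \<gamma>' i" using gt'[OF that] by (simp add: \<gamma>'_def)
      have "lam i - l \<le> 2 * (lam i - (l + d))" using half[OF that] by simp
      then show "\<gamma>' i \<le> 2 * \<gamma> i" using gt'[OF that] gt[OF that] by (simp add: \<gamma>'_def \<gamma>_def field_simps)
      then show "\<gamma>' i \<le> g" using \<gamma>m[OF that] by (simp add: g_def)
    qed
    have tr': "trpow m lam (l + d) n = (\<Sum>i<m. \<gamma>' i ^ n)" for n by (simp add: trpow_def \<gamma>'_def)
    define K1 K2 where "K1 = trpow m lam (l + d) 1 + \<theta> * trpow m lam (l + d) 2"
      and "K2 = trpow m lam (l + d) 2 + 2 * \<theta> * trpow m lam (l + d) 3"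
    have g0: "0 < g" using nn by (simp add: g_def)
    have K2: "K2 \<le> K"
    proof -
      have "trpow m lam (l + d) n \<le> real m * g ^ n" for n
        unfolding tr' using \<gamma>' sum_bounded_above[of "{..<m}" "\<lambda>i. \<gamma>' i ^ n" "g ^ n"] by (auto intro: power_mono less_imp_le)
      then have "K2 \<le> real m * g\<^sup>2 + 2 * \<theta> * (real m * g ^ 3)" unfolding K2_def using nn by (intro add_mono mult_left_mono) auto
      then show ?thesis by (simp add: K_def algebra_simps)
    qed
    have K0: "0 \<le> K1" "0 \<le> K2" using nn \<gamma>' unfolding K1_def K2_def tr'
      by (auto intro!: add_nonneg_nonneg mult_nonneg_nonneg sum_nonneg simp: less_imp_le)
    have K1: "K1 \<le> \<phi> + d * K"
    proof -
      have sh: "trpow m lam (l + d) n \<le> trpow m lam l n + real n * d * trpow m lam (l + d) (Suc n)" for n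
      proof -
        have "trpow m lam (l + d) n \<le> (\<Sum>i<m. \<gamma> i ^ n + real n * d * \<gamma>' i ^ Suc n)" unfolding tr'
        proof (rule sum_mono)
          fix i assume "i \<in> {..<m}"
          then show "\<gamma>' i ^ n \<le> \<gamma> i ^ n + real n * d * \<gamma>' i ^ Suc n"
            using level_shift[of d "lam i - l" n] gt'[of i] nn by (simp add: \<gamma>_def \<gamma>'_def diff_diff_add)
        qed
        then show ?thesis by (simp add: tr tr' sum.distrib sum_distrib_left)
      qed
      have "K1 \<le> (trpow m lam l 1 + d * trpow m lam (l + d) 2) + \<theta> * (trpow m lam l 2 + 2 * d * trpow m lam (l + d) 3)"
        unfolding K1_def using sh[of 1] sh[of 2] nn
        by (intro add_mono mult_left_mono) (auto simp: numeral_2_eq_2 numeral_3_eq_3)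
      also have "\<dots> = \<Phi> + d * K2" by (simp add: K2_def \<Phi>_def algebra_simps)
      finally show ?thesis using \<Phi>\<phi> mult_left_mono[OF K2 nn(1)] by linarith
    qed
    have e0: "0 \<le> e" using \<kappa>_nonneg by (simp add: e_def)
    have vK: "v / (1 + v * (\<phi> + d * K)) \<le> v / (1 + v * K1)"
      using K1 K0 v_pos by (intro divide_left_mono mult_pos_pos add_pos_nonneg add_left_mono mult_left_mono) auto
    have K2t: "t / 2 * (v\<^sup>2 * K2 + e * (g\<^sup>2 + 2 * \<theta> * g ^ 3)) \<le> t / 2 * (v\<^sup>2 * K + e * (g\<^sup>2 + 2 * \<theta> * g ^ 3))"
      using K2 nn by (intro mult_left_mono add_right_mono) auto
    have vs: "0 \<le> v * \<sigma>" using v_pos nn by simp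
    have c1: "d \<le> v / (1 + v * K1) - e * (g + \<theta> * g\<^sup>2) - t / 2 * (v\<^sup>2 * K2 + e * (g\<^sup>2 + 2 * \<theta> * g ^ 3))"
      using b3 vK K2t vs by linarith
    have "0 \<le> t / 2 * (v\<^sup>2 * K2 + e * (g\<^sup>2 + 2 * \<theta> * g ^ 3))" using K0 e0 g0 nn by auto
    moreover have "e * g \<le> e * (g + \<theta> * g\<^sup>2)" using e0 nn by (intro mult_left_mono) auto
    ultimately have c2: "d \<le> v / (1 + v * K1) - e * g - v * \<sigma>" using b3 vK K2t by linarith
    \<comment> \<open>The quadratic part of the potential pays for this:
      \<open>\<theta> * trpow m lam l 2 \<le> \<Phi> < \<phi>\<close>, with a factor 4 from the
      doubling.\<close>
    have c3: "real p * v\<^sup>2 * trpow m lam (l + d) 2 + real p * e * g\<^sup>2 \<le> v * r"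
    proof -
      have "trpow m lam (l + d) 2 \<le> (\<Sum>i<m. (2 * \<gamma> i)\<^sup>2)" unfolding tr'
        using \<gamma>' by (intro sum_mono power_mono) (auto simp: less_imp_le)
      also have "\<dots> = 4 * trpow m lam l 2" by (simp add: tr power_mult_distrib sum_distrib_left)
      also have "trpow m lam l 2 \<le> \<phi> / \<theta>" using \<Phi>\<phi> tr0[of 1] nn by (simp add: \<Phi>_def field_simps)
      finally have "trpow m lam (l + d) 2 \<le> 4 * \<phi> / \<theta>" by simp
      then have "real p * v\<^sup>2 * trpow m lam (l + d) 2 \<le> real p * v\<^sup>2 * (4 * \<phi> / \<theta>)" by (intro mult_left_mono) auto
      then show ?thesis using b4 by linarith
    qed
    have "\<exists>W. ess_bdd \<mu> W \<and>
      (\<forall>x lam' u'. spectral m (\<lambda>a b. A a b + x a * x b) lam' u' \<longrightarrow>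
         exp (t * (trpow m lam' (l + d) 1 + \<theta> * trpow m lam' (l + d) 2 - \<phi>)) + \<zeta> * trpow m lam' (l + d) p \<le> W x) \<and>
      (\<integral>x. W x \<partial>\<mu>) \<le> exp (t * (trpow m lam l 1 + \<theta> * trpow m lam l 2 - \<phi>)) +
         \<zeta> * (trpow m lam l p + real p * v * real m * r * (r / \<sigma>) ^ p)"
      using nn c1[unfolded K1_def K2_def e_def] c2[unfolded K1_def e_def] c3[unfolded e_def] \<gamma>'(3)
      by (intro barrier_step[OF sp gt']) (auto simp: \<gamma>'_def)
    then obtain W where W: "ess_bdd \<mu> W" and
      dom: "\<And>x lam' u'. spectral m (\<lambda>a b. A a b + x a * x b) lam' u' \<Longrightarrow>
         exp (t * (trpow m lam' (l + d) 1 + \<theta> * trpow m lam' (l + d) 2 - \<phi>)) + \<zeta> * trpow m lam' (l + d) p \<le> W x" and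
      EW: "(\<integral>x. W x \<partial>\<mu>) \<le> exp (t * (\<Phi> - \<phi>)) + \<zeta> * (trpow m lam l p + Rr)"
      unfolding \<Phi>_def Rr_def by blast
    have EE: "?E \<in> sets (PiM (insert j J) (\<lambda>_. \<mu>))"
      by (intro measurable_below_form borel_measurable_add borel_measurable_const measurable_gram) auto
    have "emeasure (PiM (insert j J) (\<lambda>_. \<mu>)) ?E = (\<integral>\<^sup>+x. indicator ?E x \<partial>PiM (insert j J) (\<lambda>_. \<mu>))"
      using EE by simp
    also have "\<dots> = (\<integral>\<^sup>+y. (\<integral>\<^sup>+x. indicator ?E (x(j := y)) \<partial>PiM J (\<lambda>_. \<mu>)) \<partial>\<mu>)"
      using EE insert.hyps by (intro P.product_nn_integral_insert_rev) auto
    also have "\<dots> \<le> (\<integral>\<^sup>+y. ennreal (W y + \<zeta> * (real (card J) * Rr)) \<partial>\<mu>)"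
    proof (rule nn_integral_mono)
      fix y assume y: "y \<in> space \<mu>"
      let ?A = "\<lambda>a b. A a b + y a * y b"
      obtain lam' u' where sp': "spectral m ?A lam' u'"
        using spectral_theorem[of m ?A] spectral_symmetric[OF sp] by (auto simp: mult.commute)
      interpret R: rank_one_update m A y lam lam' u u' by unfold_locales (rule sp, rule sp')
      let ?E' = "{x \<in> space (PiM J (\<lambda>_. \<mu>)). \<exists>w. bform m (\<lambda>a b. ?A a b + gram J x a b) w w < (l + d + real (card J) * d) * dotp m w w}"
      have "(\<integral>\<^sup>+x. indicator ?E (x(j := y)) \<partial>PiM J (\<lambda>_. \<mu>)) = (\<integral>\<^sup>+x. indicator ?E' x \<partial>PiM J (\<lambda>_. \<mu>))"
      proof (rule nn_integral_cong)
        fix x assume x: "x \<in> space (PiM J (\<lambda>_. \<mu>))"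
        have 1: "x(j := y) \<in> space (PiM (insert j J) (\<lambda>_. \<mu>))"
          using x y unfolding space_PiM by (intro PiE_fun_upd) auto
        have 2: "(\<lambda>a b. A a b + gram (insert j J) (x(j := y)) a b) = (\<lambda>a b. ?A a b + gram J x a b)"
          using insert.hyps by (simp add: gram_insert add.assoc)
        have 3: "?L = l + d + real (card J) * d" using insert.hyps by (simp add: algebra_simps)
        show "indicator ?E (x(j := y)) = (indicator ?E' x :: ennreal)"
          unfolding indicator_def mem_Collect_eq 2 3 using 1 x by simp
      qed
      also have "\<dots> = emeasure (PiM J (\<lambda>_. \<mu>)) ?E'"
        by (intro nn_integral_indicator measurable_below_form borel_measurable_add borel_measurable_const measurable_gram) auto
      also have "\<dots> \<le> ennreal (exp (t * (trpow m lam' (l + d) 1 + \<theta> * trpow m lam' (l + d) 2 - \<phi>)) + \<zeta> * (trpow m lam' (l + d) p + real (card J) * Rr))"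
        unfolding Rr_def by (rule insert.IH[OF sp' R.eigenvalue_gt[OF gt']])
      also have "\<dots> \<le> ennreal (W y + \<zeta> * (real (card J) * Rr))"
        using dom[OF sp'] by (intro ennreal_leI) (simp add: algebra_simps)
      finally show "(\<integral>\<^sup>+x. indicator ?E (x(j := y)) \<partial>PiM J (\<lambda>_. \<mu>)) \<le> ennreal (W y + \<zeta> * (real (card J) * Rr))" .
    qed
    also have "\<dots> = ennreal (\<integral>y. W y + \<zeta> * (real (card J) * Rr) \<partial>\<mu>)"
    proof (rule nn_integral_eq_integral)
      show "integrable \<mu> (\<lambda>y. W y + \<zeta> * (real (card J) * Rr))"
        by (intro ess_bdd_integrable ess_bdd_intros W)
      have "0 \<le> W y" for y
      proof -
        let ?A = "\<lambda>a b. A a b + y a * y b"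
        obtain lam' u' where sp': "spectral m ?A lam' u'"
          using spectral_theorem[of m ?A] spectral_symmetric[OF sp] by (auto simp: mult.commute)
        interpret R: rank_one_update m A y lam lam' u u' by unfold_locales (rule sp, rule sp')
        have "0 \<le> trpow m lam' (l + d) p" unfolding trpow_def using R.eigenvalue_gt[OF gt']
          by (intro sum_nonneg zero_le_power) (auto simp: less_imp_le)
        then show ?thesis using dom[OF sp'] nn
          by (meson add_nonneg_nonneg exp_ge_zero less_imp_le mult_nonneg_nonneg order.trans)
      qed
      then show "AE y in \<mu>. 0 \<le> W y + \<zeta> * (real (card J) * Rr)"
        using nn Rr0 by (intro always_eventually allI add_nonneg_nonneg mult_nonneg_nonneg) auto
    qed
    also have "\<dots> \<le> ennreal B"
    proof (rule ennreal_leI)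
      have "(\<integral>y. W y + \<zeta> * (real (card J) * Rr) \<partial>\<mu>) = (\<integral>y. W y \<partial>\<mu>) + \<zeta> * (real (card J) * Rr)"
        using ess_bdd_integrable[OF W] by (simp add: prob_space)
      then show "(\<integral>y. W y + \<zeta> * (real (card J) * Rr) \<partial>\<mu>) \<le> B"
        using EW insert.hyps by (simp add: B_def algebra_simps)
    qed
    finally show ?thesis by (simp add: B_def \<Phi>_def Rr_def)
  qed
qed

end

section \<open>Concentration and the self-consistent equation\<close>

text \<open>Given the new coordinate, the induction hypothesis controls the deviation from the
  conditional mean \<open>F\<close>; what remains is the deviation of \<open>F\<close>, a bounded
  variable to which Hoeffding's lemma applies.\<close>

lemma (in prob_space) mcdiarmid_exp:
  fixes f :: "(nat \<Rightarrow> 'a) \<Rightarrow> real"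
  assumes "finite J" "f \<in> borel_measurable (PiM J (\<lambda>_. M))"
    and "\<And>x. x \<in> space (PiM J (\<lambda>_. M)) \<Longrightarrow> \<bar>f x\<bar> \<le> B"
    and "\<And>x y j. x \<in> space (PiM J (\<lambda>_. M)) \<Longrightarrow> y \<in> space M \<Longrightarrow> j \<in> J \<Longrightarrow> \<bar>f (x(j := y)) - f x\<bar> \<le> c"
    and s: "0 < s" and c: "0 \<le> c"
  shows "(\<integral>\<^sup>+x. ennreal (exp (s * (f x - (\<integral>x. f x \<partial>PiM J (\<lambda>_. M))))) \<partial>PiM J (\<lambda>_. M)) \<le> ennreal (exp (s\<^sup>2 * real (card J) * c\<^sup>2 / 2))"
  using assms(1-4)
proof (induction J arbitrary: f rule: finite_induct)
  case empty
  interpret PE: prob_space "PiM {} (\<lambda>_::nat. M)" by (intro prob_space_PiM prob_space_axioms)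
  have sp: "space (PiM {} (\<lambda>_::nat. M)) = {\<lambda>_. undefined}" by (simp add: space_PiM)
  have "(\<integral>x. f x \<partial>PiM {} (\<lambda>_. M)) = (\<integral>x. f (\<lambda>_. undefined) \<partial>PiM {} (\<lambda>_::nat. M))"
    by (intro Bochner_Integration.integral_cong) (auto simp: sp)
  then have "(\<integral>x. f x \<partial>PiM {} (\<lambda>_. M)) = f (\<lambda>_. undefined)" by (simp add: PE.prob_space)
  then have "(\<integral>\<^sup>+x. ennreal (exp (s * (f x - (\<integral>x. f x \<partial>PiM {} (\<lambda>_. M))))) \<partial>PiM {} (\<lambda>_. M)) = (\<integral>\<^sup>+x. 1 \<partial>PiM {} (\<lambda>_::nat. M))"
    by (intro nn_integral_cong) (simp add: sp)
  then show ?case by (simp add: PE.emeasure_space_1)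
next
  case (insert j J)
  interpret P: product_prob_space "\<lambda>_::nat. M" by unfold_locales
  interpret PJ: prob_space "PiM J (\<lambda>_. M)" by (intro prob_space_PiM prob_space_axioms)
  interpret PI: prob_space "PiM (insert j J) (\<lambda>_. M)" by (intro prob_space_PiM prob_space_axioms)
  note fm = insert.prems(1) and fB = insert.prems(2) and fc = insert.prems(3)
  have add[measurable]: "(\<lambda>(y, x). x(j := y)) \<in> measurable (M \<Otimes>\<^sub>M PiM J (\<lambda>_. M)) (PiM (insert j J) (\<lambda>_. M))"
    using measurable_comp[OF measurable_pair_swap' measurable_add_dim[of j J "\<lambda>_. M"]] by (simp add: comp_def split_beta)
  have upd: "x(j := y) \<in> space (PiM (insert j J) (\<lambda>_. M))" if "x \<in> space (PiM J (\<lambda>_. M))" "y \<in> space M" for x y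
    using that unfolding space_PiM by (intro PiE_fun_upd) auto
  define F where "F = (\<lambda>y. \<integral>x. f (x(j := y)) \<partial>PiM J (\<lambda>_. M))"
  have fp: "(\<lambda>(y, x). f (x(j := y))) \<in> borel_measurable (M \<Otimes>\<^sub>M PiM J (\<lambda>_. M))"
    using measurable_comp[OF add fm] by (simp add: comp_def split_beta)
  have Fm: "F \<in> borel_measurable M" unfolding F_def
    by (rule PJ.borel_measurable_lebesgue_integral) (use fp in simp)
  have fy: "(\<lambda>x. f (x(j := y))) \<in> borel_measurable (PiM J (\<lambda>_. M))" if "y \<in> space M" for y
    using measurable_compose_Pair1[OF that fp] by simp
  have int_y: "integrable (PiM J (\<lambda>_. M)) (\<lambda>x. f (x(j := y)))" if "y \<in> space M" for y
    using fy[OF that] fB upd that by (intro PJ.integrable_const_bound[of _ B]) auto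
  have intf: "integrable (PiM (insert j J) (\<lambda>_. M)) f"
    using fm fB by (intro PI.integrable_const_bound[of _ B]) auto
  define E where "E = (\<integral>x. f x \<partial>PiM (insert j J) (\<lambda>_. M))"
  have EF: "E = (\<integral>y. F y \<partial>M)"
  proof -
    interpret PP: pair_prob_space "PiM J (\<lambda>_. M)" M ..
    have "integrable (PiM J (\<lambda>_. M) \<Otimes>\<^sub>M M) (\<lambda>(x, y). f (x(j := y)))"
      using fB upd measurable_comp[OF measurable_add_dim[of j J "\<lambda>_. M"] fm]
      by (intro PP.integrable_const_bound[of _ B]) (auto simp: space_pair_measure comp_def split_beta intro!: AE_I2)
    from PP.Fubini_integral[OF this] show ?thesis
      unfolding E_def F_def using P.product_integral_insert[OF insert.hyps intf] by simp
  qed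
  have Fdiff: "\<bar>F y - F y'\<bar> \<le> c" if y: "y \<in> space M" "y' \<in> space M" for y y'
  proof -
    have "F y - F y' = (\<integral>x. f (x(j := y)) - f (x(j := y')) \<partial>PiM J (\<lambda>_. M))"
      unfolding F_def using int_y y by simp
    also have "\<bar>\<dots>\<bar> \<le> (\<integral>x. \<bar>f (x(j := y)) - f (x(j := y'))\<bar> \<partial>PiM J (\<lambda>_. M))" by (rule integral_abs_bound)
    also have "\<dots> \<le> (\<integral>x. c \<partial>PiM J (\<lambda>_. M))"
    proof (rule Bochner_Integration.integral_mono)
      fix x assume x: "x \<in> space (PiM J (\<lambda>_. M))"
      show "\<bar>f (x(j := y)) - f (x(j := y'))\<bar> \<le> c"
      proof -
        have "(x(j := y'))(j := y) = x(j := y)" by (simp add: fun_eq_iff)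
        then show ?thesis using fc[OF upd[OF x y(2)] y(1), of j] by (simp only: insert_iff simp_thms)
      qed
    qed (use int_y y in auto)
    finally show ?thesis by (simp add: PJ.prob_space)
  qed
  have Fb: "\<bar>F y\<bar> \<le> B" if y: "y \<in> space M" for y
  proof -
    have "\<bar>F y\<bar> \<le> (\<integral>x. \<bar>f (x(j := y))\<bar> \<partial>PiM J (\<lambda>_. M))" unfolding F_def by (rule integral_abs_bound)
    also have "\<dots> \<le> (\<integral>x. B \<partial>PiM J (\<lambda>_. M))"
      by (rule Bochner_Integration.integral_mono) (use int_y y fB upd in auto)
    finally show ?thesis by (simp add: PJ.prob_space)
  qed
  have Fint: "integrable M F" using Fm Fb by (intro integrable_const_bound[of _ B]) auto
  have FE: "\<bar>F y - E\<bar> \<le> c" if y: "y \<in> space M" for y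
  proof -
    have "F y - E = (\<integral>y'. F y - F y' \<partial>M)" unfolding EF using Fint by (simp add: prob_space)
    also have "\<bar>\<dots>\<bar> \<le> (\<integral>y'. \<bar>F y - F y'\<bar> \<partial>M)" by (rule integral_abs_bound)
    also have "\<dots> \<le> (\<integral>y'. c \<partial>M)"
      by (rule Bochner_Integration.integral_mono) (use Fint Fdiff y in auto)
    finally show ?thesis by (simp add: prob_space)
  qed
  \<comment> \<open>An interval of length \<open>2 * c\<close> around the mean, which is where the
    exponent \<open>s^2 * c^2 / 2\<close> per coordinate comes from.\<close>
  interpret H: interval_bounded_random_variable M F "E - c" "E + c"
    by unfold_locales (use Fm FE in \<open>auto simp: abs_le_iff intro!: AE_I2 dest: FE\<close>)
  have hoeff: "(\<integral>\<^sup>+y. ennreal (exp (s * (F y - E))) \<partial>M) \<le> ennreal (exp (s\<^sup>2 * c\<^sup>2 / 2))"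
    using H.Hoeffdings_lemma_nn_integral[OF s] by (simp add: EF power_mult_distrib mult.commute)
  have em: "(\<lambda>x. ennreal (exp (s * (f x - E)))) \<in> borel_measurable (PiM (insert j J) (\<lambda>_. M))" using fm by measurable
  have "(\<integral>\<^sup>+x. ennreal (exp (s * (f x - E))) \<partial>PiM (insert j J) (\<lambda>_. M)) =
      (\<integral>\<^sup>+y. (\<integral>\<^sup>+x. ennreal (exp (s * (f (x(j := y)) - E))) \<partial>PiM J (\<lambda>_. M)) \<partial>M)"
    using insert.hyps by (intro P.product_nn_integral_insert_rev em) auto
  also have "\<dots> \<le> (\<integral>\<^sup>+y. ennreal (exp (s\<^sup>2 * real (card J) * c\<^sup>2 / 2)) * ennreal (exp (s * (F y - E))) \<partial>M)"
  proof (rule nn_integral_mono)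
    fix y assume y: "y \<in> space M"
    have "(\<integral>\<^sup>+x. ennreal (exp (s * (f (x(j := y)) - E))) \<partial>PiM J (\<lambda>_. M)) =
       (\<integral>\<^sup>+x. ennreal (exp (s * (f (x(j := y)) - F y))) * ennreal (exp (s * (F y - E))) \<partial>PiM J (\<lambda>_. M))"
      by (intro nn_integral_cong) (simp add: ennreal_mult[symmetric] exp_add[symmetric] algebra_simps)
    also have "\<dots> = (\<integral>\<^sup>+x. ennreal (exp (s * (f (x(j := y)) - F y))) \<partial>PiM J (\<lambda>_. M)) * ennreal (exp (s * (F y - E)))"
      by (rule nn_integral_multc) (use fy[OF y] in measurable)
    also have "\<dots> \<le> ennreal (exp (s\<^sup>2 * real (card J) * c\<^sup>2 / 2)) * ennreal (exp (s * (F y - E)))"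
    proof (rule mult_right_mono)
      show "(\<integral>\<^sup>+x. ennreal (exp (s * (f (x(j := y)) - F y))) \<partial>PiM J (\<lambda>_. M)) \<le> ennreal (exp (s\<^sup>2 * real (card J) * c\<^sup>2 / 2))"
        unfolding F_def
      proof (rule insert.IH[OF fy[OF y]])
        fix x assume x: "x \<in> space (PiM J (\<lambda>_. M))"
        show "\<bar>f (x(j := y))\<bar> \<le> B" using fB[OF upd[OF x y]] .
        fix y' k assume yk: "y' \<in> space M" "k \<in> J"
        have "k \<noteq> j" using yk insert.hyps by auto
        then have "(x(j := y))(k := y') = (x(k := y'))(j := y)" by (auto simp: fun_eq_iff)
        then show "\<bar>f ((x(k := y'))(j := y)) - f (x(j := y))\<bar> \<le> c"
          using fc[OF upd[OF x y] yk(1), of k] yk(2) by (simp only: insert_iff simp_thms)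
      qed
    qed simp
    finally show "(\<integral>\<^sup>+x. ennreal (exp (s * (f (x(j := y)) - E))) \<partial>PiM J (\<lambda>_. M)) \<le>
       ennreal (exp (s\<^sup>2 * real (card J) * c\<^sup>2 / 2)) * ennreal (exp (s * (F y - E)))" .
  qed
  also have "\<dots> = ennreal (exp (s\<^sup>2 * real (card J) * c\<^sup>2 / 2)) * (\<integral>\<^sup>+y. ennreal (exp (s * (F y - E))) \<partial>M)"
    by (rule nn_integral_cmult) (use Fm in measurable)
  also have "\<dots> \<le> ennreal (exp (s\<^sup>2 * real (card J) * c\<^sup>2 / 2)) * ennreal (exp (s\<^sup>2 * c\<^sup>2 / 2))"
    using hoeff by (rule mult_left_mono) simp
  also have "\<dots> = ennreal (exp (s\<^sup>2 * real (card (insert j J)) * c\<^sup>2 / 2))"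
    using insert.hyps by (simp add: ennreal_mult[symmetric] exp_add[symmetric] algebra_simps add_divide_distrib)
  finally show ?case by (simp add: E_def)
qed

context prob_space
begin

context
  fixes f :: "(nat \<Rightarrow> 'a) \<Rightarrow> real" and J :: "nat set" and B c :: real
  assumes fin: "finite J" and J: "J \<noteq> {}" and fm: "f \<in> borel_measurable (PiM J (\<lambda>_. M))"
    and fB: "\<And>x. x \<in> space (PiM J (\<lambda>_. M)) \<Longrightarrow> \<bar>f x\<bar> \<le> B"
    and fc: "\<And>x y j. x \<in> space (PiM J (\<lambda>_. M)) \<Longrightarrow> y \<in> space M \<Longrightarrow> j \<in> J \<Longrightarrow> \<bar>f (x(j := y)) - f x\<bar> \<le> c"
    and c: "0 < c"
begin

text \<open>Both signs in one moment: the tail bound and the bound on the mean absolute deviation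
  follow from it by integrating pointwise inequalities.\<close>

lemma mcdiarmid_exp_both:
  assumes s: "0 < s"
  shows "(\<integral>\<^sup>+x. ennreal (exp (s * (f x - (\<integral>x. f x \<partial>PiM J (\<lambda>_. M)))) + exp (- (s * (f x - (\<integral>x. f x \<partial>PiM J (\<lambda>_. M)))))) \<partial>PiM J (\<lambda>_. M))
     \<le> ennreal (2 * exp (s\<^sup>2 * real (card J) * c\<^sup>2 / 2))"
proof -
  let ?E = "\<integral>x. f x \<partial>PiM J (\<lambda>_. M)"
  have 1: "(\<integral>\<^sup>+x. ennreal (exp (s * (f x - ?E))) \<partial>PiM J (\<lambda>_. M)) \<le> ennreal (exp (s\<^sup>2 * real (card J) * c\<^sup>2 / 2))"
    using c by (intro mcdiarmid_exp[OF fin fm fB fc s]) auto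
  have "(\<integral>\<^sup>+x. ennreal (exp (s * (- f x - (\<integral>x. - f x \<partial>PiM J (\<lambda>_. M))))) \<partial>PiM J (\<lambda>_. M)) \<le> ennreal (exp (s\<^sup>2 * real (card J) * c\<^sup>2 / 2))"
    using c fm fB fc by (intro mcdiarmid_exp[OF fin _ _ _ s, where B=B]) (auto simp: abs_minus_commute)
  then have 2: "(\<integral>\<^sup>+x. ennreal (exp (- (s * (f x - ?E)))) \<partial>PiM J (\<lambda>_. M)) \<le> ennreal (exp (s\<^sup>2 * real (card J) * c\<^sup>2 / 2))"
    by (simp add: algebra_simps)
  have "(\<integral>\<^sup>+x. ennreal (exp (s * (f x - ?E)) + exp (- (s * (f x - ?E)))) \<partial>PiM J (\<lambda>_. M)) =
      (\<integral>\<^sup>+x. ennreal (exp (s * (f x - ?E))) \<partial>PiM J (\<lambda>_. M)) + (\<integral>\<^sup>+x. ennreal (exp (- (s * (f x - ?E)))) \<partial>PiM J (\<lambda>_. M))"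
    by (subst nn_integral_add[symmetric]) (use fm in \<open>auto simp: ennreal_plus[symmetric] simp del: ennreal_plus\<close>)
  also have "\<dots> \<le> ennreal (exp (s\<^sup>2 * real (card J) * c\<^sup>2 / 2)) + ennreal (exp (s\<^sup>2 * real (card J) * c\<^sup>2 / 2))"
    by (intro add_mono 1 2)
  also have "\<dots> = ennreal (2 * exp (s\<^sup>2 * real (card J) * c\<^sup>2 / 2))"
    by (simp add: ennreal_plus[symmetric] del: ennreal_plus)
  finally show ?thesis .
qed

lemma mcdiarmid_tail:
  assumes \<delta>: "0 < \<delta>"
  shows "measure (PiM J (\<lambda>_. M)) {x \<in> space (PiM J (\<lambda>_. M)). \<delta> \<le> \<bar>f x - (\<integral>x. f x \<partial>PiM J (\<lambda>_. M))\<bar>}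
    \<le> 2 * exp (- \<delta>\<^sup>2 / (2 * real (card J) * c\<^sup>2))"
proof -
  interpret PJ: prob_space "PiM J (\<lambda>_. M)" by (intro prob_space_PiM prob_space_axioms)
  define E where "E = (\<integral>x. f x \<partial>PiM J (\<lambda>_. M))"
  let ?A = "{x \<in> space (PiM J (\<lambda>_. M)). \<delta> \<le> \<bar>f x - E\<bar>}"
  define n where "n = real (card J)"
  have n: "0 < n" using fin J by (simp add: n_def card_gt_0_iff)
  \<comment> \<open>The minimiser of \<open>- s * \<delta> + s^2 * n * c^2 / 2\<close>.\<close>
  define s where "s = \<delta> / (n * c\<^sup>2)"
  have s: "0 < s" using n c \<delta> by (simp add: s_def)
  have A: "?A \<in> sets (PiM J (\<lambda>_. M))" using fm by measurable
  have "emeasure (PiM J (\<lambda>_. M)) ?A = (\<integral>\<^sup>+x. indicator ?A x \<partial>PiM J (\<lambda>_. M))" using A by simp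
  also have "\<dots> \<le> (\<integral>\<^sup>+x. ennreal (exp (- (s * \<delta>))) * ennreal (exp (s * (f x - E)) + exp (- (s * (f x - E)))) \<partial>PiM J (\<lambda>_. M))"
  proof (rule nn_integral_mono)
    fix x assume "x \<in> space (PiM J (\<lambda>_. M))"
    show "indicator ?A x \<le> ennreal (exp (- (s * \<delta>))) * ennreal (exp (s * (f x - E)) + exp (- (s * (f x - E))))"
    proof (cases "\<delta> \<le> \<bar>f x - E\<bar>")
      case True
      then have "exp (s * \<delta>) \<le> exp (s * (f x - E)) \<or> exp (s * \<delta>) \<le> exp (- (s * (f x - E)))"
        using s by (auto simp: abs_real_def mult_minus_right[symmetric] simp del: mult_minus_right split: if_splits)
      then have "exp (s * \<delta>) \<le> exp (s * (f x - E)) + exp (- (s * (f x - E)))"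
        using exp_ge_zero[of "s * (f x - E)"] exp_ge_zero[of "- (s * (f x - E))"] by linarith
      then have "exp (- (s * \<delta>)) * exp (s * \<delta>) \<le> exp (- (s * \<delta>)) * (exp (s * (f x - E)) + exp (- (s * (f x - E))))"
        by (intro mult_left_mono) auto
      then have "1 \<le> exp (- (s * \<delta>)) * (exp (s * (f x - E)) + exp (- (s * (f x - E))))"
        by (simp add: exp_add[symmetric])
      then have "ennreal 1 \<le> ennreal (exp (- (s * \<delta>)) * (exp (s * (f x - E)) + exp (- (s * (f x - E)))))" by (rule ennreal_leI)
      then show ?thesis by (subst ennreal_mult[symmetric]) (auto simp: indicator_def intro: order.trans)
    qed (simp add: indicator_def)
  qed
  also have "\<dots> = ennreal (exp (- (s * \<delta>))) * (\<integral>\<^sup>+x. ennreal (exp (s * (f x - E)) + exp (- (s * (f x - E)))) \<partial>PiM J (\<lambda>_. M))"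
    by (rule nn_integral_cmult) (use fm in measurable)
  also have "\<dots> \<le> ennreal (exp (- (s * \<delta>))) * ennreal (2 * exp (s\<^sup>2 * n * c\<^sup>2 / 2))"
    using mcdiarmid_exp_both[OF s] by (intro mult_left_mono) (auto simp: E_def n_def)
  also have "\<dots> = ennreal (2 * exp (- \<delta>\<^sup>2 / (2 * n * c\<^sup>2)))"
  proof -
    have "- (s * \<delta>) + s\<^sup>2 * n * c\<^sup>2 / 2 = - \<delta>\<^sup>2 / (2 * n * c\<^sup>2)"
      using n c by (simp add: s_def field_simps power2_eq_square)
    then have "exp (- (s * \<delta>)) * (2 * exp (s\<^sup>2 * n * c\<^sup>2 / 2)) = 2 * exp (- \<delta>\<^sup>2 / (2 * n * c\<^sup>2))"
      by (simp add: exp_add[symmetric] mult.left_commute)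
    then show ?thesis by (subst ennreal_mult[symmetric]) auto
  qed
  finally show ?thesis unfolding E_def n_def PJ.emeasure_eq_measure by (simp add: ennreal_le_iff)
qed

lemma mcdiarmid_mean:
  "(\<integral>x. \<bar>f x - (\<integral>x. f x \<partial>PiM J (\<lambda>_. M))\<bar> \<partial>PiM J (\<lambda>_. M)) \<le> 4 * c * sqrt (real (card J))"
proof -
  interpret PJ: prob_space "PiM J (\<lambda>_. M)" by (intro prob_space_PiM prob_space_axioms)
  define E where "E = (\<integral>x. f x \<partial>PiM J (\<lambda>_. M))"
  define n where "n = real (card J)"
  have n: "0 < n" using fin J by (simp add: n_def card_gt_0_iff)
  \<comment> \<open>Makes the exponent equal to 1/2, so that the constant is
    \<open>2 * exp (1/2) \<le> 4\<close>.\<close>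
  define s where "s = 1 / (c * sqrt n)"
  have s: "0 < s" using n c by (simp add: s_def)
  have fi: "integrable (PiM J (\<lambda>_. M)) f" using fm fB by (intro PJ.integrable_const_bound[of _ B]) auto
  have "ennreal (\<integral>x. \<bar>f x - E\<bar> \<partial>PiM J (\<lambda>_. M)) = (\<integral>\<^sup>+x. ennreal \<bar>f x - E\<bar> \<partial>PiM J (\<lambda>_. M))"
    by (rule nn_integral_eq_integral[symmetric]) (use fi in auto)
  also have "\<dots> \<le> (\<integral>\<^sup>+x. ennreal (1 / s) * ennreal (exp (s * (f x - E)) + exp (- (s * (f x - E)))) \<partial>PiM J (\<lambda>_. M))"
  proof (rule nn_integral_mono)
    fix x
    have "s * \<bar>f x - E\<bar> = \<bar>s * (f x - E)\<bar>" using s by (simp add: abs_mult)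
    also have "\<dots> \<le> exp (s * (f x - E)) + exp (- (s * (f x - E)))"
      using exp_ge_add_one_self[of "s * (f x - E)"] exp_ge_add_one_self[of "- (s * (f x - E))"]
        exp_ge_zero[of "s * (f x - E)"] exp_ge_zero[of "- (s * (f x - E))"] by arith
    finally have "s * \<bar>f x - E\<bar> \<le> exp (s * (f x - E)) + exp (- (s * (f x - E)))" .
    then have "\<bar>f x - E\<bar> \<le> 1 / s * (exp (s * (f x - E)) + exp (- (s * (f x - E))))"
      using s by (simp add: field_simps)
    then have "ennreal \<bar>f x - E\<bar> \<le> ennreal (1 / s * (exp (s * (f x - E)) + exp (- (s * (f x - E)))))" by (rule ennreal_leI)
    then show "ennreal \<bar>f x - E\<bar> \<le> ennreal (1 / s) * ennreal (exp (s * (f x - E)) + exp (- (s * (f x - E))))"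
      using s by (subst ennreal_mult[symmetric]) auto
  qed
  also have "\<dots> = ennreal (1 / s) * (\<integral>\<^sup>+x. ennreal (exp (s * (f x - E)) + exp (- (s * (f x - E)))) \<partial>PiM J (\<lambda>_. M))"
    by (rule nn_integral_cmult) (use fm in measurable)
  also have "\<dots> \<le> ennreal (1 / s) * ennreal (2 * exp (s\<^sup>2 * n * c\<^sup>2 / 2))"
    using mcdiarmid_exp_both[OF s] by (intro mult_left_mono) (auto simp: E_def n_def)
  also have "\<dots> = ennreal (1 / s * (2 * exp (s\<^sup>2 * n * c\<^sup>2 / 2)))" using s by (subst ennreal_mult[symmetric]) auto
  also have "1 / s * (2 * exp (s\<^sup>2 * n * c\<^sup>2 / 2)) = 2 * exp (1 / 2) * (c * sqrt n)"
    using n c by (simp add: s_def power_divide power_mult_distrib)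
  also have "\<dots> \<le> ennreal (4 * c * sqrt n)"
  proof (rule ennreal_leI)
    have "exp (1 / 2 :: real) \<le> 2"
    proof -
      have "exp (1 / 2 :: real) * exp (1 / 2) = exp 1" by (simp add: exp_add[symmetric])
      also have "\<dots> \<le> 2 * 2" using exp_le by simp
      finally have "(exp (1 / 2 :: real))\<^sup>2 \<le> 2\<^sup>2" by (simp add: power2_eq_square)
      then show ?thesis by (rule power2_le_imp_le) simp
    qed
    then have "2 * exp (1 / 2) * (c * sqrt n) \<le> 2 * 2 * (c * sqrt n)" using c n by (intro mult_right_mono mult_left_mono) auto
    then show "2 * exp (1 / 2) * (c * sqrt n) \<le> 4 * c * sqrt n" by simp
  qed
  finally show ?thesis using c n unfolding E_def n_def by (subst (asm) ennreal_le_iff) auto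
qed

end

end

section \<open>Positive semidefinite matrices and leave-one-out identities\<close>

definition quadr :: "nat \<Rightarrow> (nat \<Rightarrow> nat \<Rightarrow> real) \<Rightarrow> complex \<Rightarrow> (nat \<Rightarrow> real) \<Rightarrow> complex" where
  "quadr m A z y = (\<Sum>a<m. \<Sum>b<m. of_real (y a * y b) * resolvent m A z a b)"

definition psd :: "nat \<Rightarrow> (nat \<Rightarrow> nat \<Rightarrow> real) \<Rightarrow> bool" where
  "psd m A \<longleftrightarrow> (\<forall>a<m. \<forall>b<m. A a b = A b a) \<and> (\<forall>y. 0 \<le> bform m A y y)"

lemma psd_gram: "psd m (gram J x)"
proof -
  have "bform m (gram J x) y y = (\<Sum>j\<in>J. (dotp m (x j) y)\<^sup>2)" for y
  proof -
    have "bform m (gram J x) y y = (\<Sum>a<m. \<Sum>b<m. \<Sum>j\<in>J. (x j a * y a) * (x j b * y b))"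
      unfolding bform_def gram_def sum_distrib_right by (intro sum.cong refl) (simp add: mult_ac)
    also have "\<dots> = (\<Sum>a<m. \<Sum>j\<in>J. \<Sum>b<m. (x j a * y a) * (x j b * y b))" by (intro sum.cong refl sum.swap)
    also have "\<dots> = (\<Sum>j\<in>J. \<Sum>a<m. \<Sum>b<m. (x j a * y a) * (x j b * y b))" by (rule sum.swap)
    finally show ?thesis by (simp add: dotp_def power2_eq_square sum_product)
  qed
  then show ?thesis by (auto simp: psd_def gram_def mult.commute intro!: sum_nonneg)
qed

lemma psd_spectral:
  assumes "psd m A"
  obtains lam u where "spectral m A lam u" "\<And>i. i < m \<Longrightarrow> 0 \<le> lam i"
proof -
  obtain lam u where sp: "spectral m A lam u" using spectral_theorem[of m A] assms by (auto simp: psd_def)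
  have "0 \<le> lam i" if "i < m" for i
  proof -
    have "bform m A (u i) (u i) = (\<Sum>j<m. if j = i then lam j else 0)"
      unfolding spectral_bform[OF sp] using sp that by (intro sum.cong) (auto simp: spectral_def orthonormal_dotp)
    then show ?thesis using that assms by (simp add: psd_def) metis
  qed
  then show ?thesis using that sp by blast
qed

lemma psd_add: "psd m A \<Longrightarrow> psd m (\<lambda>a b. A a b + x a * x b)"
proof -
  assume A: "psd m A"
  have "bform m (\<lambda>a b. A a b + x a * x b) y y = bform m A y y + (dotp m x y)\<^sup>2" for y
  proof -
    have "bform m (\<lambda>a b. A a b + x a * x b) y y = bform m A y y + (\<Sum>a<m. \<Sum>b<m. (x a * y a) * (x b * y b))"
      by (simp add: bform_def algebra_simps sum.distrib)
    then show ?thesis by (simp add: dotp_def power2_eq_square sum_product)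
  qed
  then show ?thesis using A by (simp add: psd_def mult.commute)
qed

lemma quadr_spectral: "spectral m A lam u \<Longrightarrow> 0 < Im z \<Longrightarrow> quadr m A z y = qpow m lam u y z 1"
  unfolding quadr_def by (rule quad_res_spectral) auto

lemma tr_res_spectral': "spectral m A lam u \<Longrightarrow> 0 < Im z \<Longrightarrow> tr_res m A z = (\<Sum>i<m. 1 / (complex_of_real (lam i) - z))"
  by (subst tr_res_spectral[of m A lam u z]) (auto simp: trpow_def)

lemma inverse_diff_norm_le: "0 < Im z \<Longrightarrow> cmod (1 / (complex_of_real a - z)) \<le> 1 / Im z"
  using abs_Im_le_cmod[of "complex_of_real a - z"] by (simp add: norm_divide frac_le)

lemma tr_res_bound: "psd m A \<Longrightarrow> 0 < Im z \<Longrightarrow> cmod (tr_res m A z) \<le> real m / Im z"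
proof (elim psd_spectral)
  fix lam u assume z: "0 < Im z" and sp: "spectral m A lam u"
  have "cmod (tr_res m A z) \<le> (\<Sum>i<m. 1 / Im z)"
    unfolding tr_res_spectral'[OF sp z] using z by (intro sum_norm_le inverse_diff_norm_le)
  then show "cmod (tr_res m A z) \<le> real m / Im z" by simp
qed

lemma Im_mult_tr_res: "psd m A \<Longrightarrow> 0 < Im z \<Longrightarrow> 0 \<le> Im (z * tr_res m A z)"
proof (elim psd_spectral)
  fix lam u assume z: "0 < Im z" and sp: "spectral m A lam u" and l: "\<And>i. i < m \<Longrightarrow> 0 \<le> lam i"
  show "0 \<le> Im (z * tr_res m A z)"
    using Im_mult_weighted_nonneg[OF z, of "{..<m}" "\<lambda>_. 1" lam] l
    by (simp add: tr_res_spectral'[OF sp z])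
qed

lemma Im_mult_quadr: "psd m A \<Longrightarrow> 0 < Im z \<Longrightarrow> 0 \<le> Im (z * quadr m A z y)"
proof (elim psd_spectral)
  fix lam u assume z: "0 < Im z" and sp: "spectral m A lam u" and l: "\<And>i. i < m \<Longrightarrow> 0 \<le> lam i"
  show "0 \<le> Im (z * quadr m A z y)"
    using Im_mult_weighted_nonneg[OF z, of "{..<m}" "\<lambda>i. (dotp m (u i) y)\<^sup>2" lam] l
    by (simp add: quadr_spectral[OF sp z] qpow_def)
qed

lemma tr_res_rank_one:
  assumes A: "psd m A" and z: "0 < Im z"
  shows "cmod (tr_res m (\<lambda>a b. A a b + x a * x b) z - tr_res m A z) \<le> 1 / Im z"
proof -
  obtain lam u where sp: "spectral m A lam u" using psd_spectral[OF A] .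
  obtain lam' u' where sp': "spectral m (\<lambda>a b. A a b + x a * x b) lam' u'" using psd_spectral[OF psd_add[OF A]] .
  interpret rank_one_update m A x lam lam' u u' by unfold_locales (rule sp, rule sp')
  show ?thesis using trace_change_bound[OF z] tr_res_spectral'[OF sp z] tr_res_spectral'[OF sp' z]
    by (simp add: trpow_def norm_minus_commute)
qed

lemma quadr_rank_one:
  assumes A: "psd m A" and z: "0 < Im z"
  shows "quadr m (\<lambda>a b. A a b + x a * x b) z x = 1 - 1 / (1 + quadr m A z x)"
proof -
  obtain lam u where sp: "spectral m A lam u" using psd_spectral[OF A] .
  obtain lam' u' where sp': "spectral m (\<lambda>a b. A a b + x a * x b) lam' u'" using psd_spectral[OF psd_add[OF A]] .
  interpret rank_one_update m A x lam lam' u u' by unfold_locales (rule sp, rule sp')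
  have eq: "(1 + quadr m A z x) * (1 - quadr m (\<lambda>a b. A a b + x a * x b) z x) = 1"
    using quad_update[OF nz_complex[OF z]] unfolding quadr_spectral[OF sp z] quadr_spectral[OF sp' z] .
  then have "1 + quadr m A z x \<noteq> 0" by auto
  then show ?thesis using eq by (simp add: field_simps)
qed

lemma gram_remove: "finite J \<Longrightarrow> j \<in> J \<Longrightarrow> gram J x = (\<lambda>a b. gram (J - {j}) x a b + x j a * x j b)"
  by (auto simp: gram_def fun_eq_iff sum.remove)

text \<open>The left side is the trace of the Gram matrix times its resolvent, that is, the sum over
  the columns of \<open>x_j^T G x_j\<close>. Each summand is expressed through the resolvent without
  column \<open>j\<close>, which for independent columns is independent of
  \<open>x j\<close>.\<close>

lemma tr_res_gram_identity:
  assumes fin: "finite J" and z: "0 < Im z"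
  shows "of_nat m + z * tr_res m (gram J x) z = (\<Sum>j\<in>J. 1 - 1 / (1 + quadr m (gram (J - {j}) x) z (x j)))"
proof -
  obtain lam u where sp: "spectral m (gram J x) lam u" using psd_spectral[OF psd_gram] .
  have "of_nat m + z * tr_res m (gram J x) z = (\<Sum>a<m. \<Sum>b<m. of_real (gram J x a b) * resolvent m (gram J x) z a b)"
    using z by (intro tr_res_apply[OF sp, symmetric]) auto
  also have "\<dots> = (\<Sum>a<m. \<Sum>b<m. \<Sum>j\<in>J. of_real (x j a * x j b) * resolvent m (gram J x) z a b)"
    by (simp add: gram_def[of J x] sum_distrib_right)
  also have "\<dots> = (\<Sum>a<m. \<Sum>j\<in>J. \<Sum>b<m. of_real (x j a * x j b) * resolvent m (gram J x) z a b)"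
    by (intro sum.cong refl sum.swap)
  also have "\<dots> = (\<Sum>j\<in>J. quadr m (gram J x) z (x j))" unfolding quadr_def by (rule sum.swap)
  also have "\<dots> = (\<Sum>j\<in>J. 1 - 1 / (1 + quadr m (gram (J - {j}) x) z (x j)))"
  proof (rule sum.cong[OF refl])
    fix j assume j: "j \<in> J"
    show "quadr m (gram J x) z (x j) = 1 - 1 / (1 + quadr m (gram (J - {j}) x) z (x j))"
      unfolding gram_remove[OF fin j] by (rule quadr_rank_one[OF psd_gram z])
  qed
  finally show ?thesis .
qed

lemma gram_upd: "finite J \<Longrightarrow> j \<in> J \<Longrightarrow> gram J (x(j := y)) = (\<lambda>a b. gram (J - {j}) x a b + y a * y b)"
  by (auto simp: gram_def fun_eq_iff sum.remove intro!: sum.cong)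

text \<open>The denominators below have this form, for random forms and for means alike:
  \<open>z\<close> times the Stieltjes transform of a positive measure on the nonnegative half-line
  has nonnegative imaginary part.\<close>

lemma norm_inverse_one_plus:
  assumes "0 < Im z" "0 \<le> Im (z * s)"
  shows "cmod (1 / (1 + s)) \<le> cmod z / Im z" and "1 + s \<noteq> 0"
proof -
  have z: "0 < cmod z" using assms by auto
  have *: "Im z / cmod z \<le> cmod (1 + s)" by (rule norm_one_plus_ge[OF assms])
  have pos: "0 < Im z / cmod z" using assms z by simp
  then have p: "0 < cmod (1 + s)" using * by linarith
  then show "1 + s \<noteq> 0" by auto
  have "1 / cmod (1 + s) \<le> 1 / (Im z / cmod z)" by (rule divide_left_mono[OF * _ mult_pos_pos[OF p pos]]) simp
  then show "cmod (1 / (1 + s)) \<le> cmod z / Im z" by (simp add: norm_divide)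
qed

section \<open>Mean and fluctuations of the trace of the resolvent\<close>

context column_law
begin

text \<open>Real and imaginary part are quadratic forms diagonal in the same eigenbasis, so their
  variances add up to a sum of \<open>(cmod (g i))^2\<close>, each at most
  \<open>1 / (Im z)^2\<close>.\<close>

lemma quadr_moments:
  assumes A: "psd m A" and z: "0 < Im z"
  defines "s \<equiv> of_real v * tr_res m A z"
  shows "ess_bdd \<mu> (\<lambda>y. Re (quadr m A z y))" "ess_bdd \<mu> (\<lambda>y. Im (quadr m A z y))"
    and "(\<integral>y. Re (quadr m A z y) \<partial>\<mu>) = Re s" "(\<integral>y. Im (quadr m A z y) \<partial>\<mu>) = Im s"
    and "(\<integral>y. (cmod (quadr m A z y - s))\<^sup>2 \<partial>\<mu>) \<le> (\<kappa> + 2 * v\<^sup>2) * real m / (Im z)\<^sup>2"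
proof -
  obtain lam u where sp: "spectral m A lam u" using psd_spectral[OF A] .
  have on: "orthonormal m m u" using sp by (simp add: spectral_def)
  define g where "g = (\<lambda>i. 1 / (complex_of_real (lam i) - z))"
  have q: "quadr m A z y = (\<Sum>i<m. of_real ((dotp m (u i) y)\<^sup>2) * g i)" for y
    by (simp add: quadr_spectral[OF sp z] qpow_def g_def)
  have Re: "Re (quadr m A z y) = (\<Sum>i<m. Re (g i) * (dotp m (u i) y)\<^sup>2)"
    and Im: "Im (quadr m A z y) = (\<Sum>i<m. Im (g i) * (dotp m (u i) y)\<^sup>2)" for y
    by (simp_all add: q mult.commute)
  show b: "ess_bdd \<mu> (\<lambda>y. Re (quadr m A z y))" "ess_bdd \<mu> (\<lambda>y. Im (quadr m A z y))"
    unfolding Re Im by (intro ess_bdd_intros ess_bdd_dotp)+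
  have s: "Re s = v * (\<Sum>i<m. Re (g i))" "Im s = v * (\<Sum>i<m. Im (g i))"
    by (simp_all add: s_def tr_res_spectral'[OF sp z] g_def)
  show "(\<integral>y. Re (quadr m A z y) \<partial>\<mu>) = Re s" "(\<integral>y. Im (quadr m A z y) \<partial>\<mu>) = Im s"
    unfolding Re Im s by (rule expect_quad[OF on])+
  have gn: "(Re (g i))\<^sup>2 + (Im (g i))\<^sup>2 \<le> 1 / (Im z)\<^sup>2" for i
  proof -
    have "(cmod (g i))\<^sup>2 \<le> (1 / Im z)\<^sup>2"
      using inverse_diff_norm_le[OF z, of "lam i"] by (intro power_mono) (auto simp: g_def)
    then show ?thesis by (simp add: cmod_power2 power_divide)
  qed
  have "(\<integral>y. (cmod (quadr m A z y - s))\<^sup>2 \<partial>\<mu>) =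
      (\<integral>y. (Re (quadr m A z y) - Re s)\<^sup>2 + (Im (quadr m A z y) - Im s)\<^sup>2 \<partial>\<mu>)"
    by (simp add: cmod_power2)
  also have "\<dots> = (\<integral>y. (Re (quadr m A z y) - Re s)\<^sup>2 \<partial>\<mu>) + (\<integral>y. (Im (quadr m A z y) - Im s)\<^sup>2 \<partial>\<mu>)"
    by (intro Bochner_Integration.integral_add ess_bdd_integrable ess_bdd_intros b)
  also have "\<dots> \<le> (\<kappa> + 2 * v\<^sup>2) * (\<Sum>i<m. (Re (g i))\<^sup>2) + (\<kappa> + 2 * v\<^sup>2) * (\<Sum>i<m. (Im (g i))\<^sup>2)"
    unfolding Re Im s by (intro add_mono variance_quad_le on)
  also have "\<dots> = (\<kappa> + 2 * v\<^sup>2) * (\<Sum>i<m. (Re (g i))\<^sup>2 + (Im (g i))\<^sup>2)"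
    by (simp add: distrib_left sum.distrib)
  also have "\<dots> \<le> (\<kappa> + 2 * v\<^sup>2) * (\<Sum>i<m. 1 / (Im z)\<^sup>2)"
    using \<kappa>_nonneg by (intro mult_left_mono sum_mono gn) auto
  finally show "(\<integral>y. (cmod (quadr m A z y - s))\<^sup>2 \<partial>\<mu>) \<le> (\<kappa> + 2 * v\<^sup>2) * real m / (Im z)\<^sup>2"
    by simp
qed

text \<open>Second order expansion of \<open>1 / (1 + q)\<close> around the mean \<open>s\<close> of
  \<open>q\<close>: the linear term integrates to 0, so the error is of the order of the variance
  and not of the standard deviation.\<close>

lemma inverse_expect:
  assumes A: "psd m A" and z: "0 < Im z"
  defines "s \<equiv> of_real v * tr_res m A z"
  shows "cmod ((\<integral>y. 1 / (1 + quadr m A z y) - 1 / (1 + s) \<partial>\<mu>)) \<le> (cmod z / Im z) ^ 3 * ((\<kappa> + 2 * v\<^sup>2) * real m / (Im z)\<^sup>2)"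
proof -
  note mom = quadr_moments[OF A z, folded s_def]
  define q where "q = quadr m A z"
  define C where "C = cmod z / Im z"
  have C0: "0 \<le> C" using z by (simp add: C_def)
  have qm: "q \<in> borel_measurable \<mu>"
  proof -
    have "(\<lambda>y. Re (q y)) \<in> borel_measurable \<mu>" "(\<lambda>y. Im (q y)) \<in> borel_measurable \<mu>"
      using mom(1,2) by (auto simp: ess_bdd_def q_def)
    then have "(\<lambda>y. complex_of_real (Re (q y)) + \<i> * complex_of_real (Im (q y))) \<in> borel_measurable \<mu>"
      by simp
    then show ?thesis by (simp add: complex_eq[symmetric])
  qed
  have qi: "integrable \<mu> q"
  proof (rule Bochner_Integration.integrable_bound[of \<mu> "\<lambda>y. \<bar>Re (q y)\<bar> + \<bar>Im (q y)\<bar>"])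
    show "integrable \<mu> (\<lambda>y. \<bar>Re (q y)\<bar> + \<bar>Im (q y)\<bar>)"
      using ess_bdd_integrable[OF mom(1)] ess_bdd_integrable[OF mom(2)] by (simp add: q_def)
    show "AE y in \<mu>. norm (q y) \<le> norm (\<bar>Re (q y)\<bar> + \<bar>Im (q y)\<bar>)"
      by (intro always_eventually allI) (simp add: cmod_le)
  qed (rule qm)
  have Eq: "(\<integral>y. q y \<partial>\<mu>) = s"
  proof (rule complex_eqI)
    show "Re (\<integral>y. q y \<partial>\<mu>) = Re s"
      using integral_bounded_linear[OF bounded_linear_Re qi] mom(3) by (simp add: q_def)
    show "Im (\<integral>y. q y \<partial>\<mu>) = Im s"
      using integral_bounded_linear[OF bounded_linear_Im qi] mom(4) by (simp add: q_def)
  qed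
  have s0: "0 \<le> Im (z * s)"
  proof -
    have "Im (z * s) = v * Im (z * tr_res m A z)" by (simp add: s_def algebra_simps)
    then show ?thesis using Im_mult_tr_res[OF A z] v_pos by simp
  qed
  have q0: "0 \<le> Im (z * q y)" for y unfolding q_def by (rule Im_mult_quadr[OF A z])
  note bs = norm_inverse_one_plus[OF z s0, folded C_def]
  note bq = norm_inverse_one_plus[OF z q0, folded C_def]
  have invi: "integrable \<mu> (\<lambda>y. 1 / (1 + q y))"
    using bq(1) qm by (intro integrable_const_bound[of _ C]) auto
  \<comment> \<open>The exact remainder \<open>(q - s)^2 / ((1 + q) (1 + s)^2)\<close> of the
    expansion.\<close>
  define rem where "rem = (\<lambda>y. (1 / (1 + q y) - 1 / (1 + s)) + (q y - s) / (1 + s)\<^sup>2)"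
  have rem: "rem y = (q y - s)\<^sup>2 * (1 / (1 + q y)) * (1 / (1 + s)) ^ 2" for y
  proof -
    have "1 + s \<noteq> 0" "1 + q y \<noteq> 0" using bs(2) bq(2) by auto
    then show ?thesis by (simp add: rem_def divide_simps power2_eq_square) (simp add: algebra_simps)
  qed
  have remi: "integrable \<mu> rem" unfolding rem_def using invi qi by auto
  have "(\<integral>y. 1 / (1 + q y) - 1 / (1 + s) \<partial>\<mu>) = (\<integral>y. rem y - (q y - s) / (1 + s)\<^sup>2 \<partial>\<mu>)"
    by (simp add: rem_def)
  also have "\<dots> = (\<integral>y. rem y \<partial>\<mu>)" using remi qi by (simp add: Eq prob_space)
  finally have "cmod (\<integral>y. 1 / (1 + q y) - 1 / (1 + s) \<partial>\<mu>) \<le> (\<integral>y. cmod (rem y) \<partial>\<mu>)"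
    by (simp add: integral_norm_bound)
  also have "\<dots> \<le> (\<integral>y. C ^ 3 * (cmod (q y - s))\<^sup>2 \<partial>\<mu>)"
  proof (rule Bochner_Integration.integral_mono)
    show "integrable \<mu> (\<lambda>y. cmod (rem y))" using remi by simp
    show "integrable \<mu> (\<lambda>y. C ^ 3 * (cmod (q y - s))\<^sup>2)"
      unfolding cmod_power2 minus_complex.sel q_def by (intro ess_bdd_integrable ess_bdd_intros mom(1,2))
    fix y
    have "cmod (rem y) = (cmod (q y - s))\<^sup>2 * (cmod (1 / (1 + q y)) * (cmod (1 / (1 + s)))\<^sup>2)"
      unfolding rem norm_mult norm_power by simp
    also have "\<dots> \<le> (cmod (q y - s))\<^sup>2 * (C * C\<^sup>2)"
      using bs(1) bq(1) C0 by (intro mult_left_mono mult_mono power_mono) auto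
    finally show "cmod (rem y) \<le> C ^ 3 * (cmod (q y - s))\<^sup>2"
      by (simp add: power2_eq_square power3_eq_cube mult_ac)
  qed
  also have "\<dots> = C ^ 3 * (\<integral>y. (cmod (q y - s))\<^sup>2 \<partial>\<mu>)" by simp
  also have "\<dots> \<le> C ^ 3 * ((\<kappa> + 2 * v\<^sup>2) * real m / (Im z)\<^sup>2)"
    using mom(5) C0 by (intro mult_left_mono) (auto simp: q_def)
  finally show ?thesis unfolding q_def C_def .
qed

context
  fixes J :: "nat set" and z :: complex
  assumes fin: "finite J" and J: "J \<noteq> {}" and z: "0 < Im z"
begin

abbreviation "PJ \<equiv> PiM J (\<lambda>_. \<mu>)"
abbreviation "S x \<equiv> tr_res m (gram J x) z"

lemma measurable_tr_gram: "I \<subseteq> J \<Longrightarrow> (\<lambda>x. tr_res m (gram I x) z) \<in> borel_measurable PJ"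
  by (intro measurable_tr_res measurable_gram borel_measurable_const) auto

lemma measurable_quadr_gram: "j \<in> J \<Longrightarrow> I \<subseteq> J \<Longrightarrow> (\<lambda>x. quadr m (gram I x) z (x j)) \<in> borel_measurable PJ"
proof -
  assume "j \<in> J" "I \<subseteq> J"
  then have e: "(\<lambda>x. complex_of_real (x j a * x j b)) \<in> borel_measurable PJ" if "a < m" "b < m" for a b
    using measurable_entry[of j J a] measurable_entry[of j J b] that by simp
  show ?thesis unfolding quadr_def
    by (intro borel_measurable_sum borel_measurable_times e measurable_resolvent
        measurable_gram borel_measurable_const) (use \<open>I \<subseteq> J\<close> in auto)
qed

lemma prob_PJ: "prob_space PJ" by (intro prob_space_PiM prob_space_axioms)

lemma tr_gram_change: "j \<in> J \<Longrightarrow> cmod (tr_res m (gram J (x(j := y))) z - S x) \<le> 2 / Im z"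
proof -
  assume j: "j \<in> J"
  let ?A = "gram (J - {j}) x"
  have "cmod (tr_res m (gram J (x(j := y))) z - tr_res m ?A z) \<le> 1 / Im z"
    unfolding gram_upd[OF fin j] by (rule tr_res_rank_one[OF psd_gram z])
  moreover have "cmod (S x - tr_res m ?A z) \<le> 1 / Im z"
    unfolding gram_remove[OF fin j, of x] by (rule tr_res_rank_one[OF psd_gram z])
  moreover have "tr_res m (gram J (x(j := y))) z - S x = (tr_res m (gram J (x(j := y))) z - tr_res m ?A z) - (S x - tr_res m ?A z)"
    by simp
  ultimately show ?thesis using norm_triangle_ineq4[of "tr_res m (gram J (x(j := y))) z - tr_res m ?A z" "S x - tr_res m ?A z"]
    by (simp add: field_simps)
qed

lemma integrable_S: "integrable PJ (\<lambda>x. S x)"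
proof -
  interpret PJ: prob_space PJ by (rule prob_PJ)
  show ?thesis using tr_res_bound[OF psd_gram z] measurable_tr_gram[of J]
    by (intro PJ.integrable_const_bound[of _ "real m / Im z"]) auto
qed

lemma S_Re_Im:
  shows "(\<integral>x. Re (S x) \<partial>PJ) = Re (\<integral>x. S x \<partial>PJ)" "(\<integral>x. Im (S x) \<partial>PJ) = Im (\<integral>x. S x \<partial>PJ)"
  using integral_bounded_linear[OF bounded_linear_Re integrable_S] integral_bounded_linear[OF bounded_linear_Im integrable_S]
  by auto

lemma S_facts:
  shows "(\<lambda>x. Re (S x)) \<in> borel_measurable PJ" "(\<lambda>x. Im (S x)) \<in> borel_measurable PJ"
    and "\<bar>Re (S x)\<bar> \<le> real m / Im z" "\<bar>Im (S x)\<bar> \<le> real m / Im z"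
    and "j \<in> J \<Longrightarrow> \<bar>Re (tr_res m (gram J (x(j := y))) z) - Re (S x)\<bar> \<le> 2 / Im z"
    and "j \<in> J \<Longrightarrow> \<bar>Im (tr_res m (gram J (x(j := y))) z) - Im (S x)\<bar> \<le> 2 / Im z"
proof -
  show "(\<lambda>x. Re (S x)) \<in> borel_measurable PJ" "(\<lambda>x. Im (S x)) \<in> borel_measurable PJ"
    using measurable_tr_gram[of J] by auto
  show "\<bar>Re (S x)\<bar> \<le> real m / Im z" "\<bar>Im (S x)\<bar> \<le> real m / Im z"
    using tr_res_bound[OF psd_gram z] abs_Re_le_cmod abs_Im_le_cmod order.trans by blast+
  show "j \<in> J \<Longrightarrow> \<bar>Re (tr_res m (gram J (x(j := y))) z) - Re (S x)\<bar> \<le> 2 / Im z"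
    using tr_gram_change[of j x y] abs_Re_le_cmod[of "tr_res m (gram J (x(j := y))) z - S x"] by simp
  show "j \<in> J \<Longrightarrow> \<bar>Im (tr_res m (gram J (x(j := y))) z) - Im (S x)\<bar> \<le> 2 / Im z"
    using tr_gram_change[of j x y] abs_Im_le_cmod[of "tr_res m (gram J (x(j := y))) z - S x"] by simp
qed

lemma S_mean_deviation:
  "(\<integral>x. cmod (S x - (\<integral>x. S x \<partial>PJ)) \<partial>PJ) \<le> 16 * sqrt (real (card J)) / Im z"
proof -
  interpret PJ: prob_space PJ by (rule prob_PJ)
  let ?E = "\<integral>x. S x \<partial>PJ"
  have c: "0 < 2 / Im z" using z by simp
  have 1: "(\<integral>x. \<bar>Re (S x) - Re ?E\<bar> \<partial>PJ) \<le> 4 * (2 / Im z) * sqrt (real (card J))"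
    unfolding S_Re_Im[symmetric] by (rule mcdiarmid_mean[OF fin J S_facts(1) S_facts(3) S_facts(5) c])
  have 2: "(\<integral>x. \<bar>Im (S x) - Im ?E\<bar> \<partial>PJ) \<le> 4 * (2 / Im z) * sqrt (real (card J))"
    unfolding S_Re_Im[symmetric] by (rule mcdiarmid_mean[OF fin J S_facts(2) S_facts(4) S_facts(6) c])
  have iRe: "integrable PJ (\<lambda>x. \<bar>Re (S x) - Re ?E\<bar>)" and iIm: "integrable PJ (\<lambda>x. \<bar>Im (S x) - Im ?E\<bar>)"
    using integrable_S by auto
  have "(\<integral>x. cmod (S x - ?E) \<partial>PJ) \<le> (\<integral>x. \<bar>Re (S x) - Re ?E\<bar> + \<bar>Im (S x) - Im ?E\<bar> \<partial>PJ)"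
  proof (rule Bochner_Integration.integral_mono)
    fix x show "cmod (S x - ?E) \<le> \<bar>Re (S x) - Re ?E\<bar> + \<bar>Im (S x) - Im ?E\<bar>"
      using cmod_le[of "S x - ?E"] by simp
  qed (use integrable_S iRe iIm in auto)
  also have "\<dots> = (\<integral>x. \<bar>Re (S x) - Re ?E\<bar> \<partial>PJ) + (\<integral>x. \<bar>Im (S x) - Im ?E\<bar> \<partial>PJ)"
    by (rule Bochner_Integration.integral_add[OF iRe iIm])
  finally show ?thesis using 1 2 by simp
qed

lemma S_tail:
  assumes \<delta>: "0 < \<delta>"
  shows "measure PJ {x \<in> space PJ. \<delta> \<le> cmod (S x - (\<integral>x. S x \<partial>PJ))} \<le> 4 * exp (- (\<delta> * Im z)\<^sup>2 / (32 * real (card J)))"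
proof -
  interpret PJ: prob_space PJ by (rule prob_PJ)
  let ?E = "\<integral>x. S x \<partial>PJ"
  have c: "0 < 2 / Im z" using z by simp
  have d2: "0 < \<delta> / 2" using \<delta> by simp
  let ?A = "{x \<in> space PJ. \<delta> / 2 \<le> \<bar>Re (S x) - Re ?E\<bar>}" and ?B = "{x \<in> space PJ. \<delta> / 2 \<le> \<bar>Im (S x) - Im ?E\<bar>}"
  have e: "- (\<delta> / 2)\<^sup>2 / (2 * real (card J) * (2 / Im z)\<^sup>2) = - (\<delta> * Im z)\<^sup>2 / (32 * real (card J))"
    using z by (simp add: power2_eq_square field_simps)
  have 1: "measure PJ ?A \<le> 2 * exp (- (\<delta> * Im z)\<^sup>2 / (32 * real (card J)))"
    unfolding S_Re_Im[symmetric] e[symmetric] by (rule mcdiarmid_tail[OF fin J S_facts(1) S_facts(3) S_facts(5) c d2])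
  have 2: "measure PJ ?B \<le> 2 * exp (- (\<delta> * Im z)\<^sup>2 / (32 * real (card J)))"
    unfolding S_Re_Im[symmetric] e[symmetric] by (rule mcdiarmid_tail[OF fin J S_facts(2) S_facts(4) S_facts(6) c d2])
  have AB: "?A \<in> sets PJ" "?B \<in> sets PJ" using S_facts(1,2) by measurable
  have "{x \<in> space PJ. \<delta> \<le> cmod (S x - ?E)} \<subseteq> ?A \<union> ?B"
  proof
    fix x assume x: "x \<in> {x \<in> space PJ. \<delta> \<le> cmod (S x - ?E)}"
    then have "\<delta> \<le> \<bar>Re (S x) - Re ?E\<bar> + \<bar>Im (S x) - Im ?E\<bar>" using cmod_le[of "S x - ?E"] by simp
    then show "x \<in> ?A \<union> ?B" using x by auto
  qed
  then have "measure PJ {x \<in> space PJ. \<delta> \<le> cmod (S x - ?E)} \<le> measure PJ (?A \<union> ?B)"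
    using AB by (intro PJ.finite_measure_mono) auto
  also have "\<dots> \<le> measure PJ ?A + measure PJ ?B" using AB by (rule measure_Un_le)
  finally show ?thesis using 1 2 by linarith
qed

lemma Im_mult_mean: "0 \<le> Im (z * (of_real v * (\<integral>x. S x \<partial>PJ)))"
proof -
  have "Im (z * (of_real v * (\<integral>x. S x \<partial>PJ))) = v * Im (z * (\<integral>x. S x \<partial>PJ))" by (simp add: algebra_simps)
  also have "z * (\<integral>x. S x \<partial>PJ) = (\<integral>x. z * S x \<partial>PJ)" by simp
  also have "Im (\<integral>x. z * S x \<partial>PJ) = (\<integral>x. Im (z * S x) \<partial>PJ)"
    using integral_bounded_linear[OF bounded_linear_Im integrable_mult_right[OF integrable_S]] by simp
  finally show ?thesis using Im_mult_tr_res[OF psd_gram z] v_pos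
    by (auto intro!: mult_nonneg_nonneg Bochner_Integration.integral_nonneg)
qed

text \<open>In each leave-one-out term the quadratic form is first replaced by \<open>v\<close>
  times the trace without column \<open>j\<close> (error \<open>e1\<close>, from
  \<open>inverse_expect\<close>), then that trace by the mean of the full trace (error
  \<open>e2\<close>, one rank-one change and one mean deviation).\<close>

lemma self_consistent:
  defines "E \<equiv> (\<integral>x. S x \<partial>PJ)"
  defines "sb \<equiv> of_real v * E"
  shows "cmod (of_nat m + z * E - of_nat (card J) + of_nat (card J) / (1 + sb)) \<le>
    real (card J) * ((cmod z / Im z) ^ 3 * ((\<kappa> + 2 * v\<^sup>2) * real m / (Im z)\<^sup>2)
      + (cmod z / Im z)\<^sup>2 * (v / Im z + v * (16 * sqrt (real (card J)) / Im z)))"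
proof -
  interpret PJ: prob_space PJ by (rule prob_PJ)
  interpret P: product_prob_space "\<lambda>_::nat. \<mu>" by unfold_locales
  define C where "C = cmod z / Im z"
  have C0: "0 \<le> C" using z by (simp add: C_def)
  have v_scale: "Im (z * (of_real v * t)) = v * Im (z * t)" for t by (simp add: algebra_simps)
  note bsb = norm_inverse_one_plus[OF z Im_mult_mean, folded E_def sb_def C_def]
  define F where "F = (\<lambda>j x. 1 / (1 + quadr m (gram (J - {j}) x) z (x j)))"
  define H where "H = (\<lambda>j x. 1 / (1 + of_real v * tr_res m (gram (J - {j}) x) z))"
  have Fb: "cmod (F j x) \<le> C" for j x
    unfolding F_def C_def by (rule norm_inverse_one_plus[OF z Im_mult_quadr[OF psd_gram z]])
  have H0: "0 \<le> Im (z * (of_real v * tr_res m (gram I x) z))" for I x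
    unfolding v_scale using Im_mult_tr_res[OF psd_gram z] v_pos by simp
  have Hb: "cmod (H j x) \<le> C" and Hn: "1 + of_real v * tr_res m (gram (J - {j}) x) z \<noteq> 0" for j x
    unfolding H_def C_def using norm_inverse_one_plus[OF z H0] by auto
  have Fi: "integrable PJ (F j)" if "j \<in> J" for j
    using Fb measurable_quadr_gram[OF that, of "J - {j}"] unfolding F_def
    by (intro PJ.integrable_const_bound[of _ C]) auto
  have Hi: "integrable PJ (H j)" if "j \<in> J" for j
    using Hb measurable_tr_gram[of "J - {j}"] unfolding H_def
    by (intro PJ.integrable_const_bound[of _ C]) auto
  define e1 where "e1 = C ^ 3 * ((\<kappa> + 2 * v\<^sup>2) * real m / (Im z)\<^sup>2)"
  have e1_0: "0 \<le> e1" using C0 \<kappa>_nonneg by (simp add: e1_def)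
  have FH: "cmod (\<integral>x. F j x - H j x \<partial>PJ) \<le> e1" if j: "j \<in> J" for j
  proof -
    interpret PJ': prob_space "PiM (J - {j}) (\<lambda>_. \<mu>)" by (intro prob_space_PiM prob_space_axioms)
    have ins: "insert j (J - {j}) = J" using j by auto
    have "integrable (PiM (insert j (J - {j})) (\<lambda>_. \<mu>)) (\<lambda>x. F j x - H j x)"
      unfolding ins by (rule Bochner_Integration.integrable_diff[OF Fi[OF j] Hi[OF j]])
    from P.product_integral_insert[OF _ _ this, unfolded ins]
    have "(\<integral>x. F j x - H j x \<partial>PJ) = (\<integral>x. (\<integral>y. F j (x(j := y)) - H j (x(j := y)) \<partial>\<mu>) \<partial>PiM (J - {j}) (\<lambda>_. \<mu>))"
      using fin by blast
    also have "cmod \<dots> \<le> (\<integral>x. cmod (\<integral>y. F j (x(j := y)) - H j (x(j := y)) \<partial>\<mu>) \<partial>PiM (J - {j}) (\<lambda>_. \<mu>))"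
      by (rule integral_norm_bound)
    also have "\<dots> \<le> (\<integral>x. e1 \<partial>PiM (J - {j}) (\<lambda>_. \<mu>))"
    proof (rule integral_mono_AE')
      show "AE x in PiM (J - {j}) (\<lambda>_. \<mu>). cmod (\<integral>y. F j (x(j := y)) - H j (x(j := y)) \<partial>\<mu>) \<le> e1"
      proof (intro always_eventually allI)
        fix x
        have "gram (J - {j}) (x(j := y)) = gram (J - {j}) x" for y
          by (auto simp: gram_def fun_eq_iff intro!: sum.cong)
        then show "cmod (\<integral>y. F j (x(j := y)) - H j (x(j := y)) \<partial>\<mu>) \<le> e1"
          using inverse_expect[OF psd_gram z, of "J - {j}" x] by (simp add: F_def H_def e1_def C_def)
      qed
    qed (use e1_0 in auto)
    finally show ?thesis by (simp add: PJ'.prob_space)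
  qed
  define e2 where "e2 = C\<^sup>2 * (v / Im z + v * (16 * sqrt (real (card J)) / Im z))"
  have HS: "cmod (\<integral>x. H j x - 1 / (1 + sb) \<partial>PJ) \<le> e2" if j: "j \<in> J" for j
  proof -
    have "cmod (\<integral>x. H j x - 1 / (1 + sb) \<partial>PJ) \<le> (\<integral>x. cmod (H j x - 1 / (1 + sb)) \<partial>PJ)"
      by (rule integral_norm_bound)
    also have "\<dots> \<le> (\<integral>x. C\<^sup>2 * (v / Im z + v * cmod (S x - E)) \<partial>PJ)"
    proof (rule Bochner_Integration.integral_mono)
      show "integrable PJ (\<lambda>x. cmod (H j x - 1 / (1 + sb)))" using Hi[OF j] by auto
      show "integrable PJ (\<lambda>x. C\<^sup>2 * (v / Im z + v * cmod (S x - E)))" using integrable_S by auto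
      fix x
      let ?s = "of_real v * tr_res m (gram (J - {j}) x) z"
      have "H j x - 1 / (1 + sb) = (sb - ?s) * (H j x * (1 / (1 + sb)))"
        using Hn[of j x] bsb(2) by (simp add: H_def divide_simps)
      then have "cmod (H j x - 1 / (1 + sb)) = cmod (sb - ?s) * (cmod (H j x) * cmod (1 / (1 + sb)))"
        by (simp only: norm_mult)
      also have "\<dots> \<le> cmod (sb - ?s) * (C * C)"
        using Hb bsb(1) C0 by (intro mult_left_mono mult_mono) auto
      finally have h1: "cmod (H j x - 1 / (1 + sb)) \<le> cmod (sb - ?s) * (C * C)" .
      have h2: "cmod (S x - tr_res m (gram (J - {j}) x) z) \<le> 1 / Im z"
        unfolding gram_remove[OF fin j, of x] by (rule tr_res_rank_one[OF psd_gram z])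
      have "sb - ?s = of_real v * ((S x - tr_res m (gram (J - {j}) x) z) - (S x - E))"
        by (simp add: sb_def algebra_simps)
      then have "cmod (sb - ?s) = v * cmod ((S x - tr_res m (gram (J - {j}) x) z) - (S x - E))"
        using v_pos by (simp add: norm_mult)
      moreover have "cmod ((S x - tr_res m (gram (J - {j}) x) z) - (S x - E)) \<le> 1 / Im z + cmod (S x - E)"
        using norm_triangle_ineq4[of "S x - tr_res m (gram (J - {j}) x) z" "S x - E"] h2 by linarith
      ultimately have "cmod (sb - ?s) \<le> v * (1 / Im z + cmod (S x - E))"
        using v_pos by (simp add: mult_left_mono)
      then have "cmod (sb - ?s) * (C * C) \<le> v * (1 / Im z + cmod (S x - E)) * (C * C)"
        using C0 by (intro mult_right_mono) auto
      then show "cmod (H j x - 1 / (1 + sb)) \<le> C\<^sup>2 * (v / Im z + v * cmod (S x - E))"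
        using h1 by (simp add: power2_eq_square algebra_simps)
    qed
    also have "\<dots> = C\<^sup>2 * (v / Im z + v * (\<integral>x. cmod (S x - E) \<partial>PJ))"
      using integrable_S by (simp add: PJ.prob_space)
    also have "\<dots> \<le> e2" unfolding e2_def
      using S_mean_deviation v_pos unfolding E_def by (intro mult_left_mono add_left_mono) auto
    finally show ?thesis .
  qed
  have "of_nat m + z * E = (\<integral>x. of_nat m + z * S x \<partial>PJ)"
    using integrable_S by (simp add: E_def PJ.prob_space)
  also have "\<dots> = (\<integral>x. (\<Sum>j\<in>J. 1 - F j x) \<partial>PJ)"
    by (simp add: tr_res_gram_identity[OF fin z] F_def)
  also have "\<dots> = (\<Sum>j\<in>J. 1 - (\<integral>x. F j x \<partial>PJ))"
    by (subst Bochner_Integration.integral_sum) (use Fi in \<open>auto simp: PJ.prob_space\<close>)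
  finally have "of_nat m + z * E - of_nat (card J) + of_nat (card J) / (1 + sb) = (\<Sum>j\<in>J. 1 / (1 + sb) - (\<integral>x. F j x \<partial>PJ))"
    by (simp add: sum_subtractf)
  also have "cmod \<dots> \<le> (\<Sum>j\<in>J. e1 + e2)"
  proof (rule sum_norm_le)
    fix j assume j: "j \<in> J"
    have "1 / (1 + sb) - (\<integral>x. F j x \<partial>PJ) = - ((\<integral>x. F j x - H j x \<partial>PJ) + (\<integral>x. H j x - 1 / (1 + sb) \<partial>PJ))"
      using Fi[OF j] Hi[OF j] by (simp add: PJ.prob_space)
    then have "cmod (1 / (1 + sb) - (\<integral>x. F j x \<partial>PJ)) \<le> cmod (\<integral>x. F j x - H j x \<partial>PJ) + cmod (\<integral>x. H j x - 1 / (1 + sb) \<partial>PJ)"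
      by (simp only: norm_minus_cancel norm_triangle_ineq)
    then show "cmod (1 / (1 + sb) - (\<integral>x. F j x \<partial>PJ)) \<le> e1 + e2" using FH[OF j] HS[OF j] by linarith
  qed
  finally show ?thesis by (simp add: e1_def e2_def C_def)
qed

end

end

section \<open>Regularity from the Marchenko--Pastur equation\<close>

text \<open>The imaginary part of the normalised trace of the resolvent at
  \<open>E + i \<eta>\<close>, that is, the Poisson integral of the empirical spectral
  measure.\<close>

definition poisson :: "nat \<Rightarrow> (nat \<Rightarrow> real) \<Rightarrow> real \<Rightarrow> real \<Rightarrow> real" where
  "poisson m lam E \<eta> = (\<Sum>i<m. \<eta> / ((lam i - E)\<^sup>2 + \<eta>\<^sup>2)) / real m"

text \<open>\<open>w\<close> is the square root in the Marchenko--Pastur equation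
  \<open>z s\<^sup>2 + (z + a - b) s + a = 0\<close>, whose solutions satisfy \<open>2 z s + z + a - b = \<plusminus>w\<close>.\<close>

definition mp_root :: "real \<Rightarrow> real \<Rightarrow> complex \<Rightarrow> complex \<Rightarrow> bool" where
  "mp_root a b z w \<longleftrightarrow> 0 \<le> Im w \<and>
     w\<^sup>2 = (z - of_real ((sqrt b - sqrt a)\<^sup>2)) * (z - of_real ((sqrt b + sqrt a)\<^sup>2))"

text \<open>The allowed deviation \<open>\<eta>\<close> is negligible against \<open>Im w0\<close>, which is of order
  \<open>sqrt (\<bar>e\<bar> + \<eta>)\<close> near the edge.\<close>

definition edge_law :: "real \<Rightarrow> real \<Rightarrow> real \<Rightarrow> nat \<Rightarrow> (nat \<Rightarrow> real) \<Rightarrow> real \<Rightarrow> real \<Rightarrow> bool" where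
  "edge_law a b v m lam K \<eta>s \<longleftrightarrow> (\<forall>i<m. (sqrt b - sqrt a)\<^sup>2 - K * \<eta>s \<le> lam i) \<and>
     (\<forall>e \<eta>. \<bar>e\<bar> \<le> 1 \<and> \<eta>s \<le> \<eta> \<and> \<eta> \<le> 1 \<longrightarrow> (\<exists>w0. mp_root a b (Complex ((sqrt b - sqrt a)\<^sup>2 + e) \<eta>) w0 \<and>
         cmod (2 * Complex ((sqrt b - sqrt a)\<^sup>2 + e) \<eta> * (of_real v * (\<Sum>i<m. 1 / (complex_of_real (lam i) - Complex ((sqrt b - sqrt a)\<^sup>2 + e) \<eta>)))
           + Complex ((sqrt b - sqrt a)\<^sup>2 + e) \<eta> + of_real a - of_real b - w0) \<le> \<eta>))"

text \<open>Regularity of a list of eigenvalues, apart from the norm bound. The range of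
  \<open>\<eta>\<close> in the first clause, all of \<open>\<eta>s \<le> \<eta> \<le> 10\<close>,
  contains the one in \<open>edge_regular\<close>.\<close>

definition edge_bounds :: "real \<Rightarrow> real \<Rightarrow> real \<Rightarrow> nat \<Rightarrow> (nat \<Rightarrow> real) \<Rightarrow> bool" where
  "edge_bounds cH CH \<eta>s m lam \<longleftrightarrow> (let l = Min (lam ` {..<m}) in
        (\<forall>E \<eta>. l \<le> E \<and> E \<le> l + cH \<and> \<eta>s \<le> \<eta> \<and> \<eta> \<le> 10 \<longrightarrow>
           1 / CH * sqrt (\<bar>E - l\<bar> + \<eta>) \<le> poisson m lam E \<eta> \<and> poisson m lam E \<eta> \<le> CH * sqrt (\<bar>E - l\<bar> + \<eta>)) \<and>
        (\<forall>E \<eta>. l - cH \<le> E \<and> E \<le> l \<and> \<eta>s \<le> \<eta> \<and> \<eta> \<le> 10 \<longrightarrow>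
           1 / CH * (\<eta> / sqrt (\<bar>E - l\<bar> + \<eta>)) \<le> poisson m lam E \<eta> \<and> poisson m lam E \<eta> \<le> CH * (\<eta> / sqrt (\<bar>E - l\<bar> + \<eta>))) \<and>
        cH / 2 \<le> l \<and> l \<le> 2 * CH)"

lemma Im_sqrt_sq: "(Im w)\<^sup>2 = (cmod (w\<^sup>2) - Re (w\<^sup>2)) / 2"
proof -
  have "cmod (w\<^sup>2) = (Re w)\<^sup>2 + (Im w)\<^sup>2" by (simp add: norm_power cmod_power2)
  moreover have "Re (w\<^sup>2) = (Re w)\<^sup>2 - (Im w)\<^sup>2" by (simp add: power2_eq_square)
  ultimately show ?thesis by simp
qed

text \<open>Here \<open>e\<close> is the signed distance to the left edge and \<open>L\<close> the
  distance between the edges. Close to the left edge the second factor is nearly \<open>- L\<close>,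
  so \<open>w\<close> behaves like \<open>i * sqrt L * sqrt (e + i \<eta>)\<close>; slightly to the
  left, for \<open>e \<ge> - K * \<eta>\<close>, the imaginary part still has the full
  order.\<close>

lemma Im_root_bounds:
  fixes e \<eta> L K :: real and w :: complex
  assumes w: "0 \<le> Im w" "w\<^sup>2 = Complex e \<eta> * Complex (e - L) \<eta>"
    and \<eta>: "0 < \<eta>" and K: "0 \<le> K" and L: "0 < L" "L \<le> 8" and e: "- K * \<eta> \<le> e" "e \<le> L / 2" and small: "\<bar>e\<bar> + \<eta> \<le> 1"
  shows "sqrt (L / (8 * (2 * K + 1) * (K + 1))) * sqrt (\<bar>e\<bar> + \<eta>) \<le> Im w"
    and "cmod w \<le> 3 * sqrt (\<bar>e\<bar> + \<eta>)"
proof -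
  have cm: "cmod (Complex x \<eta>) \<le> \<bar>x\<bar> + \<eta>" for x using cmod_le[of "Complex x \<eta>"] \<eta> by simp
  have "(cmod w)\<^sup>2 = cmod (Complex e \<eta>) * cmod (Complex (e - L) \<eta>)"
    by (simp only: norm_power[symmetric] w(2) norm_mult)
  also have "\<dots> \<le> (\<bar>e\<bar> + \<eta>) * (\<bar>e - L\<bar> + \<eta>)"
    using \<eta> by (intro mult_mono cm) auto
  also have "\<dots> \<le> (\<bar>e\<bar> + \<eta>) * 9"
    using small L \<eta> by (intro mult_left_mono) auto
  finally have "(cmod w)\<^sup>2 \<le> (3 * sqrt (\<bar>e\<bar> + \<eta>))\<^sup>2" using \<eta> by (simp add: power_mult_distrib)
  then show "cmod w \<le> 3 * sqrt (\<bar>e\<bar> + \<eta>)" by (rule power2_le_imp_le) (use \<eta> in simp)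
  define r where "r = sqrt (e\<^sup>2 + \<eta>\<^sup>2)"
  have r: "\<eta> \<le> r" "\<bar>e\<bar> \<le> r" "r\<^sup>2 = e\<^sup>2 + \<eta>\<^sup>2" unfolding r_def using \<eta> by (auto intro: real_le_rsqrt)
  have rle: "r \<le> \<bar>e\<bar> + \<eta>" unfolding r_def using \<eta> by (intro real_le_lsqrt) (auto simp: power2_eq_square algebra_simps)
  have Le: "L / 2 \<le> L - e" using e by simp
  have "cmod (w\<^sup>2) = r * sqrt ((e - L)\<^sup>2 + \<eta>\<^sup>2)"
    unfolding w(2) norm_mult by (simp add: complex_norm r_def)
  moreover have "L - e \<le> sqrt ((e - L)\<^sup>2 + \<eta>\<^sup>2)" using Le L by (intro real_le_rsqrt) (simp add: power2_commute)
  ultimately have 1: "r * (L - e) \<le> cmod (w\<^sup>2)" using r \<eta> by (auto intro: mult_left_mono)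
  have 2: "Re (w\<^sup>2) = - (e * (L - e)) - \<eta>\<^sup>2" unfolding w(2) by (simp add: algebra_simps power2_eq_square)
  have 3: "(L - e) * (r + e) \<le> 2 * (Im w)\<^sup>2"
  proof -
    have "2 * (Im w)\<^sup>2 = cmod (w\<^sup>2) - Re (w\<^sup>2)" by (simp add: Im_sqrt_sq)
    moreover have "(L - e) * (r + e) = r * (L - e) + e * (L - e)" by (simp add: algebra_simps)
    ultimately show ?thesis using 1 2 zero_le_power2[of \<eta>] by linarith
  qed
  \<comment> \<open>Comparability of \<open>r + e\<close> and \<open>\<bar>e\<bar> + \<eta>\<close>.
    For negative \<open>e\<close> there is cancellation in \<open>r + e\<close>, resolved by
    \<open>(r + e) (r - e) = \<eta>^2\<close>.\<close>
  have re: "(\<bar>e\<bar> + \<eta>) \<le> 2 * ((2 * K + 1) * (K + 1)) * (r + e)"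
  proof (cases "0 \<le> e")
    case True
    have "(\<bar>e\<bar> + \<eta>) \<le> 1 * (r + e)" using True r by simp
    also have "\<dots> \<le> 2 * ((2 * K + 1) * (K + 1)) * (r + e)"
    proof (rule mult_right_mono)
      have "0 \<le> K * K" using K by simp
      then show "1 \<le> 2 * ((2 * K + 1) * (K + 1))" using K by (simp add: algebra_simps)
    qed (use True r \<eta> in auto)
    finally show ?thesis .
  next
    case False
    define f where "f = - e"
    have f: "0 < f" "f \<le> K * \<eta>" "\<bar>e\<bar> = f" using False e by (auto simp: f_def)
    have "(r + e) * (r + f) = \<eta>\<^sup>2" using r(3) by (simp add: f_def algebra_simps power2_eq_square)
    moreover have "r + f \<le> (2 * K + 1) * \<eta>" using rle f by (simp add: algebra_simps)
    moreover have "0 \<le> r + e" using r by linarith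
    ultimately have "\<eta>\<^sup>2 \<le> (r + e) * ((2 * K + 1) * \<eta>)"
      using mult_left_mono[of "r + f" "(2 * K + 1) * \<eta>" "r + e"] by simp
    then have "\<eta> * \<eta> \<le> ((r + e) * (2 * K + 1)) * \<eta>" by (simp add: power2_eq_square mult_ac)
    then have "\<eta> \<le> (r + e) * (2 * K + 1)" using \<eta> by simp
    then have "(K + 1) * \<eta> \<le> (K + 1) * ((r + e) * (2 * K + 1))" using K by (intro mult_left_mono) auto
    moreover have "\<bar>e\<bar> + \<eta> \<le> (K + 1) * \<eta>" using f by (simp add: algebra_simps)
    moreover have "0 \<le> (K + 1) * ((r + e) * (2 * K + 1))" using K \<open>0 \<le> r + e\<close> by auto
    ultimately show ?thesis by (simp add: algebra_simps)
  qed
  have rpe: "0 \<le> r + e" using r by linarith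
  define P where "P = (2 * K + 1) * (K + 1)"
  have P: "0 < P" using K by (simp add: P_def)
  have "L * (\<bar>e\<bar> + \<eta>) \<le> L * (2 * P * (r + e))" using re L by (intro mult_left_mono) (auto simp: P_def)
  also have "\<dots> \<le> 4 * P * ((L - e) * (r + e))"
  proof -
    have eq: "L * (2 * P * (r + e)) = 4 * P * (L / 2 * (r + e))" by simp
    show ?thesis unfolding eq using P by (intro mult_left_mono mult_right_mono Le rpe) auto
  qed
  also have "\<dots> \<le> 4 * P * (2 * (Im w)\<^sup>2)" using 3 P by (intro mult_left_mono) auto
  finally have "L / (8 * P) * (\<bar>e\<bar> + \<eta>) \<le> (Im w)\<^sup>2" using P by (simp add: field_simps)
  then have "(sqrt (L / (8 * P)) * sqrt (\<bar>e\<bar> + \<eta>))\<^sup>2 \<le> (Im w)\<^sup>2"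
    using L P \<eta> by (simp add: power_mult_distrib)
  then have "sqrt (L / (8 * P)) * sqrt (\<bar>e\<bar> + \<eta>) \<le> Im w" using w(1) by (rule power2_le_imp_le)
  then show "sqrt (L / (8 * (2 * K + 1) * (K + 1))) * sqrt (\<bar>e\<bar> + \<eta>) \<le> Im w"
    by (simp only: P_def mult.assoc)
qed

text \<open>Solving for \<open>s\<close> divides by \<open>2 z\<close>, which mixes the imaginary
  part of \<open>w\<close> with \<open>\<eta>\<close> times its real part. This and the allowed
  deviation are of order \<open>\<eta>\<close>, which for \<open>\<eta> \<le> t\<close> is small
  against \<open>sqrt (\<bar>e\<bar> + \<eta>) \<ge> sqrt \<eta>\<close>.\<close>

lemma Im_near_edge:
  fixes \<delta> K :: real
  assumes \<delta>: "0 < \<delta>" "\<delta> \<le> 1" and K: "0 \<le> K"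
  obtains t c C where "0 < t" "t \<le> 1 / 2" "0 < c" "0 < C"
    "\<And>a b e \<eta> s w0. \<delta> \<le> a \<Longrightarrow> \<delta> \<le> sqrt b - sqrt a \<Longrightarrow> b \<le> 2 \<Longrightarrow> 0 < \<eta> \<Longrightarrow> \<eta> \<le> t \<Longrightarrow> - K * \<eta> \<le> e \<Longrightarrow> e \<le> t \<Longrightarrow>
       mp_root a b (Complex ((sqrt b - sqrt a)\<^sup>2 + e) \<eta>) w0 \<Longrightarrow>
       cmod (2 * Complex ((sqrt b - sqrt a)\<^sup>2 + e) \<eta> * s + Complex ((sqrt b - sqrt a)\<^sup>2 + e) \<eta> + of_real a - of_real b - w0) \<le> \<eta> \<Longrightarrow>
       c * sqrt (\<bar>e\<bar> + \<eta>) \<le> Im s \<and> Im s \<le> C * sqrt (\<bar>e\<bar> + \<eta>)"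
proof -
  define c1 where "c1 = 4 * \<delta> / (8 * (2 * K + 1) * (K + 1))"
  have c1: "0 < c1" using \<delta> K by (simp add: c1_def)
  \<comment> \<open>The first bound keeps \<open>\<bar>e\<bar>\<close> below
    \<open>\<delta>^2 / 4\<close> and thus \<open>E\<close> away from 0; the second makes the error
    \<open>9 * \<eta>\<close> at most half of the main term in \<open>lo\<close>.\<close>
  define t where "t = min (\<delta>\<^sup>2 / (4 * (K + 1))) ((\<delta>\<^sup>2 * sqrt c1 / 36)\<^sup>2)"
  have d2: "0 < \<delta>\<^sup>2" "\<delta>\<^sup>2 \<le> \<delta>" using \<delta> by (auto simp: power2_eq_square mult_left_le)
  have t0: "0 < t" using \<delta> K c1 by (simp add: t_def)
  have "t \<le> \<delta>\<^sup>2 / (4 * (K + 1))" by (simp add: t_def)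
  then have tK: "t * (4 * (K + 1)) \<le> \<delta>\<^sup>2" using K by (simp add: pos_le_divide_eq)
  have "t * 4 \<le> t * (4 * (K + 1))" using t0 K by (intro mult_left_mono) auto
  then have t4: "t \<le> \<delta>\<^sup>2 / 4" using tK by simp
  have tq: "9 * sqrt t \<le> \<delta>\<^sup>2 * sqrt c1 / 4"
  proof -
    have "sqrt t \<le> sqrt ((\<delta>\<^sup>2 * sqrt c1 / 36)\<^sup>2)" unfolding t_def by (intro real_sqrt_le_mono) simp
    also have "\<dots> = \<delta>\<^sup>2 * sqrt c1 / 36" using c1 by simp
    finally show ?thesis by simp
  qed
  define c C where "c = \<delta>\<^sup>2 * sqrt c1 / 80" and "C = 36 / \<delta> ^ 4"
  have main: "c * sqrt (\<bar>e\<bar> + \<eta>) \<le> Im s \<and> Im s \<le> C * sqrt (\<bar>e\<bar> + \<eta>)"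
    if ab: "\<delta> \<le> a" "\<delta> \<le> sqrt b - sqrt a" "b \<le> 2" and \<eta>: "0 < \<eta>" "\<eta> \<le> t" and e: "- K * \<eta> \<le> e" "e \<le> t"
      and root: "mp_root a b (Complex ((sqrt b - sqrt a)\<^sup>2 + e) \<eta>) w0"
      and s: "cmod (2 * Complex ((sqrt b - sqrt a)\<^sup>2 + e) \<eta> * s + Complex ((sqrt b - sqrt a)\<^sup>2 + e) \<eta> + of_real a - of_real b - w0) \<le> \<eta>"
    for a b e \<eta> s w0
  proof -
    define lm where "lm = (sqrt b - sqrt a)\<^sup>2"
    define L where "L = 4 * (sqrt a * sqrt b)"
    have a0: "0 < a" using ab \<delta> by simp
    have sab: "sqrt a < sqrt b" using ab \<delta> by linarith
    then have b0: "a < b" by simp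
    have lp: "(sqrt b + sqrt a)\<^sup>2 = lm + L" by (simp add: lm_def L_def power2_eq_square algebra_simps)
    have lm1: "\<delta>\<^sup>2 \<le> lm" unfolding lm_def using ab \<delta> by (intro power_mono) auto
    have lm2: "lm \<le> 2"
    proof -
      have "sqrt b - sqrt a \<le> sqrt 2" using ab a0 real_sqrt_le_mono[OF ab(3)] real_sqrt_ge_zero[of a] by linarith
      then have "lm \<le> (sqrt 2)\<^sup>2" unfolding lm_def using sab by (intro power_mono) linarith+
      then show ?thesis by simp
    qed
    have L1: "4 * \<delta> \<le> L"
    proof -
      have "sqrt a * sqrt a \<le> sqrt a * sqrt b" using sab a0 by (intro mult_left_mono) auto
      then show ?thesis using ab a0 by (simp add: L_def)
    qed
    have L2: "L \<le> 8"
    proof -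
      have "sqrt a * sqrt b \<le> sqrt b * sqrt b" using sab a0 b0 by (intro mult_right_mono) auto
      then show ?thesis using ab a0 b0 by (simp add: L_def)
    qed
    have \<eta>K: "K * \<eta> \<le> K * t" using \<eta> K by (intro mult_left_mono) auto
    have "0 \<le> K * t" using K t0 by simp
    moreover have "- (K * \<eta>) \<le> e" using e by simp
    ultimately have abs_e: "\<bar>e\<bar> \<le> (K + 1) * t"
      unfolding abs_le_iff distrib_right mult_1 using e(2) \<eta>K t0 by linarith
    have sm: "\<bar>e\<bar> + \<eta> \<le> 1"
    proof -
      have "(K + 1) * t \<le> \<delta>\<^sup>2 / 4" using tK by (simp add: algebra_simps)
      then show ?thesis using abs_e \<eta> t4 d2 \<delta> by linarith
    qed
    define E where "E = lm + e"
    define z where "z = Complex E \<eta>"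
    have E1: "\<delta>\<^sup>2 / 2 \<le> E"
    proof -
      have "(K + 1) * t \<le> \<delta>\<^sup>2 / 4" using tK by (simp add: algebra_simps)
      then show ?thesis unfolding E_def using lm1 abs_e d2 by linarith
    qed
    have E0: "0 < E" using E1 d2 by linarith
    have E2: "E \<le> 3" using lm2 sm \<eta> by (auto simp: E_def)
    have w2: "w0\<^sup>2 = Complex e \<eta> * Complex (e - L) \<eta>" and w0: "0 \<le> Im w0"
    proof -
      have "z - of_real ((sqrt b - sqrt a)\<^sup>2) = Complex e \<eta>" "z - of_real ((sqrt b + sqrt a)\<^sup>2) = Complex (e - L) \<eta>"
        unfolding lp unfolding lm_def[symmetric] by (simp_all add: z_def E_def complex_eq_iff)
      then show "w0\<^sup>2 = Complex e \<eta> * Complex (e - L) \<eta>" "0 \<le> Im w0"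
        using root by (simp_all add: mp_root_def z_def E_def lm_def)
    qed
    have eL: "e \<le> L / 2" using e t4 d2 L1 \<delta> by linarith
    have L0: "0 < L" using L1 \<delta> by linarith
    note rb = Im_root_bounds[OF w0 w2 \<eta>(1) K L0 L2 e(1) eL sm]
    define q where "q = sqrt (\<bar>e\<bar> + \<eta>)"
    have q0: "0 < q" "q \<le> 1" using \<eta> sm by (auto simp: q_def)
    have \<eta>q: "\<eta> \<le> sqrt t * q"
    proof -
      have "\<eta> = sqrt \<eta> * sqrt \<eta>" using \<eta> by simp
      also have "\<dots> \<le> sqrt t * q" unfolding q_def using \<eta> by (intro mult_mono) auto
      finally show ?thesis .
    qed
    have \<eta>q1: "\<eta> \<le> q"
    proof -
      have "sqrt t \<le> 1" using t4 d2 \<delta> by (simp add: real_sqrt_le_1_iff)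
      then have "sqrt t * q \<le> 1 * q" using q0 by (intro mult_right_mono) auto
      then show ?thesis using \<eta>q by simp
    qed
    have lowI: "sqrt c1 * q \<le> Im w0"
    proof -
      have "sqrt c1 \<le> sqrt (L / (8 * (2 * K + 1) * (K + 1)))"
        unfolding c1_def using L1 K by (intro real_sqrt_le_mono divide_right_mono) auto
      then have "sqrt c1 * q \<le> sqrt (L / (8 * (2 * K + 1) * (K + 1))) * q" using q0 by (intro mult_right_mono) auto
      then show ?thesis using rb(1) by (simp add: q_def)
    qed
    define w where "w = 2 * z * s + z + of_real a - of_real b"
    have dw: "cmod (w - w0) \<le> \<eta>" using s by (simp add: w_def z_def E_def lm_def)
    have Imw: "\<bar>Im w - Im w0\<bar> \<le> \<eta>" and Rew: "\<bar>Re w - Re w0\<bar> \<le> \<eta>"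
      using dw abs_Im_le_cmod[of "w - w0"] abs_Re_le_cmod[of "w - w0"] by auto
    have Rew0: "\<bar>Re w0\<bar> \<le> 3 * q" and Imw0: "Im w0 \<le> 3 * q"
      using rb(2) abs_Re_le_cmod[of w0] abs_Im_le_cmod[of w0] by (auto simp: q_def)
    have ba: "\<bar>b - a\<bar> \<le> 2" using ab a0 b0 by auto
    have R: "\<bar>Re w + b - a\<bar> \<le> 6" using Rew Rew0 ba q0 \<eta> t4 d2 \<delta> by linarith
    have z2: "(cmod z)\<^sup>2 = E\<^sup>2 + \<eta>\<^sup>2" by (simp add: z_def cmod_power2)
    \<comment> \<open>The imaginary part of \<open>cnj z * (w - z - a + b)\<close>, as
      \<open>2 z s = w - z - a + b\<close>.\<close>
    have key: "2 * (cmod z)\<^sup>2 * Im s = E * Im w - \<eta> * (Re w + b - a)"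
      unfolding z2 by (simp add: w_def z_def algebra_simps power2_eq_square)
    have err: "\<bar>2 * (cmod z)\<^sup>2 * Im s - E * Im w0\<bar> \<le> 9 * \<eta>"
    proof -
      have "\<bar>E * (Im w - Im w0)\<bar> \<le> 3 * \<eta>"
        unfolding abs_mult using Imw E0 E2 by (intro mult_mono) auto
      moreover have "\<bar>\<eta> * (Re w + b - a)\<bar> \<le> \<eta> * 6"
        unfolding abs_mult using R \<eta> by (intro mult_mono) auto
      ultimately show ?thesis unfolding key by (simp add: algebra_simps abs_le_iff)
    qed
    have z3: "\<delta> ^ 4 / 4 \<le> (cmod z)\<^sup>2" "(cmod z)\<^sup>2 \<le> 10"
    proof -
      have "(\<delta>\<^sup>2 / 2)\<^sup>2 \<le> E\<^sup>2" using E1 d2 by (intro power_mono) auto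
      moreover have "(\<delta>\<^sup>2 / 2)\<^sup>2 = \<delta> ^ 4 / 4" by (simp add: power2_eq_square power4_eq_xxxx)
      ultimately show "\<delta> ^ 4 / 4 \<le> (cmod z)\<^sup>2" unfolding z2 using zero_le_power2[of \<eta>] by linarith
      have "E\<^sup>2 \<le> 3\<^sup>2" using E0 E2 by (intro power_mono) auto
      moreover have "\<eta>\<^sup>2 \<le> 1\<^sup>2" using \<eta> t4 d2 \<delta> by (intro power_mono) linarith+
      ultimately show "(cmod z)\<^sup>2 \<le> 10" unfolding z2 by simp
    qed
    have up: "2 * (cmod z)\<^sup>2 * Im s \<le> 18 * q"
    proof -
      have "E * Im w0 \<le> 3 * (3 * q)" using E1 E2 d2 Imw0 w0 by (intro mult_mono) auto
      then show ?thesis using err \<eta>q1 by linarith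
    qed
    have lo: "\<delta>\<^sup>2 * sqrt c1 / 4 * q \<le> 2 * (cmod z)\<^sup>2 * Im s"
    proof -
      have "\<delta>\<^sup>2 / 2 * (sqrt c1 * q) \<le> E * Im w0" using q0 c1 by (intro mult_mono E1 lowI less_imp_le[OF E0]) auto
      moreover have "9 * \<eta> \<le> \<delta>\<^sup>2 * sqrt c1 / 4 * q"
      proof -
        have "9 * \<eta> \<le> 9 * (sqrt t * q)" using \<eta>q by simp
        also have "\<dots> = 9 * sqrt t * q" by simp
        also have "\<dots> \<le> \<delta>\<^sup>2 * sqrt c1 / 4 * q" using tq q0 by (intro mult_right_mono) auto
        finally show ?thesis .
      qed
      ultimately show ?thesis using err by (simp add: algebra_simps abs_le_iff)
    qed
    have "0 < \<delta>\<^sup>2 * sqrt c1 / 4 * q" using q0 c1 d2 by simp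
    then have "0 < 2 * (cmod z)\<^sup>2 * Im s" using lo by linarith
    then have Ims: "0 < Im s" by (simp add: zero_less_mult_iff)
    have "2 * (cmod z)\<^sup>2 * Im s \<le> 20 * Im s" using z3 Ims by (intro mult_right_mono) auto
    moreover have "c * q = (\<delta>\<^sup>2 * sqrt c1 / 4 * q) / 20" by (simp add: c_def)
    ultimately have "c * q \<le> Im s" using lo by linarith
    have "\<delta> ^ 4 / 2 * Im s \<le> 2 * (cmod z)\<^sup>2 * Im s" using z3 Ims by (intro mult_right_mono) auto
    then have "\<delta> ^ 4 / 2 * Im s \<le> 18 * q" using up by linarith
    then have "Im s \<le> C * q" using \<delta> by (simp add: C_def field_simps)
    with \<open>c * q \<le> Im s\<close> show ?thesis by (simp add: q_def)
  qed
  have th: "t \<le> 1 / 2" using t4 d2 \<delta> by linarith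
  have cC: "0 < c" "0 < C" using \<delta> c1 by (auto simp: c_def C_def)
  show ?thesis by (rule that[OF t0 th cC main])
qed

section \<open>Poisson integrals and regularity around the smallest eigenvalue\<close>

lemma Im_stieltjes_sum:
  "Im (\<Sum>i<m. 1 / (complex_of_real (lam i) - Complex E \<eta>)) = (\<Sum>i<m. \<eta> / ((lam i - E)\<^sup>2 + \<eta>\<^sup>2))"
  by (simp add: Im_divide)

lemma poisson_mono:
  assumes "\<And>i. i < m \<Longrightarrow> \<eta> / ((lam i - E)\<^sup>2 + \<eta>\<^sup>2) \<le> c * (\<eta>' / ((lam i - E')\<^sup>2 + \<eta>'\<^sup>2))"
  shows "poisson m lam E \<eta> \<le> c * poisson m lam E' \<eta>'"
proof -
  have "(\<Sum>i<m. \<eta> / ((lam i - E)\<^sup>2 + \<eta>\<^sup>2)) \<le> (\<Sum>i<m. c * (\<eta>' / ((lam i - E')\<^sup>2 + \<eta>'\<^sup>2)))"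
    using assms by (intro sum_mono) auto
  then show ?thesis unfolding poisson_def sum_distrib_left[symmetric] by (simp add: divide_right_mono)
qed

lemma poisson_le_inverse: "0 < \<eta> \<Longrightarrow> poisson m lam E \<eta> \<le> 1 / \<eta>"
proof -
  assume \<eta>: "0 < \<eta>"
  have "(\<Sum>i<m. \<eta> / ((lam i - E)\<^sup>2 + \<eta>\<^sup>2)) \<le> (\<Sum>i<m. 1 / \<eta>)"
  proof (rule sum_mono)
    fix i
    have "\<eta> / ((lam i - E)\<^sup>2 + \<eta>\<^sup>2) \<le> \<eta> / \<eta>\<^sup>2" using \<eta> by (intro divide_left_mono) (auto intro!: mult_pos_pos add_nonneg_pos)
    then show "\<eta> / ((lam i - E)\<^sup>2 + \<eta>\<^sup>2) \<le> 1 / \<eta>" using \<eta> by (simp add: power2_eq_square)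
  qed
  then show ?thesis using \<eta> by (cases "m = 0") (auto simp: poisson_def divide_le_eq)
qed

lemma half_frac_le:
  fixes n D D' :: real
  assumes "0 \<le> n" "0 < D" "0 < D'" "D' \<le> 2 * D"
  shows "n / D \<le> 2 * (n / D')"
proof -
  have "n * D' \<le> n * (2 * D)" using assms by (intro mult_left_mono)
  then show ?thesis using assms by (simp add: field_simps)
qed

text \<open>Away from the edge only the order of magnitude of the Poisson integral matters, and that is
  inherited, term by term, from points \<open>l + i\<tau>\<close> above the smallest eigenvalue \<open>l\<close>.\<close>

theorem edge_regularity_deterministic:
  fixes \<delta> K :: real
  assumes \<delta>: "0 < \<delta>" "\<delta> \<le> 1" and K: "0 \<le> K"
  obtains cH CH h0 where "0 < cH" "300 \<le> CH" "0 < h0"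
    "\<And>m v a b lam \<eta>s. 1 \<le> m \<Longrightarrow> a = v * real m \<Longrightarrow> \<delta> \<le> a \<Longrightarrow> \<delta> \<le> sqrt b - sqrt a \<Longrightarrow> b \<le> 2 \<Longrightarrow> 0 < \<eta>s \<Longrightarrow> \<eta>s \<le> h0 \<Longrightarrow>
      edge_law a b v m lam K \<eta>s \<Longrightarrow> edge_bounds cH CH \<eta>s m lam"
proof -
  obtain t1 c C where t1: "0 < t1" "t1 \<le> 1 / 2" and cC: "0 < c" "0 < C" and near:
    "\<And>a b e \<eta> s w0. \<delta> \<le> a \<Longrightarrow> \<delta> \<le> sqrt b - sqrt a \<Longrightarrow> b \<le> 2 \<Longrightarrow> 0 < \<eta> \<Longrightarrow> \<eta> \<le> t1 \<Longrightarrow> - K * \<eta> \<le> e \<Longrightarrow> e \<le> t1 \<Longrightarrow>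
       mp_root a b (Complex ((sqrt b - sqrt a)\<^sup>2 + e) \<eta>) w0 \<Longrightarrow>
       cmod (2 * Complex ((sqrt b - sqrt a)\<^sup>2 + e) \<eta> * s + Complex ((sqrt b - sqrt a)\<^sup>2 + e) \<eta> + of_real a - of_real b - w0) \<le> \<eta> \<Longrightarrow>
       c * sqrt (\<bar>e\<bar> + \<eta>) \<le> Im s \<and> Im s \<le> C * sqrt (\<bar>e\<bar> + \<eta>)"
    using Im_near_edge[OF assms] by blast
  \<comment> \<open>The second bound gives \<open>K * t \<le> 1\<close>, so that points with
    \<open>e \<ge> - K * \<eta>\<close> lie in the window \<open>\<bar>e\<bar> \<le> 1\<close> of
    \<open>edge_law\<close>.\<close>
  define t where "t = min t1 (1 / (K + 1))"
  have t: "0 < t" "t \<le> t1" "t \<le> 1 / 2" "K * t \<le> 1"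
  proof -
    show "0 < t" "t \<le> t1" "t \<le> 1 / 2" using t1 K by (auto simp: t_def)
    have "K * t \<le> K * (1 / (K + 1))" using K by (intro mult_left_mono) (auto simp: t_def)
    also have "\<dots> \<le> 1" using K by simp
    finally show "K * t \<le> 1" .
  qed
  define c2 C2 where "c2 = c / 2" and "C2 = C / \<delta>"
  have c2: "0 < c2" "0 < C2" using cC \<delta> by (auto simp: c2_def C2_def)
  \<comment> \<open>Will bound the distance of \<open>l\<close> above the edge in units of
    \<open>\<eta>s\<close>. The square comes from comparing \<open>c2 * sqrt \<eta>s\<close> with
    \<open>2 * C2 * \<eta>s / sqrt k\<close> in the proof of \<open>l2\<close>.\<close>
  define K2 where "K2 = max 1 ((2 * C2 / c2)\<^sup>2)"
  have K2: "1 \<le> K2" "(2 * C2 / c2)\<^sup>2 \<le> K2" by (auto simp: K2_def)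
  define h0 where "h0 = min (t / (2 * K2)) (\<delta>\<^sup>2 / (2 * (K + 1)))"
  have h0: "0 < h0" "K2 * h0 \<le> t / 2" "K * h0 \<le> \<delta>\<^sup>2 / 2"
  proof -
    show "0 < h0" using t K2 \<delta> K by (auto simp: h0_def)
    have "K2 * h0 \<le> K2 * (t / (2 * K2))" using K2 by (intro mult_left_mono) (auto simp: h0_def)
    also have "\<dots> = t / 2" using K2 by simp
    finally show "K2 * h0 \<le> t / 2" .
    have "(K + 1) * h0 \<le> (K + 1) * (\<delta>\<^sup>2 / (2 * (K + 1)))" using K by (intro mult_left_mono) (auto simp: h0_def)
    also have "\<dots> = \<delta>\<^sup>2 / 2" using K by (simp add: field_simps)
    finally show "K * h0 \<le> \<delta>\<^sup>2 / 2" using \<open>0 < h0\<close> by (simp add: distrib_right)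
  qed
  define Km where "Km = max K K2"
  have Km: "K \<le> Km" "K2 \<le> Km" "1 \<le> Km" using K2 by (auto simp: Km_def)
  define cH where "cH = min (t / 2) (\<delta>\<^sup>2)"
  have cH: "0 < cH" "cH \<le> t / 2" "cH \<le> \<delta>\<^sup>2" using t \<delta> by (auto simp: cH_def)
  define R where "R = sqrt (1 + Km)"
  have R: "0 < R" using Km by (simp add: R_def)
  define c3 C3 where "c3 = c2 / R" and "C3 = C2 * R"
  \<comment> \<open>\<open>402 = 2 + 20^2\<close>: denominators are compared for shifts up to 1 and
    heights up to 20. Heights beyond 10 occur because points \<open>E + i \<eta>\<close> left of
    \<open>l\<close> are compared with \<open>l + i \<tau>\<close>, where
    \<open>\<tau> = \<bar>E - l\<bar> + \<eta>\<close>.\<close>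
  define Q where "Q = 402 / t\<^sup>2"
  have t2: "0 < t\<^sup>2" "t\<^sup>2 \<le> 1" using t by (auto intro: power_le_one)
  have Q: "402 \<le> Q" using t2 by (simp add: Q_def field_simps)
  have Qt: "Q * t\<^sup>2 = 402" using t by (simp add: Q_def)
  define c4 C4 where "c4 = min c3 (c3 * sqrt t / (5 * Q))" and "C4 = max C3 (1 / (t * sqrt t))"
  have c4: "0 < c4" "0 < C4" using c2 R t Q by (auto simp: c4_def C4_def c3_def C3_def less_max_iff_disj)
  \<comment> \<open>The value 300 leaves room for the norm bound \<open>N ^ 203\<close> obtained in
    \<open>op_norm_cov_le\<close>.\<close>
  define CH where "CH = max 300 (max (2 * C4) (2 / c4))"
  have CH: "300 \<le> CH" "2 * C4 \<le> CH" "2 / c4 \<le> CH" by (auto simp: CH_def)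
  have CHinv: "1 / CH \<le> c4 / 2"
    using CH c4 by (simp add: field_simps)
  have main: "edge_bounds cH CH \<eta>s m lam"
    if m: "1 \<le> m" and a: "a = v * real m" and ab: "\<delta> \<le> a" "\<delta> \<le> sqrt b - sqrt a" "b \<le> 2"
      and \<eta>s: "0 < \<eta>s" "\<eta>s \<le> h0" and el: "edge_law a b v m lam K \<eta>s"
    for m v a b lam \<eta>s
  proof -
    note low = conjunct1[OF el[unfolded edge_law_def], rule_format]
    note law = conjunct2[OF el[unfolded edge_law_def], rule_format]
    define lm where "lm = (sqrt b - sqrt a)\<^sup>2"
    have a0: "0 < a" "a \<le> 2"
    proof -
      show "0 < a" using ab \<delta> by simp
      have "sqrt a < sqrt b" using ab \<delta> by linarith
      then show "a \<le> 2" using ab by simp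
    qed
    have lm1: "\<delta>\<^sup>2 \<le> lm" unfolding lm_def using ab \<delta> by (intro power_mono) auto
    have lm2: "lm \<le> 2"
    proof -
      have "sqrt b - sqrt a \<le> sqrt 2" using a0 real_sqrt_le_mono[OF ab(3)] real_sqrt_ge_zero[of a] by linarith
      moreover have "0 \<le> sqrt b - sqrt a" using ab \<delta> by linarith
      ultimately have "lm \<le> (sqrt 2)\<^sup>2" unfolding lm_def by (rule power_mono)
      then show ?thesis by simp
    qed
    have nearp: "c2 * sqrt (\<bar>e\<bar> + \<eta>) \<le> poisson m lam (lm + e) \<eta> \<and> poisson m lam (lm + e) \<eta> \<le> C2 * sqrt (\<bar>e\<bar> + \<eta>)"
      if e: "- K * \<eta> \<le> e" "e \<le> t" and \<eta>: "\<eta>s \<le> \<eta>" "\<eta> \<le> t" for e \<eta>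
    proof -
      have "K * \<eta> \<le> K * t" using \<eta> K by (intro mult_left_mono) auto
      then have e1: "\<bar>e\<bar> \<le> 1" using e t by (auto simp: abs_le_iff)
      have \<eta>1: "0 < \<eta>" "\<eta> \<le> 1" "\<eta> \<le> t1" using \<eta> \<eta>s t by auto
      define s where "s = complex_of_real v * (\<Sum>i<m. 1 / (complex_of_real (lam i) - Complex (lm + e) \<eta>))"
      obtain w0 where w0: "mp_root a b (Complex (lm + e) \<eta>) w0"
        "cmod (2 * Complex (lm + e) \<eta> * s + Complex (lm + e) \<eta> + of_real a - of_real b - w0) \<le> \<eta>"
        using law[of e \<eta>] e1 \<eta>(1) \<eta>1(2) unfolding s_def lm_def by blast
      have e2: "e \<le> t1" using e t by simp
      have bd: "c * sqrt (\<bar>e\<bar> + \<eta>) \<le> Im s \<and> Im s \<le> C * sqrt (\<bar>e\<bar> + \<eta>)"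
        by (rule near[OF ab \<eta>1(1) \<eta>1(3) e(1) e2 w0[unfolded lm_def]])
      have "Im s = v * (\<Sum>i<m. \<eta> / ((lam i - (lm + e))\<^sup>2 + \<eta>\<^sup>2))"
        unfolding s_def Im_of_real_mult Im_stieltjes_sum ..
      also have "\<dots> = a * poisson m lam (lm + e) \<eta>" using m by (simp add: a poisson_def)
      finally have Ims: "Im s = a * poisson m lam (lm + e) \<eta>" .
      have p0: "0 \<le> poisson m lam (lm + e) \<eta>" unfolding poisson_def using \<eta>1 by (intro divide_nonneg_nonneg sum_nonneg) auto
      have "a * poisson m lam (lm + e) \<eta> \<le> 2 * poisson m lam (lm + e) \<eta>" using a0 p0 by (intro mult_right_mono) auto
      moreover have "\<delta> * poisson m lam (lm + e) \<eta> \<le> a * poisson m lam (lm + e) \<eta>" using ab p0 by (intro mult_right_mono) auto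
      ultimately have "c * sqrt (\<bar>e\<bar> + \<eta>) \<le> 2 * poisson m lam (lm + e) \<eta>" "\<delta> * poisson m lam (lm + e) \<eta> \<le> C * sqrt (\<bar>e\<bar> + \<eta>)"
        using bd Ims by auto
      then show ?thesis using \<delta> by (auto simp: c2_def C2_def field_simps)
    qed
    define l where "l = Min (lam ` {..<m})"
    have ne: "lam ` {..<m} \<noteq> {}" using m by (auto simp: lessThan_empty_iff)
    have lmin: "l \<le> lam i" if "i < m" for i unfolding l_def using that by (intro Min_le) auto
    obtain i0 where i0: "i0 < m" "l = lam i0" using Min_in[OF _ ne] unfolding l_def by auto
    have l1: "lm - K * \<eta>s \<le> l" using low[OF i0(1)] i0(2) by (simp add: lm_def)
    have K\<eta>s: "K2 * \<eta>s \<le> t / 2" "K * \<eta>s \<le> \<delta>\<^sup>2 / 2"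
      using mult_left_mono[OF \<eta>s(2), of K2] mult_left_mono[OF \<eta>s(2), of K] K2 K h0 by linarith+
    have \<eta>st: "\<eta>s \<le> t / 2" using K\<eta>s(1) mult_right_mono[OF K2(1), of \<eta>s] \<eta>s by linarith
    \<comment> \<open>With a gap of length \<open>k\<close> above the edge, the Poisson integral at
      the edge would be at most \<open>2 * \<eta>s / k\<close> times its value at height
      \<open>k\<close>. Such a linear decay contradicts the square root behaviour unless
      \<open>k\<close> is of order \<open>\<eta>s\<close>.\<close>
    have l2: "l \<le> lm + K2 * \<eta>s"
    proof (rule ccontr)
      assume nl: "\<not> l \<le> lm + K2 * \<eta>s"
      define k where "k = min t (l - lm)"
      have k: "K2 * \<eta>s < k" "k \<le> t" "k \<le> l - lm" using nl K\<eta>s t by (auto simp: k_def)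
      have k\<eta>: "\<eta>s \<le> k" using k(1) mult_right_mono[OF K2(1), of \<eta>s] \<eta>s by linarith
      have k0: "0 < k" using k\<eta> \<eta>s by linarith
      have "poisson m lam (lm + 0) \<eta>s \<le> (2 * \<eta>s / k) * poisson m lam (lm + 0) k"
      proof (rule poisson_mono)
        fix i assume "i < m"
        then have d: "k \<le> lam i - lm" using lmin k by force
        then have d2: "k\<^sup>2 \<le> (lam i - lm)\<^sup>2" using k0 by (intro power_mono) auto
        have gen: "p + r \<le> 2 * (p + q)" if "r \<le> p" "0 \<le> q" for p q r :: real
          using add_mono[OF that(1) order.refl[of p]] that(2) by (simp add: add.commute)
        have pos: "0 < (lam i - lm)\<^sup>2 + k\<^sup>2" "0 < (lam i - lm)\<^sup>2 + \<eta>s\<^sup>2"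
          using k0 \<eta>s by (auto intro: add_nonneg_pos)
        have "\<eta>s / ((lam i - lm)\<^sup>2 + \<eta>s\<^sup>2) \<le> 2 * (\<eta>s / ((lam i - lm)\<^sup>2 + k\<^sup>2))"
          using \<eta>s pos by (intro half_frac_le gen d2) auto
        then show "\<eta>s / ((lam i - (lm + 0))\<^sup>2 + \<eta>s\<^sup>2) \<le> 2 * \<eta>s / k * (k / ((lam i - (lm + 0))\<^sup>2 + k\<^sup>2))"
          using k0 by (simp add: mult.commute)
      qed
      moreover have "c2 * sqrt \<eta>s \<le> poisson m lam (lm + 0) \<eta>s"
        using nearp[of \<eta>s 0] \<eta>s K \<eta>st t by simp
      moreover have "poisson m lam (lm + 0) k \<le> C2 * sqrt k"
        using nearp[of k 0] k k\<eta> K k0 t by simp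
      then have "(2 * \<eta>s / k) * poisson m lam (lm + 0) k \<le> (2 * \<eta>s / k) * (C2 * sqrt k)"
        using \<eta>s k0 by (intro mult_left_mono) auto
      ultimately have "c2 * sqrt \<eta>s \<le> (2 * \<eta>s / k) * (C2 * sqrt k)" by linarith
      also have "\<dots> = 2 * C2 * sqrt \<eta>s * sqrt \<eta>s / sqrt k"
      proof -
        have "2 * (x * x) / (g * g) * (C2 * g) = 2 * C2 * x * x / g" if "0 < g" for x g :: real
          using that by (simp add: field_simps)
        from this[of "sqrt k" "sqrt \<eta>s"] show ?thesis using k0 \<eta>s by simp
      qed
      finally have "c2 * sqrt \<eta>s \<le> 2 * C2 * sqrt \<eta>s * sqrt \<eta>s / sqrt k" .
      then have "c2 * sqrt k * sqrt \<eta>s \<le> 2 * C2 * sqrt \<eta>s * sqrt \<eta>s" using k0 by (simp add: field_simps)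
      then have "c2 * sqrt k \<le> 2 * C2 * sqrt \<eta>s" using \<eta>s by simp
      then have "sqrt k \<le> 2 * C2 / c2 * sqrt \<eta>s" using c2 by (simp add: field_simps)
      then have "(sqrt k)\<^sup>2 \<le> (2 * C2 / c2 * sqrt \<eta>s)\<^sup>2" using k0 by (intro power_mono) auto
      moreover have "(2 * C2 / c2 * sqrt \<eta>s)\<^sup>2 = (2 * C2 / c2)\<^sup>2 * \<eta>s"
        using \<eta>s by (subst power_mult_distrib) simp
      ultimately have "k \<le> (2 * C2 / c2)\<^sup>2 * \<eta>s" using k0 by simp
      also have "\<dots> \<le> K2 * \<eta>s" using K2 \<eta>s by (intro mult_right_mono) auto
      finally show False using k by simp
    qed
    have ldist: "\<bar>l - lm\<bar> \<le> Km * \<eta>s"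
    proof -
      have "K * \<eta>s \<le> Km * \<eta>s" "K2 * \<eta>s \<le> Km * \<eta>s" using Km \<eta>s by (auto intro!: mult_right_mono)
      then show ?thesis using l1 l2 unfolding abs_le_iff by linarith
    qed
    \<comment> \<open>Distances are now measured from \<open>l\<close>. The shift is at most
      \<open>Km * \<eta>s \<le> Km * \<eta>\<close>, so it only costs the factor
      \<open>R\<close>.\<close>
    have step3: "c3 * sqrt (e' + \<eta>) \<le> poisson m lam (l + e') \<eta> \<and> poisson m lam (l + e') \<eta> \<le> C3 * sqrt (e' + \<eta>)"
      if e': "0 \<le> e'" "e' \<le> cH" and \<eta>: "\<eta>s \<le> \<eta>" "\<eta> \<le> t" for e' \<eta>
    proof -
      define e where "e = l - lm + e'"
      have \<eta>0: "0 < \<eta>" using \<eta> \<eta>s by linarith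
      have KK: "K * \<eta>s \<le> K * \<eta>" "Km * \<eta>s \<le> Km * \<eta>" using \<eta> K Km by (auto intro!: mult_left_mono)
      have 1: "- K * \<eta> \<le> e" "e \<le> t" using l1 l2 K\<eta>s KK e' cH by (auto simp: e_def)
      have n: "c2 * sqrt (\<bar>e\<bar> + \<eta>) \<le> poisson m lam (l + e') \<eta> \<and> poisson m lam (l + e') \<eta> \<le> C2 * sqrt (\<bar>e\<bar> + \<eta>)"
        using nearp[OF 1 \<eta>] by (simp add: e_def)
      have "\<bar>e\<bar> \<le> e' + Km * \<eta>" "e' \<le> \<bar>e\<bar> + Km * \<eta>" using ldist KK e' by (auto simp: e_def abs_le_iff)
      then have "\<bar>e\<bar> + \<eta> \<le> (1 + Km) * (e' + \<eta>)" "e' + \<eta> \<le> (1 + Km) * (\<bar>e\<bar> + \<eta>)"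
      proof -
        assume h: "\<bar>e\<bar> \<le> e' + Km * \<eta>" "e' \<le> \<bar>e\<bar> + Km * \<eta>"
        have "0 \<le> Km * e'" "0 \<le> Km * \<bar>e\<bar>" using e' Km by auto
        then show "\<bar>e\<bar> + \<eta> \<le> (1 + Km) * (e' + \<eta>)" "e' + \<eta> \<le> (1 + Km) * (\<bar>e\<bar> + \<eta>)"
          using h unfolding distrib_left distrib_right mult_1 by linarith+
      qed
      then have "sqrt (\<bar>e\<bar> + \<eta>) \<le> R * sqrt (e' + \<eta>)" "sqrt (e' + \<eta>) \<le> R * sqrt (\<bar>e\<bar> + \<eta>)"
        unfolding R_def real_sqrt_mult[symmetric] by auto
      then have "C2 * sqrt (\<bar>e\<bar> + \<eta>) \<le> C2 * (R * sqrt (e' + \<eta>))" "c2 * sqrt (e' + \<eta>) \<le> c2 * (R * sqrt (\<bar>e\<bar> + \<eta>))"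
        using c2 by (auto intro: mult_left_mono)
      moreover have "R * (c2 * sqrt (\<bar>e\<bar> + \<eta>)) \<le> R * poisson m lam (l + e') \<eta>"
        using n R by (intro mult_left_mono) auto
      moreover have "c2 * (R * sqrt (\<bar>e\<bar> + \<eta>)) = R * (c2 * sqrt (\<bar>e\<bar> + \<eta>))" by simp
      ultimately have "c2 * sqrt (e' + \<eta>) \<le> R * poisson m lam (l + e') \<eta>" "poisson m lam (l + e') \<eta> \<le> C2 * (R * sqrt (e' + \<eta>))"
        using n by linarith+
      then show ?thesis using R by (simp add: c3_def C3_def pos_divide_le_eq mult_ac)
    qed
    have c30: "0 < c3" "0 < C3" using c2 R by (auto simp: c3_def C3_def)
    \<comment> \<open>Above height \<open>t\<close> crude bounds suffice: the lower one is
      transported from \<open>l + i t\<close>, the upper one is \<open>1 / \<eta>\<close>.\<close>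
    have step4: "c4 * sqrt (e' + \<eta>) \<le> poisson m lam (l + e') \<eta> \<and> poisson m lam (l + e') \<eta> \<le> C4 * sqrt (e' + \<eta>)"
      if e': "0 \<le> e'" "e' \<le> cH" and \<eta>: "\<eta>s \<le> \<eta>" "\<eta> \<le> 20" for e' \<eta>
    proof (cases "\<eta> \<le> t")
      case True
      have "c4 * sqrt (e' + \<eta>) \<le> c3 * sqrt (e' + \<eta>)" "C3 * sqrt (e' + \<eta>) \<le> C4 * sqrt (e' + \<eta>)"
        using e' \<eta> \<eta>s by (auto intro!: mult_right_mono simp: c4_def C4_def)
      then show ?thesis using step3[OF e' \<eta>(1) True] by linarith
    next
      case False
      then have \<eta>t: "t \<le> \<eta>" "0 < \<eta>" using t by auto
      have e1: "e' \<le> 1" using e' cH t by linarith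
      have "poisson m lam l t \<le> Q * poisson m lam (l + e') \<eta>"
      proof (rule poisson_mono)
        fix i assume i: "i < m"
        define x where "x = lam i - l"
        have eq: "lam i - (l + e') = x - e'" by (simp add: x_def)
        have "(x - e')\<^sup>2 + \<eta>\<^sup>2 \<le> 2 * x\<^sup>2 + 402"
        proof -
          have "0 \<le> (x + e')\<^sup>2" by simp
          then have "(x - e')\<^sup>2 \<le> 2 * x\<^sup>2 + 2 * e'\<^sup>2" by (simp add: power2_eq_square algebra_simps)
          moreover have "e'\<^sup>2 \<le> 1" using e' e1 by (intro power_le_one) auto
          moreover have "\<eta>\<^sup>2 \<le> 20\<^sup>2" using \<eta> \<eta>t by (intro power_mono) auto
          ultimately show ?thesis by simp
        qed
        also have "\<dots> \<le> Q * (x\<^sup>2 + t\<^sup>2)" using mult_right_mono[of 2 Q "x\<^sup>2"] Q Qt by (simp add: algebra_simps)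
        finally have le: "(x - e')\<^sup>2 + \<eta>\<^sup>2 \<le> Q * (x\<^sup>2 + t\<^sup>2)" .
        have pos: "0 < x\<^sup>2 + t\<^sup>2" "0 < (x - e')\<^sup>2 + \<eta>\<^sup>2" using t \<eta>t by (auto intro: add_nonneg_pos)
        have "t * ((x - e')\<^sup>2 + \<eta>\<^sup>2) \<le> \<eta> * (Q * (x\<^sup>2 + t\<^sup>2))" using le \<eta>t t pos by (intro mult_mono) auto
        then show "t / ((lam i - l)\<^sup>2 + t\<^sup>2) \<le> Q * (\<eta> / ((lam i - (l + e'))\<^sup>2 + \<eta>\<^sup>2))"
          unfolding eq x_def[symmetric] using pos by (simp add: divide_le_eq le_divide_eq mult_ac)
      qed
      moreover have "c3 * sqrt t \<le> poisson m lam l t" using step3[of 0 t] cH t \<eta>st by simp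
      ultimately have lo: "c3 * sqrt t / Q \<le> poisson m lam (l + e') \<eta>" using Q by (simp add: divide_le_eq mult.commute)
      have "sqrt (e' + \<eta>) \<le> 5" using e1 \<eta> by (intro real_le_lsqrt) auto
      then have "c3 * sqrt t / (5 * Q) * sqrt (e' + \<eta>) \<le> c3 * sqrt t / (5 * Q) * 5"
        using c30 t Q by (intro mult_left_mono) auto
      moreover have "c4 * sqrt (e' + \<eta>) \<le> c3 * sqrt t / (5 * Q) * sqrt (e' + \<eta>)"
        using e' \<eta>t by (intro mult_right_mono) (auto simp: c4_def)
      moreover have "c3 * sqrt t / (5 * Q) * 5 = c3 * sqrt t / Q" by simp
      ultimately have A: "c4 * sqrt (e' + \<eta>) \<le> poisson m lam (l + e') \<eta>" using lo by linarith
      have "poisson m lam (l + e') \<eta> \<le> 1 / \<eta>" by (rule poisson_le_inverse[OF \<eta>t(2)])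
      also have "\<dots> \<le> 1 / t" using \<eta>t t by (intro divide_left_mono) auto
      also have "\<dots> = 1 / (t * sqrt t) * sqrt t" using t by simp
      also have "\<dots> \<le> 1 / (t * sqrt t) * sqrt (e' + \<eta>)" using t \<eta>t e' by (intro mult_left_mono) auto
      also have "\<dots> \<le> C4 * sqrt (e' + \<eta>)" using \<eta>t e' by (intro mult_right_mono) (auto simp: C4_def)
      finally show ?thesis using A by simp
    qed
    have r1: "1 / CH * sqrt (\<bar>E - l\<bar> + \<eta>) \<le> poisson m lam E \<eta> \<and> poisson m lam E \<eta> \<le> CH * sqrt (\<bar>E - l\<bar> + \<eta>)"
      if "l \<le> E" "E \<le> l + cH" "\<eta>s \<le> \<eta>" "\<eta> \<le> 10" for E \<eta>
    proof -
      have s4: "c4 * sqrt (\<bar>E - l\<bar> + \<eta>) \<le> poisson m lam E \<eta> \<and> poisson m lam E \<eta> \<le> C4 * sqrt (\<bar>E - l\<bar> + \<eta>)"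
        using step4[of "E - l" \<eta>] that by simp
      have "1 / CH * sqrt (\<bar>E - l\<bar> + \<eta>) \<le> c4 * sqrt (\<bar>E - l\<bar> + \<eta>)" "C4 * sqrt (\<bar>E - l\<bar> + \<eta>) \<le> CH * sqrt (\<bar>E - l\<bar> + \<eta>)"
      proof -
        have "1 / CH \<le> c4" "C4 \<le> CH" using CHinv CH c4 by linarith+
        moreover have "0 \<le> sqrt (\<bar>E - l\<bar> + \<eta>)" using that \<eta>s by simp
        ultimately show "1 / CH * sqrt (\<bar>E - l\<bar> + \<eta>) \<le> c4 * sqrt (\<bar>E - l\<bar> + \<eta>)" "C4 * sqrt (\<bar>E - l\<bar> + \<eta>) \<le> CH * sqrt (\<bar>E - l\<bar> + \<eta>)"
          by (auto intro: mult_right_mono simp del: times_divide_eq_left)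
      qed
      then show ?thesis using s4 by linarith
    qed
    have r2: "1 / CH * (\<eta> / sqrt (\<bar>E - l\<bar> + \<eta>)) \<le> poisson m lam E \<eta> \<and> poisson m lam E \<eta> \<le> CH * (\<eta> / sqrt (\<bar>E - l\<bar> + \<eta>))"
      if "l - cH \<le> E" "E \<le> l" "\<eta>s \<le> \<eta>" "\<eta> \<le> 10" for E \<eta>
    proof -
      define k where "k = l - E"
      define \<tau> where "\<tau> = k + \<eta>"
      have k: "0 \<le> k" "k \<le> cH" "\<bar>E - l\<bar> = k" using that by (auto simp: k_def)
      have \<eta>0: "0 < \<eta>" using that \<eta>s by linarith
      have \<tau>: "\<eta>s \<le> \<tau>" "\<tau> \<le> 20" "0 < \<tau>" using that k cH t \<eta>0 by (auto simp: \<tau>_def)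
      have s4: "c4 * sqrt \<tau> \<le> poisson m lam l \<tau>" "poisson m lam l \<tau> \<le> C4 * sqrt \<tau>"
        using step4[of 0 \<tau>] \<tau> cH by auto
      \<comment> \<open>To the left of the smallest eigenvalue \<open>lam i - l\<close> and
        \<open>l - E\<close> are both nonnegative, so nothing cancels and the two denominators agree
        up to a factor 2.\<close>
      have cmp: "((lam i - l)\<^sup>2 + \<tau>\<^sup>2) / 2 \<le> (lam i - E)\<^sup>2 + \<eta>\<^sup>2" "(lam i - E)\<^sup>2 + \<eta>\<^sup>2 \<le> 2 * ((lam i - l)\<^sup>2 + \<tau>\<^sup>2)"
        "0 < (lam i - E)\<^sup>2 + \<eta>\<^sup>2" "0 < (lam i - l)\<^sup>2 + \<tau>\<^sup>2" if "i < m" for i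
      proof -
        define x where "x = lam i - l"
        have x: "0 \<le> x" using lmin[OF that] by (simp add: x_def)
        have eq: "lam i - E = x + k" by (simp add: x_def k_def)
        have "0 \<le> x * k" "0 \<le> k * \<eta>" using x k \<eta>0 by auto
        moreover have "0 \<le> (k - \<eta>)\<^sup>2" "0 \<le> (x - k)\<^sup>2" "0 \<le> x\<^sup>2" "0 \<le> \<eta>\<^sup>2" by simp_all
        moreover have "2 * ((x + k)\<^sup>2 + \<eta>\<^sup>2) - (x\<^sup>2 + (k + \<eta>)\<^sup>2) = (k - \<eta>)\<^sup>2 + x\<^sup>2 + 4 * (x * k)"
          "2 * (x\<^sup>2 + (k + \<eta>)\<^sup>2) - ((x + k)\<^sup>2 + \<eta>\<^sup>2) = (x - k)\<^sup>2 + \<eta>\<^sup>2 + 4 * (k * \<eta>)"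
          by (simp_all add: power2_eq_square algebra_simps)
        moreover have "q / 2 \<le> p" if "2 * p - q = r" "0 \<le> r" for p q r :: real using that by linarith
        moreover have "p \<le> 2 * q" if "2 * q - p = r" "0 \<le> r" for p q r :: real using that by linarith
        ultimately have "(x\<^sup>2 + (k + \<eta>)\<^sup>2) / 2 \<le> (x + k)\<^sup>2 + \<eta>\<^sup>2" "(x + k)\<^sup>2 + \<eta>\<^sup>2 \<le> 2 * (x\<^sup>2 + (k + \<eta>)\<^sup>2)"
          by (metis add_nonneg_nonneg mult_nonneg_nonneg zero_le_numeral)+
        then show "((lam i - l)\<^sup>2 + \<tau>\<^sup>2) / 2 \<le> (lam i - E)\<^sup>2 + \<eta>\<^sup>2" "(lam i - E)\<^sup>2 + \<eta>\<^sup>2 \<le> 2 * ((lam i - l)\<^sup>2 + \<tau>\<^sup>2)"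
          unfolding eq x_def[symmetric] \<tau>_def by simp_all
        show "0 < (lam i - E)\<^sup>2 + \<eta>\<^sup>2" "0 < (lam i - l)\<^sup>2 + \<tau>\<^sup>2" using \<eta>0 \<tau> by (auto intro: add_nonneg_pos)
      qed
      have up: "poisson m lam E \<eta> \<le> (2 * \<eta> / \<tau>) * poisson m lam l \<tau>"
      proof (rule poisson_mono)
        fix i assume i: "i < m"
        show "\<eta> / ((lam i - E)\<^sup>2 + \<eta>\<^sup>2) \<le> 2 * \<eta> / \<tau> * (\<tau> / ((lam i - l)\<^sup>2 + \<tau>\<^sup>2))"
        proof -
          have "\<eta> / ((lam i - E)\<^sup>2 + \<eta>\<^sup>2) \<le> 2 * (\<eta> / ((lam i - l)\<^sup>2 + \<tau>\<^sup>2))"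
            using cmp[OF i] \<eta>0 by (intro half_frac_le) auto
          then show ?thesis using \<tau> by (simp add: mult.commute)
        qed
      qed
      have lo: "poisson m lam l \<tau> \<le> (2 * \<tau> / \<eta>) * poisson m lam E \<eta>"
      proof (rule poisson_mono)
        fix i assume i: "i < m"
        show "\<tau> / ((lam i - l)\<^sup>2 + \<tau>\<^sup>2) \<le> 2 * \<tau> / \<eta> * (\<eta> / ((lam i - E)\<^sup>2 + \<eta>\<^sup>2))"
        proof -
          have "\<tau> / ((lam i - l)\<^sup>2 + \<tau>\<^sup>2) \<le> 2 * (\<tau> / ((lam i - E)\<^sup>2 + \<eta>\<^sup>2))"
            using cmp[OF i] \<tau> by (intro half_frac_le) auto
          then show ?thesis using \<eta>0 by (simp add: mult.commute)
        qed
      qed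
      define y where "y = \<eta> / sqrt \<tau>"
      have y0: "0 < y" using \<eta>0 \<tau> by (simp add: y_def)
      have st: "sqrt \<tau> * sqrt \<tau> = \<tau>" "0 < sqrt \<tau>" using \<tau> by auto
      have "(2 * \<eta> / \<tau>) * poisson m lam l \<tau> \<le> (2 * \<eta> / \<tau>) * (C4 * sqrt \<tau>)"
        using s4 \<eta>0 \<tau> by (intro mult_left_mono) auto
      also have "\<dots> = 2 * C4 * y" unfolding y_def using st \<tau> by (simp add: field_simps)
      also have "\<dots> \<le> CH * y" using CH y0 by (intro mult_right_mono) auto
      finally have U: "poisson m lam E \<eta> \<le> CH * y" using up by linarith
      have "c4 * sqrt \<tau> \<le> (2 * \<tau> / \<eta>) * poisson m lam E \<eta>" using s4 lo by linarith
      then have "(\<eta> / (2 * \<tau>)) * (c4 * sqrt \<tau>) \<le> (\<eta> / (2 * \<tau>)) * ((2 * \<tau> / \<eta>) * poisson m lam E \<eta>)"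
        using \<eta>0 \<tau> by (intro mult_left_mono) auto
      moreover have "(\<eta> / (2 * \<tau>)) * ((2 * \<tau> / \<eta>) * poisson m lam E \<eta>) = poisson m lam E \<eta>" using \<eta>0 \<tau> by simp
      moreover have "(\<eta> / (2 * \<tau>)) * (c4 * sqrt \<tau>) = c4 / 2 * y" unfolding y_def using st \<tau> by (simp add: field_simps)
      moreover have "1 / CH * y \<le> c4 / 2 * y" using CHinv y0 by (intro mult_right_mono) auto
      ultimately have "1 / CH * y \<le> poisson m lam E \<eta>" by linarith
      then show ?thesis using U k by (simp add: y_def \<tau>_def)
    qed
    have "cH / 2 \<le> l" using l1 K\<eta>s lm1 cH by linarith
    moreover have "l \<le> 2 * CH" using l2 K\<eta>s lm2 t CH by linarith
    ultimately show ?thesis using r1 r2 unfolding edge_bounds_def Let_def l_def[symmetric] by blast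
  qed
  show ?thesis by (rule that[OF cH(1) CH(1) h0(1) main])
qed

section \<open>Edge and local law with high probability\<close>

lemma spectral_zero: "spectral m (\<lambda>_ _. 0) (\<lambda>_. 0) (\<lambda>i a. of_bool (i = a))"
proof -
  have "dotp m (\<lambda>a. of_bool (i = a)) (\<lambda>a. of_bool (j = a)) = of_bool (i = j)" if "i < m" "j < m" for i j
  proof -
    have "(\<Sum>a<m. of_bool (i = a) * of_bool (j = a) :: real) = (\<Sum>a<m. if a = i then of_bool (i = j) else 0)"
      by (intro sum.cong) auto
    then show ?thesis using that by (simp add: dotp_def)
  qed
  then show ?thesis by (auto simp: spectral_def orthonormal_def)
qed

text \<open>\<open>1 / (1 + s)\<close> has slope at least -1 on the nonnegative half-line.\<close>

lemma inverse_shift: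
  fixes s e :: real
  assumes "0 \<le> s" "0 \<le> e"
  shows "1 / (1 + s) - e \<le> 1 / (1 + s + e)"
proof -
  have "1 / (1 + s) - 1 / (1 + s + e) = e / ((1 + s) * (1 + s + e))" using assms by (simp add: field_simps)
  also have "\<dots> \<le> e / 1"
  proof (rule divide_left_mono)
    have "1 * 1 \<le> (1 + s) * (1 + s + e)" using assms by (intro mult_mono) auto
    then show "1 \<le> (1 + s) * (1 + s + e)" by simp
  qed (use assms in auto)
  finally show ?thesis by simp
qed

text \<open>The failure probability of \<open>barrier\<close> for the parameters of
  \<open>lower_edge_bound\<close>: an exponential of the initial slack of the potential, then
  \<open>\<zeta>\<close> times the initial value of \<open>Tr G ^ p\<close> together with the
  remainders of up to \<open>N\<close> columns.\<close>

definition lower_edge_error :: "real \<Rightarrow> nat \<Rightarrow> real \<Rightarrow> real \<Rightarrow> real" where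
  "lower_edge_error \<delta> p L N = exp (- (\<delta> / 2 * L ^ 9)) + (1 / L ^ 3) ^ p * (N * (1 / \<delta>\<^sup>2) ^ p + N * (2 * real p * (44 * real p / \<delta> ^ 4 * L) * (44 * real p / \<delta> ^ 4 * L\<^sup>2) ^ p))"

lemma (in column_law) lower_edge_bound:
  fixes a b \<delta> L N :: real and p :: nat
  assumes fin: "finite J" and ab: "a = v * real m" "b = v * real (card J)"
    and \<delta>: "0 < \<delta>" "\<delta> \<le> 1" "\<delta> \<le> a" "\<delta> \<le> sqrt b - sqrt a" "b \<le> 2"
    and L: "200 \<le> L" "14 / \<delta> ^ 4 \<le> L" and v: "v \<le> 2 / L ^ 20" and \<kappa>: "\<kappa> \<le> v / L ^ 10"
    and p: "1 \<le> p" and N: "real (card J) \<le> N" "real m \<le> N"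
  shows "measure (PiM J (\<lambda>_. \<mu>)) {x \<in> space (PiM J (\<lambda>_. \<mu>)).
            \<exists>y. bform m (gram J x) y y < ((sqrt b - sqrt a)\<^sup>2 - 12 / \<delta> ^ 4 / L) * dotp m y y}
     \<le> lower_edge_error \<delta> p L N"
proof -
  have L0: "0 < L" "1 \<le> L" using L by auto
  have Lp: "1 \<le> L ^ k" "0 < L ^ k" for k using L0 by (auto intro: one_le_power)
  have Lmono: "L ^ i \<le> L ^ j" if "i \<le> j" for i j using L0 that by (intro power_increasing) auto
  have a0: "0 < a" using \<delta> by simp
  have sab: "sqrt a < sqrt b" using \<delta> by linarith
  have a2: "a \<le> 2" using sab \<delta> by simp
  have b0: "0 < b" using sab a0 by (meson less_trans real_sqrt_less_iff)
  \<comment> \<open>At the level \<open>- l0\<close> the zero matrix has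
    \<open>v * Tr G = a / l0\<close>, and \<open>card J\<close> increments of
    \<open>v / (1 + a / l0)\<close> lead to the level \<open>b / (1 + a / l0) - l0\<close>. This
    choice of \<open>l0\<close> maximises it, and the maximum is
    \<open>(sqrt b - sqrt a)^2\<close>.\<close>
  define l0 where "l0 = sqrt a * (sqrt b - sqrt a)"
  have \<delta>2: "\<delta>\<^sup>2 \<le> l0"
  proof -
    have "\<delta> \<le> sqrt \<delta>" using \<delta> by (intro real_le_rsqrt) (auto simp: power2_eq_square mult_left_le)
    also have "\<dots> \<le> sqrt a" using \<delta> by simp
    finally have "\<delta> * \<delta> \<le> sqrt a * (sqrt b - sqrt a)" using \<delta> by (intro mult_mono) auto
    then show ?thesis by (simp add: l0_def power2_eq_square)
  qed
  have d0: "0 < \<delta>\<^sup>2" "0 < \<delta> ^ 4" "\<delta> ^ 4 \<le> \<delta>\<^sup>2" "\<delta> ^ 4 \<le> 1" using \<delta> by (auto intro: power_decreasing power_le_one)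
  have l00: "0 < l0" using \<delta>2 d0 by linarith
  have il: "1 / l0 \<le> 1 / \<delta> ^ 4" "1 / l0\<^sup>2 \<le> 1 / \<delta> ^ 4" "1 \<le> 1 / \<delta> ^ 4"
  proof -
    show "1 / l0 \<le> 1 / \<delta> ^ 4" using \<delta>2 d0 l00 by (intro divide_left_mono) auto
    have "\<delta> ^ 4 = (\<delta>\<^sup>2)\<^sup>2" by simp
    also have "\<dots> \<le> l0\<^sup>2" using \<delta>2 by (intro power_mono) auto
    finally show "1 / l0\<^sup>2 \<le> 1 / \<delta> ^ 4" using d0 l00 by (intro divide_left_mono) auto
    show "1 \<le> 1 / \<delta> ^ 4" using d0 by simp
  qed
  \<comment> \<open>\<open>\<zeta>\<close> is the inverse of \<open>\<gamma>m ^ p\<close>, so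
    \<open>b1\<close> holds with equality. \<open>t\<close> is small enough to keep the second order
    term in \<open>b3\<close> negligible although \<open>g\<close> is of order \<open>L ^ 3\<close>,
    and \<open>\<gamma>m\<close> exceeds the order \<open>L ^ 2\<close> of
    \<open>r / \<sigma>\<close>.\<close>
  define \<theta> \<sigma> t \<gamma>m \<zeta> where "\<theta> = 1 / L" and "\<sigma> = 1 / L" and "t = 1 / L ^ 10" and "\<gamma>m = L ^ 3" and "\<zeta> = (1 / L ^ 3) ^ p"
  \<comment> \<open>The initial potential plus the slack \<open>real m / L\<close>, which feeds the
    exponential decay and changes \<open>s\<close> only by \<open>a / L\<close>.\<close>
  define \<phi> where "\<phi> = real m / l0 + \<theta> * (real m / l0\<^sup>2) + real m / L"
  define s where "s = v * \<phi>"
  have s: "s = a / l0 + a * (1 / l0\<^sup>2 + 1) / L"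
    by (simp add: s_def \<phi>_def ab(1) \<theta>_def add_divide_distrib distrib_left mult_ac)
  have s0: "0 \<le> s" unfolding s using a0 l00 L0 by auto
  have s6: "s \<le> 6 / \<delta> ^ 4"
  proof -
    have "a / l0 = a * (1 / l0)" by simp
    also have "\<dots> \<le> 2 * (1 / \<delta> ^ 4)" using il a2 a0 l00 by (intro mult_mono) auto
    finally have 1: "a / l0 \<le> 2 / \<delta> ^ 4" by simp
    have "a * (1 / l0\<^sup>2 + 1) / L \<le> a * (1 / l0\<^sup>2 + 1) / 1" using L0 a0 l00 by (intro divide_left_mono) auto
    also have "\<dots> \<le> 2 * (1 / \<delta> ^ 4 + 1 / \<delta> ^ 4) / 1" using il a2 a0 l00 by (intro divide_right_mono mult_mono add_mono) auto
    finally show ?thesis unfolding s using 1 by simp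
  qed
  \<comment> \<open>Of the margin \<open>2 / L\<close>, one half pays for
    \<open>v * \<sigma>\<close> and the other for the errors of total size \<open>180 / L^2\<close>
    in \<open>b3\<close>; hence \<open>200 \<le> L\<close>.\<close>
  define d where "d = v * (1 / (1 + s) - 2 / L)"
  have d_nonneg: "0 \<le> d"
  proof -
    have "2 * (1 + s) \<le> 14 / \<delta> ^ 4" using s6 il by (simp add: field_simps)
    then have "2 * (1 + s) \<le> L" using L by simp
    then have "2 / L \<le> 1 / (1 + s)" using s0 L0 by (simp add: field_simps)
    then show ?thesis using v_pos by (simp add: d_def)
  qed
  have dv: "d \<le> v"
  proof -
    have "1 / (1 + s) - 2 / L \<le> 1" using s0 L0 by (smt (verit) divide_le_eq_1 divide_nonneg_nonneg)
    then have "v * (1 / (1 + s) - 2 / L) \<le> v * 1" using v_pos by (intro mult_left_mono) auto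
    then show ?thesis by (simp add: d_def)
  qed
  define g where "g = 2 * \<gamma>m"
  define e where "e = 2 * v\<^sup>2 + \<kappa>"
  define K where "K = real m * (g\<^sup>2 + 2 * \<theta> * g ^ 3)"
  have g1: "g + \<theta> * g\<^sup>2 = 2 * L ^ 3 + 4 * L ^ 5"
    using L0 by (simp add: g_def \<gamma>m_def \<theta>_def power2_eq_square field_simps power_numeral_reduce)
  have g2: "g\<^sup>2 + 2 * \<theta> * g ^ 3 = 4 * L ^ 6 + 16 * L ^ 8"
    using L0 by (simp add: g_def \<gamma>m_def \<theta>_def power2_eq_square field_simps power_numeral_reduce)
  have g1u: "g + \<theta> * g\<^sup>2 \<le> 6 * L ^ 5" unfolding g1 using Lmono[of 3 5] by simp
  have g2u: "g\<^sup>2 + 2 * \<theta> * g ^ 3 \<le> 20 * L ^ 8" unfolding g2 using Lmono[of 6 8] by simp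
  have g2n: "0 \<le> g\<^sup>2 + 2 * \<theta> * g ^ 3" "0 \<le> g + \<theta> * g\<^sup>2" unfolding g1 g2 using L0 by auto
  have vK: "v * K \<le> 40 * L ^ 8"
  proof -
    have "v * K = a * (g\<^sup>2 + 2 * \<theta> * g ^ 3)" by (simp add: K_def ab(1))
    also have "\<dots> \<le> 2 * (20 * L ^ 8)" using a2 a0 g2u g2n by (intro mult_mono) auto
    finally show ?thesis by simp
  qed
  have K0: "0 \<le> K" using g2n by (simp add: K_def)
  have e0: "0 \<le> e" using \<kappa>_nonneg by (simp add: e_def)
  have v20: "v \<le> 2 / L ^ 10"
  proof -
    have "2 / L ^ 20 \<le> 2 / L ^ 10" using Lmono[of 10 20] L0 by (intro divide_left_mono) auto
    then show ?thesis using v by simp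
  qed
  have e5: "e \<le> v * (5 / L ^ 10)"
  proof -
    have "2 * v\<^sup>2 \<le> 2 * (v * (2 / L ^ 10))" unfolding power2_eq_square using v20 v_pos by (intro mult_left_mono) auto
    moreover have "v * (5 / L ^ 10) = 4 * (v / L ^ 10) + v / L ^ 10" "2 * (v * (2 / L ^ 10)) = 4 * (v / L ^ 10)" by simp_all
    ultimately show ?thesis using \<kappa> unfolding e_def by linarith
  qed
  have i10: "L ^ 5 / L ^ 10 = 1 / L ^ 5" "L ^ 8 / L ^ 10 = 1 / L\<^sup>2" "L ^ 6 / L ^ 10 = 1 / L ^ 4" "L ^ 8 / L ^ 20 = 1 / L ^ 12"
    using L0 by (simp_all add: field_simps power_numeral_reduce)
  have iL: "1 / L ^ k \<le> 1 / L\<^sup>2" if "2 \<le> k" for k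
    using Lmono[OF that] L0 by (intro divide_left_mono) auto
  have T1: "e * (g + \<theta> * g\<^sup>2) \<le> v * (30 / L\<^sup>2)"
  proof -
    have "e * (g + \<theta> * g\<^sup>2) \<le> v * (5 / L ^ 10) * (6 * L ^ 5)" using e5 g1u g2n e0 v_pos L0 by (intro mult_mono) auto
    also have "\<dots> = v * (30 * (L ^ 5 / L ^ 10))" by simp
    also have "\<dots> \<le> v * (30 * (1 / L\<^sup>2))" unfolding i10 using iL[of 5] v_pos by (intro mult_left_mono) auto
    finally show ?thesis by simp
  qed
  have T2: "t / 2 * (v\<^sup>2 * K + e * (g\<^sup>2 + 2 * \<theta> * g ^ 3)) \<le> v * (70 / L\<^sup>2)"
  proof -
    have A: "v\<^sup>2 * K \<le> v * (40 * L ^ 8)" unfolding power2_eq_square mult.assoc using vK v_pos by (intro mult_left_mono) auto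
    have "e * (g\<^sup>2 + 2 * \<theta> * g ^ 3) \<le> v * (5 / L ^ 10) * (20 * L ^ 8)" using e5 g2u g2n e0 v_pos L0 by (intro mult_mono) auto
    also have "\<dots> = v * (100 * (L ^ 8 / L ^ 10))" by simp
    also have "\<dots> \<le> v * (100 * L ^ 8)"
    proof -
      have "L ^ 8 / L ^ 10 \<le> L ^ 8 / 1" using Lp L0 by (intro divide_left_mono) auto
      then show ?thesis using v_pos by (intro mult_left_mono) auto
    qed
    finally have "t / 2 * (v\<^sup>2 * K + e * (g\<^sup>2 + 2 * \<theta> * g ^ 3)) \<le> t / 2 * (v * (40 * L ^ 8) + v * (100 * L ^ 8))"
      using A Lp by (intro mult_left_mono add_mono) (auto simp: t_def)
    also have "\<dots> = v * (70 * (L ^ 8 / L ^ 10))" by (simp add: t_def field_simps)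
    finally show ?thesis unfolding i10 by simp
  qed
  \<comment> \<open>A single step can move the potential by \<open>d * K\<close>; this is harmless
    since \<open>v * d * K \<le> 80 / L^2\<close>.\<close>
  have T3: "v / (1 + s) - v * (80 / L\<^sup>2) \<le> v / (1 + v * (\<phi> + d * K))"
  proof -
    have "v * d * K \<le> v * v * K" using dv v_pos K0 by (intro mult_right_mono mult_left_mono) auto
    also have "\<dots> = v * (v * K)" by simp
    also have "\<dots> \<le> 2 / L ^ 20 * (40 * L ^ 8)" 
      by (rule mult_mono[OF v vK]) (use v_pos K0 L0 in simp_all)
    also have "\<dots> = 80 * (L ^ 8 / L ^ 20)" by simp
    also have "\<dots> \<le> 80 / L\<^sup>2" unfolding i10 using iL[of 12] by simp
    finally have x: "v * d * K \<le> 80 / L\<^sup>2" .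
    have x0: "0 \<le> v * d * K" using v_pos d_nonneg K0 by simp
    have "1 / (1 + s) - 80 / L\<^sup>2 \<le> 1 / (1 + s) - v * d * K" using x by simp
    also have "\<dots> \<le> 1 / (1 + s + v * d * K)" by (rule inverse_shift[OF s0 x0])
    also have "1 + s + v * d * K = 1 + v * (\<phi> + d * K)" by (simp add: s_def algebra_simps)
    finally have "v * (1 / (1 + s) - 80 / L\<^sup>2) \<le> v * (1 / (1 + v * (\<phi> + d * K)))" using v_pos by (intro mult_left_mono) auto
    then show ?thesis by (simp add: algebra_simps)
  qed
  have b3: "d + v * \<sigma> + e * (g + \<theta> * g\<^sup>2) + t / 2 * (v\<^sup>2 * K + e * (g\<^sup>2 + 2 * \<theta> * g ^ 3)) \<le> v / (1 + v * (\<phi> + d * K))"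
  proof -
    have "180 / L\<^sup>2 \<le> 1 / L" using L by (simp add: field_simps power2_eq_square)
    then have "v * (180 / L\<^sup>2) \<le> v * (1 / L)" using v_pos by (intro mult_left_mono) auto
    then have "d + v * \<sigma> + v * (30 / L\<^sup>2) + v * (70 / L\<^sup>2) \<le> v / (1 + s) - v * (80 / L\<^sup>2)"
      by (simp add: d_def \<sigma>_def algebra_simps)
    then show ?thesis using T1 T2 T3 by linarith
  qed
  define r where "r = 44 * real p / \<delta> ^ 4 * L"
  have r0: "0 \<le> r" using L0 d0 by (simp add: r_def)
  have b4: "real p * v\<^sup>2 * (4 * \<phi> / \<theta>) + real p * e * g\<^sup>2 \<le> v * r"
  proof -
    have "real p * v\<^sup>2 * (4 * \<phi> / \<theta>) = v * (4 * real p * L * s)"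
      by (simp add: s_def \<theta>_def power2_eq_square)
    also have "\<dots> \<le> v * (4 * real p * L * (6 / \<delta> ^ 4))" using s6 v_pos L0 by (intro mult_left_mono) auto
    finally have A: "real p * v\<^sup>2 * (4 * \<phi> / \<theta>) \<le> v * (24 * real p / \<delta> ^ 4 * L)" by simp
    have "g\<^sup>2 = 4 * L ^ 6" by (simp add: g_def \<gamma>m_def power_mult_distrib power_mult[symmetric])
    then have "e * g\<^sup>2 \<le> v * (5 / L ^ 10) * (4 * L ^ 6)" using mult_right_mono[OF e5, of "4 * L ^ 6"] L0 by simp
    also have "\<dots> = v * (20 * (L ^ 6 / L ^ 10))" by simp
    also have "\<dots> \<le> v * (20 / \<delta> ^ 4 * L)"
    proof -
      have "L ^ 6 / L ^ 10 \<le> 1" using Lmono[of 6 10] Lp by (simp add: divide_le_eq)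
      also have "1 \<le> 1 / \<delta> ^ 4 * L" using il L0 mult_mono[of 1 "1 / \<delta> ^ 4" 1 L] by simp
      finally have "20 * (L ^ 6 / L ^ 10) \<le> 20 / \<delta> ^ 4 * L" by simp
      then show ?thesis using v_pos by (intro mult_left_mono) auto
    qed
    finally have "real p * (e * g\<^sup>2) \<le> real p * (v * (20 / \<delta> ^ 4 * L))" by (intro mult_left_mono) auto
    then have B: "real p * e * g\<^sup>2 \<le> v * (20 * real p / \<delta> ^ 4 * L)" by (simp add: mult_ac)
    have "v * r = v * (24 * real p / \<delta> ^ 4 * L) + v * (20 * real p / \<delta> ^ 4 * L)"
      by (simp add: r_def algebra_simps add_divide_distrib[symmetric])
    then show ?thesis using A B by linarith
  qed
  have b2: "2 * d * \<gamma>m \<le> 1"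
  proof -
    have "2 * d * \<gamma>m \<le> 2 * (2 / L ^ 20) * L ^ 3" unfolding \<gamma>m_def using dv v L0 by (intro mult_right_mono mult_left_mono) auto
    also have "\<dots> = 4 * (L ^ 3 / L ^ 20)" by simp
    also have "\<dots> \<le> 4 * (1 / L\<^sup>2)"
    proof -
      have "L ^ 3 / L ^ 20 = 1 / L ^ 17" using L0 by (simp add: field_simps power_numeral_reduce)
      then show ?thesis using iL[of 17] by simp
    qed
    also have "\<dots> \<le> 1"
    proof -
      have "200\<^sup>2 \<le> L\<^sup>2" using L by (intro power_mono) auto
      then have "4 / L\<^sup>2 \<le> 4 / 200\<^sup>2" by (intro divide_left_mono) auto
      then show ?thesis by simp
    qed
    finally show ?thesis .
  qed
  have b1: "1 \<le> \<zeta> * \<gamma>m ^ p" using L0 by (simp add: \<zeta>_def \<gamma>m_def power_mult_distrib[symmetric])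
  have tr0: "trpow m (\<lambda>_. 0) (- l0) j = real m * (1 / l0) ^ j" for j by (simp add: trpow_def)
  have "emeasure (PiM J (\<lambda>_. \<mu>)) {x \<in> space (PiM J (\<lambda>_. \<mu>)).
            \<exists>y. bform m (\<lambda>a b. 0 + gram J x a b) y y < (- l0 + real (card J) * d) * dotp m y y}
     \<le> ennreal (exp (t * (trpow m (\<lambda>_. 0) (- l0) 1 + \<theta> * trpow m (\<lambda>_. 0) (- l0) 2 - \<phi>)) +
          \<zeta> * (trpow m (\<lambda>_. 0) (- l0) p + real (card J) * (real p * v * real m * r * (r / \<sigma>) ^ p)))"
    using L0 d_nonneg r0 p l00
    by (intro barrier[where \<gamma>m=\<gamma>m and \<zeta>=\<zeta> and \<phi>=\<phi>, OF fin _ _ _ _ _ _ _ _ b1 b2 b3[unfolded g_def e_def K_def] b4[unfolded g_def e_def] spectral_zero])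
       (auto simp: \<theta>_def \<sigma>_def t_def \<zeta>_def \<gamma>m_def)
  then have main: "emeasure (PiM J (\<lambda>_. \<mu>)) {x \<in> space (PiM J (\<lambda>_. \<mu>)).
            \<exists>y. bform m (gram J x) y y < (- l0 + real (card J) * d) * dotp m y y}
     \<le> ennreal (exp (- (real m / L ^ 11)) + \<zeta> * (real m * (1 / l0) ^ p + real (card J) * (real p * v * real m * r * (r / \<sigma>) ^ p)))"
    (is "emeasure _ ?E \<le> ennreal ?B")
  proof -
    have "trpow m (\<lambda>_. 0) (- l0) 1 + \<theta> * trpow m (\<lambda>_. 0) (- l0) 2 - \<phi> = - (real m / L)"
      unfolding tr0 \<phi>_def by (simp add: power_divide)
    then have "t * (trpow m (\<lambda>_. 0) (- l0) 1 + \<theta> * trpow m (\<lambda>_. 0) (- l0) 2 - \<phi>) = - (real m / L ^ 11)"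
      by (simp add: t_def power_numeral_reduce)
    then show ?thesis using \<open>emeasure _ _ \<le> _\<close> unfolding tr0 by simp
  qed
  have level: "(sqrt b - sqrt a)\<^sup>2 - 12 / \<delta> ^ 4 / L \<le> - l0 + real (card J) * d"
  proof -
    define w where "w = a * (1 / l0\<^sup>2 + 1) / L"
    have w: "0 \<le> w" "w \<le> 4 / \<delta> ^ 4 / L"
    proof -
      show "0 \<le> w" using a0 L0 by (auto simp: w_def)
      have "a * (1 / l0\<^sup>2 + 1) \<le> 2 * (1 / \<delta> ^ 4 + 1 / \<delta> ^ 4)" using il a2 a0 l00 by (intro mult_mono add_mono) auto
      then show "w \<le> 4 / \<delta> ^ 4 / L" unfolding w_def using L0 by (intro divide_right_mono) auto
    qed
    have "1 / (1 + a / l0) - w \<le> 1 / (1 + s)"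
      unfolding s w_def[symmetric] add.assoc[symmetric] using a0 l00 w by (intro inverse_shift) auto
    then have "b * (1 / (1 + a / l0) - w - 2 / L) \<le> b * (1 / (1 + s) - 2 / L)" using b0 by (intro mult_left_mono) auto
    also have "\<dots> = real (card J) * d" by (simp add: d_def ab(2))
    finally have 1: "b * (1 / (1 + a / l0)) - b * w - b * (2 / L) \<le> real (card J) * d" by (simp add: algebra_simps)
    have "b * (1 / (1 + a / l0)) = (sqrt b - sqrt a)\<^sup>2 + l0"
    proof -
      define x y where "x = sqrt a" and "y = sqrt b"
      have xy: "a = x * x" "b = y * y" "0 < x" "0 < y - x" "0 < y" using a0 b0 sab by (auto simp: x_def y_def)
      have "1 + a / l0 = y / (y - x)" unfolding l0_def x_def[symmetric] y_def[symmetric] xy(1) using xy(3-5) by (simp add: field_simps)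
      then have "b * (1 / (1 + a / l0)) = y * (y - x)" using xy by simp
      also have "\<dots> = (y - x)\<^sup>2 + x * (y - x)" by (simp add: power2_eq_square algebra_simps)
      finally show ?thesis by (simp add: l0_def x_def y_def)
    qed
    note 2 = this
    define q where "q = 4 / \<delta> ^ 4 / L"
    have 3: "b * w \<le> 2 * q" unfolding q_def using \<delta>(5) b0 w by (intro mult_mono) auto
    have 4: "b * (2 / L) \<le> q"
    proof -
      have "b * 2 \<le> 4 * (1 / \<delta> ^ 4)" using \<delta>(5) il(3) by linarith
      then have "b * 2 / L \<le> 4 * (1 / \<delta> ^ 4) / L" using L0 by (intro divide_right_mono) auto
      then show ?thesis by (simp add: q_def)
    qed
    have q: "12 / \<delta> ^ 4 / L = 3 * q" by (simp add: q_def)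
    have arith: "A = E + l \<Longrightarrow> B \<le> 2 * q \<Longrightarrow> C \<le> q \<Longrightarrow> A - B - C \<le> D \<Longrightarrow> E - 3 * q \<le> - l + D"
      for A B C D E l :: real by linarith
    show ?thesis unfolding q by (rule arith[OF 2 3 4 1])
  qed
  interpret PJ: prob_space "PiM J (\<lambda>_. \<mu>)" by (intro prob_space_PiM prob_space_axioms)
  have EE: "?E \<in> sets (PiM J (\<lambda>_. \<mu>))" by (intro measurable_below_form borel_measurable_const measurable_gram) auto
  have B0: "0 \<le> ?B" using l00 r0 v_pos L0 by (auto simp: \<zeta>_def \<sigma>_def intro!: add_nonneg_nonneg mult_nonneg_nonneg)
  have "measure (PiM J (\<lambda>_. \<mu>)) {x \<in> space (PiM J (\<lambda>_. \<mu>)).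
            \<exists>y. bform m (gram J x) y y < ((sqrt b - sqrt a)\<^sup>2 - 12 / \<delta> ^ 4 / L) * dotp m y y} \<le> measure (PiM J (\<lambda>_. \<mu>)) ?E"
  proof (rule PJ.finite_measure_mono[OF _ EE], safe)
    fix x y assume "bform m (gram J x) y y < ((sqrt b - sqrt a)\<^sup>2 - 12 / \<delta> ^ 4 / L) * dotp m y y"
    also have "\<dots> \<le> (- l0 + real (card J) * d) * dotp m y y" using level dotp_self_nonneg by (rule mult_right_mono)
    finally show "\<exists>y. bform m (gram J x) y y < (- l0 + real (card J) * d) * dotp m y y" by blast
  qed
  also have "\<dots> \<le> ?B" using main B0 unfolding PJ.emeasure_eq_measure by (simp add: ennreal_le_iff)
  also have "\<dots> \<le> exp (- (\<delta> / 2 * L ^ 9)) + (1 / L ^ 3) ^ p * (N * (1 / \<delta>\<^sup>2) ^ p + N * (2 * real p * (44 * real p / \<delta> ^ 4 * L) * (44 * real p / \<delta> ^ 4 * L\<^sup>2) ^ p))"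
  proof (rule add_mono)
    \<comment> \<open>Since \<open>v * real m \<ge> \<delta>\<close> while
      \<open>v \<le> 2 / L ^ 20\<close>, there are at least \<open>\<delta> / 2 * L ^ 20\<close>
      rows, so the exponent \<open>t * real m / L\<close> is a large power of
      \<open>L\<close>.\<close>
    have "\<delta> \<le> 2 / L ^ 20 * real m" using \<delta>(3) v unfolding ab(1) by (meson mult_right_mono of_nat_0_le_iff order.trans)
    then have "\<delta> / 2 * L ^ 20 \<le> real m" using Lp[of 20] by (simp add: field_simps)
    then have "\<delta> / 2 * L ^ 20 / L ^ 11 \<le> real m / L ^ 11" using L0 by (intro divide_right_mono) auto
    moreover have "\<delta> / 2 * L ^ 20 / L ^ 11 = \<delta> / 2 * L ^ 9" using L0 by (simp add: field_simps power_numeral_reduce)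
    ultimately have "\<delta> / 2 * L ^ 9 \<le> real m / L ^ 11" by linarith
    then show "exp (- (real m / L ^ 11)) \<le> exp (- (\<delta> / 2 * L ^ 9))" by simp
    have rs: "r / \<sigma> = 44 * real p / \<delta> ^ 4 * L\<^sup>2" by (simp add: r_def \<sigma>_def power2_eq_square)
    have "real m * (1 / l0) ^ p \<le> N * (1 / \<delta>\<^sup>2) ^ p"
      using N \<delta>2 d0 l00 by (intro mult_mono power_mono divide_left_mono) auto
    moreover have "real (card J) * (real p * v * real m * r * (r / \<sigma>) ^ p) \<le> N * (2 * real p * r * (r / \<sigma>) ^ p)"
    proof (rule mult_mono)
      have "real p * v * real m * r * (r / \<sigma>) ^ p = a * (real p * r * (r / \<sigma>) ^ p)" by (simp add: ab(1))
      also have "\<dots> \<le> 2 * (real p * r * (r / \<sigma>) ^ p)" using a2 r0 L0 by (intro mult_right_mono) (auto simp: \<sigma>_def)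
      finally show "real p * v * real m * r * (r / \<sigma>) ^ p \<le> 2 * real p * r * (r / \<sigma>) ^ p" by simp
    qed (use N r0 L0 v_pos in \<open>auto simp: \<sigma>_def\<close>)
    ultimately show "\<zeta> * (real m * (1 / l0) ^ p + real (card J) * (real p * v * real m * r * (r / \<sigma>) ^ p))
       \<le> (1 / L ^ 3) ^ p * (N * (1 / \<delta>\<^sup>2) ^ p + N * (2 * real p * (44 * real p / \<delta> ^ 4 * L) * (44 * real p / \<delta> ^ 4 * L\<^sup>2) ^ p))"
      unfolding \<zeta>_def rs unfolding r_def using L0 by (intro mult_left_mono add_mono) auto
  qed
  finally show ?thesis unfolding lower_edge_error_def .
qed

lemma exp_decay:
  fixes c s D :: real
  assumes "0 < c" "0 < s"
  shows "eventually (\<lambda>N::nat. exp (- (c * real N powr s)) \<le> real N powr (- D) / 2) sequentially"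
  using assms by real_asymp

lemma lower_edge_asymptotic:
  fixes \<delta> \<tau> D :: real
  assumes \<delta>: "0 < \<delta>" and \<tau>: "0 < \<tau>" and D: "0 < D"
  obtains p :: nat where "1 \<le> p" "eventually (\<lambda>N::nat. lower_edge_error \<delta> p (real N powr \<tau>) (real N) \<le> real N powr (- D)) sequentially"
proof -
  \<comment> \<open>Up to constants the polynomial part of the error is
    \<open>N powr (1 + \<tau> - \<tau> * p)\<close>. This \<open>p\<close> pushes the exponent below
    \<open>- D - 1\<close>, and the additional power of \<open>N\<close> absorbs the
    constants.\<close>
  obtain p :: nat where p: "(D + 2 + \<tau>) / \<tau> < real p" using reals_Archimedean2 by blast
  then have p\<tau>: "D + 2 + \<tau> < \<tau> * real p" using \<tau> by (simp add: divide_less_eq mult.commute)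
  have "0 < (D + 2 + \<tau>) / \<tau>" using \<tau> D by simp
  then have p1: "1 \<le> p" using p by (cases "p = 0") auto
  define C1 C2 where "C1 = (1 / \<delta>\<^sup>2) ^ p" and "C2 = 2 * real p * (44 * real p / \<delta> ^ 4) * (44 * real p / \<delta> ^ 4) ^ p"
  have C: "0 \<le> C1" "0 \<le> C2" using \<delta> by (auto simp: C1_def C2_def)
  have e1: "eventually (\<lambda>N::nat. exp (- (\<delta> / 2 * real N powr (9 * \<tau>))) \<le> real N powr (- D) / 2) sequentially"
    using \<delta> \<tau> by (intro exp_decay) auto
  have e2: "eventually (\<lambda>N::nat. 2 * (C1 + C2) \<le> real N) sequentially"
    using filterlim_real_sequentially by (simp add: filterlim_at_top)
  have "eventually (\<lambda>N::nat. lower_edge_error \<delta> p (real N powr \<tau>) (real N) \<le> real N powr (- D)) sequentially"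
    using e1 e2 eventually_ge_at_top[of 1] unfolding lower_edge_error_def
  proof eventually_elim
    case (elim N)
    define x where "x = real N"
    have x: "1 \<le> x" "0 < x" using elim by (auto simp: x_def)
    have pw: "(x powr \<tau>) ^ k = x powr (real k * \<tau>)" for k using x by (simp add: powr_realpow[symmetric] powr_powr mult.commute)
    have f1: "(1 / (x powr \<tau>) ^ 3) ^ p = x powr (- (3 * \<tau> * real p))"
      unfolding pw power_one_over power_divide power_one using x
      by (simp add: powr_realpow[symmetric] powr_powr powr_minus_divide mult_ac)
    have f2: "2 * real p * (44 * real p / \<delta> ^ 4 * (x powr \<tau>)) * (44 * real p / \<delta> ^ 4 * (x powr \<tau>)\<^sup>2) ^ p = C2 * x powr (\<tau> + 2 * \<tau> * real p)"
    proof -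
      have "((x powr \<tau>)\<^sup>2) ^ p = x powr (2 * \<tau> * real p)"
        using x by (simp add: pw powr_realpow[symmetric] powr_powr mult_ac)
      then show ?thesis unfolding C2_def power_mult_distrib powr_add by simp
    qed
    have "x powr (- (3 * \<tau> * real p)) * (x * C1 + x * (C2 * x powr (\<tau> + 2 * \<tau> * real p)))
        = C1 * (x powr 1 * x powr (- (3 * \<tau> * real p))) + C2 * (x powr 1 * x powr (- (3 * \<tau> * real p)) * x powr (\<tau> + 2 * \<tau> * real p))"
      using x by (simp add: algebra_simps)
    also have "\<dots> = C1 * x powr (1 - 3 * \<tau> * real p) + C2 * x powr (1 + \<tau> - \<tau> * real p)"
      by (simp only: powr_add[symmetric]) (simp add: algebra_simps)
    also have "\<dots> \<le> C1 * x powr (- D - 1) + C2 * x powr (- D - 1)"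
    proof (intro add_mono mult_left_mono powr_mono C x)
      show "1 + \<tau> - \<tau> * real p \<le> - D - 1" using p\<tau> by simp
      have "0 \<le> \<tau> * real p" using \<tau> by simp
      moreover have "3 * \<tau> * real p = 3 * (\<tau> * real p)" by simp
      ultimately show "1 - 3 * \<tau> * real p \<le> - D - 1" using p\<tau> \<tau> by linarith
    qed
    also have "\<dots> = (C1 + C2) * (x powr (- D) / x)" using x by (simp add: powr_diff algebra_simps add_divide_distrib)
    also have "\<dots> \<le> x / 2 * (x powr (- D) / x)" using elim x by (intro mult_right_mono) (auto simp: x_def)
    also have "\<dots> = x powr (- D) / 2" using x by simp
    finally have g: "x powr (- (3 * \<tau> * real p)) * (x * C1 + x * (C2 * x powr (\<tau> + 2 * \<tau> * real p))) \<le> x powr (- D) / 2" .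
    have "exp (- (\<delta> / 2 * (x powr \<tau>) ^ 9)) \<le> x powr (- D) / 2" using elim(1) unfolding pw by (simp add: x_def)
    then show ?case using g unfolding x_def[symmetric] f1 f2 C1_def by linarith
  qed
  then show ?thesis using that p1 by blast
qed

section \<open>The local law in a window around the edge\<close>

lemma tr_res_lipschitz:
  assumes A: "psd m A" and h: "0 < h" "h \<le> Im z" "h \<le> Im z'"
  shows "cmod (tr_res m A z - tr_res m A z') \<le> real m * (cmod (z - z') / h\<^sup>2)"
proof -
  obtain lam u where sp: "spectral m A lam u" using psd_spectral[OF A] .
  have pos: "0 < Im z" "0 < Im z'" using h by auto
  have *: "cmod (1 / (complex_of_real (lam i) - z) - 1 / (complex_of_real (lam i) - z')) \<le> cmod (z - z') / h\<^sup>2" for i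
  proof -
    have nz: "complex_of_real (lam i) - z \<noteq> 0" "complex_of_real (lam i) - z' \<noteq> 0" using pos by (auto simp: complex_eq_iff)
    have le: "cmod (1 / (complex_of_real (lam i) - y)) \<le> 1 / h" if "h \<le> Im y" for y
    proof -
      have "cmod (1 / (complex_of_real (lam i) - y)) \<le> 1 / Im y" using that h by (intro inverse_diff_norm_le) auto
      also have "\<dots> \<le> 1 / h" using that h by (intro divide_left_mono) auto
      finally show ?thesis .
    qed
    have "1 / (complex_of_real (lam i) - z) - 1 / (complex_of_real (lam i) - z') =
        (z - z') * (1 / (complex_of_real (lam i) - z)) * (1 / (complex_of_real (lam i) - z'))"
      using nz by (simp add: field_simps)
    then have "cmod (1 / (complex_of_real (lam i) - z) - 1 / (complex_of_real (lam i) - z')) =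
        cmod (z - z') * (cmod (1 / (complex_of_real (lam i) - z)) * cmod (1 / (complex_of_real (lam i) - z')))"
      by (simp only: norm_mult mult.assoc)
    moreover have "\<dots> \<le> cmod (z - z') * (1 / h * (1 / h))" using le h by (intro mult_left_mono mult_mono) auto
    ultimately show ?thesis by (simp add: power2_eq_square)
  qed
  have "tr_res m A z - tr_res m A z' = (\<Sum>i<m. 1 / (complex_of_real (lam i) - z) - 1 / (complex_of_real (lam i) - z'))"
    by (simp only: tr_res_spectral'[OF sp pos(1)] tr_res_spectral'[OF sp pos(2)] sum_subtractf)
  then have "cmod (tr_res m A z - tr_res m A z') \<le> (\<Sum>i<m. cmod (1 / (complex_of_real (lam i) - z) - 1 / (complex_of_real (lam i) - z')))"
    by (simp only: norm_sum)
  also have "\<dots> \<le> (\<Sum>i<m. cmod (z - z') / h\<^sup>2)" by (intro sum_mono *)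
  finally show ?thesis by simp
qed

lemma tr_res_gram_union:
  assumes "finite J" "finite B" "J \<inter> B = {}" "0 < Im z"
  shows "cmod (tr_res m (gram (J \<union> B) x) z - tr_res m (gram J x) z) \<le> real (card B) / Im z"
  using assms(2,3)
proof (induction B)
  case empty
  then show ?case by simp
next
  case (insert j B)
  have eq: "gram (J \<union> insert j B) x = (\<lambda>a b. gram (J \<union> B) x a b + x j a * x j b)"
    using gram_remove[of "J \<union> insert j B" j x] insert assms(1) by (auto simp: insert_Diff_if intro: finite_subset)
  have "cmod (tr_res m (gram (J \<union> insert j B) x) z - tr_res m (gram (J \<union> B) x) z) \<le> 1 / Im z"
    unfolding eq by (intro tr_res_rank_one psd_gram assms)
  moreover have "cmod (tr_res m (gram (J \<union> B) x) z - tr_res m (gram J x) z) \<le> real (card B) / Im z"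
    using insert by auto
  ultimately have "cmod (tr_res m (gram (J \<union> insert j B) x) z - tr_res m (gram J x) z) \<le> 1 / Im z + real (card B) / Im z"
    by (rule norm_diff_triangle_le)
  then show ?case using insert by (simp add: add_divide_distrib)
qed

lemma root_exists: "\<exists>w0. mp_root a b z w0"
proof -
  define w where "w = csqrt ((z - of_real ((sqrt b - sqrt a)\<^sup>2)) * (z - of_real ((sqrt b + sqrt a)\<^sup>2)))"
  have "mp_root a b z (if 0 \<le> Im w then w else - w)" by (auto simp: mp_root_def w_def)
  then show ?thesis by blast
qed

text \<open>The quadratic equation for \<open>s\<close> is stable because the root to be selected has imaginary
  part at least \<open>Im z\<close>.\<close>

lemma quadratic_stability:
  assumes a: "0 < a" and b: "0 < b" and z: "0 < Im z" and s: "0 \<le> Im (z * s)" and nz: "1 + s \<noteq> 0"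
    and w0: "mp_root a b z w0"
    and err: "cmod (of_real a + z * s - of_real b + of_real b / (1 + s)) \<le> \<epsilon>"
  shows "cmod (2 * z * s + z + of_real a - of_real b - w0) \<le> 4 * cmod z * (1 + cmod s) * \<epsilon> / Im z"
proof -
  define f where "f = (1 + s) * (of_real a + z * s - of_real b + of_real b / (1 + s))"
  define w where "w = 2 * z * s + z + of_real a - of_real b"
  have f: "f = z * s\<^sup>2 + (of_real a + z - of_real b) * s + of_real a"
    using nz by (simp add: f_def distrib_left add_divide_distrib power2_eq_square) (simp add: algebra_simps)
  have lam: "complex_of_real ((sqrt b - sqrt a)\<^sup>2) = of_real a + of_real b - 2 * of_real (sqrt a * sqrt b)"
    "complex_of_real ((sqrt b + sqrt a)\<^sup>2) = of_real a + of_real b + 2 * of_real (sqrt a * sqrt b)"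
  proof -
    have "(sqrt b - sqrt a)\<^sup>2 = a + b - 2 * (sqrt a * sqrt b)" "(sqrt b + sqrt a)\<^sup>2 = a + b + 2 * (sqrt a * sqrt b)"
      using a b by (simp_all add: power2_eq_square algebra_simps)
    then show "complex_of_real ((sqrt b - sqrt a)\<^sup>2) = of_real a + of_real b - 2 * of_real (sqrt a * sqrt b)"
      "complex_of_real ((sqrt b + sqrt a)\<^sup>2) = of_real a + of_real b + 2 * of_real (sqrt a * sqrt b)"
      by (simp_all only: of_real_add of_real_diff of_real_mult of_real_numeral)
  qed
  have q: "complex_of_real (sqrt a * sqrt b) * complex_of_real (sqrt a * sqrt b) = of_real a * of_real b"
    using a b by (simp add: flip: of_real_mult) (simp add: mult_ac)
  have "w0\<^sup>2 = (z - of_real ((sqrt b - sqrt a)\<^sup>2)) * (z - of_real ((sqrt b + sqrt a)\<^sup>2))"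
    using w0 by (simp add: mp_root_def)
  also have "\<dots> = (z - of_real a - of_real b)\<^sup>2 - 4 * (complex_of_real (sqrt a * sqrt b) * complex_of_real (sqrt a * sqrt b))"
    unfolding lam by (simp add: power2_eq_square algebra_simps)
  finally have "w0\<^sup>2 = (z - of_real a - of_real b)\<^sup>2 - 4 * (of_real a * of_real b)" unfolding q .
  then have "w\<^sup>2 - w0\<^sup>2 = 4 * z * f" unfolding w_def f by (simp add: power2_eq_square algebra_simps)
  then have prod: "(w - w0) * (w + w0) = 4 * z * f" by (simp add: power2_eq_square algebra_simps)
  have "Im w = 2 * Im (z * s) + Im z" by (simp add: w_def algebra_simps)
  moreover have "0 \<le> Im w0" using w0 by (simp add: mp_root_def)
  ultimately have "Im z \<le> Im (w + w0)" using s by simp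
  also have "\<dots> \<le> cmod (w + w0)" by (rule order_trans[OF abs_ge_self abs_Im_le_cmod])
  finally have "cmod (w - w0) * Im z \<le> cmod (w - w0) * cmod (w + w0)" by (intro mult_left_mono) auto
  also have "\<dots> = 4 * cmod z * cmod f" unfolding norm_mult[symmetric] prod by (simp add: norm_mult)
  also have "\<dots> \<le> 4 * cmod z * ((1 + cmod s) * \<epsilon>)"
  proof (intro mult_left_mono)
    have "cmod (1 + s) \<le> 1 + cmod s" using norm_triangle_ineq[of 1 s] by simp
    then show "cmod f \<le> (1 + cmod s) * \<epsilon>" unfolding f_def norm_mult using err by (intro mult_mono) auto
  qed auto
  finally show ?thesis using z unfolding w_def[symmetric] by (simp add: pos_le_divide_eq mult_ac)
qed

lemma window_bounds:
  fixes a b e \<eta> :: real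
  assumes "0 < a" "a \<le> b" "b \<le> 2" "\<bar>e\<bar> \<le> 1" "0 < \<eta>" "\<eta> \<le> 1"
  shows "cmod (Complex ((sqrt b - sqrt a)\<^sup>2 + e) \<eta>) \<le> 4"
proof -
  have "(sqrt b - sqrt a)\<^sup>2 \<le> (sqrt b)\<^sup>2" using assms by (intro power_mono) auto
  then have "(sqrt b - sqrt a)\<^sup>2 \<le> 2" using assms by simp
  then have "\<bar>(sqrt b - sqrt a)\<^sup>2 + e\<bar> + \<bar>\<eta>\<bar> \<le> 4" using assms zero_le_power2[of "sqrt b - sqrt a"] by linarith
  then show ?thesis using cmod_le[of "Complex ((sqrt b - sqrt a)\<^sup>2 + e) \<eta>"] by simp
qed

context column_law
begin

text \<open>The error in the self-consistent equation is of order \<open>1 / L ^ 5\<close>. The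
  stability estimate multiplies it by at most \<open>48 * L^2\<close>, which leaves order
  \<open>1 / L ^ 3\<close>, far below \<open>\<eta> \<ge> 1 / L\<close>.\<close>

lemma mean_law:
  fixes a b e \<eta> L :: real
  assumes fin: "finite J" and J: "J \<noteq> {}" and ab: "a = v * real m" "b = v * real (card J)" "0 < a" "a \<le> b" "b \<le> 2"
    and L: "700 \<le> L" and v: "v \<le> 2 / L ^ 20" and \<kappa>: "\<kappa> \<le> v / L ^ 10"
    and e: "\<bar>e\<bar> \<le> 1" and \<eta>: "1 / L \<le> \<eta>" "\<eta> \<le> 1"
  defines "z \<equiv> Complex ((sqrt b - sqrt a)\<^sup>2 + e) \<eta>"
  assumes w0: "mp_root a b z w0"
  shows "cmod (2 * z * (of_real v * (\<integral>x. tr_res m (gram J x) z \<partial>PiM J (\<lambda>_. \<mu>))) + z + of_real a - of_real b - w0) \<le> \<eta> / 4"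
proof -
  define E where "E = (\<integral>x. tr_res m (gram J x) z \<partial>PiM J (\<lambda>_. \<mu>))"
  define s where "s = of_real v * E"
  define n where "n = real (card J)"
  have L0: "0 < L" "1 \<le> L" using L by auto
  have \<eta>0: "0 < \<eta>" using less_le_trans[of 0 "1 / L" \<eta>] \<eta>(1) L0 by simp
  have iv: "1 / \<eta> \<le> L"
  proof -
    have "1 \<le> \<eta> * L" using \<eta>(1) L0 by (simp add: pos_divide_le_eq)
    then show ?thesis using \<eta>0 by (simp add: pos_divide_le_eq mult.commute)
  qed
  have z0: "0 < Im z" "Im z = \<eta>" using \<eta>0 by (simp_all add: z_def)
  have b0: "0 < b" using ab by linarith
  have z4: "cmod z \<le> 4" unfolding z_def by (rule window_bounds) (use ab e \<eta> \<eta>0 in auto)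
  have zL: "cmod z / \<eta> \<le> 4 * L" using mult_mono[OF z4 iv] L0 \<eta>0 by simp
  have zL0: "0 \<le> cmod z / \<eta>" using \<eta>0 by simp
  have n0: "0 < n" using fin J by (simp add: n_def card_gt_0_iff)
  have s1: "0 \<le> Im (z * s)" unfolding s_def E_def by (rule Im_mult_mean[OF fin J z0(1)])
  have nz: "1 + s \<noteq> 0" by (rule norm_inverse_one_plus(2)[OF z0(1) s1])
  interpret PJ: prob_space "PiM J (\<lambda>_. \<mu>)" by (intro prob_space_PiM prob_space_axioms)
  have Eb: "cmod E \<le> real m / \<eta>"
  proof -
    have "cmod E \<le> (\<integral>x. cmod (tr_res m (gram J x) z) \<partial>PiM J (\<lambda>_. \<mu>))" unfolding E_def by (rule integral_norm_bound)
    also have "\<dots> \<le> (\<integral>x. real m / \<eta> \<partial>PiM J (\<lambda>_. \<mu>))"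
      using tr_res_bound[OF psd_gram z0(1), unfolded z0(2)] integrable_S[OF fin J z0(1)]
      by (intro integral_mono integrable_norm) auto
    finally show ?thesis by (simp add: PJ.prob_space)
  qed
  have sb: "1 + cmod s \<le> 3 * L"
  proof -
    have "cmod s = v * cmod E" using v_pos by (simp add: s_def norm_mult)
    also have "\<dots> \<le> v * (real m / \<eta>)" using Eb v_pos by (intro mult_left_mono) auto
    also have "\<dots> = a * (1 / \<eta>)" by (simp add: ab(1))
    also have "\<dots> \<le> 2 * L" using ab(3-5) iv \<eta>0 by (intro mult_mono) auto
    finally show ?thesis using L0 by simp
  qed
  have Lp: "0 < L ^ k" for k using L0 by simp
  have km: "(\<kappa> + 2 * v\<^sup>2) * real m \<le> 10 / L ^ 10"
  proof -
    have "2 / L ^ 20 \<le> 2 / L ^ 10" using L0 power_increasing[of 10 20 L] by (intro divide_left_mono) auto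
    then have "2 * v \<le> 4 / L ^ 10" using v by simp
    then have "v * (2 * v) \<le> v * (4 / L ^ 10)" using v_pos by (intro mult_left_mono) auto
    moreover have "v * (5 / L ^ 10) = v * (4 / L ^ 10) + v / L ^ 10" by simp
    ultimately have "\<kappa> + 2 * v\<^sup>2 \<le> v * (5 / L ^ 10)" using \<kappa> unfolding power2_eq_square by linarith
    then have "(\<kappa> + 2 * v\<^sup>2) * real m \<le> v * (5 / L ^ 10) * real m" by (intro mult_right_mono) auto
    also have "\<dots> = a * (5 / L ^ 10)" by (simp add: ab(1))
    also have "\<dots> \<le> 2 * (5 / L ^ 10)" using ab(4,5) Lp[of 10] by (intro mult_right_mono) auto
    finally show ?thesis by simp
  qed
  have vn: "v + v * (16 * sqrt n) \<le> 34 / L ^ 10"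
  proof -
    have sv: "sqrt v * sqrt v = v" using v_pos by simp
    have "v * sqrt n = sqrt v * sqrt b" unfolding ab(2) n_def[symmetric] real_sqrt_mult using sv by (simp add: mult.assoc[symmetric])
    also have "\<dots> \<le> sqrt (2 / L ^ 20) * sqrt 2" using v ab(5) v_pos b0 by (intro mult_mono) auto
    also have "\<dots> = sqrt (4 / L ^ 20)" by (simp add: real_sqrt_mult[symmetric])
    also have "4 / L ^ 20 = (2 / L ^ 10)\<^sup>2" by (simp add: power_divide)
    also have "sqrt \<dots> = 2 / L ^ 10" using Lp[of 10] by (simp only: real_sqrt_abs) simp
    finally have 1: "v * sqrt n \<le> 2 / L ^ 10" .
    have "2 / L ^ 20 \<le> 2 / L ^ 10" using L0 power_increasing[of 10 20 L] by (intro divide_left_mono) auto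
    then have 2: "v \<le> 2 / L ^ 10" using v by simp
    define q where "q = 1 / L ^ 10"
    have "34 / L ^ 10 = 34 * q" "2 / L ^ 10 = 2 * q" by (simp_all add: q_def)
    then show ?thesis using 1 2 by simp
  qed
  \<comment> \<open>\<open>2368 = 1280 + 1088\<close>: the variance term of order
    \<open>1 / L ^ 5\<close> and the fluctuation term of order \<open>1 / L ^ 7\<close>, the latter
    enlarged to \<open>1 / L ^ 5\<close>.\<close>
  define \<epsilon> where "\<epsilon> = 2368 / L ^ 5"
  have err: "cmod (of_real a + z * s - of_real b + of_real b / (1 + s)) \<le> \<epsilon>"
  proof -
    define X where "X = of_nat m + z * E - of_nat (card J) + of_nat (card J) / (1 + s)"
    have alg: "V * p + y * (V * x) - V * q + V * q / D = V * (p + y * x - q + q / D)" for V p q x y D :: complex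
      by (simp add: algebra_simps)
    have c: "complex_of_real a = of_real v * of_nat m" "complex_of_real b = of_real v * of_nat (card J)" by (simp_all add: ab(1,2))
    have sE: "z * s = z * (of_real v * E)" by (simp add: s_def)
    have eq: "of_real a + z * s - of_real b + of_real b / (1 + s) = of_real v * X"
      unfolding c sE X_def by (rule alg)
    have "cmod (of_real a + z * s - of_real b + of_real b / (1 + s)) = v * cmod X"
      unfolding eq norm_mult using v_pos by simp
    also have "\<dots> = v * cmod (of_nat m + z * E - of_nat (card J) + of_nat (card J) / (1 + s))" by (simp only: X_def)
    finally have n1: "cmod (of_real a + z * s - of_real b + of_real b / (1 + s)) = v * cmod (of_nat m + z * E - of_nat (card J) + of_nat (card J) / (1 + s))" .
    define A B where "A = (\<kappa> + 2 * v\<^sup>2) * real m / \<eta>\<^sup>2" and "B = v / \<eta> + v * (16 * sqrt n / \<eta>)"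
    have n2: "cmod (of_nat m + z * E - of_nat (card J) + of_nat (card J) / (1 + s)) \<le> n * ((cmod z / \<eta>) ^ 3 * A + (cmod z / \<eta>)\<^sup>2 * B)"
      using self_consistent[OF fin J z0(1)] unfolding s_def E_def n_def z0(2) A_def B_def .
    have n3: "v * cmod (of_nat m + z * E - of_nat (card J) + of_nat (card J) / (1 + s)) \<le> b * ((cmod z / \<eta>) ^ 3 * A + (cmod z / \<eta>)\<^sup>2 * B)"
      using mult_left_mono[OF n2, of v] v_pos unfolding ab(2) n_def[symmetric] by (simp only: mult.assoc less_imp_le)
    have iv2: "(1 / \<eta>)\<^sup>2 \<le> L\<^sup>2" using iv \<eta>0 by (intro power_mono) auto
    have A: "A \<le> 10 / L ^ 10 * L\<^sup>2" "0 \<le> A"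
    proof -
      have "A = (\<kappa> + 2 * v\<^sup>2) * real m * (1 / \<eta>)\<^sup>2" by (simp add: A_def power_divide)
      also have "\<dots> \<le> 10 / L ^ 10 * L\<^sup>2" by (rule mult_mono[OF km iv2]) (use L0 in auto)
      finally show "A \<le> 10 / L ^ 10 * L\<^sup>2" .
      show "0 \<le> A" using \<kappa>_nonneg by (simp add: A_def)
    qed
    have B: "B \<le> 34 / L ^ 10 * L" "0 \<le> B"
    proof -
      have "B = (v + v * (16 * sqrt n)) * (1 / \<eta>)" by (simp add: B_def add_divide_distrib)
      also have "\<dots> \<le> 34 / L ^ 10 * L" by (rule mult_mono[OF vn iv]) (use L0 \<eta>0 in auto)
      finally show "B \<le> 34 / L ^ 10 * L" .
      show "0 \<le> B" using v_pos \<eta>0 n0 by (simp add: B_def)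
    qed
    have t1: "(cmod z / \<eta>) ^ 3 * A \<le> (4 * L) ^ 3 * (10 / L ^ 10 * L\<^sup>2)"
      by (rule mult_mono[OF power_mono[OF zL zL0] A(1) _ A(2)]) (use L0 in auto)
    have t2: "(cmod z / \<eta>)\<^sup>2 * B \<le> (4 * L)\<^sup>2 * (34 / L ^ 10 * L)"
      by (rule mult_mono[OF power_mono[OF zL zL0] B(1) _ B(2)]) (use L0 in auto)
    have p0: "0 \<le> (cmod z / \<eta>) ^ 3 * A + (cmod z / \<eta>)\<^sup>2 * B" using A B zL0 by (intro add_nonneg_nonneg mult_nonneg_nonneg) auto
    have n4: "b * ((cmod z / \<eta>) ^ 3 * A + (cmod z / \<eta>)\<^sup>2 * B) \<le> 2 * ((4 * L) ^ 3 * (10 / L ^ 10 * L\<^sup>2) + (4 * L)\<^sup>2 * (34 / L ^ 10 * L))"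
      by (rule mult_mono[OF ab(5) add_mono[OF t1 t2] _ p0]) simp
    have n5: "2 * ((4 * L) ^ 3 * (10 / L ^ 10 * L\<^sup>2) + (4 * L)\<^sup>2 * (34 / L ^ 10 * L)) = 1280 * (L ^ 5 / L ^ 10) + 1088 * (L ^ 3 / L ^ 10)"
      by (simp add: power_mult_distrib power_numeral_reduce)
    have q5: "L ^ 5 / L ^ 10 = 1 / L ^ 5" "L ^ 3 / L ^ 10 = 1 / L ^ 7" using L0 by (simp_all add: field_simps power_numeral_reduce)
    have q7: "1 / L ^ 7 \<le> 1 / L ^ 5" using L0 power_increasing[of 5 7 L] by (intro divide_left_mono) auto
    have n6: "cmod (of_real a + z * s - of_real b + of_real b / (1 + s)) \<le> 1280 * (1 / L ^ 5) + 1088 * (1 / L ^ 7)"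
      using n1 n3 n4 n5 unfolding q5 by linarith
    have "cmod (of_real a + z * s - of_real b + of_real b / (1 + s)) \<le> 2368 * (1 / L ^ 5)" using n6 q7 by linarith
    then show ?thesis by (simp add: \<epsilon>_def)
  qed
  have "cmod (2 * z * s + z + of_real a - of_real b - w0) \<le> 4 * cmod z * (1 + cmod s) * \<epsilon> / \<eta>"
    using quadratic_stability[OF ab(3) b0 z0(1) s1 nz w0 err] unfolding z0(2) .
  also have "\<dots> = 4 * cmod z * (1 + cmod s) * \<epsilon> * (1 / \<eta>)" by simp
  also have "\<dots> \<le> 4 * 4 * (3 * L) * \<epsilon> * L"
    by (intro mult_mono z4 sb iv order_refl) (use L0 \<eta>0 in \<open>auto simp: \<epsilon>_def intro!: mult_nonneg_nonneg\<close>)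
  also have "\<dots> = 113664 / L ^ 3" using L0 by (simp add: \<epsilon>_def field_simps power_numeral_reduce)
  \<comment> \<open>\<open>4 * 113664 = 454656 \<le> 700^2\<close> is the origin of the assumption
    \<open>700 \<le> L\<close>.\<close>
  also have "\<dots> \<le> (1 / L) / 4"
  proof -
    have "700\<^sup>2 \<le> L\<^sup>2" using L by (intro power_mono) auto
    then have "454656 * (1 / L ^ 3) \<le> L\<^sup>2 * (1 / L ^ 3)" using Lp[of 3] by (intro mult_right_mono) auto
    also have "L\<^sup>2 * (1 / L ^ 3) = 1 / L" using L0 by (simp add: field_simps power_numeral_reduce)
    finally show ?thesis by simp
  qed
  also have "\<dots> \<le> \<eta> / 4" using \<eta> by simp
  finally show ?thesis unfolding s_def E_def .
qed

text \<open>McDiarmid's inequality on a grid and Lipschitz bounds in between, for the trace and for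
  its mean. The root \<open>w0\<close> need not vary continuously, since \<open>mean_law\<close> is
  applied at the actual point and not at the grid point.\<close>

lemma local_law:
  fixes a b L :: real
  assumes fin: "finite J" and J: "J \<noteq> {}" and ab: "a = v * real m" "b = v * real (card J)" "0 < a" "a \<le> b" "b \<le> 2"
    and L: "700 \<le> L" and v: "v \<le> 2 / L ^ 20" and \<kappa>: "\<kappa> \<le> v / L ^ 10"
  obtains F where "F \<in> sets (PiM J (\<lambda>_. \<mu>))" "measure (PiM J (\<lambda>_. \<mu>)) F \<le> 2 ^ 22 * L ^ 6 * exp (- (L ^ 16 / 2 ^ 17))"
    "\<And>x e \<eta> w0. x \<in> space (PiM J (\<lambda>_. \<mu>)) - F \<Longrightarrow> \<bar>e\<bar> \<le> 1 \<Longrightarrow> 1 / L \<le> \<eta> \<Longrightarrow> \<eta> \<le> 1 \<Longrightarrow>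
      mp_root a b (Complex ((sqrt b - sqrt a)\<^sup>2 + e) \<eta>) w0 \<Longrightarrow>
      cmod (2 * Complex ((sqrt b - sqrt a)\<^sup>2 + e) \<eta> * (of_real v * tr_res m (gram J x) (Complex ((sqrt b - sqrt a)\<^sup>2 + e) \<eta>))
        + Complex ((sqrt b - sqrt a)\<^sup>2 + e) \<eta> + of_real a - of_real b - w0) \<le> 3 / 4 * \<eta>"
proof -
  define z where "z = (\<lambda>e \<eta>. Complex ((sqrt b - sqrt a)\<^sup>2 + e) \<eta>)"
  define E where "E = (\<lambda>z. \<integral>x. tr_res m (gram J x) z \<partial>PiM J (\<lambda>_. \<mu>))"
  \<comment> \<open>The budget: \<open>v * d = 1 / (32 * L)\<close> and two Lipschitz errors
    \<open>1 / (64 * L)\<close> add up to at most \<open>\<eta> / 16\<close>. The factor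
    \<open>2 * cmod z \<le> 8\<close> makes this \<open>\<eta> / 2\<close>, and
    \<open>mean_law\<close> adds \<open>\<eta> / 4\<close>. The last quarter of
    \<open>\<eta>\<close> is kept for the columns with large entries.\<close>
  define d where "d = 1 / (32 * v * L)"
  define K where "K = nat \<lceil>256 * L ^ 3\<rceil>"
  have L0: "0 < L" "1 \<le> L" using L by auto
  have L3: "1 \<le> L ^ 3" using L0 by (intro one_le_power) auto
  have d0: "0 < d" using v_pos L0 by (simp add: d_def)
  have K: "256 * L ^ 3 \<le> real K" "real K \<le> 257 * L ^ 3"
  proof -
    show "256 * L ^ 3 \<le> real K" unfolding K_def by linarith
    have "real K < 256 * L ^ 3 + 1" unfolding K_def using L3 by linarith
    then show "real K \<le> 257 * L ^ 3" using L3 by linarith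
  qed
  have K0: "0 < real K" using K L3 by linarith
  interpret PJ: prob_space "PiM J (\<lambda>_. \<mu>)" by (intro prob_space_PiM prob_space_axioms)
  define G where "G = {- int K..int K} \<times> {i \<in> {1..K}. 1 / L \<le> real i / real K}"
  define F1 where "F1 = (\<lambda>(i :: int, k :: nat). {x \<in> space (PiM J (\<lambda>_. \<mu>)).
      d \<le> cmod (tr_res m (gram J x) (z (of_int i / real K) (real k / real K)) - E (z (of_int i / real K) (real k / real K)))})"
  define F where "F = (\<Union>g\<in>G. F1 g)"
  have finG: "finite G" by (simp add: G_def)
  have cardG: "real (card G) \<le> 3 * (257 * L ^ 3)\<^sup>2"
  proof -
    have "card G \<le> card ({- int K..int K} \<times> {1..K})" unfolding G_def by (intro card_mono) auto
    also have "\<dots> = (2 * K + 1) * K" by (simp add: card_cartesian_product nat_add_distrib nat_mult_distrib)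
    finally have "real (card G) \<le> real ((2 * K + 1) * K)" by (simp only: of_nat_le_iff)
    also have "\<dots> \<le> 3 * (real K * real K)" using K0 by (simp add: algebra_simps)
    also have "\<dots> \<le> 3 * (257 * L ^ 3)\<^sup>2" unfolding power2_eq_square using K K0 L0 by (intro mult_left_mono mult_mono) auto
    finally show ?thesis .
  qed
  have F1m: "F1 g \<in> sets (PiM J (\<lambda>_. \<mu>))" for g
  proof (cases g)
    case (Pair i k)
    have "(\<lambda>x. tr_res m (gram J x) (z (of_int i / real K) (real k / real K))) \<in> borel_measurable (PiM J (\<lambda>_. \<mu>))"
      by (intro measurable_tr_res measurable_gram borel_measurable_const) auto
    then show ?thesis unfolding F1_def Pair by simp
  qed
  have F1p: "measure (PiM J (\<lambda>_. \<mu>)) (F1 g) \<le> 4 * exp (- (L ^ 16 / 2 ^ 17))" if g: "g \<in> G" for g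
  proof (cases g)
    case (Pair i k)
    define y where "y = z (of_int i / real K) (real k / real K)"
    have y: "1 / L \<le> Im y" using g by (auto simp: G_def Pair y_def z_def)
    then have y0: "0 < Im y" using less_le_trans[of 0 "1 / L" "Im y"] L0 by simp
    have "measure (PiM J (\<lambda>_. \<mu>)) (F1 g) \<le> 4 * exp (- (d * Im y)\<^sup>2 / (32 * real (card J)))"
      using S_tail[OF fin J y0 d0] unfolding F1_def Pair y_def E_def by simp
    also have "\<dots> \<le> 4 * exp (- (L ^ 16 / 2 ^ 17))"
    proof -
      have n0: "0 < real (card J)" using fin J by (simp add: card_gt_0_iff)
      have "v * b \<le> 2 / L ^ 20 * 2" using v ab v_pos L0 by (intro mult_mono) auto
      then have vb: "v * b * (2 ^ 15 * L ^ 4) \<le> 2 / L ^ 20 * 2 * (2 ^ 15 * L ^ 4)" using L0 by (intro mult_right_mono) auto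
      have "2 / L ^ 20 * 2 * (2 ^ 15 * L ^ 4) = 2 ^ 17 / L ^ 16" using L0 by (simp add: field_simps power_numeral_reduce)
      then have le: "v * b * (2 ^ 15 * L ^ 4) \<le> 2 ^ 17 / L ^ 16" using vb by simp
      have vb0: "0 < v * b * (2 ^ 15 * L ^ 4)" using v_pos ab(3,4) L0 by simp
      have "L ^ 16 / 2 ^ 17 = 1 / (2 ^ 17 / L ^ 16)" by simp
      also have "\<dots> \<le> 1 / (v * b * (2 ^ 15 * L ^ 4))" using le vb0 L0 by (intro divide_left_mono) auto
      also have "\<dots> = (d * (1 / L))\<^sup>2 / (32 * real (card J))"
        using v_pos L0 n0 by (simp add: d_def ab(2) field_simps power2_eq_square power_numeral_reduce)
      also have "\<dots> \<le> (d * Im y)\<^sup>2 / (32 * real (card J))" using y d0 L0 by (intro divide_right_mono power_mono mult_left_mono) auto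
      finally show ?thesis by simp
    qed
    finally show ?thesis .
  qed
  have "measure (PiM J (\<lambda>_. \<mu>)) F \<le> (\<Sum>g\<in>G. measure (PiM J (\<lambda>_. \<mu>)) (F1 g))"
    unfolding F_def using finG F1m by (intro measure_UNION_le) auto
  also have "\<dots> \<le> (\<Sum>g\<in>G. 4 * exp (- (L ^ 16 / 2 ^ 17)))" by (intro sum_mono F1p)
  also have "\<dots> = real (card G) * (4 * exp (- (L ^ 16 / 2 ^ 17)))" by simp
  also have "\<dots> \<le> 3 * (257 * L ^ 3)\<^sup>2 * (4 * exp (- (L ^ 16 / 2 ^ 17)))" using cardG by (intro mult_right_mono) auto
  also have "\<dots> = 792588 * (L ^ 6 * exp (- (L ^ 16 / 2 ^ 17)))" by (simp add: power_mult_distrib power_mult[symmetric])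
  also have "\<dots> \<le> 2 ^ 22 * (L ^ 6 * exp (- (L ^ 16 / 2 ^ 17)))" using L0 by (intro mult_right_mono) auto
  finally have Fp: "measure (PiM J (\<lambda>_. \<mu>)) F \<le> 2 ^ 22 * L ^ 6 * exp (- (L ^ 16 / 2 ^ 17))" by (simp only: mult.assoc)
  have Fm: "F \<in> sets (PiM J (\<lambda>_. \<mu>))" unfolding F_def using finG F1m by (intro sets.finite_UN) auto
  have Elip: "cmod (E y - E y') \<le> real m * (cmod (y - y') / h\<^sup>2)" if h: "0 < h" "h \<le> Im y" "h \<le> Im y'" for y y' h
  proof -
    have y: "0 < Im y" "0 < Im y'" using h by auto
    have "E y - E y' = (\<integral>x. tr_res m (gram J x) y - tr_res m (gram J x) y' \<partial>PiM J (\<lambda>_. \<mu>))"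
      unfolding E_def by (intro Bochner_Integration.integral_diff[symmetric] integrable_S fin J y)
    then have "cmod (E y - E y') \<le> (\<integral>x. cmod (tr_res m (gram J x) y - tr_res m (gram J x) y') \<partial>PiM J (\<lambda>_. \<mu>))"
      by (simp only: integral_norm_bound)
    also have "\<dots> \<le> (\<integral>x. real m * (cmod (y - y') / h\<^sup>2) \<partial>PiM J (\<lambda>_. \<mu>))"
      by (intro integral_mono integrable_norm Bochner_Integration.integrable_diff integrable_S fin J y tr_res_lipschitz psd_gram h) auto
    finally show ?thesis by (simp add: PJ.prob_space)
  qed
  have law: "cmod (2 * z e \<eta> * (of_real v * tr_res m (gram J x) (z e \<eta>)) + z e \<eta> + of_real a - of_real b - w0) \<le> 3 / 4 * \<eta>"
    if x: "x \<in> space (PiM J (\<lambda>_. \<mu>)) - F" and e: "\<bar>e\<bar> \<le> 1" and \<eta>: "1 / L \<le> \<eta>" "\<eta> \<le> 1" and w0: "mp_root a b (z e \<eta>) w0" for x e \<eta> w0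
  proof -
    \<comment> \<open>The height is rounded up, so that the grid point stays above
      \<open>1 / L\<close> and belongs to \<open>G\<close>.\<close>
    define i k where "i = \<lfloor>e * real K\<rfloor>" and "k = nat \<lceil>\<eta> * real K\<rceil>"
    define y where "y = z (of_int i / real K) (real k / real K)"
    have \<eta>0: "0 < \<eta>" using less_le_trans[of 0 "1 / L" \<eta>] \<eta>(1) L0 by simp
    have \<eta>K: "0 < \<eta> * real K" "\<eta> * real K \<le> real K" using \<eta>0 K0 \<eta> mult_right_mono[of \<eta> 1 "real K"] by auto
    have eK: "- real K \<le> e * real K" "e * real K \<le> real K" using e K0 mult_right_mono[of e 1 "real K"] mult_right_mono[of "-1" e "real K"] by auto
    have ib: "of_int i \<le> e * real K" "e * real K < of_int i + 1" by (auto simp: i_def)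
    have kb: "\<eta> * real K \<le> real k" "real k < \<eta> * real K + 1" unfolding k_def using \<eta>K by linarith+
    have ki: "1 \<le> k" "k \<le> K" "- int K \<le> i" "i \<le> int K" using ib kb \<eta>K eK by linarith+
    have kL: "\<eta> \<le> real k / real K" using kb K0 by (simp add: pos_le_divide_eq)
    have g: "(i, k) \<in> G" using ki kL \<eta> by (auto simp: G_def)
    then have "x \<notin> F1 (i, k)" using x by (auto simp: F_def)
    then have conc: "cmod (tr_res m (gram J x) y - E y) \<le> d" using x by (simp add: F1_def y_def)
    have Imy: "1 / L \<le> Im y" "1 / L \<le> Im (z e \<eta>)" using kL \<eta> by (auto simp: y_def z_def)
    have dist: "cmod (z e \<eta> - y) \<le> 1 / (128 * L ^ 3)"
    proof -
      have 1: "\<bar>e - of_int i / real K\<bar> \<le> 1 / real K"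
      proof -
        have "e - of_int i / real K = (e * real K - of_int i) / real K" using K0 by (simp add: field_simps)
        moreover have "\<bar>e * real K - of_int i\<bar> \<le> 1" using ib by linarith
        ultimately show ?thesis using K0 by (simp add: abs_divide divide_right_mono)
      qed
      have 2: "\<bar>\<eta> - real k / real K\<bar> \<le> 1 / real K"
      proof -
        have "\<eta> - real k / real K = (\<eta> * real K - real k) / real K" using K0 by (simp add: field_simps)
        moreover have "\<bar>\<eta> * real K - real k\<bar> \<le> 1" using kb by linarith
        ultimately show ?thesis using K0 by (simp add: abs_divide divide_right_mono)
      qed
      have "cmod (z e \<eta> - y) \<le> \<bar>e - of_int i / real K\<bar> + \<bar>\<eta> - real k / real K\<bar>"
        using cmod_le[of "z e \<eta> - y"] by (simp add: z_def y_def)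
      also have "\<dots> \<le> 2 / real K" using 1 2 by simp
      also have "\<dots> \<le> 2 / (256 * L ^ 3)" using K K0 L0 by (intro divide_left_mono) auto
      finally show ?thesis by simp
    qed
    have lip: "v * (real m * (cmod (z e \<eta> - y) / (1 / L)\<^sup>2)) \<le> 1 / (64 * L)"
    proof -
      have "v * (real m * (cmod (z e \<eta> - y) / (1 / L)\<^sup>2)) = a * (cmod (z e \<eta> - y) * L\<^sup>2)" by (simp add: ab(1) power_divide)
      also have "\<dots> \<le> 2 * (1 / (128 * L ^ 3) * L\<^sup>2)" using ab dist L0 by (intro mult_mono mult_right_mono) auto
      also have "\<dots> = 1 / (64 * L)" using L0 by (simp add: field_simps power_numeral_reduce)
      finally show ?thesis .
    qed
    define T where "T = tr_res m (gram J x)"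
    have vd: "v * d = 1 / (32 * L)" using v_pos by (simp add: d_def)
    have hL: "0 < 1 / L" using L0 by simp
    have yz: "cmod (y - z e \<eta>) = cmod (z e \<eta> - y)" by (rule norm_minus_commute)
    have "cmod (T (z e \<eta>) - E (z e \<eta>)) \<le> cmod (T (z e \<eta>) - T y) + cmod (T y - E y) + cmod (E y - E (z e \<eta>))"
    proof -
      have tri: "cmod (A - D) \<le> cmod (A - B) + cmod (B - C) + cmod (C - D)" for A B C D :: complex
        using norm_triangle_ineq[of "A - B" "B - D"] norm_triangle_ineq[of "B - C" "C - D"] by simp
      show ?thesis by (rule tri)
    qed
    then have "cmod (T (z e \<eta>) - E (z e \<eta>)) \<le> real m * (cmod (z e \<eta> - y) / (1 / L)\<^sup>2) + d + real m * (cmod (z e \<eta> - y) / (1 / L)\<^sup>2)"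
      using tr_res_lipschitz[OF psd_gram hL Imy(2) Imy(1), of m J x] conc Elip[OF hL Imy] unfolding T_def yz by linarith
    then have lin: "v * cmod (T (z e \<eta>) - E (z e \<eta>)) \<le> v * (real m * (cmod (z e \<eta> - y) / (1 / L)\<^sup>2) + d + real m * (cmod (z e \<eta> - y) / (1 / L)\<^sup>2))"
      using v_pos by (intro mult_left_mono) auto
    have arith: "X \<le> A + B + A \<Longrightarrow> A \<le> C \<Longrightarrow> B = D \<Longrightarrow> X \<le> C + D + C" for X A B C D :: real by linarith
    have "v * cmod (T (z e \<eta>) - E (z e \<eta>)) \<le> 1 / (64 * L) + 1 / (32 * L) + 1 / (64 * L)"
      by (rule arith[OF lin[unfolded distrib_left] lip vd])
    also have "\<dots> = 1 / 16 * (1 / L)" by simp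
    finally have dev: "v * cmod (T (z e \<eta>) - E (z e \<eta>)) \<le> \<eta> / 16" using \<eta> by linarith
    have z4: "cmod (z e \<eta>) \<le> 4" unfolding z_def by (rule window_bounds) (use ab e \<eta> \<eta>0 in auto)
    have "2 * z e \<eta> * (of_real v * T (z e \<eta>)) + z e \<eta> + of_real a - of_real b - w0 =
       2 * z e \<eta> * of_real v * (T (z e \<eta>) - E (z e \<eta>)) + (2 * z e \<eta> * (of_real v * E (z e \<eta>)) + z e \<eta> + of_real a - of_real b - w0)"
      by (simp add: algebra_simps)
    then have "cmod (2 * z e \<eta> * (of_real v * T (z e \<eta>)) + z e \<eta> + of_real a - of_real b - w0) \<le>
      cmod (2 * z e \<eta> * of_real v * (T (z e \<eta>) - E (z e \<eta>))) + cmod (2 * z e \<eta> * (of_real v * E (z e \<eta>)) + z e \<eta> + of_real a - of_real b - w0)"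
      by (simp only: norm_triangle_ineq)
    moreover have "cmod (2 * z e \<eta> * of_real v * (T (z e \<eta>) - E (z e \<eta>))) = 2 * cmod (z e \<eta>) * (v * cmod (T (z e \<eta>) - E (z e \<eta>)))"
      using v_pos by (simp add: norm_mult)
    moreover have "2 * cmod (z e \<eta>) * (v * cmod (T (z e \<eta>) - E (z e \<eta>))) \<le> 2 * 4 * (\<eta> / 16)"
      using z4 dev v_pos \<eta>0 by (intro mult_mono) auto
    moreover have "cmod (2 * z e \<eta> * (of_real v * E (z e \<eta>)) + z e \<eta> + of_real a - of_real b - w0) \<le> \<eta> / 4"
      unfolding z_def E_def by (rule mean_law[OF fin J ab L v \<kappa> e \<eta>]) (use w0 in \<open>simp add: z_def\<close>)
    ultimately show ?thesis unfolding T_def by linarith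
  qed
  show ?thesis by (rule that[OF Fm Fp law[unfolded z_def]])
qed

end

lemma bform_gram_mono:
  assumes "finite J" "finite B" "J \<inter> B = {}"
  shows "bform m (gram J x) y y \<le> bform m (gram (J \<union> B) x) y y"
proof -
  have "gram (J \<union> B) x = (\<lambda>a b. gram J x a b + gram B x a b)"
    using assms by (simp add: gram_def fun_eq_iff sum.union_disjoint)
  then have "bform m (gram (J \<union> B) x) y y = bform m (gram J x) y y + bform m (gram B x) y y"
    by (simp add: bform_def distrib_right sum.distrib)
  moreover have "0 \<le> bform m (gram B x) y y" using psd_gram[of m B x] by (simp add: psd_def)
  ultimately show ?thesis by simp
qed

text \<open>The exceptional event concerns the columns in \<open>J\<close> only; those of
  \<open>x'\<close> in \<open>B\<close> are arbitrary. They can only raise the quadratic form, and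
  they move the trace by at most \<open>card B / \<eta>\<close>, which the assumption on
  \<open>card B\<close> turns into a deviation of at most \<open>\<eta> / 4\<close>.\<close>

lemma (in column_law) edge_law_event:
  fixes a b \<delta> L N :: real and p :: nat
  assumes fin: "finite J" "finite B" "J \<inter> B = {}" and ab: "a = v * real m" "b = v * real (card J)"
    and \<delta>: "0 < \<delta>" "\<delta> \<le> 1" "\<delta> \<le> a" "\<delta> \<le> sqrt b - sqrt a" "b \<le> 2"
    and L: "700 \<le> L" "14 / \<delta> ^ 4 \<le> L" and v: "v \<le> 2 / L ^ 20" and \<kappa>: "\<kappa> \<le> v / L ^ 10"
    and p: "1 \<le> p" and N: "real (card J) \<le> N" "real m \<le> N" and B: "32 * (v * real (card B) * L\<^sup>2) \<le> 1"
  obtains F where "F \<in> sets (PiM J (\<lambda>_. \<mu>))"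
    "measure (PiM J (\<lambda>_. \<mu>)) F \<le> lower_edge_error \<delta> p L N
       + 2 ^ 22 * L ^ 6 * exp (- (L ^ 16 / 2 ^ 17))"
    "\<And>x x' lam u. x \<in> space (PiM J (\<lambda>_. \<mu>)) - F \<Longrightarrow> (\<And>j. j \<in> J \<Longrightarrow> x' j = x j) \<Longrightarrow> spectral m (gram (J \<union> B) x') lam u \<Longrightarrow>
       edge_law a b v m lam (12 / \<delta> ^ 4) (1 / L)"
proof -
  have a0: "0 < a" using \<delta> by simp
  have "sqrt a < sqrt b" using \<delta> by linarith
  then have ab': "a \<le> b" by simp
  have J: "J \<noteq> {}" using ab ab' a0 by auto
  have L0: "0 < L" "200 \<le> L" using L by auto
  define P where "P = PiM J (\<lambda>_. \<mu>)"
  interpret PJ: prob_space P unfolding P_def by (intro prob_space_PiM prob_space_axioms)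
  define F1 where "F1 = {x \<in> space P. \<exists>y. bform m (gram J x) y y < ((sqrt b - sqrt a)\<^sup>2 - 12 / \<delta> ^ 4 / L) * dotp m y y}"
  have F1m: "F1 \<in> sets P"
    unfolding F1_def P_def by (intro measurable_below_form borel_measurable_const measurable_gram) auto
  have F1p: "measure P F1 \<le> lower_edge_error \<delta> p L N"
    unfolding F1_def P_def by (rule lower_edge_bound[OF fin(1) ab \<delta> L0(2) L(2) v \<kappa> p N])
  obtain F2 where F2: "F2 \<in> sets P" "measure P F2 \<le> 2 ^ 22 * L ^ 6 * exp (- (L ^ 16 / 2 ^ 17))"
    and law: "\<And>x e \<eta> w0. x \<in> space P - F2 \<Longrightarrow> \<bar>e\<bar> \<le> 1 \<Longrightarrow> 1 / L \<le> \<eta> \<Longrightarrow> \<eta> \<le> 1 \<Longrightarrow>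
      mp_root a b (Complex ((sqrt b - sqrt a)\<^sup>2 + e) \<eta>) w0 \<Longrightarrow>
      cmod (2 * Complex ((sqrt b - sqrt a)\<^sup>2 + e) \<eta> * (of_real v * tr_res m (gram J x) (Complex ((sqrt b - sqrt a)\<^sup>2 + e) \<eta>))
        + Complex ((sqrt b - sqrt a)\<^sup>2 + e) \<eta> + of_real a - of_real b - w0) \<le> 3 / 4 * \<eta>"
    using local_law[OF fin(1) J ab a0 ab' \<delta>(5) L(1) v \<kappa>] unfolding P_def by blast
  have "measure P (F1 \<union> F2) \<le> measure P F1 + measure P F2" by (rule measure_Un_le[OF F1m F2(1)])
  then have prob: "measure P (F1 \<union> F2) \<le> lower_edge_error \<delta> p L N
       + 2 ^ 22 * L ^ 6 * exp (- (L ^ 16 / 2 ^ 17))"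
    using F1p F2(2) by linarith
  have main: "edge_law a b v m lam (12 / \<delta> ^ 4) (1 / L)"
    if x: "x \<in> space P - (F1 \<union> F2)" and x': "\<And>j. j \<in> J \<Longrightarrow> x' j = x j" and sp: "spectral m (gram (J \<union> B) x') lam u" for x x' lam u
  proof -
    have g: "gram J x' = gram J x" using x' by (simp add: gram_def fun_eq_iff)
    have 1: "(sqrt b - sqrt a)\<^sup>2 - 12 / \<delta> ^ 4 / L \<le> lam i" if i: "i < m" for i
    proof -
      have on: "orthonormal m m u" using sp by (simp add: spectral_def)
      have u1: "dotp m (u i) (u i) = 1" using orthonormal_dotp[OF on i i] by simp
      have "bform m (gram (J \<union> B) x') (u i) (u i) = (\<Sum>k<m. lam k * dotp m (u k) (u i) * dotp m (u k) (u i))"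
        by (rule spectral_bform[OF sp])
      also have "\<dots> = (\<Sum>k<m. if k = i then lam k else 0)"
        using orthonormal_dotp[OF on _ i] by (intro sum.cong) auto
      finally have bl: "bform m (gram (J \<union> B) x') (u i) (u i) = lam i" using i by simp
      have "((sqrt b - sqrt a)\<^sup>2 - 12 / \<delta> ^ 4 / L) * dotp m (u i) (u i) \<le> bform m (gram J x) (u i) (u i)"
        using x unfolding F1_def by (auto simp: not_less)
      then show ?thesis using bform_gram_mono[OF fin, of m x' "u i"] unfolding g u1 bl by simp
    qed
    have 2: "\<exists>w0. mp_root a b (Complex ((sqrt b - sqrt a)\<^sup>2 + e) \<eta>) w0 \<and>
         cmod (2 * Complex ((sqrt b - sqrt a)\<^sup>2 + e) \<eta> * (of_real v * (\<Sum>i<m. 1 / (complex_of_real (lam i) - Complex ((sqrt b - sqrt a)\<^sup>2 + e) \<eta>)))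
           + Complex ((sqrt b - sqrt a)\<^sup>2 + e) \<eta> + of_real a - of_real b - w0) \<le> \<eta>"
      if e: "\<bar>e\<bar> \<le> 1" and \<eta>: "1 / L \<le> \<eta>" "\<eta> \<le> 1" for e \<eta>
    proof -
      define z where "z = Complex ((sqrt b - sqrt a)\<^sup>2 + e) \<eta>"
      have \<eta>0: "0 < \<eta>" using less_le_trans[of 0 "1 / L" \<eta>] \<eta>(1) L0 by simp
      have z0: "0 < Im z" "Im z = \<eta>" using \<eta>0 by (simp_all add: z_def)
      have z4: "cmod z \<le> 4" unfolding z_def by (rule window_bounds) (use a0 ab' \<delta> e \<eta> \<eta>0 in auto)
      obtain w0 where w0: "mp_root a b z w0" using root_exists by blast
      define T T' where "T = tr_res m (gram J x) z" and "T' = tr_res m (gram (J \<union> B) x') z"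
      have l: "cmod (2 * z * (of_real v * T) + z + of_real a - of_real b - w0) \<le> 3 / 4 * \<eta>"
        unfolding T_def z_def by (rule law) (use x e \<eta> w0 in \<open>auto simp: z_def\<close>)
      have TT: "cmod (T' - T) \<le> real (card B) / \<eta>"
        using tr_res_gram_union[OF fin z0(1), of m x'] unfolding T_def T'_def g z0(2) .
      have iv: "1 / \<eta> \<le> L"
      proof -
        have "1 \<le> \<eta> * L" using \<eta>(1) L0 by (simp add: pos_divide_le_eq)
        then show ?thesis using \<eta>0 by (simp add: pos_divide_le_eq mult.commute)
      qed
      have "2 * cmod z * (v * cmod (T' - T)) \<le> 2 * 4 * (v * (real (card B) / \<eta>))"
        using z4 TT v_pos by (intro mult_mono) auto
      also have "\<dots> = 8 * (v * real (card B) * (1 / \<eta>))" by simp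
      also have "\<dots> \<le> 8 * (v * real (card B) * L)" using iv v_pos by (intro mult_left_mono) auto
      finally have c1: "2 * cmod z * (v * cmod (T' - T)) \<le> 8 * (v * real (card B) * L)" .
      have "32 * (v * real (card B) * L\<^sup>2) * (1 / L) \<le> 1 * (1 / L)" using B L0 by (intro mult_right_mono) auto
      moreover have "32 * (v * real (card B) * L\<^sup>2) * (1 / L) = 32 * (v * real (card B) * L)" using L0 by (simp add: power2_eq_square)
      ultimately have c2: "8 * (v * real (card B) * L) \<le> \<eta> / 4" using \<eta>(1) by linarith
      have "2 * z * (of_real v * T') + z + of_real a - of_real b - w0 =
          2 * z * of_real v * (T' - T) + (2 * z * (of_real v * T) + z + of_real a - of_real b - w0)"
        by (simp add: algebra_simps)
      then have "cmod (2 * z * (of_real v * T') + z + of_real a - of_real b - w0) \<le>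
          cmod (2 * z * of_real v * (T' - T)) + cmod (2 * z * (of_real v * T) + z + of_real a - of_real b - w0)"
        by (simp only: norm_triangle_ineq)
      moreover have "cmod (2 * z * of_real v * (T' - T)) = 2 * cmod z * (v * cmod (T' - T))" using v_pos by (simp add: norm_mult)
      ultimately have "cmod (2 * z * (of_real v * T') + z + of_real a - of_real b - w0) \<le> \<eta>" using l c1 c2 by linarith
      then show ?thesis using w0 unfolding T'_def tr_res_spectral'[OF sp z0(1)] z_def[symmetric] by blast
    qed
    show ?thesis unfolding edge_law_def using 1 2 by auto
  qed
  show ?thesis by (rule that[OF F1m[THEN sets.Un, OF F2(1), unfolded P_def] prob[unfolded P_def] main[unfolded P_def]])
qed

text \<open>In the application \<open>J\<close> depends on \<open>\<Psi>\<close>, so all data are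
  quantified inside the eventuality and the threshold for \<open>N\<close> depends only on
  \<open>\<delta>\<close>, \<open>\<tau>\<close> and \<open>D\<close>. From
  \<open>\<tau> \<le> 1 / 20\<close> follows \<open>L ^ 20 \<le> N\<close> for
  \<open>L = N powr \<tau>\<close>, hence \<open>v \<le> 2 / L ^ 20\<close>.\<close>

theorem edge_law_eventually:
  fixes \<delta> \<tau> D :: real
  assumes \<delta>: "0 < \<delta>" "\<delta> \<le> 1" and \<tau>: "0 < \<tau>" "\<tau> \<le> 1 / 20" and D: "0 < D"
  shows "eventually (\<lambda>N. \<forall>m J B \<mu> v \<kappa> R. column_law \<mu> m v \<kappa> R \<and> J \<union> B = {..<N} \<and> J \<inter> B = {} \<and> m \<le> N \<and>
      \<delta> \<le> v * real m \<and> \<delta> \<le> sqrt (v * real (card J)) - sqrt (v * real m) \<and> v * real (card J) \<le> 2 \<and> v \<le> 2 / real N \<and>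
      \<kappa> \<le> v / (real N powr \<tau>) ^ 10 \<and> 64 * (real (card B) * (real N powr \<tau>)\<^sup>2) \<le> real N \<longrightarrow>
      (\<exists>F\<in>sets (PiM J (\<lambda>_. \<mu>)). measure (PiM J (\<lambda>_. \<mu>)) F \<le> real N powr (- D) \<and>
        (\<forall>x x' lam u. x \<in> space (PiM J (\<lambda>_. \<mu>)) - F \<and> (\<forall>j\<in>J. x' j = x j) \<and> spectral m (gram {..<N} x') lam u \<longrightarrow>
          edge_law (v * real m) (v * real (card J)) v m lam (12 / \<delta> ^ 4) (real N powr (- \<tau>))))) sequentially"
proof -
  obtain p :: nat where p: "1 \<le> p" and lo: "eventually (\<lambda>N::nat. lower_edge_error \<delta> p (real N powr \<tau>) (real N) \<le> real N powr (- (D + 1))) sequentially"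
    using lower_edge_asymptotic[of \<delta> \<tau> "D + 1"] \<delta> \<tau> D by auto
  have e1: "eventually (\<lambda>N::nat. 2 ^ 22 * real N powr (6 * \<tau>) * exp (- (1 / 2 ^ 17 * real N powr (16 * \<tau>))) \<le> real N powr (- D) / 2) sequentially"
    using \<tau> by real_asymp
  have "LIM N sequentially. real N powr \<tau> :> at_top" using \<tau> by real_asymp
  then have e2: "eventually (\<lambda>N. max 700 (14 / \<delta> ^ 4) \<le> real N powr \<tau>) sequentially" unfolding filterlim_at_top by blast
  show ?thesis
    using lo e1 e2 eventually_ge_at_top[of 2]
  proof eventually_elim
    case (elim N)
    define L where "L = real N powr \<tau>"
    have N: "2 \<le> real N" using elim by simp
    have pw: "L ^ k = real N powr (real k * \<tau>)" for k using N by (simp add: L_def powr_realpow[symmetric] powr_powr mult.commute)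
    have L: "700 \<le> L" "14 / \<delta> ^ 4 \<le> L" using elim by (auto simp: L_def)
    have iL: "1 / L = real N powr (- \<tau>)" by (simp add: L_def powr_minus_divide)
    have L20: "L ^ 20 \<le> real N"
    proof -
      have "L ^ 20 \<le> real N powr 1" unfolding pw using N \<tau> by (intro powr_mono) auto
      then show ?thesis using N by simp
    qed
    have LL: "2 / real N \<le> 2 / L ^ 20" using L20 L N by (intro divide_left_mono) auto
    show ?case
    proof (intro allI impI, elim conjE)
      fix m J B \<mu> v \<kappa> R
      assume cl: "column_law \<mu> m v \<kappa> R" and JB: "J \<union> B = {..<N}" "J \<inter> B = {}" and m: "m \<le> N"
        and c: "\<delta> \<le> v * real m" "\<delta> \<le> sqrt (v * real (card J)) - sqrt (v * real m)" "v * real (card J) \<le> 2" "v \<le> 2 / real N"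
          "\<kappa> \<le> v / (real N powr \<tau>) ^ 10" "64 * (real (card B) * (real N powr \<tau>)\<^sup>2) \<le> real N"
      interpret column_law \<mu> m v \<kappa> R by (rule cl)
      have fin: "finite J" "finite B" using JB(1) by (metis finite_Un finite_lessThan)+
      have cJ: "real (card J) \<le> real N" using JB(1) card_mono[of "{..<N}" J] by auto
      have v20: "v \<le> 2 / L ^ 20" using c(4) LL by linarith
      have B: "32 * (v * real (card B) * L\<^sup>2) \<le> 1"
      proof -
        have "32 * (v * real (card B) * L\<^sup>2) = v * (32 * (real (card B) * L\<^sup>2))" by simp
        also have "\<dots> \<le> 2 / real N * (32 * (real (card B) * L\<^sup>2))" using c(4) by (intro mult_right_mono) auto
        also have "\<dots> = 64 * (real (card B) * L\<^sup>2) / real N" by simp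
        also have "\<dots> \<le> real N / real N" using c(6) N unfolding L_def by (intro divide_right_mono) auto
        finally show ?thesis using N by simp
      qed
      obtain F where F: "F \<in> sets (PiM J (\<lambda>_. \<mu>))"
        and Fp: "measure (PiM J (\<lambda>_. \<mu>)) F \<le> lower_edge_error \<delta> p L (real N)
           + 2 ^ 22 * L ^ 6 * exp (- (L ^ 16 / 2 ^ 17))"
        and Fl: "\<And>x x' lam u. x \<in> space (PiM J (\<lambda>_. \<mu>)) - F \<Longrightarrow> (\<And>j. j \<in> J \<Longrightarrow> x' j = x j) \<Longrightarrow> spectral m (gram (J \<union> B) x') lam u \<Longrightarrow>
           edge_law (v * real m) (v * real (card J)) v m lam (12 / \<delta> ^ 4) (1 / L)"
        using edge_law_event[OF fin JB(2) refl refl \<delta> c(1-3) L v20 c(5)[folded L_def] p cJ _ B] m by auto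
      have h1: "real N powr (- (D + 1)) \<le> real N powr (- D) / 2"
      proof -
        have "real N powr (- (D + 1)) = real N powr (- D) * (1 / real N)" using N by (simp add: powr_diff powr_minus_divide)
        also have "\<dots> \<le> real N powr (- D) * (1 / 2)" using N by (intro mult_left_mono divide_left_mono) auto
        finally show ?thesis by simp
      qed
      have h2: "2 ^ 22 * L ^ 6 * exp (- (L ^ 16 / 2 ^ 17)) \<le> real N powr (- D) / 2" using elim(2) unfolding pw by simp
      have "measure (PiM J (\<lambda>_. \<mu>)) F \<le> real N powr (- D)"
        using Fp elim(1)[folded L_def] h1 h2 by linarith
      then show "\<exists>F\<in>sets (PiM J (\<lambda>_. \<mu>)). measure (PiM J (\<lambda>_. \<mu>)) F \<le> real N powr (- D) \<and>
        (\<forall>x x' lam u. x \<in> space (PiM J (\<lambda>_. \<mu>)) - F \<and> (\<forall>j\<in>J. x' j = x j) \<and> spectral m (gram {..<N} x') lam u \<longrightarrow>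
          edge_law (v * real m) (v * real (card J)) v m lam (12 / \<delta> ^ 4) (real N powr (- \<tau>)))"
        using F Fl unfolding iL[symmetric] JB(1) by blast
    qed
  qed
qed

section \<open>Matrices and measurability\<close>

lemma spectrum_spectral:
  assumes A: "A \<in> carrier_mat m m" and sp: "spectral m (\<lambda>a b. A $$ (a, b)) lam u"
  shows "spectrum A = lam ` {..<m}"
proof -
  have on: "orthonormal m m u" using sp by (simp add: spectral_def)
  have mv: "(A *\<^sub>v Matrix.vec m x) $ a = (\<Sum>b<m. A $$ (a, b) * x b)" if "a < m" for x a
    using A that by (simp add: scalar_prod_def atLeast0LessThan)
  show ?thesis
  proof (intro equalityI subsetI)
    fix k assume "k \<in> spectrum A"
    then obtain w where w: "w \<in> carrier_vec m" "w \<noteq> 0\<^sub>v m" "A *\<^sub>v w = k \<cdot>\<^sub>v w"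
      using A by (auto simp: spectrum_def eigenvalue_def eigenvector_def)
    define x where "x = (\<lambda>a. w $ a)"
    have wx: "w = Matrix.vec m x" using w(1) by (intro eq_vecI) (auto simp: x_def)
    have ev: "(\<Sum>b<m. A $$ (a, b) * x b) = k * x a" if a: "a < m" for a
      using arg_cong[OF w(3), of "\<lambda>v. v $ a"] mv[OF a, of x] a w(1) unfolding wx by simp
    have "\<exists>a<m. x a \<noteq> 0"
    proof (rule ccontr)
      assume "\<not> ?thesis"
      then have "w = 0\<^sub>v m" unfolding wx by (intro eq_vecI) auto
      then show False using w(2) by simp
    qed
    then obtain a where a: "a < m" "x a \<noteq> 0" by blast
    have "dotp m x x \<noteq> 0" using a by (auto simp: dotp_self_eq_0)
    have "\<exists>i<m. dotp m (u i) x \<noteq> 0"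
    proof (rule ccontr)
      assume "\<not> ?thesis"
      then show False using \<open>dotp m x x \<noteq> 0\<close> spectral_dotp_sq[OF sp, of x] by simp
    qed
    then obtain i where i: "i < m" "dotp m (u i) x \<noteq> 0" by blast
    have "bform m (\<lambda>a b. A $$ (a, b)) (u i) x = k * dotp m (u i) x"
      unfolding bform_dotp using ev by (simp add: dotp_def sum_distrib_left mult_ac)
    moreover have "bform m (\<lambda>a b. A $$ (a, b)) (u i) x = (\<Sum>j<m. if j = i then lam i * dotp m (u i) x else 0)"
      unfolding spectral_bform[OF sp] using orthonormal_dotp[OF on _ i(1)] by (intro sum.cong) auto
    ultimately have "lam i = k" using i by simp
    then show "k \<in> lam ` {..<m}" using i by auto
  next
    fix k assume "k \<in> lam ` {..<m}"
    then obtain i where i: "i < m" "k = lam i" by auto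
    have "A *\<^sub>v Matrix.vec m (u i) = k \<cdot>\<^sub>v Matrix.vec m (u i)"
      using mv[of _ "u i"] spectral_apply[OF sp i(1)] A i(2) by (intro eq_vecI) auto
    moreover have "Matrix.vec m (u i) \<noteq> 0\<^sub>v m"
    proof
      assume "Matrix.vec m (u i) = 0\<^sub>v m"
      then have "u i a = 0" if "a < m" for a using that by (metis index_vec index_zero_vec(1))
      then have "dotp m (u i) (u i) = 0" by (simp add: dotp_self_eq_0)
      then show False using orthonormal_dotp[OF on i(1) i(1)] by simp
    qed
    ultimately show "k \<in> spectrum A" using A unfolding spectrum_def eigenvalue_def eigenvector_def
      by (auto intro!: exI[of _ "Matrix.vec m (u i)"])
  qed
qed

text \<open>Restriction to the row indices makes a column extensional, so that it can be compared
  with points of a product space \<open>PiM\<close>.\<close>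

definition columns :: "real mat \<Rightarrow> nat \<Rightarrow> nat \<Rightarrow> real" where
  "columns H j = (\<lambda>a\<in>{..<dim_row H}. H $$ (a, j))"

lemma cov_entry: "a < dim_row H \<Longrightarrow> b < dim_row H \<Longrightarrow> cov H $$ (a, b) = gram {..<dim_col H} (columns H) a b"
  by (simp add: cov_def gram_def columns_def scalar_prod_def atLeast0LessThan)

lemma cov_carrier [simp]: "cov H \<in> carrier_mat (dim_row H) (dim_row H)"
  by (auto simp: cov_def)

lemma spectral_cov:
  "spectral (dim_row H) (gram {..<dim_col H} (columns H)) lam u \<longleftrightarrow> spectral (dim_row H) (\<lambda>a b. cov H $$ (a, b)) lam u"
  by (simp add: spectral_def cov_entry)

lemma lambda_min_cov:
  assumes "spectral (dim_row H) (gram {..<dim_col H} (columns H)) lam u"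
  shows "lambda_min (cov H) = Min (lam ` {..<dim_row H})"
  unfolding lambda_min_def using spectrum_spectral[OF cov_carrier, of H lam u] assms by (simp add: spectral_cov)

text \<open>The variational form of the smallest eigenvalue; through
  \<open>measurable_below_form\<close> it makes \<open>lambda_min\<close> measurable.\<close>

lemma lambda_min_less:
  assumes "0 < dim_row H"
  shows "lambda_min (cov H) < c \<longleftrightarrow>
     (\<exists>y. bform (dim_row H) (gram {..<dim_col H} (columns H)) y y < c * dotp (dim_row H) y y)"
proof -
  obtain lam u where sp: "spectral (dim_row H) (gram {..<dim_col H} (columns H)) lam u"
    using psd_spectral[OF psd_gram] by blast
  have on: "orthonormal (dim_row H) (dim_row H) u" using sp by (simp add: spectral_def)
  have "(\<exists>y. bform (dim_row H) (gram {..<dim_col H} (columns H)) y y < c * dotp (dim_row H) y y) \<longleftrightarrow> (\<exists>i<dim_row H. lam i < c)"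
  proof safe
    fix y assume y: "bform (dim_row H) (gram {..<dim_col H} (columns H)) y y < c * dotp (dim_row H) y y"
    show "\<exists>i<dim_row H. lam i < c"
    proof (rule ccontr)
      assume neg: "\<not> ?thesis"
      have "c \<le> lam i" if "i < dim_row H" for i using neg that by (meson not_less)
      then have "c * dotp (dim_row H) y y \<le> bform (dim_row H) (gram {..<dim_col H} (columns H)) y y"
        by (rule spectral_lower_bound[OF sp])
      then show False using y by simp
    qed
  next
    fix i assume i: "i < dim_row H" "lam i < c"
    have "bform (dim_row H) (gram {..<dim_col H} (columns H)) (u i) (u i) = (\<Sum>k<dim_row H. if k = i then lam k else 0)"
      unfolding spectral_bform[OF sp] using orthonormal_dotp[OF on _ i(1)] by (intro sum.cong) auto
    moreover have "dotp (dim_row H) (u i) (u i) = 1" using orthonormal_dotp[OF on i(1) i(1)] by simp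
    ultimately show "\<exists>y. bform (dim_row H) (gram {..<dim_col H} (columns H)) y y < c * dotp (dim_row H) y y"
      using i by (intro exI[of _ "u i"]) auto
  qed
  moreover have "Min (lam ` {..<dim_row H}) < c \<longleftrightarrow> (\<exists>i<dim_row H. lam i < c)" using assms by (subst Min_less_iff) auto
  ultimately show ?thesis unfolding lambda_min_cov[OF sp] by simp
qed

text \<open>\<open>stieltjes\<close> applies \<open>the\<close> to the result of
  \<open>mat_inverse\<close>. The matrix \<open>smat\<close> built from eigenvectors is a two-sided
  inverse, so that result is not \<open>None\<close> and its content is \<open>smat\<close>.\<close>

lemma stieltjes_tr_res:
  assumes z: "0 < Im z"
  shows "stieltjes H z = tr_res (dim_row H) (gram {..<dim_col H} (columns H)) z / of_nat (dim_row H)"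
proof -
  define m A where "m = dim_row H" and "A = gram {..<dim_col H} (columns H)"
  obtain lam u where sp: "spectral m A lam u" using psd_spectral[OF psd_gram] unfolding A_def by blast
  have nz: "complex_of_real (lam i) \<noteq> z" for i using z by auto
  have eq: "map_mat complex_of_real (cov H) - z \<cdot>\<^sub>m 1\<^sub>m m = rmat m A z"
  proof (rule eq_matI)
    fix a b assume "a < dim_row (rmat m A z)" "b < dim_col (rmat m A z)"
    then have ab: "a < m" "b < m" by (auto simp: rmat_def)
    then have "cov H $$ (a, b) = A a b" by (simp add: m_def A_def cov_entry)
    then show "(map_mat complex_of_real (cov H) - z \<cdot>\<^sub>m 1\<^sub>m m) $$ (a, b) = rmat m A z $$ (a, b)"
      using ab by (simp add: rmat_def m_def cov_def)
  qed (auto simp: rmat_def m_def cov_def)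
  have inv: "rmat m A z * smat m lam u z = 1\<^sub>m m" by (rule rmat_times_smat[OF sp nz])
  have inv': "smat m lam u z * rmat m A z = 1\<^sub>m m" by (rule mat_mult_left_right_inverse[OF _ _ inv]) auto
  obtain G where G: "mat_inverse (rmat m A z) = Some G"
  proof (cases "mat_inverse (rmat m A z)")
    case None
    have "rmat m A z \<in> Units (ring_mat TYPE(complex) m ())"
      using inv inv' by (auto simp: Units_def ring_mat_simps intro!: bexI[of _ "smat m lam u z"])
    then show ?thesis using mat_inverse(1)[OF rmat_carrier None, where b = "()"] by blast
  qed auto
  have G': "rmat m A z * G = 1\<^sub>m m" "G * rmat m A z = 1\<^sub>m m" "G \<in> carrier_mat m m"
    using mat_inverse(2)[OF rmat_carrier G] by auto
  have "G = G * (rmat m A z * smat m lam u z)" using inv G'(3) by simp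
  also have "\<dots> = (G * rmat m A z) * smat m lam u z" by (rule assoc_mult_mat[symmetric, OF G'(3) rmat_carrier smat_carrier])
  also have "\<dots> = smat m lam u z" unfolding G'(2) by (rule left_mult_one_mat[OF smat_carrier])
  finally have Gs: "G = smat m lam u z" .
  have "(\<Sum>i<m. G $$ (i, i)) = tr_res m A z"
    unfolding tr_res_def Gs using resolvent_spectral[OF sp nz] by (intro sum.cong) (auto simp: smat_def)
  then show ?thesis unfolding stieltjes_def m_def[symmetric] A_def[symmetric] Let_def eq G by simp
qed

lemma Im_stieltjes_poisson:
  assumes "spectral (dim_row H) (gram {..<dim_col H} (columns H)) lam u" "0 < \<eta>"
  shows "Im (stieltjes H (Complex E \<eta>)) = poisson (dim_row H) lam E \<eta>"
proof -
  have "Im (stieltjes H (Complex E \<eta>)) =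
      Im (\<Sum>i<dim_row H. 1 / (complex_of_real (lam i) - Complex E \<eta>)) / real (dim_row H)"
    using stieltjes_tr_res[of "Complex E \<eta>" H] tr_res_spectral'[OF assms(1), of "Complex E \<eta>"] assms(2)
    by (simp only: Im_divide_of_nat complex.sel)
  then show ?thesis unfolding Im_stieltjes_sum poisson_def .
qed

text \<open>The truncation bounds the norm deterministically, so the last condition of regularity holds
  surely.\<close>

lemma op_norm_le:
  fixes A :: "real mat"
  assumes A: "A \<in> carrier_mat m m" and m: "0 < m" and B: "0 \<le> B" "\<And>a b. a < m \<Longrightarrow> b < m \<Longrightarrow> \<bar>A $$ (a, b)\<bar> \<le> B"
  shows "op_norm A \<le> real m ^ 2 * B"
  unfolding op_norm_def
proof (rule cSUP_least)
  have "unit_vec m 0 \<in> {v \<in> carrier_vec (dim_col A). v \<bullet> v = (1 :: real)}" using A m by (auto simp: scalar_prod_left_unit)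
  then show "{v \<in> carrier_vec (dim_col A). v \<bullet> v = (1 :: real)} \<noteq> {}" by blast
next
  fix v :: "real Matrix.vec" assume "v \<in> {v \<in> carrier_vec (dim_col A). v \<bullet> v = 1}"
  then have v: "dim_vec v = m" "(\<Sum>b<m. v $ b * v $ b) = 1" using A by (auto simp: scalar_prod_def atLeast0LessThan)
  have vb: "\<bar>v $ b\<bar> \<le> 1" if "b < m" for b
  proof -
    have "v $ b * v $ b \<le> (\<Sum>b<m. v $ b * v $ b)" using that by (intro member_le_sum) auto
    then have "(v $ b)\<^sup>2 \<le> 1\<^sup>2" using v by (simp add: power2_eq_square)
    then show ?thesis using abs_le_square_iff[of "v $ b" 1] by simp
  qed
  have row: "\<bar>(A *\<^sub>v v) $ a\<bar> \<le> real m * B" if a: "a < m" for a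
  proof -
    have "(A *\<^sub>v v) $ a = (\<Sum>b<m. A $$ (a, b) * v $ b)" using A a v by (simp add: scalar_prod_def atLeast0LessThan)
    then have "\<bar>(A *\<^sub>v v) $ a\<bar> \<le> (\<Sum>b<m. \<bar>A $$ (a, b) * v $ b\<bar>)" by (simp only: sum_abs)
    also have "\<dots> \<le> (\<Sum>b<m. B * 1)" using B vb a by (intro sum_mono) (simp only: abs_mult, intro mult_mono, auto)
    finally show ?thesis by simp
  qed
  have "(A *\<^sub>v v) \<bullet> (A *\<^sub>v v) = (\<Sum>a<m. (A *\<^sub>v v) $ a * (A *\<^sub>v v) $ a)" using A by (simp add: scalar_prod_def atLeast0LessThan)
  also have "\<dots> \<le> (\<Sum>a<m. (real m * B)\<^sup>2)"
  proof (intro sum_mono)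
    fix a assume "a \<in> {..<m}"
    then have "(A *\<^sub>v v) $ a * (A *\<^sub>v v) $ a = \<bar>(A *\<^sub>v v) $ a\<bar>\<^sup>2" by (simp add: power2_eq_square)
    also have "\<dots> \<le> (real m * B)\<^sup>2" using row \<open>a \<in> _\<close> by (intro power_mono) auto
    finally show "(A *\<^sub>v v) $ a * (A *\<^sub>v v) $ a \<le> (real m * B)\<^sup>2" .
  qed
  also have "\<dots> = real m * (real m * B)\<^sup>2" by simp
  also have "\<dots> \<le> (real m)\<^sup>2 * (real m * B)\<^sup>2" using m by (intro mult_right_mono) (auto simp: power2_eq_square)
  also have "\<dots> = (real m ^ 2 * B)\<^sup>2" by (simp add: power_mult_distrib power2_eq_square)
  finally show "sqrt ((A *\<^sub>v v) \<bullet> (A *\<^sub>v v)) \<le> real m ^ 2 * B" using B by (intro real_le_lsqrt) auto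
qed

text \<open>The exponent in the proof is \<open>203 = 2 + 1 + 200\<close>: the square of the
  dimension, the number of terms in an entry of \<open>cov H\<close>, and two truncated
  factors.\<close>

lemma op_norm_cov_le:
  assumes m: "0 < dim_row H" "dim_row H \<le> dim_col H" and N: "2 \<le> dim_col H"
    and H: "\<And>a j. a < dim_row H \<Longrightarrow> j < dim_col H \<Longrightarrow> \<bar>H $$ (a, j)\<bar> \<le> real (dim_col H) ^ 100" and CH: "300 \<le> CH"
  shows "op_norm (cov H) \<le> real (dim_col H) powr CH"
proof -
  define N where "N = real (dim_col H)"
  have N1: "1 \<le> N" using assms by (simp add: N_def)
  have ent: "\<bar>cov H $$ (a, b)\<bar> \<le> N * (N ^ 100 * N ^ 100)" if ab: "a < dim_row H" "b < dim_row H" for a b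
  proof -
    have "cov H $$ (a, b) = (\<Sum>j<dim_col H. H $$ (a, j) * H $$ (b, j))" using ab by (simp add: cov_entry gram_def columns_def)
    then have "\<bar>cov H $$ (a, b)\<bar> \<le> (\<Sum>j<dim_col H. \<bar>H $$ (a, j) * H $$ (b, j)\<bar>)" by (simp only: sum_abs)
    also have "\<dots> \<le> (\<Sum>j<dim_col H. N ^ 100 * N ^ 100)"
      using H ab N1 unfolding N_def[symmetric] by (intro sum_mono) (simp only: abs_mult, intro mult_mono, auto)
    finally show ?thesis by (simp add: N_def)
  qed
  have "op_norm (cov H) \<le> real (dim_row H) ^ 2 * (N * (N ^ 100 * N ^ 100))"
    by (rule op_norm_le[OF cov_carrier m(1) _ ent]) (use N1 in auto)
  also have "\<dots> \<le> N ^ 2 * (N * (N ^ 100 * N ^ 100))" using m N1 by (intro mult_right_mono power_mono) (auto simp: N_def)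
  also have "\<dots> = N ^ 203" by (simp add: power_numeral_reduce)
  also have "\<dots> = N powr 203" using powr_realpow[of N 203] N1 by simp
  also have "\<dots> \<le> N powr CH" using N1 CH by (intro powr_mono) auto
  finally show ?thesis by (simp add: N_def)
qed

lemma edge_regularI:
  fixes H :: "real mat"
  assumes sp: "spectral (dim_row H) (gram {..<dim_col H} (columns H)) lam u" and \<tau>: "0 < \<tau>" "\<tau> \<le> 2 / 3"
    and c: "0 < cH" "1 < CH" and N: "0 < dim_col H"
    and op: "op_norm (cov H) \<le> real (dim_col H) powr CH"
    and reg: "edge_bounds cH CH (real (dim_col H) powr (- \<tau>)) (dim_row H) lam"
  shows "edge_regular \<tau> cH CH H"
proof -
  define \<eta>s l where "\<eta>s = real (dim_col H) powr (- \<tau>)" and "l = lambda_min (cov H)"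
  have s0: "0 < \<eta>s" using N by (simp add: \<eta>s_def)
  have le: "\<eta>s \<le> \<eta>" if "\<eta>s + sqrt (\<eta>s * \<bar>E - l\<bar>) \<le> \<eta>" for E \<eta>
  proof -
    have "0 \<le> sqrt (\<eta>s * \<bar>E - l\<bar>)" using s0 by simp
    then show ?thesis using that by linarith
  qed
  have st: "Im (stieltjes H (Complex E \<eta>)) = poisson (dim_row H) lam E \<eta>" if "\<eta>s \<le> \<eta>" for E \<eta>
    using that s0 by (intro Im_stieltjes_poisson[OF sp]) auto
  note reg' = reg[unfolded edge_bounds_def Let_def, folded lambda_min_cov[OF sp] \<eta>s_def, folded l_def]
  have A: "1 / CH * sqrt (\<bar>E - l\<bar> + \<eta>) \<le> Im (stieltjes H (Complex E \<eta>)) \<and> Im (stieltjes H (Complex E \<eta>)) \<le> CH * sqrt (\<bar>E - l\<bar> + \<eta>)"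
    if "l \<le> E" "E \<le> l + cH" "\<eta>s + sqrt (\<eta>s * \<bar>E - l\<bar>) \<le> \<eta>" "\<eta> \<le> 10" for E \<eta>
    using reg' that le[OF that(3)] unfolding st[OF le[OF that(3)]] by blast
  have B: "1 / CH * (\<eta> / sqrt (\<bar>E - l\<bar> + \<eta>)) \<le> Im (stieltjes H (Complex E \<eta>)) \<and> Im (stieltjes H (Complex E \<eta>)) \<le> CH * (\<eta> / sqrt (\<bar>E - l\<bar> + \<eta>))"
    if "l - cH \<le> E" "E \<le> l" "\<eta>s \<le> \<eta>" "\<eta> \<le> 10" for E \<eta>
    using reg' that unfolding st[OF that(3)] by blast
  show ?thesis
    unfolding edge_regular_def Let_def \<eta>s_def[symmetric] l_def[symmetric] using A B reg' op c \<tau> by blast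
qed

section \<open>Measurability of the event of regularity\<close>

lemma closed_on_dense:
  fixes g :: "'a::metric_space \<Rightarrow> real"
  assumes S: "S \<subseteq> closure D" "D \<subseteq> S" and g: "continuous_on S g" and D: "\<And>x. x \<in> D \<Longrightarrow> 0 \<le> g x" and x: "x \<in> S"
  shows "0 \<le> g x"
proof -
  obtain y where y: "\<And>n. y n \<in> D" "y \<longlonglongrightarrow> x" using x S(1) by (auto simp: closure_sequential subset_iff)
  have "(\<lambda>n. g (y n)) \<longlonglongrightarrow> g x"
    using g x y S(2) unfolding continuous_on_sequentially by (auto simp: o_def subset_iff)
  then show ?thesis using D y by (intro LIMSEQ_le_const) auto
qed

text \<open>By continuity a condition at uncountably many points reduces to a countable dense subset
  of them.\<close>

lemma sets_Ball_continuous: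
  fixes S :: "(real \<times> real) set" and g :: "'w \<Rightarrow> real \<times> real \<Rightarrow> real"
  assumes m: "\<And>p. p \<in> S \<Longrightarrow> (\<lambda>w. g w p) \<in> borel_measurable W" and c: "\<And>w. w \<in> space W \<Longrightarrow> continuous_on S (g w)"
  shows "{w \<in> space W. \<forall>p\<in>S. 0 \<le> g w p} \<in> sets W"
proof -
  obtain D where D: "countable D" "D \<subseteq> S" "S \<subseteq> closure D" using separable by metis
  have "{w \<in> space W. \<forall>p\<in>S. 0 \<le> g w p} = {w \<in> space W. \<forall>p\<in>D. 0 \<le> g w p}"
  proof (intro Collect_cong conj_cong refl iffI)
    fix w assume w: "w \<in> space W" and h: "\<forall>p\<in>D. 0 \<le> g w p"
    show "\<forall>p\<in>S. 0 \<le> g w p" using closed_on_dense[OF D(3,2) c[OF w]] h by blast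
  qed (use D in auto)
  moreover have "{w \<in> space W. \<forall>p\<in>D. 0 \<le> g w p} \<in> sets W"
  proof (intro sets.sets_Collect_countable_All' D(1))
    fix p assume "p \<in> D"
    then have "(\<lambda>w. g w p) \<in> borel_measurable W" using m D(2) by blast
    then show "{w \<in> space W. 0 \<le> g w p} \<in> sets W" by (intro borel_measurable_le borel_measurable_const)
  qed
  ultimately show ?thesis by simp
qed

lemma continuous_poisson:
  assumes f: "continuous_on S f" and "continuous_on S h" "\<And>p. p \<in> S \<Longrightarrow> 0 < h p"
  shows "continuous_on S (\<lambda>p. poisson m lam (f p) (h p))"
proof -
  have "(lam i - f p)\<^sup>2 + (h p)\<^sup>2 \<noteq> 0" if "p \<in> S" for i p
  proof -
    have "0 < (h p)\<^sup>2" using assms(3)[OF that] by simp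
    then show ?thesis using zero_le_power2[of "lam i - f p"] by linarith
  qed
  then show ?thesis unfolding poisson_def using assms by (cases "m = 0") (auto intro!: continuous_intros)
qed

text \<open>A non-measurable event has \<open>measure\<close> 0, so the lower bound on the
  conditional probability rests on this. Points are shifted by the smallest eigenvalue, which makes
  the index sets \<open>S1\<close> and \<open>S2\<close> deterministic; the norm condition holds
  surely by assumption.\<close>

lemma measurable_edge_regular:
  fixes H :: "'w \<Rightarrow> real mat"
  assumes dim: "\<And>w. w \<in> space W \<Longrightarrow> dim_row (H w) = m" "\<And>w. w \<in> space W \<Longrightarrow> dim_col (H w) = n" and m: "0 < m" and n: "0 < n"
    and H: "\<And>a j. a < m \<Longrightarrow> j < n \<Longrightarrow> (\<lambda>w. H w $$ (a, j)) \<in> borel_measurable W"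
    and op: "\<And>w. w \<in> space W \<Longrightarrow> op_norm (cov (H w)) \<le> real n powr CH"
  shows "{w \<in> space W. edge_regular \<tau> cH CH (H w)} \<in> sets W"
proof -
  define \<eta>s where "\<eta>s = real n powr (- \<tau>)"
  have s0: "0 < \<eta>s" using n by (simp add: \<eta>s_def)
  define A where "A = (\<lambda>w. gram {..<n} (columns (H w)))"
  define l where "l = (\<lambda>w. lambda_min (cov (H w)))"
  have Am: "(\<lambda>w. A w a b) \<in> borel_measurable W" if ab: "a < m" "b < m" for a b
  proof -
    have "(\<lambda>w. \<Sum>j<n. H w $$ (a, j) * H w $$ (b, j)) \<in> borel_measurable W"
      using H ab by (intro borel_measurable_sum borel_measurable_times) auto
    then show ?thesis using ab dim by (subst measurable_cong[where g = "\<lambda>w. \<Sum>j<n. H w $$ (a, j) * H w $$ (b, j)"])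
      (auto simp: A_def gram_def columns_def)
  qed
  have lm: "l \<in> borel_measurable W"
    unfolding borel_measurable_iff_less
  proof
    fix c
    have "{w \<in> space W. l w < c} = {w \<in> space W. \<exists>y. bform m (A w) y y < c * dotp m y y}"
      using lambda_min_less[of "H _" c] dim m unfolding l_def A_def by (intro Collect_cong conj_cong refl) simp
    also have "\<dots> \<in> sets W" by (intro measurable_below_form Am borel_measurable_const)
    finally show "{w \<in> space W. l w < c} \<in> sets W" .
  qed
  \<comment> \<open>Two descriptions of \<open>f\<close> are combined: as a trace of the resolvent
    it is measurable in \<open>w\<close>, as a Poisson integral it is continuous in
    \<open>p\<close>.\<close>
  define f where "f = (\<lambda>w (p :: real \<times> real). Im (tr_res m (A w) (Complex (l w + fst p) (snd p)) / of_nat m))"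
  have fm: "(\<lambda>w. f w p) \<in> borel_measurable W" for p
  proof -
    have "(\<lambda>w. Complex (l w + fst p) (snd p)) \<in> borel_measurable W"
    proof -
      have "continuous_on UNIV (\<lambda>x :: real. Complex (x + fst p) (snd p))" unfolding Complex_eq by (intro continuous_intros)
      from measurable_compose[OF lm borel_measurable_continuous_onI[OF this]] show ?thesis .
    qed
    then have "(\<lambda>w. tr_res m (A w) (Complex (l w + fst p) (snd p))) \<in> borel_measurable W" by (intro measurable_tr_res Am)
    then have "(\<lambda>w. tr_res m (A w) (Complex (l w + fst p) (snd p)) / of_nat m) \<in> borel_measurable W"
      by (intro borel_measurable_divide borel_measurable_const)
    moreover have "continuous_on UNIV Im" by (intro continuous_intros)
    ultimately show ?thesis unfolding f_def by (rule measurable_compose[OF _ borel_measurable_continuous_onI])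
  qed
  have fc: "continuous_on S (f w)" if S: "\<And>p. p \<in> S \<Longrightarrow> 0 < snd p" and w: "w \<in> space W" for S w
  proof -
    obtain lam u where sp: "spectral m (A w) lam u" using psd_spectral[OF psd_gram] unfolding A_def by blast
    have "f w p = poisson m lam (l w + fst p) (snd p)" if "p \<in> S" for p
      using Im_stieltjes_poisson[of "H w" lam u "snd p" "l w + fst p"] stieltjes_tr_res[of "Complex (l w + fst p) (snd p)" "H w"] sp S[OF that] dim[OF w]
      by (simp add: f_def A_def)
    moreover have "continuous_on S (\<lambda>p. poisson m lam (l w + fst p) (snd p))" using S by (intro continuous_poisson continuous_intros) auto
    ultimately show ?thesis by (simp cong: continuous_on_cong)
  qed
  define S1 S2 where "S1 = {p. 0 \<le> fst p \<and> fst p \<le> cH \<and> \<eta>s + sqrt (\<eta>s * \<bar>fst p\<bar>) \<le> snd p \<and> snd p \<le> 10}"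
    and "S2 = {p. - cH \<le> fst p \<and> fst p \<le> 0 \<and> \<eta>s \<le> snd p \<and> snd p \<le> (10 :: real)}"
  define h1 h2 where "h1 = (\<lambda>p :: real \<times> real. sqrt (\<bar>fst p\<bar> + snd p))" and "h2 = (\<lambda>p :: real \<times> real. snd p / sqrt (\<bar>fst p\<bar> + snd p))"
  have S1p: "0 < snd p" if "p \<in> S1" for p
  proof -
    have "0 \<le> sqrt (\<eta>s * \<bar>fst p\<bar>)" using s0 by simp
    moreover have "\<eta>s + sqrt (\<eta>s * \<bar>fst p\<bar>) \<le> snd p" using that unfolding S1_def by blast
    ultimately show ?thesis using s0 by linarith
  qed
  have S2p: "0 < snd p" if "p \<in> S2" for p using that s0 by (auto simp: S2_def)
  have hc: "continuous_on S1 h1" "continuous_on S2 h2"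
  proof -
    show "continuous_on S1 h1" unfolding h1_def by (intro continuous_intros)
    have "\<bar>fst p\<bar> + snd p \<noteq> 0" if "p \<in> S2" for p using S2p[OF that] by linarith
    then show "continuous_on S2 h2" unfolding h2_def by (intro continuous_intros) auto
  qed
  have sets: "{w \<in> space W. \<forall>p\<in>S. 0 \<le> f w p - 1 / CH * h p} \<in> sets W" "{w \<in> space W. \<forall>p\<in>S. 0 \<le> CH * h p - f w p} \<in> sets W"
    if "continuous_on S h" "\<And>p. p \<in> S \<Longrightarrow> 0 < snd p" for S h
    using that by (intro sets_Ball_continuous borel_measurable_diff borel_measurable_const fm continuous_intros fc; simp)+
  have eq: "edge_regular \<tau> cH CH (H w) \<longleftrightarrow> 0 < \<tau> \<and> \<tau> \<le> 2 / 3 \<and> 0 < cH \<and> 1 < CH \<and>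
     (\<forall>p\<in>S1. 0 \<le> f w p - 1 / CH * h1 p) \<and> (\<forall>p\<in>S1. 0 \<le> CH * h1 p - f w p) \<and>
     (\<forall>p\<in>S2. 0 \<le> f w p - 1 / CH * h2 p) \<and> (\<forall>p\<in>S2. 0 \<le> CH * h2 p - f w p) \<and> cH / 2 \<le> l w \<and> l w \<le> 2 * CH"
    if w: "w \<in> space W" for w
  proof -
    have F: "f w (E - l w, \<eta>) = Im (stieltjes (H w) (Complex E \<eta>))" if "0 < \<eta>" for E \<eta>
      using stieltjes_tr_res[of "Complex E \<eta>" "H w"] that dim[OF w] by (simp add: f_def A_def)
    have all: "(\<forall>p\<in>S. Q (f w p) p) \<longleftrightarrow> (\<forall>E \<eta>. (E - l w, \<eta>) \<in> S \<longrightarrow> Q (Im (stieltjes (H w) (Complex E \<eta>))) (E - l w, \<eta>))"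
      if "\<And>p. p \<in> S \<Longrightarrow> 0 < snd p" for S Q
    proof safe
      fix E \<eta> assume "\<forall>p\<in>S. Q (f w p) p" "(E - l w, \<eta>) \<in> S"
      then show "Q (Im (stieltjes (H w) (Complex E \<eta>))) (E - l w, \<eta>)" using F[of \<eta> E] that[of "(E - l w, \<eta>)"] by auto
    next
      fix e \<eta> assume h: "\<forall>E \<eta>. (E - l w, \<eta>) \<in> S \<longrightarrow> Q (Im (stieltjes (H w) (Complex E \<eta>))) (E - l w, \<eta>)" "(e, \<eta>) \<in> S"
      then show "Q (f w (e, \<eta>)) (e, \<eta>)" using h(1)[rule_format, of "e + l w" \<eta>] F[of \<eta> "e + l w"] that[of "(e, \<eta>)"] by auto
    qed
    have S1i: "(E - l w, \<eta>) \<in> S1 \<longleftrightarrow> l w \<le> E \<and> E \<le> l w + cH \<and> \<eta>s + sqrt (\<eta>s * \<bar>E - l w\<bar>) \<le> \<eta> \<and> \<eta> \<le> 10"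
      and S2i: "(E - l w, \<eta>) \<in> S2 \<longleftrightarrow> l w - cH \<le> E \<and> E \<le> l w \<and> \<eta>s \<le> \<eta> \<and> \<eta> \<le> 10" for E \<eta>
      unfolding S1_def S2_def mem_Collect_eq fst_conv snd_conv by linarith+
    have hi: "h1 (E - l w, \<eta>) = sqrt (\<bar>E - l w\<bar> + \<eta>)" "h2 (E - l w, \<eta>) = \<eta> / sqrt (\<bar>E - l w\<bar> + \<eta>)" for E \<eta>
      by (simp_all add: h1_def h2_def)
    have c1: "(\<forall>p\<in>S1. 0 \<le> f w p - 1 / CH * h1 p) \<longleftrightarrow> (\<forall>E \<eta>. l w \<le> E \<and> E \<le> l w + cH \<and> \<eta>s + sqrt (\<eta>s * \<bar>E - l w\<bar>) \<le> \<eta> \<and> \<eta> \<le> 10 \<longrightarrow>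
        1 / CH * sqrt (\<bar>E - l w\<bar> + \<eta>) \<le> Im (stieltjes (H w) (Complex E \<eta>)))"
      using all[of S1, OF S1p, where Q = "\<lambda>y p. 0 \<le> y - 1 / CH * h1 p"] unfolding S1i hi diff_ge_0_iff_ge .
    have c2: "(\<forall>p\<in>S1. 0 \<le> CH * h1 p - f w p) \<longleftrightarrow> (\<forall>E \<eta>. l w \<le> E \<and> E \<le> l w + cH \<and> \<eta>s + sqrt (\<eta>s * \<bar>E - l w\<bar>) \<le> \<eta> \<and> \<eta> \<le> 10 \<longrightarrow>
        Im (stieltjes (H w) (Complex E \<eta>)) \<le> CH * sqrt (\<bar>E - l w\<bar> + \<eta>))"
      using all[of S1, OF S1p, where Q = "\<lambda>y p. 0 \<le> CH * h1 p - y"] unfolding S1i hi diff_ge_0_iff_ge .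
    have c3: "(\<forall>p\<in>S2. 0 \<le> f w p - 1 / CH * h2 p) \<longleftrightarrow> (\<forall>E \<eta>. l w - cH \<le> E \<and> E \<le> l w \<and> \<eta>s \<le> \<eta> \<and> \<eta> \<le> 10 \<longrightarrow>
        1 / CH * (\<eta> / sqrt (\<bar>E - l w\<bar> + \<eta>)) \<le> Im (stieltjes (H w) (Complex E \<eta>)))"
      using all[of S2, OF S2p, where Q = "\<lambda>y p. 0 \<le> y - 1 / CH * h2 p"] unfolding S2i hi diff_ge_0_iff_ge .
    have c4: "(\<forall>p\<in>S2. 0 \<le> CH * h2 p - f w p) \<longleftrightarrow> (\<forall>E \<eta>. l w - cH \<le> E \<and> E \<le> l w \<and> \<eta>s \<le> \<eta> \<and> \<eta> \<le> 10 \<longrightarrow>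
        Im (stieltjes (H w) (Complex E \<eta>)) \<le> CH * (\<eta> / sqrt (\<bar>E - l w\<bar> + \<eta>)))"
      using all[of S2, OF S2p, where Q = "\<lambda>y p. 0 \<le> CH * h2 p - y"] unfolding S2i hi diff_ge_0_iff_ge .
    show ?thesis
      unfolding edge_regular_def Let_def dim[OF w] \<eta>s_def[symmetric] l_def[symmetric] c1 c2 c3 c4
      using op[OF w] unfolding l_def[THEN fun_cong, symmetric] by blast
  qed
  have "{w \<in> space W. edge_regular \<tau> cH CH (H w)} = {w \<in> space W. 0 < \<tau> \<and> \<tau> \<le> 2 / 3 \<and> 0 < cH \<and> 1 < CH \<and>
     (\<forall>p\<in>S1. 0 \<le> f w p - 1 / CH * h1 p) \<and> (\<forall>p\<in>S1. 0 \<le> CH * h1 p - f w p) \<and>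
     (\<forall>p\<in>S2. 0 \<le> f w p - 1 / CH * h2 p) \<and> (\<forall>p\<in>S2. 0 \<le> CH * h2 p - f w p) \<and> cH / 2 \<le> l w \<and> l w \<le> 2 * CH}"
    using eq by (intro Collect_cong) blast
  also have "\<dots> \<in> sets W"
    by (intro sets.sets_Collect_conj sets.sets_Collect_const sets hc S1p S2p borel_measurable_le[OF borel_measurable_const lm] borel_measurable_le[OF lm borel_measurable_const]) auto
  finally show ?thesis .
qed

section \<open>Heavy-tailed entries and resampling\<close>

context heavy_tailed
begin

lemma meas [measurable]: "\<Theta> \<in> borel_measurable P" by (rule rv)

text \<open>Atoms have to be excluded because \<open>chi_prob\<close> uses a closed interval where
  the law of \<open>b\<close> uses a half-open one.\<close>

lemma no_atom: "prob {\<omega> \<in> space P. \<bar>\<Theta> \<omega>\<bar> = t} = 0"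
proof -
  obtain f where f: "distributed P lborel \<Theta> f" using density by blast
  then have d: "distr P lborel \<Theta> = density lborel f" and fm: "f \<in> borel_measurable lborel"
    by (auto simp: distributed_def)
  have "{t, - t} \<in> null_sets lborel" by (intro finite_imp_null_set_lborel) auto
  then have n: "AE x in lborel. x \<notin> {t, - t}" by (rule AE_not_in)
  have "AE x in density lborel f. x \<notin> {t, - t}" using n by (subst AE_density[OF fm]) auto
  then have "AE x in distr P lborel \<Theta>. x \<notin> {t, - t}" unfolding d .
  then have "AE \<omega> in P. \<Theta> \<omega> \<notin> {t, - t}" by (rule AE_distrD[rotated]) simp
  then have "AE \<omega> in P. \<not> \<bar>\<Theta> \<omega>\<bar> = t" by (rule AE_mp) auto
  then show ?thesis by (subst prob_Collect_eq_0) auto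
qed

text \<open>Only the absolute value of the Gamma factor enters. The summand
  \<open>s1 powr \<alpha>\<close> of \<open>C\<close> covers the \<open>s\<close> below the range of
  the asymptotics.\<close>

lemma tail_le: obtains C where "0 < C" "\<And>s. 1 \<le> s \<Longrightarrow> prob {\<omega> \<in> space P. s < \<bar>\<Theta> \<omega>\<bar>} \<le> C * s powr (- \<alpha>)"
proof -
  define k where "k = \<bar>\<c> / Gamma (1 - \<alpha> / 2)\<bar>"
  obtain c where c: "0 < c" "eventually (\<lambda>s. norm (prob {\<omega> \<in> space P. s < \<bar>\<Theta> \<omega>\<bar>} + \<c> / Gamma (1 - \<alpha> / 2) * s powr (- \<alpha>))
      \<le> c * norm (s powr (- (\<alpha> + \<rho>)))) at_top"
    using landau_o.bigE[OF tail] by blast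
  then obtain s0 where s0: "\<And>s. s0 \<le> s \<Longrightarrow> norm (prob {\<omega> \<in> space P. s < \<bar>\<Theta> \<omega>\<bar>} + \<c> / Gamma (1 - \<alpha> / 2) * s powr (- \<alpha>))
      \<le> c * norm (s powr (- (\<alpha> + \<rho>)))" by (auto simp: eventually_at_top_linorder)
  define s1 where "s1 = max 1 s0"
  define C where "C = k + c + s1 powr \<alpha>"
  have p1: "0 < s1 powr \<alpha>" by (simp add: s1_def)
  have k0: "0 \<le> k" by (simp add: k_def)
  show ?thesis
  proof (rule that[of C])
    show "0 < C" using p1 k0 c(1) unfolding C_def by linarith
    fix s :: real assume s: "1 \<le> s"
    show "prob {\<omega> \<in> space P. s < \<bar>\<Theta> \<omega>\<bar>} \<le> C * s powr (- \<alpha>)"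
    proof (cases "s1 \<le> s")
      case True
      have "\<c> / Gamma (1 - \<alpha> / 2) * s powr (- \<alpha>) \<ge> - (k * s powr (- \<alpha>))"
        using mult_right_mono[of "- k" "\<c> / Gamma (1 - \<alpha> / 2)" "s powr (- \<alpha>)"] by (simp add: k_def abs_if split: if_splits)
      moreover have "c * norm (s powr (- (\<alpha> + \<rho>))) \<le> c * s powr (- \<alpha>)"
        using s c params by (intro mult_left_mono) (auto intro: powr_mono)
      moreover have "norm (prob {\<omega> \<in> space P. s < \<bar>\<Theta> \<omega>\<bar>} + \<c> / Gamma (1 - \<alpha> / 2) * s powr (- \<alpha>)) \<le> c * norm (s powr (- (\<alpha> + \<rho>)))"
        using True by (intro s0) (auto simp: s1_def)
      ultimately have "prob {\<omega> \<in> space P. s < \<bar>\<Theta> \<omega>\<bar>} \<le> k * s powr (- \<alpha>) + c * s powr (- \<alpha>)" unfolding real_norm_def by linarith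
      also have "\<dots> \<le> C * s powr (- \<alpha>)" using p1 by (simp add: C_def algebra_simps)
      finally show ?thesis .
    next
      case False
      have "1 = s powr \<alpha> * s powr (- \<alpha>)" using s by (simp add: powr_minus)
      also have "\<dots> \<le> s1 powr \<alpha> * s powr (- \<alpha>)" using False s params by (intro mult_right_mono powr_mono2) auto
      also have "\<dots> \<le> C * s powr (- \<alpha>)" using k0 c by (intro mult_right_mono) (auto simp: C_def)
      finally show ?thesis using prob_le_1[of "{\<omega> \<in> space P. s < \<bar>\<Theta> \<omega>\<bar>}"] by linarith
    qed
  qed
qed

text \<open>The one dyadic layer that contains \<open>t\<close> already dominates; the sum over all
  layers can be integrated term by term.\<close>

lemma dyadic_bound:
  fixes t \<beta> :: real
  assumes "0 \<le> t" "0 < \<beta>"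
  shows "ennreal (t powr \<beta>) \<le> 1 + (\<Sum>k. ennreal ((2 ^ Suc k) powr \<beta>) * indicator {2 ^ k<..} t)"
proof (cases "t \<le> 1")
  case True
  then have "t powr \<beta> \<le> 1" using assms powr_mono2[of \<beta> t 1] by simp
  then have "ennreal (t powr \<beta>) \<le> 1" by (simp add: ennreal_le_1)
  then show ?thesis by (rule order_trans) simp
next
  case False
  have ex: "\<exists>n. t \<le> 2 ^ n" using real_arch_pow[of 2 t] by (auto intro: less_imp_le)
  define n where "n = (LEAST n. t \<le> 2 ^ n)"
  have n: "t \<le> 2 ^ n" unfolding n_def by (rule LeastI_ex[OF ex])
  then obtain k where k: "n = Suc k" using False by (cases n) auto
  have "2 ^ k < t" using not_less_Least[of k "\<lambda>n. t \<le> 2 ^ n"] k unfolding n_def by (simp add: not_le)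
  then have "ennreal (t powr \<beta>) \<le> ennreal ((2 ^ Suc k) powr \<beta>) * indicator {2 ^ k<..} t"
    using n k assms by (auto intro!: ennreal_leI powr_mono2)
  also have "\<dots> \<le> (\<Sum>k. ennreal ((2 ^ Suc k) powr \<beta>) * indicator {2 ^ k<..} t)"
  proof -
    have "sum f {k} \<le> suminf f" for f :: "nat \<Rightarrow> ennreal" by (intro sum_le_suminf) auto
    moreover have "sum f {k} = f k" for f :: "nat \<Rightarrow> ennreal" by simp
    ultimately have "f k \<le> suminf f" for f :: "nat \<Rightarrow> ennreal" by metis
    then show ?thesis .
  qed
  finally show ?thesis by (rule order_trans) simp
qed

text \<open>By the tail bound the layers of \<open>dyadic_bound\<close> contribute a geometric
  series with ratio \<open>2 powr (\<beta> - \<alpha>) < 1\<close>.\<close>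

lemma integrable_powr:
  assumes \<beta>: "0 < \<beta>" "\<beta> < \<alpha>"
  shows "integrable P (\<lambda>\<omega>. \<bar>\<Theta> \<omega>\<bar> powr \<beta>)"
proof -
  obtain C where C: "0 < C" "\<And>s. 1 \<le> s \<Longrightarrow> prob {\<omega> \<in> space P. s < \<bar>\<Theta> \<omega>\<bar>} \<le> C * s powr (- \<alpha>)" using tail_le by blast
  define r where "r = (2 :: real) powr (\<beta> - \<alpha>)"
  have r: "0 < r" "r < 1" using \<beta> powr_less_mono[of "\<beta> - \<alpha>" 0 2] by (auto simp: r_def)
  have layer: "ennreal ((2 ^ Suc k) powr \<beta>) * emeasure P {\<omega> \<in> space P. 2 ^ k < \<bar>\<Theta> \<omega>\<bar>} \<le> ennreal (2 powr \<beta> * C * r ^ k)" for k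
  proof -
    have "prob {\<omega> \<in> space P. 2 ^ k < \<bar>\<Theta> \<omega>\<bar>} \<le> C * (2 ^ k) powr (- \<alpha>)" by (rule C(2)) simp
    then have "(2 ^ Suc k) powr \<beta> * prob {\<omega> \<in> space P. 2 ^ k < \<bar>\<Theta> \<omega>\<bar>} \<le> (2 ^ Suc k) powr \<beta> * (C * (2 ^ k) powr (- \<alpha>))"
      by (intro mult_left_mono) auto
    also have "\<dots> = 2 powr \<beta> * C * ((2 ^ k) powr \<beta> * (2 ^ k) powr (- \<alpha>))" by (simp add: powr_mult)
    also have "(2 ^ k) powr \<beta> * (2 ^ k) powr (- \<alpha>) = (2 ^ k :: real) powr (\<beta> - \<alpha>)" by (simp add: powr_add[symmetric])
    also have "\<dots> = r ^ k" by (simp add: r_def powr_realpow[symmetric] powr_powr mult.commute)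
    finally show ?thesis unfolding emeasure_eq_measure by (simp add: ennreal_mult[symmetric] ennreal_leI)
  qed
  have "(\<integral>\<^sup>+\<omega>. ennreal (\<bar>\<Theta> \<omega>\<bar> powr \<beta>) \<partial>P) \<le> (\<integral>\<^sup>+\<omega>. 1 + (\<Sum>k. ennreal ((2 ^ Suc k) powr \<beta>) * indicator {2 ^ k<..} \<bar>\<Theta> \<omega>\<bar>) \<partial>P)"
    using \<beta> by (intro nn_integral_mono dyadic_bound) auto
  also have "\<dots> = 1 + (\<Sum>k. ennreal ((2 ^ Suc k) powr \<beta>) * (\<integral>\<^sup>+\<omega>. indicator {2 ^ k<..} \<bar>\<Theta> \<omega>\<bar> \<partial>P))"
    by (simp add: nn_integral_add nn_integral_suminf nn_integral_cmult emeasure_space_1)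
  also have "\<dots> = 1 + (\<Sum>k. ennreal ((2 ^ Suc k) powr \<beta>) * emeasure P {\<omega> \<in> space P. 2 ^ k < \<bar>\<Theta> \<omega>\<bar>})"
  proof -
    have "(\<integral>\<^sup>+\<omega>. indicator {2 ^ k<..} \<bar>\<Theta> \<omega>\<bar> \<partial>P) = emeasure P {\<omega> \<in> space P. 2 ^ k < \<bar>\<Theta> \<omega>\<bar>}" for k :: nat
    proof -
      have "(\<integral>\<^sup>+\<omega>. indicator {2 ^ k<..} \<bar>\<Theta> \<omega>\<bar> \<partial>P) = (\<integral>\<^sup>+\<omega>. indicator {\<omega> \<in> space P. 2 ^ k < \<bar>\<Theta> \<omega>\<bar>} \<omega> \<partial>P)"
        by (intro nn_integral_cong) (auto simp: indicator_def)
      then show ?thesis by simp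
    qed
    then show ?thesis by simp
  qed
  also have "\<dots> \<le> 1 + (\<Sum>k. ennreal (2 powr \<beta> * C * r ^ k))" by (intro add_left_mono suminf_le layer) auto
  also have "(\<Sum>k. ennreal (2 powr \<beta> * C * r ^ k)) = ennreal (\<Sum>k. 2 powr \<beta> * C * r ^ k)"
    using C r by (intro suminf_ennreal2) (auto intro!: summable_mult summable_geometric)
  finally have "(\<integral>\<^sup>+\<omega>. ennreal (\<bar>\<Theta> \<omega>\<bar> powr \<beta>) \<partial>P) < \<infinity>"
    by (rule le_less_trans) (simp add: ennreal_add_less_top ennreal_less_top)
  then show ?thesis by (intro integrableI_nonneg) auto
qed

text \<open>\<open>A\<close> is the range of the medium entries. The product of
  \<open>\<chi>\<close> and \<open>b\<close> has the law of an entry conditioned to be below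
  \<open>N powr (- \<epsilon>b)\<close> with its small values replaced by 0, so its second and
  fourth moments will be \<open>m2 / pN\<close> and \<open>m4 / pN\<close>.\<close>

definition A where "A \<epsilon>a \<epsilon>b N = {x. \<bar>x\<bar> \<in> {real N powr (- 1/2 - \<epsilon>a) ..< real N powr (- \<epsilon>b)}}"
definition m2 where "m2 \<epsilon>a \<epsilon>b N = (\<integral>\<omega>. indicator (A \<epsilon>a \<epsilon>b N) (\<Theta> \<omega> / sqrt (real N)) * (\<Theta> \<omega> / sqrt (real N))\<^sup>2 \<partial>P)"
definition m4 where "m4 \<epsilon>a \<epsilon>b N = (\<integral>\<omega>. indicator (A \<epsilon>a \<epsilon>b N) (\<Theta> \<omega> / sqrt (real N)) * (\<Theta> \<omega> / sqrt (real N)) ^ 4 \<partial>P)"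
definition pN where "pN \<epsilon>b N = prob {\<omega> \<in> space P. \<bar>\<Theta> \<omega> / sqrt (real N)\<bar> < real N powr (- \<epsilon>b)}"

lemma A_sets [measurable]: "A \<epsilon>a \<epsilon>b N \<in> sets borel"
  unfolding A_def by measurable

lemma scaled_A:
  assumes "1 \<le> N"
  shows "t / sqrt (real N) \<in> A \<epsilon>a \<epsilon>b N \<longleftrightarrow> real N powr (- \<epsilon>a) \<le> \<bar>t\<bar> \<and> \<bar>t\<bar> < real N powr (1/2 - \<epsilon>b)"
    and "\<bar>t / sqrt (real N)\<bar> < real N powr (- \<epsilon>b) \<longleftrightarrow> \<bar>t\<bar> < real N powr (1/2 - \<epsilon>b)"
proof -
  have N: "0 < real N" using assms by simp
  have s: "sqrt (real N) = real N powr (1/2)" using N by (simp add: powr_half_sqrt)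
  have s0: "0 < sqrt (real N)" using N by simp
  have 1: "real N powr (- 1/2 - \<epsilon>a) * sqrt (real N) = real N powr (- \<epsilon>a)" unfolding s powr_add[symmetric] by simp
  have 2: "real N powr (- \<epsilon>b) * sqrt (real N) = real N powr (1/2 - \<epsilon>b)" unfolding s powr_add[symmetric] by simp
  have ab: "\<bar>t / sqrt (real N)\<bar> = \<bar>t\<bar> / sqrt (real N)" using s0 by (simp add: abs_divide)
  show "\<bar>t / sqrt (real N)\<bar> < real N powr (- \<epsilon>b) \<longleftrightarrow> \<bar>t\<bar> < real N powr (1/2 - \<epsilon>b)"
    unfolding ab pos_divide_less_eq[OF s0] 2 ..
  then show "t / sqrt (real N) \<in> A \<epsilon>a \<epsilon>b N \<longleftrightarrow> real N powr (- \<epsilon>a) \<le> \<bar>t\<bar> \<and> \<bar>t\<bar> < real N powr (1/2 - \<epsilon>b)"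
    unfolding A_def mem_Collect_eq atLeastLessThan_iff unfolding ab pos_le_divide_eq[OF s0] 1 by simp
qed

text \<open>In terms of \<open>\<Theta>\<close> the cutoffs tend to 0 and to infinity, so dominated
  convergence recovers the full second moment; the value 0 of \<open>\<Theta>\<close> contributes
  nothing.\<close>

lemma m2_limit:
  assumes "0 < \<epsilon>a" "\<epsilon>b < 1/2"
  shows "(\<lambda>N. real N * m2 \<epsilon>a \<epsilon>b N) \<longlonglongrightarrow> 1"
proof -
  define B where "B = (\<lambda>N. {t. real N powr (- \<epsilon>a) \<le> \<bar>t\<bar> \<and> \<bar>t\<bar> < real N powr (1/2 - \<epsilon>b)})"
  have Bm [measurable]: "B N \<in> sets borel" for N unfolding B_def by measurable
  have eq: "real N * m2 \<epsilon>a \<epsilon>b N = (\<integral>\<omega>. indicator (B N) (\<Theta> \<omega>) * (\<Theta> \<omega>)\<^sup>2 \<partial>P)" if "1 \<le> N" for N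
  proof -
    have "real N * m2 \<epsilon>a \<epsilon>b N = (\<integral>\<omega>. real N * (indicator (A \<epsilon>a \<epsilon>b N) (\<Theta> \<omega> / sqrt (real N)) * (\<Theta> \<omega> / sqrt (real N))\<^sup>2) \<partial>P)"
      unfolding m2_def by simp
    also have "\<dots> = (\<integral>\<omega>. indicator (B N) (\<Theta> \<omega>) * (\<Theta> \<omega>)\<^sup>2 \<partial>P)"
      using that scaled_A(1)[OF that] by (intro Bochner_Integration.integral_cong) (auto simp: B_def indicator_def power_divide)
    finally show ?thesis .
  qed
  have "(\<lambda>N. \<integral>\<omega>. indicator (B N) (\<Theta> \<omega>) * (\<Theta> \<omega>)\<^sup>2 \<partial>P) \<longlonglongrightarrow> (\<integral>\<omega>. (\<Theta> \<omega>)\<^sup>2 \<partial>P)"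
  proof (rule integral_dominated_convergence[where w = "\<lambda>\<omega>. (\<Theta> \<omega>)\<^sup>2"])
    show "AE \<omega> in P. (\<lambda>N. indicator (B N) (\<Theta> \<omega>) * (\<Theta> \<omega>)\<^sup>2) \<longlonglongrightarrow> (\<Theta> \<omega>)\<^sup>2"
    proof (rule AE_I2)
      fix \<omega>
      show "(\<lambda>N. indicator (B N) (\<Theta> \<omega>) * (\<Theta> \<omega>)\<^sup>2) \<longlonglongrightarrow> (\<Theta> \<omega>)\<^sup>2"
      proof (cases "\<Theta> \<omega> = 0")
        case False
        have "(\<lambda>N. real N powr (- \<epsilon>a)) \<longlonglongrightarrow> 0" using assms(1) by real_asymp
        then have e1: "eventually (\<lambda>N. real N powr (- \<epsilon>a) < \<bar>\<Theta> \<omega>\<bar>) sequentially" using False by (intro order_tendstoD) auto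
        have e0: "0 < 1/2 - \<epsilon>b" using assms(2) by simp
        have "LIM N sequentially. real N powr (1/2 - \<epsilon>b) :> at_top" using e0 by real_asymp
        then have e2: "eventually (\<lambda>N. \<bar>\<Theta> \<omega>\<bar> < real N powr (1/2 - \<epsilon>b)) sequentially" by (simp add: filterlim_at_top_dense)
        show ?thesis
          by (rule tendsto_eventually) (use e1 e2 in \<open>eventually_elim, auto simp: B_def\<close>)
      qed simp
    qed
  qed (auto simp: integrable_sq indicator_def)
  then have "(\<lambda>N. \<integral>\<omega>. indicator (B N) (\<Theta> \<omega>) * (\<Theta> \<omega>)\<^sup>2 \<partial>P) \<longlonglongrightarrow> 1" unfolding second_moment .
  then show ?thesis
    by (rule Lim_transform_eventually) (use eq in \<open>auto intro!: eventually_mono[OF eventually_ge_at_top[of 1]]\<close>)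
qed

lemma pN_limit:
  assumes "\<epsilon>b < 1/2"
  shows "pN \<epsilon>b \<longlonglongrightarrow> 1"
proof -
  define B where "B = (\<lambda>N :: nat. {t :: real. \<bar>t\<bar> < real N powr (1/2 - \<epsilon>b)})"
  have Bm [measurable]: "B N \<in> sets borel" for N unfolding B_def by measurable
  have eq: "pN \<epsilon>b N = (\<integral>\<omega>. indicator (B N) (\<Theta> \<omega>) \<partial>P)" if "1 \<le> N" for N
  proof -
    have "(\<integral>\<omega>. indicator (B N) (\<Theta> \<omega>) \<partial>P) = (\<integral>\<omega>. indicator {\<omega> \<in> space P. \<bar>\<Theta> \<omega> / sqrt (real N)\<bar> < real N powr (- \<epsilon>b)} \<omega> \<partial>P)"
      using scaled_A(2)[OF that] by (intro Bochner_Integration.integral_cong) (auto simp: B_def indicator_def)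
    also have "\<dots> = pN \<epsilon>b N"
      unfolding pN_def Bochner_Integration.integral_indicator by (rule arg_cong[of _ _ prob]) auto
    finally show ?thesis by simp
  qed
  have "(\<lambda>N. \<integral>\<omega>. indicator (B N) (\<Theta> \<omega>) \<partial>P) \<longlonglongrightarrow> (\<integral>\<omega>. (1 :: real) \<partial>P)"
  proof (rule integral_dominated_convergence[where w = "\<lambda>\<omega>. 1"])
    show "AE \<omega> in P. (\<lambda>N. indicator (B N) (\<Theta> \<omega>) :: real) \<longlonglongrightarrow> 1"
    proof (rule AE_I2)
      fix \<omega>
      have e0: "0 < 1/2 - \<epsilon>b" using assms by simp
      have "LIM N sequentially. real N powr (1/2 - \<epsilon>b) :> at_top" using e0 by real_asymp
      then have e2: "eventually (\<lambda>N. \<bar>\<Theta> \<omega>\<bar> < real N powr (1/2 - \<epsilon>b)) sequentially" by (simp add: filterlim_at_top_dense)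
      show "(\<lambda>N. indicator (B N) (\<Theta> \<omega>) :: real) \<longlonglongrightarrow> 1"
        by (rule tendsto_eventually) (use e2 in \<open>eventually_elim, auto simp: B_def\<close>)
    qed
  qed (auto simp: indicator_def)
  then have "(\<lambda>N. \<integral>\<omega>. indicator (B N) (\<Theta> \<omega>) \<partial>P) \<longlonglongrightarrow> (1 :: real)" by (simp add: prob_space)
  then show ?thesis
    by (rule Lim_transform_eventually) (use eq in \<open>auto intro!: eventually_mono[OF eventually_ge_at_top[of 1]]\<close>)
qed

text \<open>Interpolation: below the cutoff \<open>T = N powr (1/2 - \<epsilon>b)\<close> one has
  \<open>\<Theta>^4 \<le> T powr (4 - \<beta>) * \<bar>\<Theta>\<bar> powr \<beta>\<close>. The
  bound on \<open>\<epsilon>b\<close> implies \<open>20 * \<epsilon>b < \<alpha> - 2\<close>, which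
  makes room for an exponent \<open>\<beta>\<close> between \<open>2 + 20 * \<epsilon>b\<close> and
  \<open>\<alpha>\<close>: it has a finite moment and leaves a power of \<open>N\<close> to
  spare.\<close>

lemma m4_le:
  assumes "0 < \<epsilon>a" "0 < \<epsilon>b" "\<epsilon>b < (\<alpha> - 2) / (10 * \<alpha>)"
  shows "eventually (\<lambda>N. m4 \<epsilon>a \<epsilon>b N \<le> m2 \<epsilon>a \<epsilon>b N / (real N powr \<epsilon>b) ^ 10) sequentially"
proof -
  have eb: "20 * \<epsilon>b < \<alpha> - 2"
  proof -
    have "\<epsilon>b * (10 * \<alpha>) < \<alpha> - 2" using assms(3) params by (simp add: pos_less_divide_eq)
    moreover have "\<epsilon>b * 20 < \<epsilon>b * (10 * \<alpha>)" using assms(2) params by (intro mult_strict_left_mono) auto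
    ultimately show ?thesis by linarith
  qed
  define \<beta> where "\<beta> = (2 + 20 * \<epsilon>b + \<alpha>) / 2"
  have \<beta>: "2 + 20 * \<epsilon>b < \<beta>" "\<beta> < \<alpha>" "0 < \<beta>" using eb assms(2) params by (auto simp: \<beta>_def)
  define Mb where "Mb = (\<integral>\<omega>. \<bar>\<Theta> \<omega>\<bar> powr \<beta> \<partial>P)"
  \<comment> \<open>The exponent of \<open>N\<close> in
    \<open>T powr (4 - \<beta>) * L ^ 10\<close>, where \<open>L = N powr \<epsilon>b\<close>. It
    has to be below 1, since \<open>m4\<close> carries a factor \<open>1 / N^2\<close> and
    \<open>m2\<close> is of order \<open>1 / N\<close>.\<close>
  define e where "e = (1/2 - \<epsilon>b) * (4 - \<beta>) + 10 * \<epsilon>b"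
  have e1: "0 < 1 - e"
  proof -
    have "0 \<le> \<epsilon>b * (4 - \<beta>)" using assms(2) \<beta> params by simp
    moreover have "e = (4 - \<beta>) / 2 - \<epsilon>b * (4 - \<beta>) + 10 * \<epsilon>b" by (simp add: e_def left_diff_distrib)
    moreover have "0 < 1 - e" if "0 \<le> x" "e = (4 - \<beta>) / 2 - x + 10 * \<epsilon>b" for x
    proof -
      have "2 * e = 4 - \<beta> - 2 * x + 20 * \<epsilon>b" using that(2) by simp
      then have "2 * e < 2" using \<beta>(1) that(1) by linarith
      then show ?thesis by simp
    qed
    ultimately show ?thesis by blast
  qed
  have eb2: "\<epsilon>b < 1/2" using eb params by simp
  have "eventually (\<lambda>N. 1/2 < real N * m2 \<epsilon>a \<epsilon>b N) sequentially"
    using m2_limit[OF assms(1) eb2] by (intro order_tendstoD) auto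
  moreover have "LIM N sequentially. real N powr (1 - e) :> at_top" using e1 by real_asymp
  then have "eventually (\<lambda>N. 2 * Mb \<le> real N powr (1 - e)) sequentially" unfolding filterlim_at_top by blast
  ultimately show ?thesis using eventually_ge_at_top[of 1]
  proof eventually_elim
    case (elim N)
    define T where "T = real N powr (1/2 - \<epsilon>b)"
    have N: "0 < real N" using elim by simp
    have T: "0 < T" using N by (simp add: T_def)
    have Am: "t / sqrt (real N) \<in> A \<epsilon>a \<epsilon>b N \<longleftrightarrow> real N powr (- \<epsilon>a) \<le> \<bar>t\<bar> \<and> \<bar>t\<bar> < T" for t
      unfolding T_def by (rule scaled_A(1)) (use elim in simp)
    have "m4 \<epsilon>a \<epsilon>b N \<le> (\<integral>\<omega>. T powr (4 - \<beta>) * \<bar>\<Theta> \<omega>\<bar> powr \<beta> / (real N)\<^sup>2 \<partial>P)"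
      unfolding m4_def
    proof (rule integral_mono')
      show "integrable P (\<lambda>\<omega>. T powr (4 - \<beta>) * \<bar>\<Theta> \<omega>\<bar> powr \<beta> / (real N)\<^sup>2)" using integrable_powr[OF \<beta>(3,2)] by simp
      fix \<omega>
      show "indicator (A \<epsilon>a \<epsilon>b N) (\<Theta> \<omega> / sqrt (real N)) * (\<Theta> \<omega> / sqrt (real N)) ^ 4 \<le> T powr (4 - \<beta>) * \<bar>\<Theta> \<omega>\<bar> powr \<beta> / (real N)\<^sup>2"
      proof (cases "\<Theta> \<omega> / sqrt (real N) \<in> A \<epsilon>a \<epsilon>b N")
        case True
        then have t: "\<bar>\<Theta> \<omega>\<bar> < T" "0 < \<bar>\<Theta> \<omega>\<bar>" using Am[of "\<Theta> \<omega>"] N powr_gt_zero[of "real N" "- \<epsilon>a"] by (auto simp del: powr_gt_zero)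
        have "(\<Theta> \<omega> / sqrt (real N)) ^ 4 = \<bar>\<Theta> \<omega>\<bar> ^ 4 / (real N)\<^sup>2"
        proof -
          have "sqrt (real N) ^ 4 = ((sqrt (real N))\<^sup>2)\<^sup>2" by (simp only: power_mult[symmetric]) simp
          then show ?thesis by (simp add: power_divide)
        qed
        also have "\<bar>\<Theta> \<omega>\<bar> ^ 4 = \<bar>\<Theta> \<omega>\<bar> powr 4" using t(2) by simp
        also have "\<bar>\<Theta> \<omega>\<bar> powr 4 = \<bar>\<Theta> \<omega>\<bar> powr (4 - \<beta>) * \<bar>\<Theta> \<omega>\<bar> powr \<beta>" by (simp add: powr_add[symmetric])
        also have "\<dots> / (real N)\<^sup>2 \<le> T powr (4 - \<beta>) * \<bar>\<Theta> \<omega>\<bar> powr \<beta> / (real N)\<^sup>2"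
          using t \<beta> params by (intro divide_right_mono mult_right_mono powr_mono2) auto
        finally show ?thesis using True by simp
      qed (use T in auto)
    qed auto
    also have "\<dots> = T powr (4 - \<beta>) * Mb / (real N)\<^sup>2" by (simp add: Mb_def)
    finally have 1: "m4 \<epsilon>a \<epsilon>b N \<le> T powr (4 - \<beta>) * Mb / (real N)\<^sup>2" .
    have L: "0 < (real N powr \<epsilon>b) ^ 10" using N by simp
    have pw: "T powr (4 - \<beta>) * (real N powr \<epsilon>b) ^ 10 = real N powr e"
      using N by (simp add: T_def e_def powr_powr powr_add powr_realpow[symmetric] mult.commute)
    have "T powr (4 - \<beta>) * Mb / (real N)\<^sup>2 * (real N powr \<epsilon>b) ^ 10 = real N powr e * Mb / (real N)\<^sup>2"
      unfolding pw[symmetric] by simp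
    also have "\<dots> \<le> real N powr e * (real N powr (1 - e) / 2) / (real N)\<^sup>2"
      using elim(2) by (intro divide_right_mono mult_left_mono) auto
    also have "\<dots> = (real N powr e * real N powr (1 - e)) / 2 / (real N)\<^sup>2" by simp
    also have "real N powr e * real N powr (1 - e) = real N" using N by (simp add: powr_add[symmetric])
    also have "real N / 2 / (real N)\<^sup>2 = (1/2) / real N" using N by (simp add: power2_eq_square)
    also have "\<dots> \<le> real N * m2 \<epsilon>a \<epsilon>b N / real N" using elim(1) N by (intro divide_right_mono) auto
    also have "\<dots> = m2 \<epsilon>a \<epsilon>b N" using N by simp
    finally have "T powr (4 - \<beta>) * Mb / (real N)\<^sup>2 \<le> m2 \<epsilon>a \<epsilon>b N / (real N powr \<epsilon>b) ^ 10" unfolding pos_le_divide_eq[OF L] .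
    then show ?case using 1 by linarith
  qed
qed

lemma odd_zero:
  assumes [measurable]: "f \<in> borel_measurable borel" and odd: "\<And>x. f (- x) = - f x"
  shows "(\<integral>\<omega>. f (\<Theta> \<omega>) \<partial>P) = (0 :: real)"
proof -
  have "(\<integral>\<omega>. f (\<Theta> \<omega>) \<partial>P) = (\<integral>x. f x \<partial>distr P borel \<Theta>)" by (rule integral_distr[symmetric]) auto
  also have "\<dots> = (\<integral>x. f x \<partial>distr P borel (\<lambda>\<omega>. - \<Theta> \<omega>))" unfolding symmetric ..
  also have "\<dots> = (\<integral>\<omega>. f (- \<Theta> \<omega>) \<partial>P)" by (rule integral_distr) auto
  also have "\<dots> = - (\<integral>\<omega>. f (\<Theta> \<omega>) \<partial>P)" unfolding odd by simp
  finally show ?thesis by simp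
qed

end

text \<open>Conditioning on a null set by \<open>uniform_measure\<close> gives the zero measure,
  which is not the law of a random variable. So the existence of the resampling variables already
  shows that the conditioning events have positive probability.\<close>

lemma (in prob_space) uniform_measure_prob_pos:
  assumes X: "X \<in> borel_measurable M" and d: "distr M borel X = uniform_measure \<mu> S" and \<mu>: "prob_space \<mu>" "sets \<mu> = sets borel" and S: "S \<in> sets borel"
  shows "0 < measure \<mu> S"
proof (rule ccontr)
  assume "\<not> ?thesis"
  then have "measure \<mu> S = 0" using measure_nonneg[of \<mu> S] by linarith
  then have z: "emeasure \<mu> S = 0" using \<mu>(1) by (simp add: finite_measure.emeasure_eq_measure prob_space.finite_measure)
  interpret D: prob_space "distr M borel X" by (rule prob_space_distr[OF X])
  have "1 = emeasure (distr M borel X) UNIV" using D.emeasure_space_1 by simp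
  also have "\<dots> = emeasure \<mu> (S \<inter> UNIV) / emeasure \<mu> S"
    unfolding d using \<mu>(2) S sets_eq_imp_space_eq[OF \<mu>(2)] by (intro emeasure_uniform_measure) auto
  finally show False by (simp add: z)
qed

lemma integral_uniform_measure:
  fixes h :: "'a \<Rightarrow> real"
  assumes "finite_measure M" and S [measurable]: "S \<in> sets M" and h [measurable]: "h \<in> borel_measurable M" and pos: "0 < measure M S"
  shows "(\<integral>x. h x \<partial>uniform_measure M S) = (\<integral>x. indicator S x * h x \<partial>M) / measure M S"
proof -
  interpret finite_measure M by fact
  have "uniform_measure M S = density M (\<lambda>x. ennreal (indicator S x / measure M S))"
  proof -
    have d: "1 / ennreal (measure M S) = ennreal (1 / measure M S)" using divide_ennreal[of 1 "measure M S"] pos by simp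
    show ?thesis unfolding uniform_measure_def emeasure_eq_measure by (intro density_cong) (auto simp: d split: split_indicator)
  qed
  then have "(\<integral>x. h x \<partial>uniform_measure M S) = (\<integral>x. (indicator S x / measure M S) *\<^sub>R h x \<partial>M)"
    using pos by (simp add: integral_density)
  then show ?thesis by simp
qed

section \<open>Laws of the resampled entries and conditioning on the positions of large
  entries\<close>

locale resampled = resampling Q "entry_law P \<Theta> N" \<epsilon>a \<epsilon>b M N \<xi> + H: heavy_tailed P \<Theta> \<alpha> \<c> \<rho>
  for P :: "'p measure" and \<Theta> \<alpha> \<c> \<rho> and Q :: "'q measure" and \<epsilon>a \<epsilon>b M N \<xi> +
  assumes pos: "0 < M" "0 < N" "0 < \<epsilon>b"
begin

abbreviation "\<mu> \<equiv> entry_law P \<Theta> N"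
abbreviation "A \<equiv> H.A \<epsilon>a \<epsilon>b N"

lemma prob_mu: "prob_space \<mu>"
  unfolding entry_law_def by (intro H.prob_space_distr) simp

lemma sets_mu: "sets \<mu> = sets borel" by (simp add: entry_law_def)

lemma measure_mu: "S \<in> sets borel \<Longrightarrow> measure \<mu> S = H.prob {\<omega> \<in> space P. \<Theta> \<omega> / sqrt (real N) \<in> S}"
  unfolding entry_law_def by (subst measure_distr) (auto intro!: arg_cong[where f = H.prob])

lemma rv: "k \<in> UNIV \<times> {..<M} \<times> {..<N} \<Longrightarrow> \<xi> k \<in> borel_measurable Q"
  using indep by (auto simp: indep_vars_def)

lemma rv': "i < M \<Longrightarrow> j < N \<Longrightarrow> \<xi> (k, i, j) \<in> borel_measurable Q"
  by (rule rv) auto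

lemma A_pos: "0 < measure \<mu> A"
  by (rule uniform_measure_prob_pos[OF rv'[OF pos(1,2)] medium[OF pos(1,2), folded H.A_def] prob_mu sets_mu]) simp

text \<open>Strict bounds on both sides, so that every 0-1 matrix \<open>\<Psi>\<close> is attained
  with positive probability.\<close>

lemma psi_prob: "0 < psi_prob \<mu> \<epsilon>b N" "psi_prob \<mu> \<epsilon>b N < 1"
proof -
  interpret mu: prob_space \<mu> by (rule prob_mu)
  have m: "{x :: real. real N powr (- \<epsilon>b) \<le> \<bar>x\<bar>} \<in> sets borel" by measurable
  show "0 < psi_prob \<mu> \<epsilon>b N" unfolding psi_prob_def
    by (rule uniform_measure_prob_pos[OF rv'[OF pos(1,2)] large[OF pos(1,2)] prob_mu sets_mu]) (use m in simp)
  have "A \<inter> {x. real N powr (- \<epsilon>b) \<le> \<bar>x\<bar>} = {}" by (auto simp: H.A_def)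
  then have "measure \<mu> A + measure \<mu> {x. real N powr (- \<epsilon>b) \<le> \<bar>x\<bar>} = measure \<mu> (A \<union> {x. real N powr (- \<epsilon>b) \<le> \<bar>x\<bar>})"
    using m by (intro mu.finite_measure_Union[symmetric]) (auto simp: sets_mu)
  also have "\<dots> \<le> 1" by (rule mu.prob_le_1)
  finally show "psi_prob \<mu> \<epsilon>b N < 1" using A_pos by (simp add: psi_prob_def)
qed

text \<open>The closed interval and \<open>A\<close> differ only in points of modulus
  \<open>N powr (- \<epsilon>b)\<close>, which carry no mass.\<close>

lemma chi_prob: "chi_prob \<mu> \<epsilon>a \<epsilon>b N = measure \<mu> A / H.pN \<epsilon>b N" "0 < H.pN \<epsilon>b N"
proof -
  interpret mu: prob_space \<mu> by (rule prob_mu)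
  define h where "h = real N powr (- \<epsilon>b)"
  have m [measurable]: "{x :: real. \<bar>x\<bar> < h} \<in> sets borel" "{x :: real. \<bar>x\<bar> = h} \<in> sets borel"
    "{x :: real. \<bar>x\<bar> \<in> {real N powr (- 1/2 - \<epsilon>a) .. h}} \<in> sets borel"
    unfolding atLeastAtMost_iff by measurable
  have p: "measure \<mu> {x. \<bar>x\<bar> < h} = H.pN \<epsilon>b N" using measure_mu[OF m(1)] by (simp only: H.pN_def h_def mem_Collect_eq)
  have "H.prob {\<omega> \<in> space P. \<Theta> \<omega> / sqrt (real N) \<in> {x. \<bar>x\<bar> = h}} = H.prob {\<omega> \<in> space P. \<bar>\<Theta> \<omega>\<bar> = h * sqrt (real N)}"
    using pos by (intro arg_cong[where f = H.prob] Collect_cong conj_cong refl) (simp add: abs_divide divide_eq_eq)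
  then have z: "measure \<mu> {x. \<bar>x\<bar> = h} = 0" unfolding measure_mu[OF m(2)] using H.no_atom by simp
  have "measure \<mu> {x. \<bar>x\<bar> \<in> {real N powr (- 1/2 - \<epsilon>a) .. h}} \<le> measure \<mu> (A \<union> {x. \<bar>x\<bar> = h})"
    using m by (intro mu.finite_measure_mono) (auto simp: H.A_def h_def sets_mu)
  also have "\<dots> \<le> measure \<mu> A + measure \<mu> {x. \<bar>x\<bar> = h}" using m by (intro measure_Un_le) (auto simp: sets_mu)
  finally have "measure \<mu> {x. \<bar>x\<bar> \<in> {real N powr (- 1/2 - \<epsilon>a) .. h}} \<le> measure \<mu> A" using z by simp
  moreover have "measure \<mu> A \<le> measure \<mu> {x. \<bar>x\<bar> \<in> {real N powr (- 1/2 - \<epsilon>a) .. h}}"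
    using m by (intro mu.finite_measure_mono) (auto simp: H.A_def h_def sets_mu)
  ultimately have e: "measure \<mu> {x. \<bar>x\<bar> \<in> {real N powr (- 1/2 - \<epsilon>a) .. h}} = measure \<mu> A" by simp
  show "chi_prob \<mu> \<epsilon>a \<epsilon>b N = measure \<mu> A / H.pN \<epsilon>b N" unfolding chi_prob_def h_def[symmetric] e p ..
  have "measure \<mu> A \<le> measure \<mu> {x. \<bar>x\<bar> < h}"
    using m by (intro mu.finite_measure_mono) (auto simp: H.A_def h_def sets_mu)
  then show "0 < H.pN \<epsilon>b N" using A_pos p by simp
qed

definition trunc :: "real \<Rightarrow> real" where "trunc x = (if \<bar>x\<bar> \<le> real N ^ 100 then x else 0)"
text \<open>What an entry of \<open>X\<close> becomes at a position where \<open>\<psi>\<close>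
  vanishes.\<close>

definition W where "W i j \<omega> = trunc (\<xi> (Chi, i, j) \<omega> * \<xi> (Medium, i, j) \<omega>)"
definition \<nu> where "\<nu> = distr Q borel (W 0 0)"

lemma trunc_measurable [measurable]: "trunc \<in> borel_measurable borel"
  unfolding trunc_def by measurable

lemma W_measurable: "i < M \<Longrightarrow> j < N \<Longrightarrow> W i j \<in> borel_measurable Q"
  using rv'[of i j Chi] rv'[of i j Medium] unfolding W_def by measurable

lemma chi_medium_indep:
  assumes ij: "i < M" "j < N"
  shows "indep_var borel (\<xi> (Chi, i, j)) borel (\<xi> (Medium, i, j))"
proof -
  define K where "K = (\<lambda>b. if b then {(Chi, i, j)} else {(Medium, i, j)})"
  have "indep_vars (\<lambda>b. PiM (K b) (\<lambda>_. borel)) (\<lambda>b \<omega>. restrict (\<lambda>k. \<xi> k \<omega>) (K b)) UNIV"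
    using ij by (intro indep_vars_restrict[OF indep]) (auto simp: K_def disjoint_family_on_def)
  then have "indep_vars (\<lambda>_. borel) (\<lambda>b \<omega>. (\<lambda>f. f (if b then (Chi, i, j) else (Medium, i, j))) (restrict (\<lambda>k. \<xi> k \<omega>) (K b))) UNIV"
    by (rule indep_vars_compose2) (auto simp: K_def)
  moreover have "(\<lambda>b \<omega>. (\<lambda>f. f (if b then (Chi, i, j) else (Medium, i, j))) (restrict (\<lambda>k. \<xi> k \<omega>) (K b))) = case_bool (\<xi> (Chi, i, j)) (\<xi> (Medium, i, j))"
    by (auto simp: fun_eq_iff K_def split: bool.split)
  ultimately show ?thesis unfolding indep_var_def by (simp add: case_bool_if cong: if_cong)
qed

lemma medium_bounded:
  assumes ij: "i < M" "j < N"
  shows "AE \<omega> in Q. \<bar>\<xi> (Medium, i, j) \<omega>\<bar> \<le> 1"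
proof -
  have "AE x in uniform_measure \<mu> A. \<bar>x\<bar> \<le> 1"
  proof (rule AE_uniform_measureI)
    have "real N powr (- \<epsilon>b) \<le> real N powr 0" using pos by (intro powr_mono) auto
    then show "AE x in \<mu>. x \<in> A \<longrightarrow> \<bar>x\<bar> \<le> 1" using pos by (intro AE_I2) (auto simp: H.A_def)
  qed (simp add: sets_mu)
  then have "AE x in distr Q borel (\<xi> (Medium, i, j)). \<bar>x\<bar> \<le> 1" unfolding medium[OF ij, folded H.A_def] .
  then show ?thesis by (rule AE_distrD[OF rv'[OF ij]])
qed

text \<open>As \<open>h 0 = 0\<close>, the 0-1 variable \<open>\<chi>\<close> can be pulled out of
  \<open>h\<close> and independence applies. The factor \<open>measure \<mu> A\<close> in the mean
  of \<open>\<chi>\<close> cancels the normalisation of the conditioned law, which leaves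
  \<open>pN\<close>. The truncation does not affect variables bounded by 1.\<close>

lemma entry_integral:
  fixes h :: "real \<Rightarrow> real"
  assumes ij: "i < M" "j < N" and h [measurable]: "h \<in> borel_measurable borel" and h0: "h 0 = 0" and hb: "\<And>x. \<bar>x\<bar> \<le> 1 \<Longrightarrow> \<bar>h x\<bar> \<le> 1"
  shows "(\<integral>\<omega>. h (W i j \<omega>) \<partial>Q) = (\<integral>\<omega>. indicator A (\<Theta> \<omega> / sqrt (real N)) * h (\<Theta> \<omega> / sqrt (real N)) \<partial>P) / H.pN \<epsilon>b N"
proof -
  interpret mu: prob_space \<mu> by (rule prob_mu)
  note [measurable] = rv'[OF ij, of Chi] rv'[OF ij, of Medium] W_measurable[OF ij]
  have c01: "\<xi> (Chi, i, j) \<omega> \<in> {0, 1}" if "\<omega> \<in> space Q" for \<omega> using chi[OF ij] that by blast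
  have N1: "1 \<le> real N ^ 100" using pos by simp
  have "(\<integral>\<omega>. h (W i j \<omega>) \<partial>Q) = (\<integral>\<omega>. \<xi> (Chi, i, j) \<omega> * h (\<xi> (Medium, i, j) \<omega>) \<partial>Q)"
  proof (rule integral_cong_AE)
    show "AE \<omega> in Q. h (W i j \<omega>) = \<xi> (Chi, i, j) \<omega> * h (\<xi> (Medium, i, j) \<omega>)"
      using medium_bounded[OF ij] AE_space
    proof eventually_elim
      case (elim \<omega>)
      then show ?case using c01[of \<omega>] N1 h0 by (auto simp: W_def trunc_def)
    qed
  qed measurable
  also have "\<dots> = (\<integral>\<omega>. \<xi> (Chi, i, j) \<omega> \<partial>Q) * (\<integral>\<omega>. h (\<xi> (Medium, i, j) \<omega>) \<partial>Q)"
  proof (rule indep_var_lebesgue_integral)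
    have "indep_var borel ((\<lambda>x. x) \<circ> \<xi> (Chi, i, j)) borel (h \<circ> \<xi> (Medium, i, j))"
      by (rule indep_var_compose[OF chi_medium_indep[OF ij]]) auto
    then show "indep_var borel (\<xi> (Chi, i, j)) borel (\<lambda>\<omega>. h (\<xi> (Medium, i, j) \<omega>))" by (simp add: comp_def)
    show "integrable Q (\<xi> (Chi, i, j))" using c01 by (intro integrable_const_bound[where B = 1]) (auto intro!: AE_I2, fastforce)
    show "integrable Q (\<lambda>\<omega>. h (\<xi> (Medium, i, j) \<omega>))"
      using medium_bounded[OF ij] hb by (intro integrable_const_bound[where B = 1]) (auto elim!: eventually_mono)
  qed
  also have "(\<integral>\<omega>. \<xi> (Chi, i, j) \<omega> \<partial>Q) = measure \<mu> A / H.pN \<epsilon>b N"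
  proof -
    have "(\<integral>\<omega>. \<xi> (Chi, i, j) \<omega> \<partial>Q) = (\<integral>\<omega>. indicator {\<omega> \<in> space Q. \<xi> (Chi, i, j) \<omega> = 1} \<omega> \<partial>Q)"
    proof (rule Bochner_Integration.integral_cong[OF refl])
      fix \<omega> assume "\<omega> \<in> space Q"
      then show "\<xi> (Chi, i, j) \<omega> = indicator {\<omega> \<in> space Q. \<xi> (Chi, i, j) \<omega> = 1} \<omega>"
        using c01[of \<omega>] by (auto simp: indicator_def)
    qed
    also have "\<dots> = prob {\<omega> \<in> space Q. \<xi> (Chi, i, j) \<omega> = 1}" by simp
    finally show ?thesis using chi[OF ij] chi_prob(1) by simp
  qed
  also have "(\<integral>\<omega>. h (\<xi> (Medium, i, j) \<omega>) \<partial>Q) = (\<integral>x. h x \<partial>distr Q borel (\<xi> (Medium, i, j)))"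
    by (rule integral_distr[symmetric]) auto
  also have "\<dots> = (\<integral>x. h x \<partial>uniform_measure \<mu> A)" unfolding medium[OF ij, folded H.A_def] ..
  also have "\<dots> = (\<integral>x. indicator A x * h x \<partial>\<mu>) / measure \<mu> A"
    by (rule integral_uniform_measure) (use A_pos in \<open>auto simp: sets_mu cong: measurable_cong_sets\<close>, unfold_locales)
  also have "(\<integral>x. indicator A x * h x \<partial>\<mu>) = (\<integral>\<omega>. indicator A (\<Theta> \<omega> / sqrt (real N)) * h (\<Theta> \<omega> / sqrt (real N)) \<partial>P)"
    unfolding entry_law_def by (rule integral_distr) auto
  finally show ?thesis using A_pos by simp
qed

text \<open>By independence the pair has a product law, and the law of a 0-1 variable is determined
  by one probability.\<close>

lemma W_law:
  assumes ij: "i < M" "j < N"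
  shows "distr Q borel (W i j) = \<nu>"
proof -
  have law: "distr Q borel (W i j) = distr (distr Q borel (\<xi> (Chi, i, j)) \<Otimes>\<^sub>M uniform_measure \<mu> A) borel (\<lambda>(x, y). trunc (x * y))"
    if ij: "i < M" "j < N" for i j
  proof -
    note [measurable] = rv'[OF ij, of Chi] rv'[OF ij, of Medium]
    have "distr Q borel (\<xi> (Chi, i, j)) \<Otimes>\<^sub>M uniform_measure \<mu> A = distr Q (borel \<Otimes>\<^sub>M borel) (\<lambda>\<omega>. (\<xi> (Chi, i, j) \<omega>, \<xi> (Medium, i, j) \<omega>))"
      using chi_medium_indep[OF ij] unfolding indep_var_distribution_eq medium[OF ij, folded H.A_def] by simp
    moreover have "W i j = (\<lambda>\<omega>. trunc (\<xi> (Chi, i, j) \<omega> * \<xi> (Medium, i, j) \<omega>))" by (simp add: fun_eq_iff W_def)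
    ultimately show ?thesis by (simp add: distr_distr comp_def)
  qed
  have c: "distr Q borel (\<xi> (Chi, i, j)) = distr Q borel (\<xi> (Chi, 0, 0))"
  proof (rule measure_eqI)
    fix S assume "S \<in> sets (distr Q borel (\<xi> (Chi, i, j)))"
    then have S [measurable]: "S \<in> sets borel" by simp
    have E: "emeasure (distr Q borel (\<xi> (Chi, i, j))) S =
        ennreal (of_bool (1 \<in> S) * chi_prob \<mu> \<epsilon>a \<epsilon>b N + of_bool (0 \<in> S) * (1 - chi_prob \<mu> \<epsilon>a \<epsilon>b N))"
      if ij: "i < M" "j < N" for i j
    proof -
      note [measurable] = rv'[OF ij, of Chi]
      define E1 where "E1 = {\<omega> \<in> space Q. \<xi> (Chi, i, j) \<omega> = 1}"
      have E1: "E1 \<in> events" "prob E1 = chi_prob \<mu> \<epsilon>a \<epsilon>b N" using chi[OF ij] by (auto simp: E1_def)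
      have c01: "\<xi> (Chi, i, j) \<omega> \<in> {0, 1}" if "\<omega> \<in> space Q" for \<omega> using chi[OF ij] that by blast
      have "\<xi> (Chi, i, j) -` S \<inter> space Q = (if 1 \<in> S then E1 else {}) \<union> (if 0 \<in> S then space Q - E1 else {})"
        using c01 by (auto simp: E1_def) (metis insert_iff singletonD)+
      then have "prob (\<xi> (Chi, i, j) -` S \<inter> space Q) = prob ((if 1 \<in> S then E1 else {}) \<union> (if 0 \<in> S then space Q - E1 else {}))" by simp
      also have "\<dots> = prob (if 1 \<in> S then E1 else {}) + prob (if 0 \<in> S then space Q - E1 else {})"
        using E1 by (intro finite_measure_Union) auto
      also have "\<dots> = of_bool (1 \<in> S) * chi_prob \<mu> \<epsilon>a \<epsilon>b N + of_bool (0 \<in> S) * (1 - chi_prob \<mu> \<epsilon>a \<epsilon>b N)"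
        using E1 by (auto simp: prob_compl)
      finally show ?thesis by (simp add: emeasure_distr emeasure_eq_measure)
    qed
    show "emeasure (distr Q borel (\<xi> (Chi, i, j))) S = emeasure (distr Q borel (\<xi> (Chi, 0, 0))) S"
      unfolding E[OF ij] E[OF pos(1,2)] ..
  qed simp
  show ?thesis unfolding \<nu>_def law[OF ij] law[OF pos(1,2)] c ..
qed

lemma W_bounded: "i < M \<Longrightarrow> j < N \<Longrightarrow> AE \<omega> in Q. \<bar>W i j \<omega>\<bar> \<le> 1"
proof -
  assume ij: "i < M" "j < N"
  have c01: "\<xi> (Chi, i, j) \<omega> \<in> {0, 1}" if "\<omega> \<in> space Q" for \<omega> using chi[OF ij] that by blast
  show ?thesis using medium_bounded[OF ij] AE_space
  proof eventually_elim
    case (elim \<omega>)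
    then show ?case using c01[of \<omega>] by (auto simp: W_def trunc_def)
  qed
qed

lemma column_law_nu:
  assumes "0 < H.m2 \<epsilon>a \<epsilon>b N"
  shows "column_law (PiM {..<M} (\<lambda>_. \<nu>)) M (H.m2 \<epsilon>a \<epsilon>b N / H.pN \<epsilon>b N) (H.m4 \<epsilon>a \<epsilon>b N / H.pN \<epsilon>b N) 1"
proof (rule iid_column_law)
  note Wm [measurable] = W_measurable[OF pos(1,2)]
  show "prob_space \<nu>" unfolding \<nu>_def by (rule prob_space_distr[OF Wm])
  show "sets \<nu> = sets borel" by (simp add: \<nu>_def)
  show "AE x in \<nu>. \<bar>x\<bar> \<le> 1" unfolding \<nu>_def using W_bounded[OF pos(1,2)] by (subst AE_distr_iff) auto
  have i: "(\<integral>x. h x \<partial>\<nu>) = (\<integral>\<omega>. h (W 0 0 \<omega>) \<partial>Q)" if "h \<in> borel_measurable borel" for h :: "real \<Rightarrow> real"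
    unfolding \<nu>_def by (rule integral_distr[OF Wm that])
  have "(\<integral>x. x \<partial>\<nu>) = (\<integral>\<omega>. W 0 0 \<omega> \<partial>Q)" by (rule i) simp
  also have "\<dots> = (\<integral>\<omega>. indicator A (\<Theta> \<omega> / sqrt (real N)) * (\<Theta> \<omega> / sqrt (real N)) \<partial>P) / H.pN \<epsilon>b N"
    by (rule entry_integral[OF pos(1,2), of "\<lambda>x. x"]) auto
  also have "(\<integral>\<omega>. indicator A (\<Theta> \<omega> / sqrt (real N)) * (\<Theta> \<omega> / sqrt (real N)) \<partial>P) = 0"
  proof (rule H.odd_zero[of "\<lambda>t. indicator A (t / sqrt (real N)) * (t / sqrt (real N))"])
    have "- x \<in> A \<longleftrightarrow> x \<in> A" for x by (simp add: H.A_def)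
    then have "indicator A (- x) = (indicator A x :: real)" for x by (simp add: indicator_def)
    then show "indicator A (- x / sqrt (real N)) * (- x / sqrt (real N)) = - (indicator A (x / sqrt (real N)) * (x / sqrt (real N)))" for x
      by (simp only: minus_divide_left[symmetric] mult_minus_right)
  qed measurable
  finally show "(\<integral>x. x \<partial>\<nu>) = 0" by simp
  show "(\<integral>x. x\<^sup>2 \<partial>\<nu>) = H.m2 \<epsilon>a \<epsilon>b N / H.pN \<epsilon>b N" unfolding H.m2_def
    by (subst i) (auto intro!: entry_integral[OF pos(1,2), of "\<lambda>x. x\<^sup>2"] simp: abs_square_le_1)
  have "(\<integral>x. x ^ 4 \<partial>\<nu>) = (\<integral>\<omega>. W 0 0 \<omega> ^ 4 \<partial>Q)" by (rule i) simp
  also have "\<dots> = (\<integral>\<omega>. indicator A (\<Theta> \<omega> / sqrt (real N)) * (\<Theta> \<omega> / sqrt (real N)) ^ 4 \<partial>P) / H.pN \<epsilon>b N"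
  proof (rule entry_integral[OF pos(1,2), of "\<lambda>x. x ^ 4"])
    show "\<bar>x ^ 4\<bar> \<le> 1" if "\<bar>x\<bar> \<le> 1" for x :: real unfolding power_abs by (rule power_le_one[OF abs_ge_zero that])
  qed auto
  finally show "(\<integral>x. x ^ 4 \<partial>\<nu>) = H.m4 \<epsilon>a \<epsilon>b N / H.pN \<epsilon>b N" unfolding H.m4_def .
  show "0 < H.m2 \<epsilon>a \<epsilon>b N / H.pN \<epsilon>b N" using assms chi_prob(2) by simp
qed

definition Z where "Z j \<omega> = (\<lambda>a\<in>{..<M}. W a j \<omega>)"

text \<open>The family is grouped twice: by entries for the product law within a column, by columns
  for the independence between them.\<close>

lemma columns_law:
  assumes J: "J \<subseteq> {..<N}" "J \<noteq> {}"
  shows "distr Q (PiM J (\<lambda>_. PiM {..<M} (\<lambda>_. borel))) (\<lambda>\<omega>. \<lambda>j\<in>J. Z j \<omega>) = PiM J (\<lambda>_. PiM {..<M} (\<lambda>_. \<nu>))"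
proof -
  have Zm: "Z j \<in> measurable Q (PiM {..<M} (\<lambda>_. borel))" if "j \<in> J" for j
    unfolding Z_def using that J by (intro measurable_restrict W_measurable) auto
  have col: "distr Q (PiM {..<M} (\<lambda>_. borel)) (Z j) = PiM {..<M} (\<lambda>_. \<nu>)" if j: "j \<in> J" for j
  proof -
    define K where "K = (\<lambda>a :: nat. {(Chi, a, j), (Medium, a, j)})"
    have "indep_vars (\<lambda>a. PiM (K a) (\<lambda>_. borel)) (\<lambda>a \<omega>. restrict (\<lambda>k. \<xi> k \<omega>) (K a)) {..<M}"
      using j J by (intro indep_vars_restrict[OF indep]) (auto simp: K_def disjoint_family_on_def)
    then have "indep_vars (\<lambda>_. borel) (\<lambda>a \<omega>. (\<lambda>f. trunc (f (Chi, a, j) * f (Medium, a, j))) (restrict (\<lambda>k. \<xi> k \<omega>) (K a))) {..<M}"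
      by (rule indep_vars_compose2) (simp add: K_def)
    then have "indep_vars (\<lambda>_. borel) (\<lambda>a. W a j) {..<M}" by (simp add: K_def W_def[abs_def])
    then have "distr Q (PiM {..<M} (\<lambda>_. borel)) (\<lambda>\<omega>. \<lambda>a\<in>{..<M}. W a j \<omega>) = PiM {..<M} (\<lambda>a. distr Q borel (W a j))"
      using pos(1) j J by (subst (asm) indep_vars_iff_distr_eq_PiM') (auto intro!: W_measurable)
    also have "\<dots> = PiM {..<M} (\<lambda>_. \<nu>)" using j J by (intro PiM_cong) (auto simp: W_law)
    finally show ?thesis by (simp add: Z_def[abs_def])
  qed
  define K where "K = (\<lambda>j. {Chi, Medium} \<times> {..<M} \<times> {j :: nat})"
  have "indep_vars (\<lambda>j. PiM (K j) (\<lambda>_. borel)) (\<lambda>j \<omega>. restrict (\<lambda>k. \<xi> k \<omega>) (K j)) J"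
    using J by (intro indep_vars_restrict[OF indep]) (auto simp: K_def disjoint_family_on_def)
  then have "indep_vars (\<lambda>_. PiM {..<M} (\<lambda>_. borel)) (\<lambda>j \<omega>. (\<lambda>f. \<lambda>a\<in>{..<M}. trunc (f (Chi, a, j) * f (Medium, a, j))) (restrict (\<lambda>k. \<xi> k \<omega>) (K j))) J"
  proof (rule indep_vars_compose2)
    show "(\<lambda>f. \<lambda>a\<in>{..<M}. trunc (f (Chi, a, j) * f (Medium, a, j))) \<in> measurable (PiM (K j) (\<lambda>_. borel)) (PiM {..<M} (\<lambda>_. borel))" for j
      by (intro measurable_restrict measurable_compose[OF _ trunc_measurable] borel_measurable_times measurable_component_singleton) (auto simp: K_def)
  qed
  moreover have "(\<lambda>j \<omega>. (\<lambda>f. \<lambda>a\<in>{..<M}. trunc (f (Chi, a, j) * f (Medium, a, j))) (restrict (\<lambda>k. \<xi> k \<omega>) (K j))) = Z"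
    by (auto simp: fun_eq_iff Z_def W_def K_def restrict_def)
  ultimately have "indep_vars (\<lambda>_. PiM {..<M} (\<lambda>_. borel)) Z J" by simp
  then have "distr Q (PiM J (\<lambda>_. PiM {..<M} (\<lambda>_. borel))) (\<lambda>\<omega>. \<lambda>j\<in>J. Z j \<omega>) = PiM J (\<lambda>j. distr Q (PiM {..<M} (\<lambda>_. borel)) (Z j))"
    using J Zm by (subst (asm) indep_vars_iff_distr_eq_PiM') auto
  also have "\<dots> = PiM J (\<lambda>_. PiM {..<M} (\<lambda>_. \<nu>))" using col by (intro PiM_cong) auto
  finally show ?thesis .
qed

lemma X_entry: "a < M \<Longrightarrow> j < N \<Longrightarrow> X_mat M N \<xi> \<omega> $$ (a, j) =
    trunc ((1 - \<xi> (Psi, a, j) \<omega>) * \<xi> (Chi, a, j) \<omega> * \<xi> (Medium, a, j) \<omega> + \<xi> (Psi, a, j) \<omega> * \<xi> (Large, a, j) \<omega>)"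
  by (simp add: X_mat_def B_mat_def C_mat_def trunc_def)

lemma X_dim: "dim_row (X_mat M N \<xi> \<omega>) = M" "dim_col (X_mat M N \<xi> \<omega>) = N"
  by (simp_all add: X_mat_def B_mat_def C_mat_def)

lemma X_measurable: "a < M \<Longrightarrow> j < N \<Longrightarrow> (\<lambda>\<omega>. X_mat M N \<xi> \<omega> $$ (a, j)) \<in> borel_measurable Q"
  unfolding X_entry using rv'[of a j] by measurable

lemma X_bounded: "a < M \<Longrightarrow> j < N \<Longrightarrow> \<bar>X_mat M N \<xi> \<omega> $$ (a, j)\<bar> \<le> real N ^ 100"
  by (simp add: X_entry trunc_def)

lemma Psi_mat_eq:
  assumes "\<Psi> \<in> carrier_mat M N"
  shows "Psi_mat M N \<xi> \<omega> = \<Psi> \<longleftrightarrow> (\<forall>k\<in>{Psi} \<times> {..<M} \<times> {..<N}. \<xi> k \<omega> = \<Psi> $$ snd k)"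
proof -
  have "Psi_mat M N \<xi> \<omega> = \<Psi> \<longleftrightarrow> (\<forall>i<M. \<forall>j<N. \<xi> (Psi, i, j) \<omega> = \<Psi> $$ (i, j))"
    using assms by (auto simp: Psi_mat_def mat_eq_iff)
  then show ?thesis by auto
qed

lemma columns_eq:
  assumes "\<Psi> \<in> carrier_mat M N" "Psi_mat M N \<xi> \<omega> = \<Psi>" "j < N" "\<forall>a<M. \<Psi> $$ (a, j) = 0"
  shows "columns (X_mat M N \<xi> \<omega>) j = Z j \<omega>"
proof -
  have "\<xi> (Psi, a, j) \<omega> = 0" if "a < M" for a
    using assms that by (auto simp: Psi_mat_def)
  then show ?thesis using assms(3) by (auto simp: columns_def Z_def X_dim X_entry W_def fun_eq_iff restrict_def)
qed

text \<open>The condition is a function of the \<open>\<psi>\<close> variables and the columns in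
  \<open>J\<close> are functions of the \<open>\<chi>\<close> and \<open>b\<close> variables, so
  conditioning does not change the probability of \<open>F\<close>.\<close>

lemma conditional_bound:
  assumes \<Psi>: "\<Psi> \<in> carrier_mat M N" "elements_mat \<Psi> \<subseteq> {0, 1}" and J: "J \<subseteq> {..<N}" "J \<noteq> {}"
    and F: "F \<in> sets (PiM J (\<lambda>_. PiM {..<M} (\<lambda>_. \<nu>)))" "measure (PiM J (\<lambda>_. PiM {..<M} (\<lambda>_. \<nu>))) F \<le> \<epsilon>"
    and reg: "{\<omega> \<in> space Q. reg \<omega>} \<in> events"
    and imp: "\<And>\<omega>. \<omega> \<in> space Q \<Longrightarrow> Psi_mat M N \<xi> \<omega> = \<Psi> \<Longrightarrow> (\<lambda>j\<in>J. Z j \<omega>) \<notin> F \<Longrightarrow> reg \<omega>"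
  shows "\<P>(\<omega> in Q. reg \<omega> \<bar> Psi_mat M N \<xi> \<omega> = \<Psi>) \<ge> 1 - \<epsilon>"
proof -
  \<comment> \<open>The \<open>Large\<close> variables are in neither group: they can enter only the
    columns outside \<open>J\<close>, and \<open>imp\<close> gives \<open>reg\<close> whatever their
    values.\<close>
  define K where "K = (\<lambda>b. if b then {Psi} \<times> {..<M} \<times> {..<N} else {Chi, Medium} \<times> {..<M} \<times> {..<N})"
  define E where "E = {\<omega> \<in> space Q. Psi_mat M N \<xi> \<omega> = \<Psi>}"
  define G where "G = {\<omega> \<in> space Q. (\<lambda>j\<in>J. Z j \<omega>) \<in> F}"
  have setsF: "F \<in> sets (PiM J (\<lambda>_. PiM {..<M} (\<lambda>_. borel)))"
  proof -
    have "sets (PiM J (\<lambda>_. PiM {..<M} (\<lambda>_. \<nu>))) = sets (PiM J (\<lambda>_. PiM {..<M} (\<lambda>_. borel)))"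
      by (intro sets_PiM_cong refl) (simp add: \<nu>_def)
    then show ?thesis using F(1) by simp
  qed
  have Zm: "(\<lambda>\<omega>. \<lambda>j\<in>J. Z j \<omega>) \<in> measurable Q (PiM J (\<lambda>_. PiM {..<M} (\<lambda>_. borel)))"
    unfolding Z_def using J by (intro measurable_restrict W_measurable) auto
  have Gp: "prob G \<le> \<epsilon>"
  proof -
    have "prob G = measure (distr Q (PiM J (\<lambda>_. PiM {..<M} (\<lambda>_. borel))) (\<lambda>\<omega>. \<lambda>j\<in>J. Z j \<omega>)) F"
      unfolding measure_distr[OF Zm setsF] by (rule arg_cong[where f = prob]) (auto simp: G_def)
    then show ?thesis using F(2) unfolding columns_law[OF J] by simp
  qed
  have Kind: "indep_vars (\<lambda>b. PiM (K b) (\<lambda>_. borel)) (\<lambda>b \<omega>. restrict (\<lambda>k. \<xi> k \<omega>) (K b)) UNIV"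
    by (intro indep_vars_restrict[OF indep]) (auto simp: K_def disjoint_family_on_def)
  define g where "g = (\<lambda>f. \<lambda>j\<in>J. \<lambda>a\<in>{..<M}. trunc (f (Chi, a, j) * f (Medium, a, j)) :: real)"
  have gm: "g \<in> measurable (PiM (K False) (\<lambda>_. borel)) (PiM J (\<lambda>_. PiM {..<M} (\<lambda>_. borel)))"
    unfolding g_def using J
    by (auto simp: K_def intro!: measurable_restrict measurable_compose[OF _ trunc_measurable] borel_measurable_times measurable_component_singleton)
  define S where "S = (\<lambda>b. if b then {f \<in> space (PiM (K True) (\<lambda>_. borel)). \<forall>k\<in>{Psi} \<times> {..<M} \<times> {..<N}. f k = \<Psi> $$ snd k}
      else g -` F \<inter> space (PiM (K False) (\<lambda>_. borel :: real measure)))"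
  have Sm: "S b \<in> sets (PiM (K b) (\<lambda>_. borel))" for b
  proof (cases b)
    case True
    have "{f \<in> space (PiM (K True) (\<lambda>_. borel)). \<forall>k\<in>{Psi} \<times> {..<M} \<times> {..<N}. f k = \<Psi> $$ snd k} \<in> sets (PiM (K True) (\<lambda>_. borel))"
    proof (intro sets.sets_Collect_finite_All)
      fix k assume "k \<in> {Psi} \<times> {..<M} \<times> {..<N}"
      then have "(\<lambda>f. f k) \<in> borel_measurable (PiM (K True) (\<lambda>_. borel))" by (intro measurable_component_singleton) (simp add: K_def)
      then show "{f \<in> space (PiM (K True) (\<lambda>_. borel)). f k = \<Psi> $$ snd k} \<in> sets (PiM (K True) (\<lambda>_. borel))"
        by (intro borel_measurable_eq) auto
    qed simp
    then show ?thesis using True by (simp add: S_def)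
  next
    case False
    then show ?thesis using measurable_sets[OF gm setsF] by (simp add: S_def)
  qed
  have S1: "(\<lambda>\<omega>. restrict (\<lambda>k. \<xi> k \<omega>) (K True)) -` S True \<inter> space Q = E"
    by (auto simp: S_def E_def Psi_mat_eq[OF \<Psi>(1)] K_def space_PiM)
  have S2: "(\<lambda>\<omega>. restrict (\<lambda>k. \<xi> k \<omega>) (K False)) -` S False \<inter> space Q = G"
  proof -
    have "g (restrict (\<lambda>k. \<xi> k \<omega>) (K False)) = (\<lambda>j\<in>J. Z j \<omega>)" for \<omega>
      using J by (auto simp: g_def Z_def W_def K_def fun_eq_iff restrict_def)
    then show ?thesis by (auto simp: S_def G_def space_PiM)
  qed
  have "prob (\<Inter>b\<in>UNIV. (\<lambda>\<omega>. restrict (\<lambda>k. \<xi> k \<omega>) (K b)) -` S b \<inter> space Q) =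
      (\<Prod>b\<in>UNIV. prob ((\<lambda>\<omega>. restrict (\<lambda>k. \<xi> k \<omega>) (K b)) -` S b \<inter> space Q))"
    by (rule indep_varsD_finite[OF Kind]) (use Sm in auto)
  then have EG: "prob (E \<inter> G) = prob E * prob G"
  proof -
    have "(\<lambda>\<omega>. restrict (\<lambda>k. \<xi> k \<omega>) (K b)) -` S b \<inter> space Q = (if b then E else G)" for b using S1 S2 by (cases b) auto
    then show ?thesis using \<open>prob (\<Inter>b\<in>UNIV. _) = _\<close> by (simp add: UNIV_bool Int_commute mult.commute)
  qed
  have Em: "E \<in> events"
    using measurable_sets[OF _ Sm[of True], of "\<lambda>\<omega>. restrict (\<lambda>k. \<xi> k \<omega>) (K True)" Q] Kind unfolding S1 by (auto simp: indep_vars_def)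
  have Gm: "G \<in> events" using measurable_sets[OF Zm setsF] by (simp add: G_def vimage_def Int_def conj_commute)
  \<comment> \<open>A conditional probability given a null event is 0 by division by zero, so the
    lower bound rests on this.\<close>
  have Epos: "0 < prob E"
  proof -
    have fin: "{Psi} \<times> {..<M} \<times> {..<N} \<noteq> {}" "finite ({Psi} \<times> {..<M} \<times> {..<N})" using pos by auto
    have "E = (\<Inter>k\<in>{Psi} \<times> {..<M} \<times> {..<N}. \<xi> k -` {\<Psi> $$ snd k} \<inter> space Q)"
      using fin by (auto simp: E_def Psi_mat_eq[OF \<Psi>(1)])
    also have "prob \<dots> = (\<Prod>k\<in>{Psi} \<times> {..<M} \<times> {..<N}. prob (\<xi> k -` {\<Psi> $$ snd k} \<inter> space Q))"
      by (rule indep_varsD[OF indep fin]) auto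
    also have "\<dots> > 0"
    proof (rule prod_pos)
      fix k assume "k \<in> {Psi} \<times> {..<M} \<times> {..<N}"
      then obtain i j where k: "k = (Psi, i, j)" and ij: "i < M" "j < N" by auto
      note [measurable] = rv'[OF ij, of Psi]
      define E1 where "E1 = {\<omega> \<in> space Q. \<xi> k \<omega> = 1}"
      have E1: "E1 \<in> events" "prob E1 = psi_prob \<mu> \<epsilon>b N" using psi[OF ij] by (auto simp: E1_def k)
      have p01: "\<xi> k \<omega> \<in> {0, 1}" if "\<omega> \<in> space Q" for \<omega> using psi[OF ij] that unfolding k by blast
      have "\<Psi> $$ (i, j) \<in> {0, 1}" using \<Psi> ij by (metis elements_matI subsetD)
      then consider "\<Psi> $$ snd k = 1" | "\<Psi> $$ snd k = 0" by (auto simp: k)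
      then show "0 < prob (\<xi> k -` {\<Psi> $$ snd k} \<inter> space Q)"
      proof cases
        case 1
        then have "\<xi> k -` {\<Psi> $$ snd k} \<inter> space Q = E1" by (auto simp: E1_def)
        then show ?thesis using E1 psi_prob by simp
      next
        case 2
        then have "\<xi> k -` {\<Psi> $$ snd k} \<inter> space Q = space Q - E1" using p01 by (auto simp: E1_def)
        then show ?thesis using E1 psi_prob by (simp add: prob_compl)
      qed
    qed
    finally show ?thesis .
  qed
  define RE where "RE = {\<omega> \<in> space Q. reg \<omega> \<and> Psi_mat M N \<xi> \<omega> = \<Psi>}"
  have REm: "RE \<in> events"
  proof -
    have "RE = {\<omega> \<in> space Q. reg \<omega>} \<inter> E" by (auto simp: RE_def E_def)
    then show ?thesis using reg Em by auto
  qed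
  have "E \<subseteq> RE \<union> (E \<inter> G)" using imp by (auto simp: RE_def E_def G_def)
  then have "prob E \<le> prob (RE \<union> (E \<inter> G))" using REm Em Gm by (intro finite_measure_mono) auto
  also have "\<dots> \<le> prob RE + prob (E \<inter> G)" using REm Em Gm by (intro measure_Un_le) auto
  also have "\<dots> \<le> prob RE + prob E * \<epsilon>" unfolding EG using Gp by (intro add_left_mono mult_left_mono) auto
  finally have "(1 - \<epsilon>) * prob E \<le> prob RE" by (simp add: algebra_simps)
  then show ?thesis unfolding cond_prob_def RE_def[symmetric] E_def[symmetric] using Epos by (simp add: pos_le_divide_eq)
qed

end

section \<open>Counting exceptional columns, choice of constants and conclusion\<close>

lemma card_bad_columns:
  assumes \<Psi>: "\<Psi> \<in> carrier_mat M N" "elements_mat \<Psi> \<subseteq> {0, 1}" and g: "good \<alpha> \<Psi>"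
  shows "real (card {j \<in> {..<N}. \<exists>a<M. \<Psi> $$ (a, j) \<noteq> 0}) \<le> real N powr (1 - (\<alpha> - 2) / (5 * \<alpha>))"
proof -
  define S where "S = {(i, j). i < dim_row \<Psi> \<and> j < dim_col \<Psi> \<and> \<Psi> $$ (i, j) = 1}"
  have d: "dim_row \<Psi> = M" "dim_col \<Psi> = N" using \<Psi> by auto
  have fin: "finite S" by (rule finite_subset[of _ "{..<M} \<times> {..<N}"]) (auto simp: S_def d)
  have "{j \<in> {..<N}. \<exists>a<M. \<Psi> $$ (a, j) \<noteq> 0} \<subseteq> snd ` S"
  proof safe
    fix j a assume j: "j < N" and a: "a < M" and nz: "\<Psi> $$ (a, j) \<noteq> 0"
    have "\<Psi> $$ (a, j) \<in> elements_mat \<Psi>" using j a d by (intro elements_matI[OF \<Psi>(1)]) auto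
    then have "\<Psi> $$ (a, j) = 1" using \<Psi>(2) nz by auto
    then have "(a, j) \<in> S" using j a by (simp add: S_def d)
    then show "j \<in> snd ` S" by force
  qed
  then have "card {j \<in> {..<N}. \<exists>a<M. \<Psi> $$ (a, j) \<noteq> 0} \<le> card (snd ` S)" using fin by (intro card_mono) auto
  also have "\<dots> \<le> card S" using fin by (rule card_image_le)
  finally have "real (card {j \<in> {..<N}. \<exists>a<M. \<Psi> $$ (a, j) \<noteq> 0}) \<le> real (card S)" by simp
  also have "\<dots> \<le> real (dim_col \<Psi>) powr (1 - (\<alpha> - 2) / (5 * \<alpha>))" using g unfolding good_def S_def .
  finally show ?thesis unfolding d .
qed

text \<open>\<open>cH\<close> and \<open>CH\<close> come from
  \<open>edge_regularity_deterministic\<close> for a \<open>\<delta>\<close> that depends only on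
  \<open>c_inf\<close>, so they are fixed before \<open>D\<close> and \<open>N\<close>.\<close>

theorem proposition2p6:
  fixes P :: "'p measure" and \<Theta> :: "'p \<Rightarrow> real" and \<alpha> \<c> \<rho> c_inf \<epsilon>a \<epsilon>b :: real
    and M :: "nat \<Rightarrow> nat"
    and Q :: "nat \<Rightarrow> 'q measure"
    and \<xi> :: "nat \<Rightarrow> kind \<times> nat \<times> nat \<Rightarrow> 'q \<Rightarrow> real"
  assumes "heavy_tailed P \<Theta> \<alpha> \<c> \<rho>"
    and "\<And>N. 0 < N \<Longrightarrow> M N < N"
    and "(\<lambda>N. real (M N) / real N) \<longlonglongrightarrow> c_inf" and "0 < c_inf" and "c_inf < 1"
    and "0 < \<epsilon>b" and "\<epsilon>b < (\<alpha> - 2) / (10 * \<alpha>)"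
    and "0 < \<epsilon>a" and "\<epsilon>a < min \<epsilon>b (4 - \<alpha>) / 10000"
    and "eventually (\<lambda>N. resampling (Q N) (entry_law P \<Theta> N) \<epsilon>a \<epsilon>b (M N) N (\<xi> N)) sequentially"
  shows "\<exists>cH>0. \<exists>CH>1. \<forall>D>0. eventually (\<lambda>N.
           \<forall>\<Psi> \<in> carrier_mat (M N) N. elements_mat \<Psi> \<subseteq> {0, 1} \<and> good \<alpha> \<Psi> \<longrightarrow>
             \<P>(\<omega> in Q N. edge_regular \<epsilon>b cH CH (X_mat (M N) N (\<xi> N) \<omega>)
                 \<bar> Psi_mat (M N) N (\<xi> N) \<omega> = \<Psi>) \<ge> 1 - real N powr (- D)) sequentially"
proof -
  note ht = assms(1) and MN = assms(2) and lim = assms(3) and c = assms(4,5) and eb = assms(6,7) and ea = assms(8) and rs = assms(10)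
  interpret H: heavy_tailed P \<Theta> \<alpha> \<c> \<rho> by (rule ht)
  have al: "2 < \<alpha>" "\<alpha> < 4" using H.params by auto
  have eb20: "\<epsilon>b < 1 / 20"
  proof -
    have "(\<alpha> - 2) / (10 * \<alpha>) < 1 / 20" using al by (simp add: divide_less_eq)
    then show ?thesis using eb by linarith
  qed
  \<comment> \<open>The limit of \<open>sqrt b - sqrt a\<close>, as \<open>a = v * M\<close> tends
    to \<open>c_inf\<close> and \<open>b\<close> to 1; \<open>\<delta>\<close> is chosen strictly
    below the limits of \<open>a\<close> and of this difference.\<close>
  define g where "g = 1 - sqrt c_inf"
  have g: "0 < g" using c by (simp add: g_def)
  define \<delta> where "\<delta> = min 1 (min (c_inf / 2) (g / 2))"
  have \<delta>: "0 < \<delta>" "\<delta> \<le> 1" "\<delta> < c_inf" "\<delta> < g" using c g by (auto simp: \<delta>_def)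
  define K where "K = 12 / \<delta> ^ 4"
  have K: "0 \<le> K" using \<delta> by (simp add: K_def)
  obtain cH CH h0 where cH: "0 < cH" and CH: "300 \<le> CH" and h0: "0 < h0"
    and det: "\<And>m v a b lam \<eta>s. 1 \<le> m \<Longrightarrow> a = v * real m \<Longrightarrow> \<delta> \<le> a \<Longrightarrow> \<delta> \<le> sqrt b - sqrt a \<Longrightarrow> b \<le> 2 \<Longrightarrow> 0 < \<eta>s \<Longrightarrow> \<eta>s \<le> h0 \<Longrightarrow>
      edge_law a b v m lam K \<eta>s \<Longrightarrow> edge_bounds cH CH \<eta>s m lam"
    using edge_regularity_deterministic[OF \<delta>(1,2) K] by blast
  \<comment> \<open>Since \<open>ex > 2 * \<epsilon>b\<close>, the at most
    \<open>N powr (1 - ex)\<close> exceptional columns remain few compared with \<open>N\<close>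
    after multiplication by \<open>L^2 = N powr (2 * \<epsilon>b)\<close>.\<close>
  define ex where "ex = (\<alpha> - 2) / (5 * \<alpha>)"
  have ex: "2 * \<epsilon>b < ex" "0 < ex"
  proof -
    have "ex = 2 * ((\<alpha> - 2) / (10 * \<alpha>))" using al by (simp add: ex_def field_simps)
    then show "2 * \<epsilon>b < ex" using eb by linarith
    then show "0 < ex" using eb by linarith
  qed
  define v where "v = (\<lambda>N. H.m2 \<epsilon>a \<epsilon>b N / H.pN \<epsilon>b N)"
  have eb2: "\<epsilon>b < 1 / 2" using eb20 by linarith
  have m2l: "(\<lambda>N. real N * H.m2 \<epsilon>a \<epsilon>b N) \<longlonglongrightarrow> 1" by (rule H.m2_limit[OF ea eb2])
  have "(\<lambda>N. real N * H.m2 \<epsilon>a \<epsilon>b N / H.pN \<epsilon>b N) \<longlonglongrightarrow> 1 / 1"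
    by (rule tendsto_divide[OF m2l H.pN_limit[OF eb2]]) simp
  then have vl: "(\<lambda>N. real N * v N) \<longlonglongrightarrow> 1" by (simp add: v_def)
  have "(\<lambda>N. real N * v N * (real (M N) / real N)) \<longlonglongrightarrow> 1 * c_inf" by (rule tendsto_mult[OF vl lim])
  then have al1: "(\<lambda>N. real N * v N * (real (M N) / real N)) \<longlonglongrightarrow> c_inf" by simp
  have "(\<lambda>N. real N powr (- ex)) \<longlonglongrightarrow> 0" using ex(2) by real_asymp
  then have "(\<lambda>N. real N * v N * (1 - real N powr (- ex))) \<longlonglongrightarrow> 1 * (1 - 0)"
    by (intro tendsto_mult[OF vl] tendsto_diff tendsto_const)
  \<comment> \<open>\<open>N * (1 - N powr (- ex))\<close> is a lower bound for
    \<open>card J\<close> valid for every good \<open>\<Psi>\<close>, so one threshold for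
    \<open>N\<close> serves them all.\<close>
  then have bl: "(\<lambda>N. sqrt (real N * v N * (1 - real N powr (- ex))) - sqrt (real N * v N * (real (M N) / real N))) \<longlonglongrightarrow> sqrt 1 - sqrt c_inf"
    by (intro tendsto_diff tendsto_real_sqrt al1) simp
  have exx: "0 < ex - 2 * \<epsilon>b" using ex by simp
  have main: "eventually (\<lambda>N. \<forall>\<Psi> \<in> carrier_mat (M N) N. elements_mat \<Psi> \<subseteq> {0, 1} \<and> good \<alpha> \<Psi> \<longrightarrow>
             \<P>(\<omega> in Q N. edge_regular \<epsilon>b cH CH (X_mat (M N) N (\<xi> N) \<omega>)
                 \<bar> Psi_mat (M N) N (\<xi> N) \<omega> = \<Psi>) \<ge> 1 - real N powr (- D)) sequentially" if D: "0 < D" for D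
  proof -
    have E1: "eventually (\<lambda>N. 1 / 2 < real N * H.m2 \<epsilon>a \<epsilon>b N) sequentially" using m2l by (intro order_tendstoD) auto
    have E2: "eventually (\<lambda>N. real N * v N < 2) sequentially" using vl by (intro order_tendstoD) auto
    have E3: "eventually (\<lambda>N. \<delta> < real N * v N * (real (M N) / real N)) sequentially" using al1 \<delta>(3) by (rule order_tendstoD)
    have E4: "eventually (\<lambda>N. \<delta> < sqrt (real N * v N * (1 - real N powr (- ex))) - sqrt (real N * v N * (real (M N) / real N))) sequentially"
      using bl by (rule order_tendstoD) (use \<delta>(4) in \<open>simp add: g_def\<close>)
    have "LIM N sequentially. real N powr (ex - 2 * \<epsilon>b) :> at_top" using exx by real_asymp
    then have E5: "eventually (\<lambda>N. 64 \<le> real N powr (ex - 2 * \<epsilon>b)) sequentially" unfolding filterlim_at_top by blast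
    have "(\<lambda>N. real N powr (- \<epsilon>b)) \<longlonglongrightarrow> 0" using eb(1) by real_asymp
    then have E6: "eventually (\<lambda>N. real N powr (- \<epsilon>b) < h0) sequentially" using h0 by (rule order_tendstoD)
    note E7 = edge_law_eventually[OF \<delta>(1,2) eb(1) less_imp_le[OF eb20] D]
    note E8 = H.m4_le[OF ea eb]
    show ?thesis
      using E1 E2 E3 E4 E5 E6 E7 E8 rs eventually_ge_at_top[of 2]
    proof eventually_elim
      case (elim N)
      have N: "2 \<le> N" "0 < real N" using elim(10) by auto
      have v: "0 < v N"
      proof (rule ccontr)
        assume "\<not> 0 < v N"
        then have "real N * v N * (real (M N) / real N) \<le> 0" using N by (intro mult_nonpos_nonneg mult_nonneg_nonpos) auto
        then show False using elim(3) \<delta>(1) by linarith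
      qed
      have a: "real N * v N * (real (M N) / real N) = v N * real (M N)" using N by simp
      have Mpos: "0 < M N" using elim(3) \<delta>(1) by (cases "M N = 0") auto
      have MN': "M N < N" using MN N by simp
      interpret R: resampled P \<Theta> \<alpha> \<c> \<rho> "Q N" \<epsilon>a \<epsilon>b "M N" N "\<xi> N"
        using elim(9) ht Mpos N eb(1) by (intro resampled.intro resampled_axioms.intro) auto
      have m2: "0 < H.m2 \<epsilon>a \<epsilon>b N" by (rule zero_less_mult_pos[of "real N"]) (use elim(1) N in auto)
      have cl: "column_law (PiM {..<M N} (\<lambda>_. R.\<nu>)) (M N) (v N) (H.m4 \<epsilon>a \<epsilon>b N / H.pN \<epsilon>b N) 1"
        unfolding v_def by (rule R.column_law_nu[OF m2])
      have op: "op_norm (cov (X_mat (M N) N (\<xi> N) \<omega>)) \<le> real N powr CH" for \<omega>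
        using op_norm_cov_le[of "X_mat (M N) N (\<xi> N) \<omega>" CH] Mpos MN' N CH R.X_bounded by (simp add: R.X_dim)
      show ?case
      proof (intro ballI impI, elim conjE)
        fix \<Psi> :: "real mat"
        assume \<Psi>: "\<Psi> \<in> carrier_mat (M N) N" and el: "elements_mat \<Psi> \<subseteq> {0, 1}" and gd: "good \<alpha> \<Psi>"
        define B where "B = {j \<in> {..<N}. \<exists>a<M N. \<Psi> $$ (a, j) \<noteq> 0}"
        define J where "J = {..<N} - B"
        have JB: "J \<union> B = {..<N}" "J \<inter> B = {}" "J \<subseteq> {..<N}" by (auto simp: J_def B_def)
        have cB: "real (card B) \<le> real N powr (1 - ex)"
          unfolding B_def ex_def by (rule card_bad_columns[OF \<Psi> el gd])
        have fin: "finite J" "finite B" by (auto simp: J_def B_def)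
        have cJB: "real (card J) + real (card B) = real N"
          using card_Un_disjoint[OF fin JB(2)] unfolding JB(1) by simp
        have pw: "real N powr (1 - ex) = real N * real N powr (- ex)" using N by (simp add: powr_diff powr_minus_divide)
        have bJ: "real N * v N * (1 - real N powr (- ex)) \<le> v N * real (card J)"
        proof -
          have "real N - real N * real N powr (- ex) \<le> real (card J)" using cJB cB unfolding pw by linarith
          then have "v N * (real N - real N * real N powr (- ex)) \<le> v N * real (card J)" using v by (intro mult_left_mono) auto
          then show ?thesis by (simp add: algebra_simps)
        qed
        have h1: "\<delta> \<le> v N * real (M N)" using elim(3) unfolding a by simp
        have h2: "\<delta> \<le> sqrt (v N * real (card J)) - sqrt (v N * real (M N))"
          using elim(4) real_sqrt_le_mono[OF bJ] unfolding a by linarith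
        have h3: "v N * real (card J) \<le> 2"
        proof -
          have "v N * real (card J) \<le> v N * real N" using cJB v by (intro mult_left_mono) auto
          then show ?thesis using elim(2) by (simp add: mult.commute)
        qed
        have h4: "v N \<le> 2 / real N" using elim(2) N by (simp add: pos_le_divide_eq mult.commute)
        have h5: "H.m4 \<epsilon>a \<epsilon>b N / H.pN \<epsilon>b N \<le> v N / (real N powr \<epsilon>b) ^ 10"
          using divide_right_mono[OF elim(8), of "H.pN \<epsilon>b N"] R.chi_prob(2) by (simp add: v_def mult.commute)
        have h6: "64 * (real (card B) * (real N powr \<epsilon>b)\<^sup>2) \<le> real N"
        proof -
          have L2: "(real N powr \<epsilon>b)\<^sup>2 = real N powr (2 * \<epsilon>b)" using N by (simp add: powr_realpow[symmetric] powr_powr mult.commute)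
          have "64 * (real (card B) * (real N powr \<epsilon>b)\<^sup>2) \<le> real N powr (ex - 2 * \<epsilon>b) * (real N powr (1 - ex) * real N powr (2 * \<epsilon>b))"
            unfolding L2 using elim(5) cB by (intro mult_mono mult_right_mono) auto
          also have "\<dots> = real N" using N by (simp add: powr_add[symmetric])
          finally show ?thesis .
        qed
        have Jne: "J \<noteq> {}"
        proof
          assume "J = {}"
          then have "\<delta> \<le> - sqrt (v N * real (M N))" using h2 by simp
          moreover have "0 \<le> sqrt (v N * real (M N))" using v by (simp only: real_sqrt_ge_0_iff) simp
          ultimately show False using \<delta>(1) by linarith
        qed
        have "\<exists>F\<in>sets (PiM J (\<lambda>_. PiM {..<M N} (\<lambda>_. R.\<nu>))). measure (PiM J (\<lambda>_. PiM {..<M N} (\<lambda>_. R.\<nu>))) F \<le> real N powr (- D) \<and>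
          (\<forall>x x' lam u. x \<in> space (PiM J (\<lambda>_. PiM {..<M N} (\<lambda>_. R.\<nu>))) - F \<and> (\<forall>j\<in>J. x' j = x j) \<and> spectral (M N) (gram {..<N} x') lam u \<longrightarrow>
            edge_law (v N * real (M N)) (v N * real (card J)) (v N) (M N) lam (12 / \<delta> ^ 4) (real N powr (- \<epsilon>b)))"
          using cl JB(1,2) less_imp_le[OF MN'] h1 h2 h3 h4 h5 h6 by (intro elim(7)[rule_format, where R = 1 and B = B] conjI)
        then obtain F where F: "F \<in> sets (PiM J (\<lambda>_. PiM {..<M N} (\<lambda>_. R.\<nu>)))"
          and Fp: "measure (PiM J (\<lambda>_. PiM {..<M N} (\<lambda>_. R.\<nu>))) F \<le> real N powr (- D)"
          and Fl: "\<And>x x' lam u. x \<in> space (PiM J (\<lambda>_. PiM {..<M N} (\<lambda>_. R.\<nu>))) - F \<Longrightarrow> (\<forall>j\<in>J. x' j = x j) \<Longrightarrow> spectral (M N) (gram {..<N} x') lam u \<Longrightarrow>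
            edge_law (v N * real (M N)) (v N * real (card J)) (v N) (M N) lam (12 / \<delta> ^ 4) (real N powr (- \<epsilon>b))"
          by blast
        show "\<P>(\<omega> in Q N. edge_regular \<epsilon>b cH CH (X_mat (M N) N (\<xi> N) \<omega>) \<bar> Psi_mat (M N) N (\<xi> N) \<omega> = \<Psi>) \<ge> 1 - real N powr (- D)"
        proof (rule R.conditional_bound[OF \<Psi> el JB(3) Jne F Fp])
          show "{\<omega> \<in> space (Q N). edge_regular \<epsilon>b cH CH (X_mat (M N) N (\<xi> N) \<omega>)} \<in> R.events"
            by (rule measurable_edge_regular[OF _ _ Mpos _ R.X_measurable op]) (use N in \<open>auto simp: R.X_dim\<close>)
        next
          fix \<omega> assume \<omega>: "\<omega> \<in> space (Q N)" and Ps: "Psi_mat (M N) N (\<xi> N) \<omega> = \<Psi>" and nF: "(\<lambda>j\<in>J. R.Z j \<omega>) \<notin> F"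
          define X where "X = X_mat (M N) N (\<xi> N) \<omega>"
          have dim: "dim_row X = M N" "dim_col X = N" by (simp_all add: X_def R.X_dim)
          obtain lam u where sp: "spectral (M N) (gram {..<N} (columns X)) lam u" using psd_spectral[OF psd_gram] by blast
          have "(\<lambda>j\<in>J. R.Z j \<omega>) \<in> space (PiM J (\<lambda>_. PiM {..<M N} (\<lambda>_. R.\<nu>)))"
            by (auto simp: space_PiM R.Z_def R.\<nu>_def)
          moreover have "columns X j = (\<lambda>j\<in>J. R.Z j \<omega>) j" if j: "j \<in> J" for j
          proof -
            have "j < N" "\<forall>a<M N. \<Psi> $$ (a, j) = 0" using j by (auto simp: J_def B_def)
            then show ?thesis using R.columns_eq[OF \<Psi> Ps] j by (simp add: X_def)
          qed
          ultimately have law: "edge_law (v N * real (M N)) (v N * real (card J)) (v N) (M N) lam K (real N powr (- \<epsilon>b))"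
            unfolding K_def using nF sp by (intro Fl[of "\<lambda>j\<in>J. R.Z j \<omega>" "columns X"]) auto
          have reg: "edge_bounds cH CH (real N powr (- \<epsilon>b)) (M N) lam"
            by (rule det[OF _ refl h1 h2 h3 _ _ law]) (use Mpos N elim(6) in auto)
          show "edge_regular \<epsilon>b cH CH (X_mat (M N) N (\<xi> N) \<omega>)"
            unfolding X_def[symmetric]
            by (rule edge_regularI[where lam = lam and u = u]) (use sp eb(1) eb20 cH CH N op[of \<omega>] reg in \<open>simp_all add: dim X_def[symmetric] del: One_nat_def\<close>)
        qed
      qed
    qed
  qed
  show ?thesis using cH CH main by (intro exI[of _ cH] conjI exI[of _ CH]) auto
qed

end
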